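(* Let $P=(X,\prec)$ be a finite poset, let $z_1,z_2,z_3\in X$ be distinct, let $A=\{z_1,z_2,z_3\}$, and let $t\ge1$ be an integer such that $P$ is either $t$-thin or $t$-flat with respect to $A$. Let $k,\ell\ge1$ be integers, and let $\mathrm{F}(a,b)$ be the number of linear extensions $L$ of $P$ with $L(z_2)-L(z_1)=a$ and $L(z_3)-L(z_2)=b$. Suppose that $\mathrm{F}(k,\ell+2)\,\mathrm{F}(k+2,\ell)>0$. Then $$\frac{\mathrm{F}(k+1,\ell)\,\mathrm{F}(k,\ell+1)}{\mathrm{F}(k,\ell)\,\mathrm{F}(k+1,\ell+1)}\ \ge\ \max\Big\{\tfrac12+\tfrac{1}{2\sqrt{k\ell}\,(2t+1)},\ \tfrac12+\tfrac{1}{2(2t^2+t)}\Big\}.$$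
   Context: A linear extension of a finite poset $P=(X,\prec)$ with $|X|=n$ is a bijection $L:X\to\{1,\dots,n\}$ with $L(u)<L(v)$ whenever $u\prec v$. $P$ is $t$-thin with respect to $A$ if every $u\in X\setminus A$ is incomparable to at most $t$ elements of $X$; $P$ is $t$-flat with respect to $A$ if every $u\in A$ is comparable to at most $t$ elements of $X$. *)

theory Defs
  imports Complex_Main "HOL-Library.FuncSet"
begin

text \<open>
  A finite poset \<open>P = (X, R)\<close> is a finite carrier \<open>X\<close> with a strict order \<open>R\<close>,
  i.e. \<open>irreflp_on X R\<close> and \<open>transp_on X R\<close>; nothing is required of \<open>R\<close> outside \<open>X\<close>.
\<close>

text \<open>
  Membership in \<open>extensional X\<close> fixes the values outside \<open>X\<close>, so that elements of this
  set correspond one-to-one to bijections from \<open>X\<close> to \<open>{1..card X}\<close> and can be counted.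
\<close>

definition linear_extensions :: "'a set \<Rightarrow> ('a \<Rightarrow> 'a \<Rightarrow> bool) \<Rightarrow> ('a \<Rightarrow> nat) set" where
  "linear_extensions X R =
     {L \<in> extensional X. bij_betw L X {1..card X} \<and>
        (\<forall>u\<in>X. \<forall>v\<in>X. R u v \<longrightarrow> L u < L v)}"

text \<open>
  Both notions relate distinct elements only: an element counts neither as comparable
  nor as incomparable to itself.
\<close>

definition comparable :: "('a \<Rightarrow> 'a \<Rightarrow> bool) \<Rightarrow> 'a \<Rightarrow> 'a \<Rightarrow> bool" where
  "comparable R u v \<longleftrightarrow> u \<noteq> v \<and> (R u v \<or> R v u)"

definition incomparable :: "('a \<Rightarrow> 'a \<Rightarrow> bool) \<Rightarrow> 'a \<Rightarrow> 'a \<Rightarrow> bool" where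
  "incomparable R u v \<longleftrightarrow> u \<noteq> v \<and> \<not> R u v \<and> \<not> R v u"

definition thin_wrt :: "'a set \<Rightarrow> ('a \<Rightarrow> 'a \<Rightarrow> bool) \<Rightarrow> 'a set \<Rightarrow> nat \<Rightarrow> bool" where
  "thin_wrt X R A t \<longleftrightarrow> (\<forall>u\<in>X - A. card {v\<in>X. incomparable R u v} \<le> t)"

definition flat_wrt :: "'a set \<Rightarrow> ('a \<Rightarrow> 'a \<Rightarrow> bool) \<Rightarrow> 'a set \<Rightarrow> nat \<Rightarrow> bool" where
  "flat_wrt X R A t \<longleftrightarrow> (\<forall>u\<in>A. card {v\<in>X. comparable R u v} \<le> t)"

definition num_ext ::
  "'a set \<Rightarrow> ('a \<Rightarrow> 'a \<Rightarrow> bool) \<Rightarrow> 'a \<Rightarrow> 'a \<Rightarrow> 'a \<Rightarrow> int \<Rightarrow> int \<Rightarrow> nat" where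
  "num_ext X R z1 z2 z3 a b =
     card {L \<in> linear_extensions X R.
             int (L z2) - int (L z1) = a \<and> int (L z3) - int (L z2) = b}"

end

theory Submission
  imports Defs
begin

text \<open>Write \<open>a\<close>, \<open>b\<close>, \<open>c\<close>, \<open>d\<close>, \<open>e\<close>, \<open>f\<close> for the numbers of linear extensions with gaps \<open>(k, l)\<close>,
  \<open>(k + 1, l)\<close>, \<open>(k, l + 1)\<close>, \<open>(k + 2, l)\<close>, \<open>(k + 1, l + 1)\<close>, \<open>(k, l + 2)\<close>. They are mixed volumes of
  polytopes of order preserving maps, so the Alexandrov--Fenchel inequality applied to the
  combination with coefficients \<open>c\<close> and \<open>b\<close> gives \<open>a (c\<^sup>2 d + 2 b c e + b\<^sup>2 f) \<le> (2 b c)\<^sup>2\<close>, whence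
  \<open>a (e + sqrt (d f)) \<le> 2 b c\<close> by AM-GM. Moving single elements across \<open>z1\<close>, \<open>z2\<close>, \<open>z3\<close> bounds \<open>e\<close> by
  multiples of \<open>d\<close> and of \<open>f\<close>; the product of the two bounds controls \<open>e\<close> by \<open>sqrt (d f)\<close>.

  The Alexandrov--Fenchel inequality is proved by the Bochner method, by induction on the dimension
  through the faces of the polytope. No geometry is needed: a face is a preorder containing the given
  order, its facets arise by merging the two ends of a covering pair, and mixed volumes are sums over
  linear extensions.\<close>

section \<open>Symmetric matrices with one positive eigenvalue\<close>

text \<open>Two obstacles shape the proof. Order polytopes are not simple: squares occur beside
  triangles as links of faces of codimension 3. The Bochner argument survives because a square
  contributes a term of favourable sign. Moreover, the mixed volumes that count linear extensions
  belong to degenerate bodies, whose marks are unit vectors, while the Bochner method needs positive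
  marks; a perturbation and a limit bridge this. The constants come from the end. If
  \<open>e \<le> m * sqrt (d * f)\<close>, then dividing
  \<open>a * (e + sqrt (d * f)) \<le> 2 * b * c\<close> by \<open>2 * a * e\<close> gives the bound
  \<open>1/2 + 1/(2 * m)\<close>. The two bounds on \<open>e\<close> carry the factors
  \<open>min l t * (2 * t + 1)\<close> and \<open>min k t * (2 * t + 1)\<close>: the minimum counts
  the ways to shorten one gap, the summand 1 stands for the case where the same move widens the
  other gap, and \<open>2 * t\<close> for the case where this takes a second move. So
  \<open>m\<close> may be \<open>sqrt (k * l) * (2 * t + 1)\<close> or
  \<open>t * (2 * t + 1)\<close>. One flat configuration only gives \<open>2 * t + 2\<close>; there
  the opposite bound is so good that the product still suffices.\<close>

text \<open>The Fredholm alternative, by elimination of one unknown at a time. It stands in for the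
  spectral theorem: below it solves a singular symmetric system whose right-hand side is orthogonal
  to the kernel.\<close>

lemma linear_system_alternative:
  fixes a :: "'i \<Rightarrow> 'j \<Rightarrow> real" and b :: "'i \<Rightarrow> real"
  assumes "finite J" "finite I"
  shows "(\<exists>u. \<forall>i\<in>I. (\<Sum>j\<in>J. a i j * u j) = b i) \<or>
         (\<exists>y. (\<forall>j\<in>J. (\<Sum>i\<in>I. y i * a i j) = 0) \<and> (\<Sum>i\<in>I. y i * b i) \<noteq> 0)"
  using assms(1)
proof (induction J arbitrary: a b rule: finite_induct)
  case empty
  show ?case
  proof (cases "\<forall>i\<in>I. b i = 0")
    case False
    then obtain i where i: "i \<in> I" "b i \<noteq> 0" by auto
    have "(\<Sum>j\<in>I. (if j = i then 1 else 0) * b j) = b i"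
      using i assms(2) by (simp add: if_distrib[of "\<lambda>x. x * _"] cong: if_cong)
    then show ?thesis using i by (intro disjI2 exI[of _ "\<lambda>j. if j = i then 1 else 0"]) auto
  qed auto
next
  case (insert j J)
  show ?case
  proof (cases "\<forall>i\<in>I. a i j = 0")
    case True
    from insert.IH[of a b] show ?thesis
    proof
      assume "\<exists>u. \<forall>i\<in>I. (\<Sum>j\<in>J. a i j * u j) = b i"
      then obtain u where "\<forall>i\<in>I. (\<Sum>j\<in>J. a i j * u j) = b i" by auto
      then have "\<forall>i\<in>I. (\<Sum>j\<in>insert j J. a i j * u j) = b i"
        using True insert.hyps by simp
      then show ?thesis by blast
    next
      assume "\<exists>y. (\<forall>j\<in>J. (\<Sum>i\<in>I. y i * a i j) = 0) \<and> (\<Sum>i\<in>I. y i * b i) \<noteq> 0"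
      then show ?thesis using True by fastforce
    qed
  next
    case False
    then obtain p where p: "p \<in> I" "a p j \<noteq> 0" by auto
    \<comment> \<open>Multiples of row \<open>p\<close> are subtracted so that column
      \<open>j\<close> disappears. Row \<open>p\<close> itself becomes 0 and is satisfied afterwards
      by the choice of \<open>u' j\<close>.\<close>
    define a' where "a' i m = a i m - a i j / a p j * a p m" for i m
    define b' where "b' i = b i - a i j / a p j * b p" for i
    have row_p: "a' p m = 0" "b' p = 0" for m using p by (auto simp: a'_def b'_def)
    from insert.IH[of a' b'] show ?thesis
    proof
      assume "\<exists>u. \<forall>i\<in>I. (\<Sum>j\<in>J. a' i j * u j) = b' i"
      then obtain u where u: "\<And>i. i \<in> I \<Longrightarrow> (\<Sum>j\<in>J. a' i j * u j) = b' i" by auto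
      define s where "s = (\<Sum>m\<in>J. a p m * u m)"
      define u' where "u' = u(j := (b p - s) / a p j)"
      have "(\<Sum>m\<in>insert j J. a i m * u' m) = b i" if i: "i \<in> I" for i
      proof -
        have "(\<Sum>m\<in>J. a i m * u' m) = (\<Sum>m\<in>J. a i m * u m)"
          using insert.hyps by (intro sum.cong) (auto simp: u'_def)
        also have "\<dots> = (\<Sum>m\<in>J. a' i m * u m) + a i j / a p j * s"
          unfolding s_def sum_distrib_left sum.distrib[symmetric]
          by (intro sum.cong) (auto simp: a'_def algebra_simps)
        finally have "(\<Sum>m\<in>J. a i m * u' m) = b' i + a i j / a p j * s" using u[OF i] by simp
        moreover have "a i j * u' j = a i j / a p j * (b p - s)" by (simp add: u'_def)
        ultimately show ?thesis using insert.hyps by (simp add: b'_def algebra_simps diff_divide_distrib)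
      qed
      then show ?thesis by blast
    next
      assume "\<exists>y. (\<forall>j\<in>J. (\<Sum>i\<in>I. y i * a' i j) = 0) \<and> (\<Sum>i\<in>I. y i * b' i) \<noteq> 0"
      then obtain y where y: "\<And>m. m \<in> J \<Longrightarrow> (\<Sum>i\<in>I. y i * a' i m) = 0" "(\<Sum>i\<in>I. y i * b' i) \<noteq> 0"
        by auto
      define s where "s = (\<Sum>i\<in>I - {p}. y i * a i j) / a p j"
      \<comment> \<open>The coefficient of row \<open>p\<close> undoes the elimination: by
        \<open>comb\<close>, \<open>y'\<close> combines the original rows as \<open>y\<close>
        combines the reduced ones.\<close>
      define y' where "y' = y(p := - s)"
      have comb: "(\<Sum>i\<in>I. y' i * h i) = (\<Sum>i\<in>I. y i * (h i - a i j / a p j * h p))" for h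
      proof -
        have "(\<Sum>i\<in>I. y i * (h i - a i j / a p j * h p))
            = (\<Sum>i\<in>I - {p}. y i * (h i - a i j / a p j * h p))"
          using p assms(2) by (simp add: sum.remove)
        also have "\<dots> = (\<Sum>i\<in>I - {p}. y i * h i) - s * h p"
          unfolding s_def sum_divide_distrib sum_distrib_right sum_subtractf[symmetric]
          by (intro sum.cong) (auto simp: algebra_simps)
        also have "(\<Sum>i\<in>I - {p}. y i * h i) = (\<Sum>i\<in>I - {p}. y' i * h i)"
          by (intro sum.cong) (auto simp: y'_def)
        finally show ?thesis using p assms(2) by (simp add: sum.remove y'_def)
      qed
      have "(\<Sum>i\<in>I. y' i * a i m) = 0" if "m \<in> insert j J" for m
        using that y(1)[of m] p by (auto simp: comb a'_def)
      moreover have "(\<Sum>i\<in>I. y' i * b i) \<noteq> 0" using y(2) by (simp add: comb b'_def)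
      ultimately show ?thesis by blast
    qed
  qed
qed

locale symmetric_matrix =
  fixes I :: "'i set" and a :: "'i \<Rightarrow> 'i \<Rightarrow> real"
  assumes finite_I: "finite I" and sym: "\<And>i j. i \<in> I \<Longrightarrow> j \<in> I \<Longrightarrow> a i j = a j i"
begin

definition row :: "('i \<Rightarrow> real) \<Rightarrow> 'i \<Rightarrow> real" where "row v i = (\<Sum>j\<in>I. a i j * v j)"
definition form :: "('i \<Rightarrow> real) \<Rightarrow> ('i \<Rightarrow> real) \<Rightarrow> real" where "form v w = (\<Sum>i\<in>I. v i * row w i)"

lemma form_sym: "form v w = form w v"
proof -
  have "form v w = (\<Sum>i\<in>I. \<Sum>j\<in>I. v i * a i j * w j)"
    by (simp add: form_def row_def sum_distrib_left mult.assoc)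
  also have "\<dots> = (\<Sum>j\<in>I. \<Sum>i\<in>I. v i * a i j * w j)" by (rule sum.swap)
  also have "\<dots> = form w v"
    by (auto simp: form_def row_def sum_distrib_left sym mult_ac intro!: sum.cong)
  finally show ?thesis .
qed

lemma form_add_left: "form (\<lambda>i. v i + x * w i) u = form v u + x * form w u"
  by (simp add: form_def algebra_simps sum.distrib sum_distrib_left)

lemma form_add: "form (\<lambda>i. v i + x * w i) (\<lambda>i. v i + x * w i)
    = form v v + 2 * x * form v w + x^2 * form w w"
proof -
  have "form u (\<lambda>i. v i + x * w i) = form u v + x * form u w" for u
    by (subst (1 2 3) form_sym) (rule form_add_left)
  then show ?thesis
    by (simp add: form_add_left form_sym[of w v] power2_eq_square algebra_simps)
qed

lemma psd_cauchy_schwarz: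
  assumes psd: "\<And>v. form v v \<ge> 0"
  shows "(form v w)\<^sup>2 \<le> form v v * form w w"
proof (cases "form w w = 0")
  case True
  have "form v w = 0"
  proof (rule ccontr)
    assume n: "form v w \<noteq> 0"
    \<comment> \<open>With this value the form of the combination would be -1.\<close>
    define x where "x = - (form v v + 1) / (2 * form v w)"
    have "0 \<le> form v v + 2 * x * form v w" using psd[of "\<lambda>i. v i + x * w i"] True by (simp add: form_add)
    also have "2 * x * form v w = - (form v v + 1)" using n by (simp add: x_def)
    finally show False by simp
  qed
  then show ?thesis using True by simp
next
  case False
  then have p: "form w w > 0" using psd[of w] by simp
  define x where "x = - form v w / form w w"
  have "0 \<le> form v v + 2 * x * form v w + x^2 * form w w"
    using psd[of "\<lambda>i. v i + x * w i"] by (simp add: form_add)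
  also have "\<dots> = form v v - (form v w)\<^sup>2 / form w w"
    using p by (simp add: x_def field_simps power2_eq_square)
  finally show ?thesis using p by (simp add: field_simps)
qed

end

text \<open>The Bochner-type hypothesis \<open>bochner\<close> says that the spectrum of the operator
  \<open>D\<^sup>-\<^sup>1 A\<close>, where \<open>D\<close> is the diagonal matrix fixing \<open>k\<close>, avoids the interval between 0 and 1;
  by the Perron argument 1 is its largest eigenvalue and is simple.\<close>

lemma (in symmetric_matrix) bochner_imp_negative:
  assumes off: "\<And>i j. i \<in> I \<Longrightarrow> j \<in> I \<Longrightarrow> i \<noteq> j \<Longrightarrow> a i j \<ge> 0"
    and k: "\<And>i. i \<in> I \<Longrightarrow> k i > 0" and ak: "\<And>i. i \<in> I \<Longrightarrow> row k i > 0"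
    and conn: "\<And>S. S \<subseteq> I \<Longrightarrow> S \<noteq> {} \<Longrightarrow> (\<And>i j. i \<in> S \<Longrightarrow> j \<in> I \<Longrightarrow> i \<noteq> j \<Longrightarrow> a i j \<noteq> 0 \<Longrightarrow> j \<in> S) \<Longrightarrow> S = I"
    and bochner: "\<And>v. form v v \<le> (\<Sum>i\<in>I. k i * (row v i)\<^sup>2 / row k i)"
    and orth: "form v k = 0"
  shows "form v v \<le> 0"
proof -
  define D where "D i = row k i / k i" for i
  have D: "D i > 0" if "i \<in> I" for i using that k ak by (simp add: D_def)
  \<comment> \<open>\<open>c\<close> is \<open>D - A\<close>. As \<open>D i * k i\<close> is
    \<open>row k i\<close>, this is a weighted graph Laplacian in the variables
    \<open>u i / k i\<close>: \<open>Csq\<close> displays it as a sum of squares, and connectedness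
    leaves only the multiples of \<open>k\<close> in the kernel.\<close>
  define c where "c i j = (if i = j then D i else 0) - a i j" for i j
  interpret C: symmetric_matrix I c
    by unfold_locales (use finite_I sym in \<open>auto simp: c_def\<close>)
  have Crow: "C.row u i = D i * u i - row u i" if "i \<in> I" for u i
  proof -
    have "C.row u i = (\<Sum>j\<in>I. (if i = j then D i else 0) * u j - a i j * u j)"
      by (simp add: C.row_def c_def algebra_simps)
    also have "\<dots> = (\<Sum>j\<in>I. (if i = j then D i * u j else 0)) - row u i"
      by (simp add: sum_subtractf row_def if_distrib[of "\<lambda>x. x * _"] cong: if_cong)
    finally show ?thesis using that finite_I by simp
  qed
  have Cform: "C.form u u = (\<Sum>i\<in>I. D i * (u i)\<^sup>2) - form u u" for u
    by (simp add: C.form_def form_def Crow algebra_simps power2_eq_square sum_subtractf)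
  have Csq: "C.form u u = (\<Sum>i\<in>I. \<Sum>j\<in>I. a i j * k i * k j * (u i / k i - u j / k j)\<^sup>2) / 2" for u
  proof -
    have "(\<Sum>i\<in>I. \<Sum>j\<in>I. a i j * k i * k j * (u i / k i - u j / k j)\<^sup>2)
      = (\<Sum>i\<in>I. \<Sum>j\<in>I. a i j * k j * ((u i)\<^sup>2 / k i)) + (\<Sum>i\<in>I. \<Sum>j\<in>I. a i j * k i * ((u j)\<^sup>2 / k j))
        - 2 * (\<Sum>i\<in>I. \<Sum>j\<in>I. a i j * u i * u j)"
      unfolding sum_distrib_left sum.distrib[symmetric] sum_subtractf[symmetric]
    proof (intro sum.cong refl)
      fix i j assume "i \<in> I" "j \<in> I"
      then have "k i \<noteq> 0" "k j \<noteq> 0" using k by (metis less_irrefl)+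
      then show "a i j * k i * k j * (u i / k i - u j / k j)\<^sup>2 =
         a i j * k j * ((u i)\<^sup>2 / k i) + a i j * k i * ((u j)\<^sup>2 / k j) - 2 * (a i j * u i * u j)"
        by (simp add: field_simps power2_eq_square)
    qed
    also have "(\<Sum>i\<in>I. \<Sum>j\<in>I. a i j * k j * ((u i)\<^sup>2 / k i)) = (\<Sum>i\<in>I. D i * (u i)\<^sup>2)"
      by (auto simp: D_def row_def sum_distrib_right sum_divide_distrib intro!: sum.cong)
    also have "(\<Sum>i\<in>I. \<Sum>j\<in>I. a i j * k i * ((u j)\<^sup>2 / k j)) = (\<Sum>j\<in>I. \<Sum>i\<in>I. a j i * k i * ((u j)\<^sup>2 / k j))"
      by (subst sum.swap) (auto intro!: sum.cong simp: sym)
    also have "\<dots> = (\<Sum>i\<in>I. D i * (u i)\<^sup>2)"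
      by (auto simp: D_def row_def sum_distrib_right sum_divide_distrib intro!: sum.cong)
    also have "(\<Sum>i\<in>I. \<Sum>j\<in>I. a i j * u i * u j) = form u u"
      by (auto simp: form_def row_def sum_distrib_left mult_ac intro!: sum.cong)
    finally show ?thesis by (simp add: Cform)
  qed
  have term_nn: "a i j * k i * k j * (u i / k i - u j / k j)\<^sup>2 \<ge> 0" if "i \<in> I" "j \<in> I" for i j u
    using that off[of i j] k[of i] k[of j] by (cases "i = j") auto
  have psd: "C.form u u \<ge> 0" for u
    unfolding Csq by (intro divide_nonneg_nonneg sum_nonneg term_nn) auto
  have ker: "\<exists>x. \<forall>i\<in>I. u i = x * k i" if "C.form u u = 0" for u
  proof (cases "I = {}")
    case False
    then obtain p where p: "p \<in> I" by auto
    have "(\<Sum>i\<in>I. \<Sum>j\<in>I. a i j * k i * k j * (u i / k i - u j / k j)\<^sup>2) = 0"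
      using that Csq[of u] by simp
    then have z: "a i j * k i * k j * (u i / k i - u j / k j)\<^sup>2 = 0" if "i \<in> I" "j \<in> I" for i j
      using that finite_I by (simp add: sum_nonneg_eq_0_iff sum_nonneg term_nn)
    define S where "S = {i\<in>I. u i / k i = u p / k p}"
    have "S = I"
    proof (rule conn)
      fix i j assume ij: "i \<in> S" "j \<in> I" "i \<noteq> j" "a i j \<noteq> 0"
      have "k i \<noteq> 0" "k j \<noteq> 0" using k[of i] k[of j] ij by (auto simp: S_def)
      then have "u i / k i = u j / k j" using z[of i j] ij by (auto simp: S_def)
      then show "j \<in> S" using ij by (simp add: S_def)
    qed (use p in \<open>auto simp: S_def\<close>)
    have "u i = (u p / k p) * k i" if i: "i \<in> I" for i
    proof -
      have "i \<in> S" using i \<open>S = I\<close> by simp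
      then have "u i / k i = u p / k p" by (simp add: S_def)
      then show ?thesis using k[OF i] by (simp add: field_simps)
    qed
    then show ?thesis by blast
  qed auto
  \<comment> \<open>The system \<open>C u = D v\<close> is solvable because its right-hand side is
    orthogonal to the kernel: paired with \<open>k\<close> it gives \<open>form v k\<close>, which
    is 0.\<close>
  obtain u where u: "\<And>i. i \<in> I \<Longrightarrow> C.row u i = D i * v i"
  proof -
    consider u where "\<forall>i\<in>I. (\<Sum>j\<in>I. c i j * u j) = D i * v i"
      | y where "\<forall>j\<in>I. (\<Sum>i\<in>I. y i * c i j) = 0" "(\<Sum>i\<in>I. y i * (D i * v i)) \<noteq> 0"
      using linear_system_alternative[OF finite_I finite_I, of c "\<lambda>i. D i * v i"] by blast
    then show ?thesis
    proof cases
      case 1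
      then show ?thesis using that[of u] by (simp add: C.row_def)
    next
      case 2
      have "(\<Sum>i\<in>I. y i * c i j) = C.row y j" if "j \<in> I" for j
        using that C.sym by (auto simp: C.row_def mult.commute intro!: sum.cong)
      then have "C.form y y = 0" using 2 by (simp add: C.form_def)
      then obtain x where "\<forall>i\<in>I. y i = x * k i" using ker by blast
      then have "(\<Sum>i\<in>I. y i * (D i * v i)) = (\<Sum>i\<in>I. x * (v i * row k i))"
        using k[THEN less_imp_neq] by (intro sum.cong) (auto simp: D_def)
      also have "\<dots> = x * form v k" by (simp add: form_def sum_distrib_left)
      finally show ?thesis using 2 orth by simp
    qed
  qed
  define q where "q = (\<Sum>i\<in>I. D i * (v i)\<^sup>2)"
  have qnn: "q \<ge> 0" unfolding q_def using D by (intro sum_nonneg) (auto simp: less_imp_le)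
  have vu: "C.form v u = q"
    by (simp add: C.form_def u q_def power2_eq_square algebra_simps)
  \<comment> \<open>For this \<open>u\<close> the vector \<open>A u\<close> equals
    \<open>D (u - v)\<close>, so the Bochner hypothesis becomes a comparison of square sums.
    Cauchy--Schwarz for \<open>C\<close> then turns it into \<open>q \<le> C.form v v\<close>, and
    the right-hand side is \<open>q - form v v\<close>.\<close>
  have "C.form u u \<le> q"
  proof -
    have r: "row u i = D i * (u i - v i)" if "i \<in> I" for i
      using Crow[OF that, of u] u[OF that] by (simp add: algebra_simps)
    have "(\<Sum>i\<in>I. k i * (row u i)\<^sup>2 / row k i) = (\<Sum>i\<in>I. D i * (u i - v i)\<^sup>2)"
    proof (intro sum.cong refl)
      fix i assume i: "i \<in> I"
      have "k i * (row u i)\<^sup>2 / row k i = (k i * D i / row k i) * (D i * (u i - v i)\<^sup>2)"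
        by (simp add: r[OF i] power2_eq_square)
      also have "k i * D i / row k i = 1" using k[OF i] ak[OF i] by (simp add: D_def)
      finally show "k i * (row u i)\<^sup>2 / row k i = D i * (u i - v i)\<^sup>2" by simp
    qed
    then have "form u u \<le> (\<Sum>i\<in>I. D i * (u i - v i)\<^sup>2)" using bochner[of u] by simp
    also have "\<dots> = (\<Sum>i\<in>I. D i * (u i)\<^sup>2) - 2 * (\<Sum>i\<in>I. u i * (D i * v i)) + q"
      unfolding q_def sum_distrib_left sum.distrib[symmetric] sum_subtractf[symmetric]
      by (intro sum.cong) (auto simp: power2_eq_square algebra_simps)
    also have "(\<Sum>i\<in>I. u i * (D i * v i)) = C.form u u" by (simp add: C.form_def u)
    finally show ?thesis using Cform[of u] by simp
  qed
  have "q\<^sup>2 \<le> C.form v v * C.form u u"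
    using C.psd_cauchy_schwarz[OF psd, of v u] vu by simp
  also have "\<dots> \<le> C.form v v * q" using \<open>C.form u u \<le> q\<close> psd[of v] by (rule mult_left_mono)
  finally have "q \<le> C.form v v"
    using qnn psd[of v] by (cases "q = 0") (auto simp: power2_eq_square)
  then show ?thesis using Cform[of v] by (simp add: q_def)
qed

text \<open>Passing from one positive vector \<open>k\<close> to an arbitrary vector \<open>w\<close> with positive form:
  some combination of \<open>v\<close> and \<open>w\<close> is orthogonal to \<open>k\<close>.\<close>

lemma (in symmetric_matrix) reversed_cauchy_schwarz:
  assumes neg: "\<And>v. form v k = 0 \<Longrightarrow> form v v \<le> 0" and w: "form w w > 0"
  shows "form v v * form w w \<le> (form v w)\<^sup>2"
proof -
  have wk: "form w k \<noteq> 0" using neg[of w] w by auto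
  define x where "x = - form v k / form w k"
  have "form v k + x * form w k = 0" using wk by (simp add: x_def)
  then have "form (\<lambda>i. v i + x * w i) k = 0" by (simp only: form_add_left)
  then have "form v v + 2 * x * form v w + x\<^sup>2 * form w w \<le> 0" using neg form_add by metis
  then have "form w w * (form v v + 2 * x * form v w + x\<^sup>2 * form w w) \<le> 0"
    using w by (simp add: mult_le_0_iff)
  moreover have "0 \<le> (form v w + x * form w w)\<^sup>2" by simp
  ultimately show ?thesis by (simp add: power2_eq_square algebra_simps)
qed

section \<open>The Alexandrov--Fenchel inequality for abstract face systems\<close>

definition pos3 :: "real \<times> real \<times> real \<Rightarrow> bool" where
  "pos3 c \<longleftrightarrow> fst c > 0 \<and> fst (snd c) > 0 \<and> snd (snd c) > 0"

text \<open>The six roots of the root system A2 in cyclic order, in coordinates with respect to the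
  first two. Each is the sum of its two neighbours. They are the possible edge normals of a face of
  dimension 2.\<close>

definition root_x :: "nat \<Rightarrow> real" where "root_x i = [1, 0, -1, -1, 0, 1] ! i"
definition root_y :: "nat \<Rightarrow> real" where "root_y i = [0, 1, 1, 0, -1, -1] ! i"

text \<open>A polytope is given by a mark \<open>c\<close>, and its affine space consists of the
  \<phi> with \<open>mk \<phi> = c\<close>; so vectors of mark 0 are translations, and
  \<open>dl R \<phi> F\<close> is the height of the facet \<open>F\<close> above the origin \<phi>.
  The assumption \<open>square\<close> is what replaces simplicity: in a simple polytope only three
  facets contain a face of codimension 3, while here there may be four, and then their heights
  satisfy a linear relation.\<close>

locale face_system =
  fixes face :: "nat \<Rightarrow> 'f \<Rightarrow> bool" and fac :: "'f \<Rightarrow> 'f set"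
    and Con :: "'f \<Rightarrow> ('y \<Rightarrow> real) set" and dl :: "'f \<Rightarrow> ('y \<Rightarrow> real) \<Rightarrow> 'f \<Rightarrow> real"
    and mk :: "('y \<Rightarrow> real) \<Rightarrow> real \<times> real \<times> real"
    and vol :: "'f \<Rightarrow> (real \<times> real \<times> real) list \<Rightarrow> real"
  assumes finite_fac: "face d R \<Longrightarrow> finite (fac R)"
    and face_fac: "face (Suc d) R \<Longrightarrow> F \<in> fac R \<Longrightarrow> face d F"
    and Con_zero: "(\<lambda>y. 0) \<in> Con R"
    and Con_lin: "\<theta> \<in> Con R \<Longrightarrow> \<eta> \<in> Con R \<Longrightarrow> (\<lambda>y. \<theta> y + x * \<eta> y) \<in> Con R"
    and dl_lin: "dl R (\<lambda>y. \<theta> y + x * \<eta> y) F = dl R \<theta> F + x * dl R \<eta> F"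
    and mk_zero: "mk (\<lambda>y. 0) = (0, 0, 0)"
    and mk_add: "mk \<eta> = (0, 0, 0) \<Longrightarrow> mk (\<lambda>y. \<theta> y + x * \<eta> y) = mk \<theta>"
    and Con_fac: "face (Suc d) R \<Longrightarrow> F \<in> fac R \<Longrightarrow> \<theta> \<in> Con F \<longleftrightarrow> \<theta> \<in> Con R \<and> dl R \<theta> F = 0"
    and shift_ex: "face (Suc d) R \<Longrightarrow> F \<in> fac R \<Longrightarrow> \<exists>\<theta>. \<theta> \<in> Con R \<and> mk \<theta> = (0, 0, 0) \<and> dl R \<theta> F = 1"
    and other_ex: "face (Suc (Suc d)) R \<Longrightarrow> F \<in> fac R \<Longrightarrow> G \<in> fac F \<Longrightarrow>
      \<exists>F'. F' \<in> fac R \<and> F' \<noteq> F \<and> G \<in> fac F' \<and> (\<forall>E\<in>fac R. G \<in> fac E \<longrightarrow> E = F \<or> E = F')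
         \<and> (\<forall>\<theta>\<in>Con F. dl F \<theta> G = dl R \<theta> F')"
    and join_unique: "face (Suc (Suc d)) R \<Longrightarrow> E \<in> fac R \<Longrightarrow> F \<in> fac R \<Longrightarrow> E \<noteq> F \<Longrightarrow>
      G \<in> fac E \<Longrightarrow> G \<in> fac F \<Longrightarrow> G' \<in> fac E \<Longrightarrow> G' \<in> fac F \<Longrightarrow> G = G'"
    and square: "face (Suc (Suc (Suc d))) R \<Longrightarrow> up = {F \<in> fac R. \<exists>G\<in>fac F. H \<in> fac G} \<Longrightarrow>
      E \<in> up \<Longrightarrow> F \<in> up \<Longrightarrow> E \<noteq> F \<Longrightarrow>
      (\<exists>G. G \<in> fac E \<and> G \<in> fac F \<and> H \<in> fac G) \<or>
      (\<exists>P Q. up = {E, F, P, Q} \<and> (\<forall>\<theta>\<in>Con R. dl R \<theta> E + dl R \<theta> F = dl R \<theta> P + dl R \<theta> Q))"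
    and connected: "face (Suc (Suc (Suc d))) R \<Longrightarrow> S \<subseteq> fac R \<Longrightarrow> S \<noteq> {} \<Longrightarrow>
      (\<And>E F. E \<in> S \<Longrightarrow> F \<in> fac R \<Longrightarrow> fac E \<inter> fac F \<noteq> {} \<Longrightarrow> F \<in> S) \<Longrightarrow> S = fac R"
    and strict_ex: "face d R \<Longrightarrow> pos3 c \<Longrightarrow> \<exists>\<phi>\<in>Con R. mk \<phi> = c \<and> (\<forall>F\<in>fac R. dl R \<phi> F > 0)"
    and vol_facets: "face (Suc d) R \<Longrightarrow> \<phi> \<in> Con R \<Longrightarrow> length cs = d \<Longrightarrow>
      vol R (mk \<phi> # cs) = (\<Sum>F\<in>fac R. dl R \<phi> F * vol F cs)"
    and vol_pos: "face d R \<Longrightarrow> length cs = d \<Longrightarrow> (\<And>c. c \<in> set cs \<Longrightarrow> pos3 c) \<Longrightarrow> vol R cs > 0"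
    and vol_point: "face 0 R \<Longrightarrow> vol R [] = 1"
    and segment: "face (Suc 0) R \<Longrightarrow> card (fac R) \<le> 2"
    and polygon: "face (Suc (Suc 0)) R \<Longrightarrow> \<exists>\<theta> \<eta> \<rho>. \<theta> \<in> Con R \<and> \<eta> \<in> Con R \<and> mk \<theta> = (0, 0, 0) \<and> mk \<eta> = (0, 0, 0)
      \<and> inj_on \<rho> (fac R) \<and> \<rho> ` fac R \<subset> {..<6}
      \<and> (\<forall>F\<in>fac R. dl R \<theta> F = root_x (\<rho> F) \<and> dl R \<eta> F = root_y (\<rho> F))
      \<and> (\<forall>\<zeta>\<in>Con R. mk \<zeta> = (0, 0, 0) \<longrightarrow> (\<exists>x y. \<forall>F\<in>fac R. dl R \<zeta> F = x * dl R \<theta> F + y * dl R \<eta> F))"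
begin

definition oth :: "'f \<Rightarrow> 'f \<Rightarrow> 'f \<Rightarrow> 'f" where
  "oth R F G = (SOME F'. F' \<in> fac R \<and> F' \<noteq> F \<and> G \<in> fac F')"
definition sh :: "'f \<Rightarrow> 'f \<Rightarrow> 'y \<Rightarrow> real" where
  "sh R F = (SOME \<theta>. \<theta> \<in> Con R \<and> mk \<theta> = (0, 0, 0) \<and> dl R \<theta> F = 1)"

text \<open>\<open>T R F v\<close> is the height vector of the facet \<open>F\<close> of a virtual polytope with height
  vector \<open>v\<close>, after a translation (along \<open>sh R F\<close>) that moves that facet to height 0.
  \<open>A R v w cs\<close> plays the role of the mixed volume of \<open>v\<close>, \<open>w\<close> and \<open>cs\<close>.\<close>

definition T :: "'f \<Rightarrow> 'f \<Rightarrow> ('f \<Rightarrow> real) \<Rightarrow> 'f \<Rightarrow> real" where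
  "T R F v G = v (oth R F G) - v F * dl R (sh R F) (oth R F G)"
definition V :: "'f \<Rightarrow> ('f \<Rightarrow> real) \<Rightarrow> (real \<times> real \<times> real) list \<Rightarrow> real" where
  "V R v cs = (\<Sum>F\<in>fac R. v F * vol F cs)"
definition A :: "'f \<Rightarrow> ('f \<Rightarrow> real) \<Rightarrow> ('f \<Rightarrow> real) \<Rightarrow> (real \<times> real \<times> real) list \<Rightarrow> real" where
  "A R v w cs = (\<Sum>F\<in>fac R. v F * V F (T R F w) cs)"

lemma oth:
  assumes "face (Suc (Suc d)) R" "F \<in> fac R" "G \<in> fac F"
  shows "oth R F G \<in> fac R" "oth R F G \<noteq> F" "G \<in> fac (oth R F G)"
    and "\<And>E. E \<in> fac R \<Longrightarrow> G \<in> fac E \<Longrightarrow> E \<noteq> F \<Longrightarrow> oth R F G = E"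
    and "\<And>\<theta>. \<theta> \<in> Con F \<Longrightarrow> dl F \<theta> G = dl R \<theta> (oth R F G)"
proof -
  obtain F' where F': "F' \<in> fac R" "F' \<noteq> F" "G \<in> fac F'"
      "\<And>E. E \<in> fac R \<Longrightarrow> G \<in> fac E \<Longrightarrow> E = F \<or> E = F'" "\<And>\<theta>. \<theta> \<in> Con F \<Longrightarrow> dl F \<theta> G = dl R \<theta> F'"
    using other_ex[OF assms] by blast
  have o: "oth R F G \<in> fac R \<and> oth R F G \<noteq> F \<and> G \<in> fac (oth R F G)"
    unfolding oth_def by (rule someI[of _ F']) (use F' in auto)
  then have "oth R F G = F'" using F'(4) by blast
  with F' o show "oth R F G \<in> fac R" "oth R F G \<noteq> F" "G \<in> fac (oth R F G)"
    "\<And>E. E \<in> fac R \<Longrightarrow> G \<in> fac E \<Longrightarrow> E \<noteq> F \<Longrightarrow> oth R F G = E"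
    "\<And>\<theta>. \<theta> \<in> Con F \<Longrightarrow> dl F \<theta> G = dl R \<theta> (oth R F G)" by blast+
qed

lemma sh:
  assumes "face (Suc d) R" "F \<in> fac R"
  shows "sh R F \<in> Con R" "mk (sh R F) = (0, 0, 0)" "dl R (sh R F) F = 1"
  using someI_ex[OF shift_ex[OF assms]] unfolding sh_def by blast+

lemma dl_zero: "dl R (\<lambda>y. 0) F = 0"
  using dl_lin[of R "\<lambda>y. 0" 1 "\<lambda>y. 0" F] by simp

lemma vol_zero:
  assumes "face (Suc d) R" "length cs = d"
  shows "vol R ((0, 0, 0) # cs) = 0"
  using vol_facets[OF assms(1) Con_zero assms(2)] by (simp add: dl_zero mk_zero)

lemma T_add: "T R F (\<lambda>E. v E + x * w E) G = T R F v G + x * T R F w G"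
  by (simp add: T_def algebra_simps)

lemma V_cong: "(\<And>F. F \<in> fac R \<Longrightarrow> v F = w F) \<Longrightarrow> V R v cs = V R w cs"
  by (simp add: V_def)

lemma V_dl:
  assumes "face (Suc d) R" "\<phi> \<in> Con R" "length cs = d"
  shows "V R (dl R \<phi>) cs = vol R (mk \<phi> # cs)"
  using vol_facets[OF assms] by (simp add: V_def)

text \<open>Subtracting a multiple of \<open>sh R F\<close> puts \<phi> onto the hyperplane of
  \<open>F\<close> without changing its mark; the result is a height vector of the facet with the
  same mark.\<close>

lemma T_dl:
  assumes R: "face (Suc (Suc d)) R" and F: "F \<in> fac R" and \<phi>: "\<phi> \<in> Con R"
  shows "\<exists>\<phi>'\<in>Con F. mk \<phi>' = mk \<phi> \<and> (\<forall>G\<in>fac F. T R F (dl R \<phi>) G = dl F \<phi>' G)"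
proof -
  define \<phi>' where "\<phi>' = (\<lambda>y. \<phi> y + (- dl R \<phi> F) * sh R F y)"
  note s = sh[OF R F]
  have d: "dl R \<phi>' E = dl R \<phi> E + (- dl R \<phi> F) * dl R (sh R F) E" for E
    unfolding \<phi>'_def by (rule dl_lin)
  have "\<phi>' \<in> Con R" unfolding \<phi>'_def by (rule Con_lin[OF \<phi> s(1)])
  moreover have "dl R \<phi>' F = 0" using d[of F] s(3) by simp
  ultimately have c: "\<phi>' \<in> Con F" using Con_fac[OF R F] by blast
  have "mk \<phi>' = mk \<phi>" unfolding \<phi>'_def by (rule mk_add[OF s(2)])
  have "T R F (dl R \<phi>) G = dl F \<phi>' G" if "G \<in> fac F" for G
    using oth(5)[OF R F that c] d[of "oth R F G"] by (simp add: T_def)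
  then show ?thesis using c \<open>mk \<phi>' = mk \<phi>\<close> by blast
qed

lemma V_T_dl:
  assumes R: "face (Suc (Suc d)) R" and F: "F \<in> fac R" and \<phi>: "\<phi> \<in> Con R" and cs: "length cs = d"
  shows "V F (T R F (dl R \<phi>)) cs = vol F (mk \<phi> # cs)"
proof -
  obtain \<phi>' where p: "\<phi>' \<in> Con F" "mk \<phi>' = mk \<phi>" "\<forall>G\<in>fac F. T R F (dl R \<phi>) G = dl F \<phi>' G"
    using T_dl[OF R F \<phi>] by blast
  have "V F (T R F (dl R \<phi>)) cs = V F (dl F \<phi>') cs" using p by (intro V_cong) auto
  also have "\<dots> = vol F (mk \<phi> # cs)" using V_dl[OF face_fac[OF R F] p(1) cs] p(2) by simp
  finally show ?thesis .
qed

text \<open>Links the form to mixed volumes. Only one argument has to come from a map in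
  \<open>Con R\<close>, the other may be any vector of heights.\<close>

lemma A_dl:
  assumes R: "face (Suc (Suc d)) R" and \<phi>: "\<phi> \<in> Con R" and cs: "length cs = d"
  shows "A R w (dl R \<phi>) cs = V R w (mk \<phi> # cs)"
  unfolding A_def V_def[of R] using V_T_dl[OF R _ \<phi> cs] by (intro sum.cong) auto

lemma A_cong: "(\<And>F. F \<in> fac R \<Longrightarrow> v F = v' F) \<Longrightarrow> A R v w cs = A R v' w cs"
  by (simp add: A_def)

text \<open>The matrix of the form \<open>A\<close>. Its diagonal consists of the corrections made
  by the translations in \<open>T\<close>; off the diagonal there remain the volumes of common faces
  of codimension 2, which is why the form is symmetric.\<close>

definition mat :: "'f \<Rightarrow> (real \<times> real \<times> real) list \<Rightarrow> 'f \<Rightarrow> 'f \<Rightarrow> real" where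
  "mat R cs F E = (\<Sum>G\<in>fac F. ((if oth R F G = E then 1 else 0)
      - (if E = F then dl R (sh R F) (oth R F G) else 0)) * vol G cs)"

lemma mat_off_diagonal:
  assumes R: "face (Suc (Suc d)) R" and "F \<in> fac R" "E \<in> fac R" "E \<noteq> F"
  shows "mat R cs F E = (\<Sum>G\<in>fac F \<inter> fac E. vol G cs)"
proof -
  have "oth R F G = E \<longleftrightarrow> G \<in> fac E" if "G \<in> fac F" for G
    using oth[OF R assms(2) that] assms by blast
  then have "mat R cs F E = (\<Sum>G\<in>fac F. if G \<in> fac E then vol G cs else 0)"
    unfolding mat_def using assms(4) by (intro sum.cong) auto
  also have "\<dots> = (\<Sum>G\<in>fac F \<inter> fac E. vol G cs)"
    using finite_fac[OF face_fac[OF R assms(2)]] by (simp add: sum.inter_restrict)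
  finally show ?thesis .
qed

lemma symmetric_mat:
  assumes R: "face (Suc (Suc d)) R"
  shows "symmetric_matrix (fac R) (mat R cs)"
proof
  show "finite (fac R)" by (rule finite_fac[OF R])
  fix E F assume "E \<in> fac R" "F \<in> fac R"
  then show "mat R cs E F = mat R cs F E"
    using mat_off_diagonal[OF R, of E F cs] mat_off_diagonal[OF R, of F E cs]
    by (cases "E = F") (auto simp: Int_commute)
qed

lemma row_mat:
  assumes R: "face (Suc (Suc d)) R" and F: "F \<in> fac R"
  shows "symmetric_matrix.row (fac R) (mat R cs) w F = V F (T R F w) cs"
proof -
  interpret symmetric_matrix "fac R" "mat R cs" by (rule symmetric_mat[OF R])
  have "row w F = (\<Sum>E\<in>fac R. \<Sum>G\<in>fac F. ((if oth R F G = E then 1 else 0)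
      - (if E = F then dl R (sh R F) (oth R F G) else 0)) * vol G cs * w E)"
    by (simp add: row_def mat_def sum_distrib_right)
  also have "\<dots> = (\<Sum>G\<in>fac F. \<Sum>E\<in>fac R. ((if oth R F G = E then 1 else 0)
      - (if E = F then dl R (sh R F) (oth R F G) else 0)) * vol G cs * w E)"
    by (rule sum.swap)
  also have "\<dots> = (\<Sum>G\<in>fac F. T R F w G * vol G cs)"
  proof (intro sum.cong refl)
    fix G assume G: "G \<in> fac F"
    have "(\<Sum>E\<in>fac R. ((if oth R F G = E then 1 else 0)
        - (if E = F then dl R (sh R F) (oth R F G) else 0)) * vol G cs * w E)
      = (\<Sum>E\<in>fac R. if oth R F G = E then vol G cs * w E else 0)
        - (\<Sum>E\<in>fac R. if E = F then dl R (sh R F) (oth R F G) * vol G cs * w E else 0)"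
      unfolding sum_subtractf[symmetric] by (intro sum.cong) (auto simp: algebra_simps)
    also have "\<dots> = T R F w G * vol G cs"
      using finite_I F oth(1)[OF R F G] by (simp add: T_def left_diff_distrib)
    finally show "(\<Sum>E\<in>fac R. ((if oth R F G = E then 1 else 0)
        - (if E = F then dl R (sh R F) (oth R F G) else 0)) * vol G cs * w E) = T R F w G * vol G cs" .
  qed
  finally show ?thesis by (simp add: V_def)
qed

lemma form_mat:
  assumes R: "face (Suc (Suc d)) R"
  shows "symmetric_matrix.form (fac R) (mat R cs) v w = A R v w cs"
  using row_mat[OF R] by (simp add: symmetric_matrix.form_def[OF symmetric_mat[OF R]] A_def)

lemma A_sym:
  assumes R: "face (Suc (Suc d)) R"
  shows "A R v w cs = A R w v cs"
  using symmetric_matrix.form_sym[OF symmetric_mat[OF R]] by (simp add: form_mat[OF R])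

text \<open>The codimension 3 contributions to the difference of the two sides of the Bochner
  inequality: they vanish where the link is a triangle, and where it is a square they are minus
  the square of the obstruction to extending \<open>v\<close> linearly.\<close>

lemma link_sum_nonpos:
  assumes R: "face (Suc (Suc (Suc d))) R"
    and up: "up = {F \<in> fac R. \<exists>G\<in>fac F. H \<in> fac G}"
    and \<phi>: "\<phi> \<in> Con R" "\<And>F. F \<in> fac R \<Longrightarrow> k F = dl R \<phi> F" "\<And>F. F \<in> fac R \<Longrightarrow> k F > 0"
    and \<psi>: "\<And>F G. F \<in> fac R \<Longrightarrow> G \<in> fac F \<Longrightarrow> \<psi> G \<in> Con R"
      "\<And>F G. F \<in> fac R \<Longrightarrow> G \<in> fac F \<Longrightarrow> dl R (\<psi> G) F = v F"
    and t: "\<And>F G. t F G = (v F * k (oth R F G) - k F * v (oth R F G)) *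
      (v (oth R F (oth F G H)) - dl R (\<psi> G) (oth R F (oth F G H)))"
  shows "(\<Sum>F\<in>up. \<Sum>G\<in>{G \<in> fac F. H \<in> fac G}. t F G) \<le> 0"
proof (cases "up = {}")
  case False
  define gs where "gs F = {G \<in> fac F. H \<in> fac G}" for F
  have upI: "F \<in> up \<longleftrightarrow> F \<in> fac R \<and> gs F \<noteq> {}" for F by (auto simp: up gs_def)
  have gs: "gs F = {G, oth F G H}" "oth F G H \<noteq> G" "oth F G H \<in> gs F" if "F \<in> fac R" "G \<in> gs F" for F G
  proof -
    have G: "G \<in> fac F" "H \<in> fac G" using that(2) by (auto simp: gs_def)
    note o = oth[OF face_fac[OF R that(1)] G]
    show "oth F G H \<noteq> G" by (rule o(2))
    show "oth F G H \<in> gs F" using o(1,3) by (simp add: gs_def)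
    show "gs F = {G, oth F G H}" unfolding gs_def using G o(1,3,4) by blast
  qed
  have oo: "oth R F G \<in> up" "oth R F G \<noteq> F" "G \<in> gs (oth R F G)" "oth R (oth R F G) G = F"
    if "F \<in> fac R" "G \<in> gs F" for F G
  proof -
    have G: "G \<in> fac F" "H \<in> fac G" using that(2) by (auto simp: gs_def)
    note o = oth[OF R that(1) G(1)]
    show "oth R F G \<noteq> F" by (rule o(2))
    show m: "G \<in> gs (oth R F G)" using o(3) G by (simp add: gs_def)
    show "oth R F G \<in> up" using o(1) m upI by blast
    show "oth R (oth R F G) G = F"
      by (rule oth(4)[OF R o(1) o(3) that(1) G(1) o(2)[symmetric]])
  qed
  have ou: "E = F \<or> E = oth R F G" if "F \<in> fac R" "G \<in> gs F" "E \<in> fac R" "G \<in> gs E" for E F G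
  proof -
    have "G \<in> fac F" "G \<in> fac E" using that by (auto simp: gs_def)
    from oth(4)[OF R that(1) this(1) that(3) this(2)] show ?thesis by blast
  qed
  have ju: "G = G'" if "E \<in> fac R" "F \<in> fac R" "E \<noteq> F" "G \<in> gs E" "G \<in> gs F" "G' \<in> gs E" "G' \<in> gs F" for E F G G'
    using join_unique[OF R that(1-3), of G G'] that by (simp add: gs_def)
  \<comment> \<open>The names follow the link polygon of \<open>H\<close>: \<open>F2\<close> and
    \<open>F3\<close> are the neighbours of \<open>F1\<close> across \<open>G12\<close> and
    \<open>G13\<close>.\<close>
  obtain F1 G12 where F1: "F1 \<in> fac R" "G12 \<in> gs F1" using False upI by auto
  define F2 G13 where "F2 = oth R F1 G12" and "G13 = oth F1 G12 H"
  define F3 where "F3 = oth R F1 G13"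
  note g1 = gs[OF F1, folded G13_def]
  note o2 = oo[OF F1, folded F2_def]
  have F2: "F2 \<in> fac R" using o2 upI by auto
  note o3 = oo[OF F1(1) g1(3), folded F3_def]
  have F3: "F3 \<in> fac R" using o3 upI by auto
  have n23: "F2 \<noteq> F3" using ju[OF F1(1) F2, of G12 G13] o2 o3 g1 F1 by auto
  define G2 G3 where "G2 = oth F2 G12 H" and "G3 = oth F3 G13 H"
  note g2 = gs[OF F2 o2(3), folded G2_def] and g3 = gs[OF F3 o3(3), folded G3_def]
  have far1: "oth F1 G12 H = G13" "oth F1 G13 H = G12" using gs[OF F1(1)] g1 F1 by (auto simp: G13_def)
  have far2: "oth F2 G12 H = G2" "oth F2 G2 H = G12"
    using gs[OF F2, of G2] g2 o2 by (auto simp: G2_def)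
  have far3: "oth F3 G13 H = G3" "oth F3 G3 H = G13"
    using gs[OF F3, of G3] g3 o3 by (auto simp: G3_def)
  have o1: "oth R F1 G12 = F2" "oth R F1 G13 = F3" "oth R F2 G12 = F1" "oth R F3 G13 = F1"
    using o2 o3 by (auto simp: F2_def F3_def)
  have u0: "dl R (\<psi> G) F = v F" if "F \<in> fac R" "G \<in> gs F" for F G
    using \<psi>(2) that by (auto simp: gs_def)
  have \<psi>c: "\<psi> G \<in> Con R" if "F \<in> fac R" "G \<in> gs F" for F G
    using \<psi>(1) that by (auto simp: gs_def)
  show ?thesis unfolding gs_def[symmetric]
  proof (cases "\<exists>G. G \<in> gs F2 \<and> G \<in> gs F3")
    case True
    then obtain G23 where G: "G23 \<in> gs F2" "G23 \<in> gs F3" by auto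
    have "G23 \<noteq> G12" using ou[OF F1, of F3] o1 n23 G o3 F3 by auto
    moreover have "G23 \<noteq> G13" using ou[OF F1(1) g1(3), of F2] o1 n23 G o2 F2 by auto
    ultimately have G': "G2 = G23" "G3 = G23" using g2 g3 G by auto
    have o23: "oth R F2 G23 = F3" "oth R F3 G23 = F2"
      using ou[OF F2 G(1) F3 G(2)] ou[OF F3 G(2) F2 G(1)] n23 by auto
    have up3: "up = {F1, F2, F3}"
    proof
      show "{F1, F2, F3} \<subseteq> up" using F1 F2 F3 o2 o3 upI by auto
      show "up \<subseteq> {F1, F2, F3}"
      proof (rule ccontr)
        assume "\<not> up \<subseteq> {F1, F2, F3}"
        \<comment> \<open>All sides of the triangle are taken, so \<open>F4\<close> is joined to
          none of the three facets. Then \<open>square\<close> makes \<open>F4\<close> and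
          \<open>F1\<close> the opposite corners of a square formed by the same facets, and
          \<open>F4\<close> has no possible neighbour.\<close>
        then obtain F4 where F4: "F4 \<in> up" "F4 \<noteq> F1" "F4 \<noteq> F2" "F4 \<noteq> F3" by auto
        have na: "\<not> (G \<in> gs F4 \<and> G \<in> gs F)" if "F \<in> {F1, F2, F3}" for G F
        proof
          assume a: "G \<in> gs F4 \<and> G \<in> gs F"
          have F: "F \<in> fac R" using that F1 F2 F3 by auto
          have "F4 = oth R F G" using ou[OF F, of G F4] a F4 upI that by auto
          moreover have "oth R F G \<in> {F1, F2, F3}"
            using that a g1 g2 g3 G' o1 o23 F1 by auto
          ultimately show False using F4 by auto
        qed
        obtain P Q where PQ: "up = {F4, F1, P, Q}"
          using square[OF R up F4(1), of F1] na[of F1] F1 F4 upI by (auto simp: gs_def)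
        then have "{P, Q} = {F2, F3}"
          using \<open>{F1, F2, F3} \<subseteq> up\<close> F4 n23 o2 o3 by auto
        then have "up = {F4, F1, F2, F3}" using PQ by auto
        moreover obtain G4 where "G4 \<in> gs F4" using F4 upI by auto
        ultimately show False using oo[of F4 G4] F4 upI na by blast
      qed
    qed
    \<comment> \<open>The two terms at one side of the triangle refer to the same third facet and
      have opposite prefactors.\<close>
    have "(\<Sum>F\<in>up. sum (t F) (gs F)) = (t F1 G12 + t F1 G13) + (t F2 G12 + t F2 G23) + (t F3 G13 + t F3 G23)"
      using up3 n23 o2 o3 g1 g2 g3 G' by simp
    also have "\<dots> = 0"
      unfolding t using far1 far2 far3 G' o1 o23 by (simp add: algebra_simps)
    finally show "(\<Sum>F\<in>up. sum (t F) (gs F)) \<le> 0" by simp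
  next
    case False
    have nadj: "\<not> (\<exists>G. G \<in> fac F2 \<and> G \<in> fac F3 \<and> H \<in> fac G)" using False by (auto simp: gs_def)
    then obtain P Q where PQ: "up = {F2, F3, P, Q}"
      "\<forall>\<theta>\<in>Con R. dl R \<theta> F2 + dl R \<theta> F3 = dl R \<theta> P + dl R \<theta> Q"
      using square[OF R up o2(1) o3(1) n23] by auto
    have "F1 \<in> up" using F1 upI by auto
    then have "F1 = P \<or> F1 = Q" using PQ o2 o3 by auto
    then obtain F4 where F4: "up = {F2, F3, F1, F4}"
      "\<And>\<theta>. \<theta> \<in> Con R \<Longrightarrow> dl R \<theta> F2 + dl R \<theta> F3 = dl R \<theta> F1 + dl R \<theta> F4"
    proof
      assume "F1 = P" then show ?thesis using PQ that[of Q] by blast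
    next
      assume "F1 = Q" then show ?thesis using PQ that[of P] by (simp add: insert_commute add.commute)
    qed
    have g2m: "G2 \<in> gs F2" and g3m: "G3 \<in> gs F3" using g2 g3 by auto
    have "oth R F2 G2 \<noteq> F3" using oo[OF F2 g2m] g2m False by auto
    moreover have "oth R F2 G2 \<noteq> F1" using ju[OF F1(1) F2, of G12 G2] oo[OF F2 g2m] g2 o2 F1 by auto
    ultimately have o24: "oth R F2 G2 = F4" using oo[OF F2 g2m] F4 by auto
    have "oth R F3 G3 \<noteq> F2" using oo[OF F3 g3m] g3m False by auto
    moreover have "oth R F3 G3 \<noteq> F1" using ju[OF F1(1) F3, of G13 G3] oo[OF F3 g3m] g3 o3 g1 by auto
    ultimately have o34: "oth R F3 G3 = F4" using oo[OF F3 g3m] F4 by auto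
    have n4: "F4 \<noteq> F1" "F4 \<noteq> F2" "F4 \<noteq> F3"
      using \<open>oth R F2 G2 \<noteq> F1\<close> \<open>oth R F3 G3 \<noteq> F2\<close> \<open>oth R F2 G2 \<noteq> F3\<close> o24 o34 by auto
    have F4': "F4 \<in> fac R" using F4 upI by auto
    have m4: "G2 \<in> gs F4" "G3 \<in> gs F4" "oth R F4 G2 = F2" "oth R F4 G3 = F3"
      using oo[OF F2 g2m] oo[OF F3 g3m] o24 o34 by auto
    have "G2 \<noteq> G3" using False g2m g3m by auto
    then have g4: "gs F4 = {G2, G3}" "oth F4 G2 H = G3" "oth F4 G3 H = G2"
      using gs[OF F4' m4(1)] gs[OF F4' m4(2)] m4 by auto
    \<comment> \<open>\<open>q\<close> measures how far \<open>v\<close> is from satisfying the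
      linear relation of the square. As all \<open>\<psi> G\<close> satisfy it and agree with
      \<open>v\<close> at \<open>G\<close>, each side of the square contributes its prefactor times
      \<open>q\<close>.\<close>
    define q where "q = v F2 + v F3 - v F1 - v F4"
    have rel: "dl R (\<psi> G) F2 + dl R (\<psi> G) F3 = dl R (\<psi> G) F1 + dl R (\<psi> G) F4"
      if "G \<in> {G12, G13, G2, G3}" for G
      using that F4(2) \<psi>c[OF F1] \<psi>c[OF F1(1) g1(3)] \<psi>c[OF F2 g2m] \<psi>c[OF F3 g3m] by auto
    have key: "t E G + t F G = (v E * k F - k E * v F) * (x - y)"
      if "oth R E G = F" "oth R F G = E" "oth R E (oth E G H) = E'" "oth R F (oth F G H) = F'"
        "v E' - dl R (\<psi> G) E' = x" "v F' - dl R (\<psi> G) F' = y" for E F G E' F' x y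
      unfolding t that by (simp add: algebra_simps)
    have "t F1 G12 + t F2 G12 = (v F1 * k F2 - k F1 * v F2) * q"
      using key[OF o1(1) o1(3), of F3 F4, unfolded far1 far2, OF o1(2) o24 refl refl]
        rel[of G12] u0[OF F1] u0[OF F2 o2(3)] by (simp add: q_def)
    moreover have "t F1 G13 + t F3 G13 = (v F1 * k F3 - k F1 * v F3) * q"
      using key[OF o1(2) o1(4), of F2 F4, unfolded far1 far3, OF o1(1) o34 refl refl]
        rel[of G13] u0[OF F1(1) g1(3)] u0[OF F3 o3(3)] by (simp add: q_def)
    moreover have "t F4 G2 + t F2 G2 = (v F4 * k F2 - k F4 * v F2) * q"
      using key[OF m4(3) o24, of F3 F1, unfolded far2 g4, OF m4(4) o1(3) refl refl]
        rel[of G2] u0[OF F2 g2m] u0[OF F4' m4(1)] by (simp add: q_def)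
    moreover have "t F4 G3 + t F3 G3 = (v F4 * k F3 - k F4 * v F3) * q"
      using key[OF m4(4) o34, of F2 F1, unfolded far3 g4, OF m4(3) o1(4) refl refl]
        rel[of G3] u0[OF F3 g3m] u0[OF F4' m4(2)] by (simp add: q_def)
    moreover have "(\<Sum>F\<in>up. sum (t F) (gs F)) = (t F1 G12 + t F2 G12) + (t F1 G13 + t F3 G13)
        + (t F4 G2 + t F2 G2) + (t F4 G3 + t F3 G3)"
      using F4(1) n4 n23 o2 o3 g1 g2 g3 g4 \<open>G2 \<noteq> G3\<close> by simp
    ultimately have "(\<Sum>F\<in>up. sum (t F) (gs F))
        = ((v F1 + v F4) * (k F2 + k F3) - (k F1 + k F4) * (v F2 + v F3)) * q"
      by (simp add: algebra_simps)
    also have "k F2 + k F3 = k F1 + k F4" using F4(2)[OF \<phi>(1)] \<phi>(2) F1 F2 F3 F4' by simp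
    finally have "(\<Sum>F\<in>up. sum (t F) (gs F)) = - ((k F1 + k F4) * q\<^sup>2)"
      by (simp add: q_def power2_eq_square algebra_simps)
    moreover have "(k F1 + k F4) * q\<^sup>2 \<ge> 0" using \<phi>(3)[OF F1(1)] \<phi>(3)[OF F4'] by simp
    ultimately show "(\<Sum>F\<in>up. sum (t F) (gs F)) \<le> 0" by simp
  qed
qed simp

end

section \<open>The Bochner inequality\<close>

text \<open>Both sides are expanded down to codimension 3, where their difference becomes a sum over
  flags of faces \<open>F\<close>, \<open>G\<close>, \<open>H\<close>. Collecting the flags that end
  in the same \<open>H\<close> leaves the link sums of \<open>link_sum_nonpos\<close>, weighted with
  the positive numbers \<open>vol H cs\<close>.\<close>

lemma (in face_system) bochner_inequality:
  assumes R: "face (Suc (Suc (Suc d))) R" and cs: "length cs = d" "\<And>c. c \<in> set cs \<Longrightarrow> pos3 c"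
    and \<phi>: "\<phi> \<in> Con R" "mk \<phi> = c" "\<And>F. F \<in> fac R \<Longrightarrow> dl R \<phi> F > 0"
  shows "A R v v (c # cs) \<le> (\<Sum>F\<in>fac R. dl R \<phi> F * A F (T R F v) (T R F v) cs)"
proof -
  define k where "k = dl R \<phi>"
  have FF: "face (Suc (Suc d)) F" if "F \<in> fac R" for F using face_fac[OF R that] .
  have GG: "face (Suc d) G" if "F \<in> fac R" "G \<in> fac F" for F G using face_fac[OF FF[OF that(1)] that(2)] .
  have HH: "face d H" if "F \<in> fac R" "G \<in> fac F" "H \<in> fac G" for F G H
    using face_fac[OF GG[OF that(1,2)] that(3)] .
  have "\<exists>\<theta>. \<theta> \<in> Con R \<and> mk \<theta> = (0, 0, 0) \<and> (\<forall>F\<in>fac R. G \<in> fac F \<longrightarrow> dl R \<theta> F = v F)"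
    if F: "F \<in> fac R" and G: "G \<in> fac F" for F G
  proof -
    define E where "E = oth R F G"
    note o = oth[OF R F G, folded E_def]
    have o': "oth R E G = F" by (rule oth(4)[OF R o(1) o(3) F G o(2)[symmetric]])
    note s = sh[OF FF[OF F] G] and s' = sh[OF FF[OF o(1)] o(3)]
    \<comment> \<open>\<open>sh F G\<close> vanishes on \<open>F\<close> and is 1 on
      \<open>E\<close>, and \<open>sh E G\<close> behaves the other way round. So the values on both
      facets through \<open>G\<close> can be prescribed by a vector of mark 0.\<close>
    have c1: "sh F G \<in> Con R" "dl R (sh F G) F = 0" using s(1) Con_fac[OF R F] by auto
    have c2: "sh E G \<in> Con R" "dl R (sh E G) E = 0" using s'(1) Con_fac[OF R o(1)] by auto
    have c3: "dl R (sh F G) E = 1" using o(5)[OF s(1)] s(3) by simp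
    have c4: "dl R (sh E G) F = 1" using oth(5)[OF R o(1) o(3) s'(1)] s'(3) o' by simp
    define \<theta>\<^sub>1 where "\<theta>\<^sub>1 = (\<lambda>y. 0 + v E * sh F G y)"
    define \<theta> where "\<theta> = (\<lambda>y. \<theta>\<^sub>1 y + v F * sh E G y)"
    have "\<theta>\<^sub>1 \<in> Con R" unfolding \<theta>\<^sub>1_def by (rule Con_lin[OF Con_zero c1(1)])
    then have "\<theta> \<in> Con R" unfolding \<theta>_def by (rule Con_lin[OF _ c2(1)])
    moreover have "mk \<theta>\<^sub>1 = mk (\<lambda>y. 0)" unfolding \<theta>\<^sub>1_def by (rule mk_add[OF s(2)])
    then have "mk \<theta> = (0, 0, 0)" unfolding \<theta>_def using mk_add[OF s'(2), of \<theta>\<^sub>1] mk_zero by simp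
    moreover have "dl R \<theta> X = dl R (\<lambda>y. 0) X + v E * dl R (sh F G) X + v F * dl R (sh E G) X" for X
      unfolding \<theta>_def \<theta>\<^sub>1_def by (simp only: dl_lin)
    then have "dl R \<theta> F = v F" "dl R \<theta> E = v E" using c1 c2 c3 c4 by (simp_all add: dl_zero)
    moreover have "X = F \<or> X = E" if "X \<in> fac R" "G \<in> fac X" for X
      using o(4)[OF that] by blast
    ultimately show ?thesis by blast
  qed
  then have "\<exists>\<psi>. \<forall>G. (\<exists>F\<in>fac R. G \<in> fac F) \<longrightarrow> \<psi> G \<in> Con R \<and> mk (\<psi> G) = (0, 0, 0) \<and>
      (\<forall>F\<in>fac R. G \<in> fac F \<longrightarrow> dl R (\<psi> G) F = v F)"
    by (intro choice) blast
  then obtain \<psi> where \<psi>: "\<And>F G. F \<in> fac R \<Longrightarrow> G \<in> fac F \<Longrightarrow> \<psi> G \<in> Con R"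
    "\<And>F G. F \<in> fac R \<Longrightarrow> G \<in> fac F \<Longrightarrow> mk (\<psi> G) = (0, 0, 0)"
    "\<And>F G. F \<in> fac R \<Longrightarrow> G \<in> fac F \<Longrightarrow> dl R (\<psi> G) F = v F" by metis
  define u where "u G E = v E - dl R (\<psi> G) E" for G E
  \<comment> \<open>The translation \<open>\<psi> G\<close> changes no volume. After it is
    subtracted, \<open>v\<close> vanishes on both facets through \<open>G\<close>, so
    \<open>T\<close> needs no correction there and the height at \<open>H\<close> is just the
    remaining value at the facet on the far side of \<open>H\<close>.\<close>
  have W: "V G (T F G (T R F v)) cs = (\<Sum>H\<in>fac G. u G (oth R F (oth F G H)) * vol H cs)"
    if F: "F \<in> fac R" and G: "G \<in> fac F" for F G
  proof -
    obtain \<psi>' where p: "\<psi>' \<in> Con F" "mk \<psi>' = (0, 0, 0)" "\<And>G'. G' \<in> fac F \<Longrightarrow> T R F (dl R (\<psi> G)) G' = dl F \<psi>' G'"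
      using T_dl[OF R F \<psi>(1)[OF F G]] \<psi>(2)[OF F G] by auto
    have u0: "u G F = 0" "u G (oth R F G) = 0"
      using \<psi>(3) F G oth(1,3)[OF R F G] by (simp_all add: u_def)
    have Tv: "T R F v G' = u G (oth R F G') + dl F \<psi>' G'" if "G' \<in> fac F" for G'
    proof -
      have "T R F v G' = T R F (\<lambda>E. u G E + 1 * dl R (\<psi> G) E) G'" by (simp add: u_def)
      also have "\<dots> = T R F (u G) G' + 1 * T R F (dl R (\<psi> G)) G'" by (rule T_add)
      finally show ?thesis using p(3)[OF that] u0 by (simp add: T_def)
    qed
    have "T F G (T R F v) H = u G (oth R F (oth F G H)) + T F G (dl F \<psi>') H" if H: "H \<in> fac G" for H
      using Tv[OF oth(1)[OF FF[OF F] G H]] Tv[OF G] u0 by (simp add: T_def)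
    then have "V G (T F G (T R F v)) cs
        = (\<Sum>H\<in>fac G. (u G (oth R F (oth F G H)) + T F G (dl F \<psi>') H) * vol H cs)"
      by (simp add: V_def)
    also have "\<dots> = (\<Sum>H\<in>fac G. u G (oth R F (oth F G H)) * vol H cs) + V G (T F G (dl F \<psi>')) cs"
      by (simp add: V_def algebra_simps sum.distrib)
    also have "V G (T F G (dl F \<psi>')) cs = 0"
      using V_T_dl[OF FF[OF F] G p(1) cs(1)] p(2) vol_zero[OF GG[OF F G] cs(1)] by simp
    finally show ?thesis by simp
  qed
  define t where "t H F G = (v F * k (oth R F G) - k F * v (oth R F G)) * u G (oth R F (oth F G H))" for H F G
  have "v F * V F (T R F v) (c # cs) - k F * A F (T R F v) (T R F v) cs
      = (\<Sum>G\<in>fac F. \<Sum>H\<in>fac G. t H F G * vol H cs)" if F: "F \<in> fac R" for F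
  proof -
    obtain \<phi>' where p: "\<phi>' \<in> Con F" "mk \<phi>' = c" "\<And>G. G \<in> fac F \<Longrightarrow> T R F k G = dl F \<phi>' G"
      using T_dl[OF R F \<phi>(1)] \<phi>(2) by (auto simp: k_def)
    have "V F (T R F v) (c # cs) = A F (T R F v) (dl F \<phi>') cs"
      using A_dl[OF FF[OF F] p(1) cs(1)] p(2) by simp
    also have "\<dots> = A F (dl F \<phi>') (T R F v) cs" by (rule A_sym[OF FF[OF F]])
    also have "\<dots> = A F (T R F k) (T R F v) cs" by (intro A_cong) (simp add: p(3))
    finally have "v F * V F (T R F v) (c # cs) - k F * A F (T R F v) (T R F v) cs
        = (\<Sum>G\<in>fac F. (v F * T R F k G - k F * T R F v G) * V G (T F G (T R F v)) cs)"
      by (simp add: A_def sum_distrib_left sum_subtractf[symmetric] algebra_simps)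
    also have "\<dots> = (\<Sum>G\<in>fac F. \<Sum>H\<in>fac G. t H F G * vol H cs)"
    proof (rule sum.cong[OF refl])
      fix G assume G: "G \<in> fac F"
      have "v F * T R F k G - k F * T R F v G = v F * k (oth R F G) - k F * v (oth R F G)"
        by (simp add: T_def algebra_simps)
      then show "(v F * T R F k G - k F * T R F v G) * V G (T F G (T R F v)) cs = (\<Sum>H\<in>fac G. t H F G * vol H cs)"
        by (simp add: W[OF F G] t_def sum_distrib_left mult_ac)
    qed
    finally show ?thesis .
  qed
  then have "A R v v (c # cs) - (\<Sum>F\<in>fac R. k F * A F (T R F v) (T R F v) cs)
      = (\<Sum>F\<in>fac R. \<Sum>G\<in>fac F. \<Sum>H\<in>fac G. t H F G * vol H cs)"
    by (simp add: A_def[of R] sum_subtractf[symmetric])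
  also have "\<dots> = (\<Sum>F\<in>fac R. \<Sum>G\<in>fac F. \<Sum>H\<in>(\<Union>F\<in>fac R. \<Union>G\<in>fac F. fac G). if H \<in> fac G then t H F G * vol H cs else 0)"
    (is "_ = (\<Sum>F\<in>_. \<Sum>G\<in>_. \<Sum>H\<in>?H. _)")
  proof (rule sum.cong[OF refl], rule sum.cong[OF refl])
    fix F G assume F: "F \<in> fac R" "G \<in> fac F"
    have "finite ?H" using finite_fac[OF R] finite_fac[OF FF] finite_fac[OF GG] by blast
    moreover have "?H \<inter> fac G = fac G" using F by blast
    ultimately show "(\<Sum>H\<in>fac G. t H F G * vol H cs) = (\<Sum>H\<in>?H. if H \<in> fac G then t H F G * vol H cs else 0)"
      using sum.inter_restrict[of ?H "\<lambda>H. t H F G * vol H cs" "fac G"] by simp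
  qed
  also have "\<dots> = (\<Sum>F\<in>fac R. \<Sum>H\<in>?H. \<Sum>G\<in>fac F. if H \<in> fac G then t H F G * vol H cs else 0)"
    by (rule sum.cong[OF refl], rule sum.swap)
  also have "\<dots> = (\<Sum>H\<in>?H. \<Sum>F\<in>fac R. \<Sum>G\<in>fac F. if H \<in> fac G then t H F G * vol H cs else 0)"
    by (rule sum.swap)
  also have "\<dots> \<le> 0"
  proof (rule sum_nonpos)
    fix H assume "H \<in> ?H"
    then have H: "vol H cs > 0" using HH vol_pos[OF _ cs] by blast
    define up where "up = {F \<in> fac R. \<exists>G\<in>fac F. H \<in> fac G}"
    have "(\<Sum>F\<in>fac R. \<Sum>G\<in>fac F. if H \<in> fac G then t H F G * vol H cs else 0)
        = (\<Sum>F\<in>fac R. (\<Sum>G\<in>{G \<in> fac F. H \<in> fac G}. t H F G) * vol H cs)"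
      using finite_fac[OF FF] by (auto simp: sum.inter_filter sum_distrib_right intro!: sum.cong)
    also have "\<dots> = (\<Sum>F\<in>up. \<Sum>G\<in>{G \<in> fac F. H \<in> fac G}. t H F G) * vol H cs"
    proof -
      have "(\<Sum>F\<in>fac R. \<Sum>G\<in>{G \<in> fac F. H \<in> fac G}. t H F G) = (\<Sum>F\<in>up. \<Sum>G\<in>{G \<in> fac F. H \<in> fac G}. t H F G)"
        using finite_fac[OF R] by (intro sum.mono_neutral_right) (auto simp: up_def intro!: sum.neutral)
      then show ?thesis by (simp add: sum_distrib_right[symmetric])
    qed
    also have "\<dots> \<le> 0"
    proof -
      have "(\<Sum>F\<in>up. \<Sum>G\<in>{G \<in> fac F. H \<in> fac G}. t H F G) \<le> 0"
        by (rule link_sum_nonpos[OF R up_def \<phi>(1), of k \<psi> v])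
          (use \<phi>(3) \<psi> in \<open>simp_all add: k_def t_def u_def\<close>)
      then show ?thesis using H by (simp add: mult_le_0_iff)
    qed
    finally show "(\<Sum>F\<in>fac R. \<Sum>G\<in>fac F. if H \<in> fac G then t H F G * vol H cs else 0) \<le> 0" .
  qed
  finally show ?thesis by (simp add: k_def)
qed

section \<open>Dimension 2: polygons with hexagonal edge directions\<close>

lemma lessThan_6: "{..<6::nat} = {0, 1, 2, 3, 4, 5}"
  by auto

lemma hexagon_form_hyperbolic:
  fixes a b :: "nat \<Rightarrow> real"
  defines "B \<equiv> \<lambda>a b. (\<Sum>i<6. a i * (b ((i + 1) mod 6) + b ((i + 5) mod 6) - b i))"
  assumes "B b b > 0"
  shows "B a a * B b b \<le> (B a b)\<^sup>2"
proof -
  text \<open>A hexagon with the given edge directions is a rectangle with two opposite corners cut off.\<close>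
  define X where "X a = a 0 + a 3" for a :: "nat \<Rightarrow> real"
  define Y where "Y a = a 1 + a 4" for a :: "nat \<Rightarrow> real"
  define p where "p a = a 1 + a 3 - a 2" for a :: "nat \<Rightarrow> real"
  define q where "q a = a 0 + a 4 - a 5" for a :: "nat \<Rightarrow> real"
  have B: "B a b = X a * Y b + X b * Y a - p a * p b - q a * q b" for a b
    by (simp add: B_def X_def Y_def p_def q_def lessThan_6 numeral_2_eq_2[symmetric] algebra_simps del: One_nat_def)
  have "2 * (X b * Y b) > p b * p b + q b * q b" using assms(2) unfolding B by (simp add: mult_ac)
  moreover have "p b * p b \<ge> 0" "q b * q b \<ge> 0" by simp_all
  ultimately have "X b * Y b > 0" by linarith
  then have Xb: "X b \<noteq> 0" by auto
  \<comment> \<open>In these coordinates the form has one hyperbolic plane and two negative squares.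
    This multiple of \<open>b\<close> cancels the \<open>X\<close> component, and only the negative
    squares survive.\<close>
  define x where "x = X a / X b"
  have "B a a - 2 * x * B a b + x\<^sup>2 * B b b = - (p a - x * p b)\<^sup>2 - (q a - x * q b)\<^sup>2"
  proof -
    have "X a = x * X b" using Xb by (simp add: x_def)
    then show ?thesis unfolding B by (simp add: power2_eq_square algebra_simps)
  qed
  also have "\<dots> \<le> 0" by (smt (verit) zero_le_power2)
  finally have "B b b * (B a a - 2 * x * B a b + x\<^sup>2 * B b b) \<le> 0" using assms(2) by (simp add: mult_le_0_iff)
  moreover have "0 \<le> (B a b - x * B b b)\<^sup>2" by simp
  ultimately show ?thesis by (simp add: power2_eq_square algebra_simps)
qed

text \<open>If \<open>j\<close> skipped the present direction \<open>j + 1\<close>, then the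
  predecessor of \<open>j + 1\<close> could only be \<open>j - 1\<close>, which in turn skips
  \<open>j\<close>, and so on backwards: the sides would run along two interlaced triangles and use
  all six directions. This is excluded by \<open>D\<close> being a proper subset.\<close>

lemma hexagon_neighbours:
  fixes rt lf :: "nat \<Rightarrow> nat"
  assumes D: "D \<subset> {..<6}"
    and rt: "\<And>i. i \<in> D \<Longrightarrow> rt i \<in> D" "\<And>i. i \<in> D \<Longrightarrow> lf i \<in> D"
      "\<And>i. i \<in> D \<Longrightarrow> lf (rt i) = i" "\<And>i. i \<in> D \<Longrightarrow> rt (lf i) = i"
      "\<And>i. i \<in> D \<Longrightarrow> rt i = (i + 1) mod 6 \<or> rt i = (i + 2) mod 6"
      "\<And>i. i \<in> D \<Longrightarrow> lf i = (i + 5) mod 6 \<or> lf i = (i + 4) mod 6"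
    and i: "i \<in> D"
  shows "rt i = (if (i + 1) mod 6 \<in> D then (i + 1) mod 6 else (i + 2) mod 6)"
    and "lf i = (if (i + 5) mod 6 \<in> D then (i + 5) mod 6 else (i + 4) mod 6)"
proof -
  have r: "rt j = (j + 1) mod 6" if j: "j \<in> D" "(j + 1) mod 6 \<in> D" for j
  proof (rule ccontr)
    assume n: "rt j \<noteq> (j + 1) mod 6"
    have j6: "j < 6" using D j by auto
    then have "j \<in> {0, 1, 2, 3, 4, 5}" unfolding lessThan_6[symmetric] by simp
    then have a: "((j + 1) mod 6 + 5) mod 6 = j" "((j + 1) mod 6 + 4) mod 6 = (j + 5) mod 6"
      "((j + 5) mod 6 + 5) mod 6 = (j + 4) mod 6" "((j + 5) mod 6 + 4) mod 6 = (j + 3) mod 6"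
      "(j + 1) mod 6 \<noteq> j" "(j + 5) mod 6 \<noteq> j"
      by (elim insertE emptyE; simp)+
    have c2: "(j + 2) mod 6 \<in> D" "rt j = (j + 2) mod 6" using n rt(1,5)[OF j(1)] by auto
    have "lf ((j + 1) mod 6) \<noteq> j" using n rt(4)[OF j(2)] by auto
    then have "lf ((j + 1) mod 6) = (j + 5) mod 6" using rt(6)[OF j(2)] unfolding a by blast
    then have c5: "(j + 5) mod 6 \<in> D" "rt ((j + 5) mod 6) = (j + 1) mod 6"
      using rt(2)[OF j(2)] rt(4)[OF j(2)] by auto
    have "lf j \<noteq> (j + 5) mod 6" using c5 rt(4)[OF j(1)] a by auto
    then have "lf j = (j + 4) mod 6" using rt(6)[OF j(1)] by auto
    then have c4: "(j + 4) mod 6 \<in> D" "rt ((j + 4) mod 6) = j"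
      using rt(2)[OF j(1)] rt(4)[OF j(1)] by auto
    have "lf ((j + 5) mod 6) \<noteq> (j + 4) mod 6" using c4 rt(4)[OF c5(1)] a by auto
    then have "lf ((j + 5) mod 6) = (j + 3) mod 6" using rt(6)[OF c5(1)] unfolding a by blast
    then have "(j + 3) mod 6 \<in> D" using rt(2)[OF c5(1)] by simp
    then have "{..<6} \<subseteq> D"
    proof -
      consider "j = 0" | "j = 1" | "j = 2" | "j = 3" | "j = 4" | "j = 5" using j6 by linarith
      then show ?thesis using \<open>(j + 3) mod 6 \<in> D\<close> j c2(1) c4(1) c5(1) by cases (simp_all add: lessThan_6 numeral_2_eq_2[symmetric] del: One_nat_def)
    qed
    then show False using D by auto
  qed
  have i6: "i < 6" using D i by auto
  show "rt i = (if (i + 1) mod 6 \<in> D then (i + 1) mod 6 else (i + 2) mod 6)"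
    using r[OF i] rt(1,5)[OF i] by auto
  show "lf i = (if (i + 5) mod 6 \<in> D then (i + 5) mod 6 else (i + 4) mod 6)"
  proof (cases "(i + 5) mod 6 \<in> D")
    case True
    have "i \<in> {0, 1, 2, 3, 4, 5}" using i6 unfolding lessThan_6[symmetric] by simp
    then have "((i + 5) mod 6 + 1) mod 6 = i" by (elim insertE emptyE) simp_all
    then have "rt ((i + 5) mod 6) = i" using r[OF True] i by simp
    then show ?thesis using rt(3)[OF True] True by simp
  next
    case False then show ?thesis using rt(2,6)[OF i] by auto
  qed
qed

lemma root_det:
  assumes "i < 6" "j < 6"
  shows "root_x i * root_y j - root_y i * root_x j \<noteq> 0 \<longleftrightarrow>
      j \<in> {(i + 1) mod 6, (i + 2) mod 6, (i + 4) mod 6, (i + 5) mod 6}"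
    and "root_x i * root_y j - root_y i * root_x j > 0 \<longleftrightarrow> j \<in> {(i + 1) mod 6, (i + 2) mod 6}"
    and "root_x i * root_y j - root_y i * root_x j < 0 \<longleftrightarrow> j \<in> {(i + 5) mod 6, (i + 4) mod 6}"
proof -
  have "i \<in> {0, 1, 2, 3, 4, 5}" "j \<in> {0, 1, 2, 3, 4, 5}" using assms by auto
  then show "root_x i * root_y j - root_y i * root_x j \<noteq> 0 \<longleftrightarrow>
      j \<in> {(i + 1) mod 6, (i + 2) mod 6, (i + 4) mod 6, (i + 5) mod 6}"
    "root_x i * root_y j - root_y i * root_x j > 0 \<longleftrightarrow> j \<in> {(i + 1) mod 6, (i + 2) mod 6}"
    "root_x i * root_y j - root_y i * root_x j < 0 \<longleftrightarrow> j \<in> {(i + 5) mod 6, (i + 4) mod 6}"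
    by (elim insertE emptyE; simp add: root_x_def root_y_def)+
qed

text \<open>The two neighbours of a root add up to it, and replacing a neighbour by the next root
  but one subtracts the root once more. This yields the diagonal coefficient of a side according to
  which neighbouring directions are present.\<close>

lemma root_sum:
  assumes "i < 6" "(x::real) * root_x i + y * root_y i = 1"
  shows "x * (root_x ((i + 1) mod 6) + root_x ((i + 5) mod 6)) + y * (root_y ((i + 1) mod 6) + root_y ((i + 5) mod 6)) = 1"
    "x * (root_x ((i + 2) mod 6) + root_x ((i + 5) mod 6)) + y * (root_y ((i + 2) mod 6) + root_y ((i + 5) mod 6)) = 0"
    "x * (root_x ((i + 1) mod 6) + root_x ((i + 4) mod 6)) + y * (root_y ((i + 1) mod 6) + root_y ((i + 4) mod 6)) = 0"
    "x * (root_x ((i + 2) mod 6) + root_x ((i + 4) mod 6)) + y * (root_y ((i + 2) mod 6) + root_y ((i + 4) mod 6)) = -1"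
proof -
  have "i \<in> {0, 1, 2, 3, 4, 5}" using assms by auto
  then show "x * (root_x ((i + 1) mod 6) + root_x ((i + 5) mod 6)) + y * (root_y ((i + 1) mod 6) + root_y ((i + 5) mod 6)) = 1"
    "x * (root_x ((i + 2) mod 6) + root_x ((i + 5) mod 6)) + y * (root_y ((i + 2) mod 6) + root_y ((i + 5) mod 6)) = 0"
    "x * (root_x ((i + 1) mod 6) + root_x ((i + 4) mod 6)) + y * (root_y ((i + 1) mod 6) + root_y ((i + 4) mod 6)) = 0"
    "x * (root_x ((i + 2) mod 6) + root_x ((i + 4) mod 6)) + y * (root_y ((i + 2) mod 6) + root_y ((i + 4) mod 6)) = -1"
    using assms(2) by (elim insertE emptyE; simp add: root_x_def root_y_def)+
qed

text \<open>\<zeta> is the translation along the edge \<open>F\<close>, and \<open>d G\<close> is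
  its height at the end \<open>G\<close>. A translation does not change the length of the edge, so
  these numbers add up to 0. None of them is 0; hence both signs occur, and by
  \<open>segment\<close> there is no room for a third end.\<close>

lemma (in face_system) polygon_neighbours:
  assumes R: "face (Suc (Suc 0)) R"
    and \<theta>: "\<theta> \<in> Con R" "\<eta> \<in> Con R" "mk \<theta> = (0, 0, 0)" "mk \<eta> = (0, 0, 0)"
    and \<rho>: "\<And>F. F \<in> fac R \<Longrightarrow> \<rho> F < 6"
      "\<And>F. F \<in> fac R \<Longrightarrow> dl R \<theta> F = root_x (\<rho> F)" "\<And>F. F \<in> fac R \<Longrightarrow> dl R \<eta> F = root_y (\<rho> F)"
    and span: "\<And>\<zeta>. \<zeta> \<in> Con R \<Longrightarrow> mk \<zeta> = (0, 0, 0) \<Longrightarrow> \<exists>x y. \<forall>F\<in>fac R. dl R \<zeta> F = x * dl R \<theta> F + y * dl R \<eta> F"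
    and F: "F \<in> fac R"
  shows "\<exists>G G'. fac F = {G, G'} \<and> G \<noteq> G' \<and>
      \<rho> (oth R F G) \<in> {(\<rho> F + 1) mod 6, (\<rho> F + 2) mod 6} \<and>
      \<rho> (oth R F G') \<in> {(\<rho> F + 5) mod 6, (\<rho> F + 4) mod 6}"
proof -
  have FF: "face (Suc 0) F" by (rule face_fac[OF R F])
  define i where "i = \<rho> F"
  define d where "d G = root_x i * root_y (\<rho> (oth R F G)) - root_y i * root_x (\<rho> (oth R F G))" for G
  define \<zeta> where "\<zeta> = (\<lambda>y. (0 + (- root_y i) * \<theta> y) + root_x i * \<eta> y)"
  have "(\<lambda>y. 0 + (- root_y i) * \<theta> y) \<in> Con R" by (rule Con_lin[OF Con_zero \<theta>(1)])
  then have z1: "\<zeta> \<in> Con R" unfolding \<zeta>_def by (rule Con_lin[OF _ \<theta>(2)])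
  have "mk (\<lambda>y. 0 + (- root_y i) * \<theta> y) = mk (\<lambda>y. 0)" by (rule mk_add[OF \<theta>(3)])
  moreover have "mk \<zeta> = mk (\<lambda>y. 0 + (- root_y i) * \<theta> y)" unfolding \<zeta>_def by (rule mk_add[OF \<theta>(4)])
  ultimately have z2: "mk \<zeta> = (0, 0, 0)" using mk_zero by simp
  have z3: "dl R \<zeta> E = dl R (\<lambda>y. 0) E + (- root_y i) * dl R \<theta> E + root_x i * dl R \<eta> E" for E
    unfolding \<zeta>_def by (simp only: dl_lin)
  have "dl R \<zeta> F = 0" unfolding z3 using \<rho>[OF F] by (simp add: dl_zero i_def)
  then have zF: "\<zeta> \<in> Con F" using Con_fac[OF R F] z1 by blast
  have dG: "dl F \<zeta> G = d G" if G: "G \<in> fac F" for G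
    unfolding oth(5)[OF R F G zF] z3 using \<rho>[OF oth(1)[OF R F G]] by (simp add: dl_zero d_def)
  have vG: "vol G [] = 1" if "G \<in> fac F" for G using vol_point[OF face_fac[OF FF that]] .
  have "vol F (mk \<zeta> # []) = (\<Sum>G\<in>fac F. dl F \<zeta> G * vol G [])" by (rule vol_facets[OF FF zF]) simp
  then have s0: "(\<Sum>G\<in>fac F. d G) = 0" using vol_zero[OF FF] z2 vG dG by simp
  \<comment> \<open>Otherwise the neighbour across \<open>G\<close> would have the same or the
    opposite direction as \<open>F\<close>, but \<open>sh F G\<close> is 0 on \<open>F\<close> and 1
    on that neighbour.\<close>
  have nz: "d G \<noteq> 0" if G: "G \<in> fac F" for G
  proof
    assume a: "d G = 0"
    note s = sh[OF FF G]
    have s1: "sh F G \<in> Con R" "dl R (sh F G) F = 0" using s(1) Con_fac[OF R F] by auto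
    obtain x y where xy: "\<And>E. E \<in> fac R \<Longrightarrow> dl R (sh F G) E = x * root_x (\<rho> E) + y * root_y (\<rho> E)"
      using span[OF s1(1) s(2)] \<rho> by auto
    define j where "j = \<rho> (oth R F G)"
    have e1: "x * root_x i + y * root_y i = 0" using xy[OF F] s1 by (simp add: i_def)
    have e2: "x * root_x j + y * root_y j = 1"
      using xy[OF oth(1)[OF R F G]] oth(5)[OF R F G s(1)] s(3) by (simp add: j_def)
    have "j \<notin> {(i + 1) mod 6, (i + 2) mod 6, (i + 4) mod 6, (i + 5) mod 6}" "i < 6" "j < 6"
      using a root_det(1)[of i j] \<rho>(1)[OF F] \<rho>(1)[OF oth(1)[OF R F G]] by (auto simp: d_def i_def j_def)
    moreover have "i \<in> {0, 1, 2, 3, 4, 5}" "j \<in> {0, 1, 2, 3, 4, 5}" using calculation(2,3) by auto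
    ultimately show False using e1 e2
      by (elim insertE emptyE; simp add: root_x_def root_y_def)
  qed
  have "fac F \<noteq> {}"
  proof
    assume "fac F = {}"
    obtain \<phi> where "\<phi> \<in> Con F" "mk \<phi> = (1, 1, 1)" using strict_ex[OF FF, of "(1, 1, 1)"] by (auto simp: pos3_def)
    then have "vol F [(1, 1, 1)] = 0" using vol_facets[OF FF, of \<phi> "[]"] \<open>fac F = {}\<close> by simp
    moreover have "vol F [(1, 1, 1)] > 0" by (rule vol_pos[OF FF]) (auto simp: pos3_def)
    ultimately show False by simp
  qed
  have fin: "finite (fac F)" by (rule finite_fac[OF FF])
  have "\<exists>G\<in>fac F. d G > 0"
  proof (rule ccontr)
    assume "\<not> (\<exists>G\<in>fac F. d G > 0)"
    then have "\<And>G. G \<in> fac F \<Longrightarrow> d G < 0" using nz by force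
    then have "(\<Sum>G\<in>fac F. - d G) > 0" using fin \<open>fac F \<noteq> {}\<close> by (intro sum_pos) auto
    then show False using s0 by (simp add: sum_negf)
  qed
  then obtain G where G: "G \<in> fac F" "d G > 0" by auto
  have "\<exists>G\<in>fac F. d G < 0"
  proof (rule ccontr)
    assume "\<not> (\<exists>G\<in>fac F. d G < 0)"
    then have "\<And>G. G \<in> fac F \<Longrightarrow> d G > 0" using nz by force
    then have "(\<Sum>G\<in>fac F. d G) > 0" using fin \<open>fac F \<noteq> {}\<close> by (intro sum_pos)
    then show False using s0 by simp
  qed
  then obtain G' where G': "G' \<in> fac F" "d G' < 0" by auto
  have ne: "G \<noteq> G'" using G G' by auto
  have "fac F = {G, G'}"
  proof (rule sym, rule card_subset_eq[OF fin])
    have "card {G, G'} \<le> card (fac F)" using G G' fin by (intro card_mono) auto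
    then show "card {G, G'} = card (fac F)" using segment[OF FF] ne by simp
  qed (use G G' in auto)
  moreover have "\<rho> (oth R F G) \<in> {(i + 1) mod 6, (i + 2) mod 6}"
    using root_det(2)[of i "\<rho> (oth R F G)"] G \<rho>(1)[OF F] \<rho>(1)[OF oth(1)[OF R F G(1)]] by (simp add: d_def i_def)
  moreover have "\<rho> (oth R F G') \<in> {(i + 5) mod 6, (i + 4) mod 6}"
    using root_det(3)[of i "\<rho> (oth R F G')"] G' \<rho>(1)[OF F] \<rho>(1)[OF oth(1)[OF R F G'(1)]] by (simp add: d_def i_def)
  ultimately show ?thesis using ne unfolding i_def by blast
qed

lemma hexagon_asym:
  fixes i j :: nat
  assumes "i < 6" "j < 6"
  shows "i \<in> {(j + 1) mod 6, (j + 2) mod 6} \<Longrightarrow> j \<notin> {(i + 1) mod 6, (i + 2) mod 6}"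
    and "i \<in> {(j + 5) mod 6, (j + 4) mod 6} \<Longrightarrow> j \<notin> {(i + 5) mod 6, (i + 4) mod 6}"
proof -
  have "i = 0 \<or> i = 1 \<or> i = 2 \<or> i = 3 \<or> i = 4 \<or> i = 5" "j = 0 \<or> j = 1 \<or> j = 2 \<or> j = 3 \<or> j = 4 \<or> j = 5"
    using assms by linarith+
  then have "i \<in> {(j + 1) mod 6, (j + 2) mod 6} \<longrightarrow> j \<notin> {(i + 1) mod 6, (i + 2) mod 6}"
    "i \<in> {(j + 5) mod 6, (j + 4) mod 6} \<longrightarrow> j \<notin> {(i + 5) mod 6, (i + 4) mod 6}"
    by (elim disjE; hypsubst; simp)+
  then show "i \<in> {(j + 1) mod 6, (j + 2) mod 6} \<Longrightarrow> j \<notin> {(i + 1) mod 6, (i + 2) mod 6}"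
     "i \<in> {(j + 5) mod 6, (j + 4) mod 6} \<Longrightarrow> j \<notin> {(i + 5) mod 6, (i + 4) mod 6}"
    by blast+
qed
text \<open>The last present direction before two adjacent missing ones would have no
  successor.\<close>

lemma hexagon_gap:
  fixes D :: "nat set"
  assumes D: "i0 \<in> D" "i0 < 6" "j < 6" "j \<notin> D"
  and c: "\<And>i. i \<in> D \<Longrightarrow> (i + 1) mod 6 \<in> D \<or> (i + 2) mod 6 \<in> D" "\<And>i. i \<in> D \<Longrightarrow> (i + 5) mod 6 \<in> D \<or> (i + 4) mod 6 \<in> D"
  shows "(j + 1) mod 6 \<in> D \<and> (j + 5) mod 6 \<in> D"
proof -
  define d where "d i \<longleftrightarrow> i \<in> D" for i
  have r: "d 0 \<Longrightarrow> d 1 \<or> d 2" "d 1 \<Longrightarrow> d 2 \<or> d 3" "d 2 \<Longrightarrow> d 3 \<or> d 4" "d 3 \<Longrightarrow> d 4 \<or> d 5" "d 4 \<Longrightarrow> d 5 \<or> d 0" "d 5 \<Longrightarrow> d 0 \<or> d 1"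
    using c(1)[of 0] c(1)[of 1] c(1)[of 2] c(1)[of 3] c(1)[of 4] c(1)[of 5]
    by (simp_all add: d_def numeral_2_eq_2[symmetric] del: One_nat_def)
  have l: "d 0 \<Longrightarrow> d 5 \<or> d 4" "d 1 \<Longrightarrow> d 0 \<or> d 5" "d 2 \<Longrightarrow> d 1 \<or> d 0" "d 3 \<Longrightarrow> d 2 \<or> d 1" "d 4 \<Longrightarrow> d 3 \<or> d 2" "d 5 \<Longrightarrow> d 4 \<or> d 3"
    using c(2)[of 0] c(2)[of 1] c(2)[of 2] c(2)[of 3] c(2)[of 4] c(2)[of 5]
    by (simp_all add: d_def numeral_2_eq_2[symmetric] del: One_nat_def)
  have "i0 = 0 \<or> i0 = 1 \<or> i0 = 2 \<or> i0 = 3 \<or> i0 = 4 \<or> i0 = 5" using D by linarith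
  then have ne: "d 0 \<or> d 1 \<or> d 2 \<or> d 3 \<or> d 4 \<or> d 5" using D(1) d_def by metis
  have n: "\<not> d 0 \<Longrightarrow> d 1 \<and> d 5" "\<not> d 1 \<Longrightarrow> d 2 \<and> d 0" "\<not> d 2 \<Longrightarrow> d 3 \<and> d 1" "\<not> d 3 \<Longrightarrow> d 4 \<and> d 2"
     "\<not> d 4 \<Longrightarrow> d 5 \<and> d 3" "\<not> d 5 \<Longrightarrow> d 0 \<and> d 4"
    using r l ne by argo+
  have "j = 0 \<or> j = 1 \<or> j = 2 \<or> j = 3 \<or> j = 4 \<or> j = 5" using D by linarith
  then have "\<not> d j \<longrightarrow> d ((j + 1) mod 6) \<and> d ((j + 5) mod 6)"
    by (elim disjE; hypsubst; simp add: numeral_2_eq_2[symmetric] del: One_nat_def; use n in blast)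
  then show ?thesis using D(4) by (simp add: d_def)
qed

text \<open>The form is transported to the full hexagon, where a missing direction becomes a side of
  length 0 and contributes nothing.\<close>

lemma (in face_system) polygon_hyperbolic:
  assumes R: "face (Suc (Suc 0)) R" and pos: "A R w w [] > 0"
  shows "A R v v [] * A R w w [] \<le> (A R v w [])\<^sup>2"
proof -
  from polygon[OF R] obtain \<theta> \<eta> \<rho> where th: "\<theta> \<in> Con R" "\<eta> \<in> Con R" "mk \<theta> = (0, 0, 0)" "mk \<eta> = (0, 0, 0)"
    and inj: "inj_on \<rho> (fac R)" and sub: "\<rho> ` fac R \<subset> {..<6}"
    and rt': "\<forall>F\<in>fac R. dl R \<theta> F = root_x (\<rho> F) \<and> dl R \<eta> F = root_y (\<rho> F)"
    and span': "\<forall>\<zeta>\<in>Con R. mk \<zeta> = (0, 0, 0) \<longrightarrow> (\<exists>x y. \<forall>F\<in>fac R. dl R \<zeta> F = x * dl R \<theta> F + y * dl R \<eta> F)"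
    by (elim exE conjE) (rule that)
  have rt: "dl R \<theta> F = root_x (\<rho> F)" "dl R \<eta> F = root_y (\<rho> F)" if "F \<in> fac R" for F
    using rt' that by auto
  have span: "\<exists>x y. \<forall>F\<in>fac R. dl R \<zeta> F = x * dl R \<theta> F + y * dl R \<eta> F"
    if "\<zeta> \<in> Con R" "mk \<zeta> = (0, 0, 0)" for \<zeta> using span' that by blast
  define D where "D = \<rho> ` fac R"
  define f where "f = the_inv_into (fac R) \<rho>"
  have f: "f (\<rho> F) = F" if "F \<in> fac R" for F using the_inv_into_f_f[OF inj that] by (simp add: f_def)
  have D: "i \<in> D \<Longrightarrow> f i \<in> fac R \<and> \<rho> (f i) = i" for i using f by (auto simp: D_def)
  have \<rho>D: "\<rho> F \<in> D" if "F \<in> fac R" for F using that by (simp add: D_def)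
  have \<rho>6: "\<rho> F < 6" if "F \<in> fac R" for F using sub that by auto
  have D6: "i < 6" if "i \<in> D" for i using sub that by (auto simp: D_def)
  have "\<forall>F. \<exists>G G'. F \<in> fac R \<longrightarrow> fac F = {G, G'} \<and> G \<noteq> G' \<and>
      \<rho> (oth R F G) \<in> {(\<rho> F + 1) mod 6, (\<rho> F + 2) mod 6} \<and>
      \<rho> (oth R F G') \<in> {(\<rho> F + 5) mod 6, (\<rho> F + 4) mod 6}"
    using polygon_neighbours[OF R th \<rho>6 rt span] by blast
  then obtain g g' where g: "\<And>F. F \<in> fac R \<Longrightarrow> fac F = {g F, g' F}" "\<And>F. F \<in> fac R \<Longrightarrow> g F \<noteq> g' F"
      "\<And>F. F \<in> fac R \<Longrightarrow> \<rho> (oth R F (g F)) \<in> {(\<rho> F + 1) mod 6, (\<rho> F + 2) mod 6}"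
      "\<And>F. F \<in> fac R \<Longrightarrow> \<rho> (oth R F (g' F)) \<in> {(\<rho> F + 5) mod 6, (\<rho> F + 4) mod 6}"
    by metis
  define r where "r i = \<rho> (oth R (f i) (g (f i)))" for i
  define l where "l i = \<rho> (oth R (f i) (g' (f i)))" for i
  have bk: "oth R (oth R F G) G = F" if "F \<in> fac R" "G \<in> fac F" for F G
    by (rule oth(4)[OF R oth(1)[OF R that] oth(3)[OF R that] that oth(2)[OF R that, symmetric]])
  have gm: "g F \<in> fac F" "g' F \<in> fac F" if "F \<in> fac R" for F using g(1)[OF that] by auto
  have lr: "l (r i) = i" if "i \<in> D" for i
  proof -
    define F where "F = f i"
    define E where "E = oth R F (g F)"
    have F: "F \<in> fac R" "\<rho> F = i" using D[OF that] by (auto simp: F_def)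
    have E: "E \<in> fac R" "g F \<in> fac E" using oth(1,3)[OF R F(1) gm(1)[OF F(1)]] by (auto simp: E_def)
    have b: "oth R E (g F) = F" using bk[OF F(1) gm(1)[OF F(1)]] by (simp add: E_def)
    have "g F \<noteq> g E" using hexagon_asym(1)[OF \<rho>6[OF F(1)] \<rho>6[OF E(1)]] g(3)[OF F(1)] g(3)[OF E(1)] b
      unfolding E_def by metis
    then have "g F = g' E" using g(1)[OF E(1)] E(2) by auto
    then have "l (\<rho> E) = i" using b F f[OF E(1)] by (simp add: l_def)
    then show ?thesis by (simp add: r_def F_def E_def)
  qed
  have rl: "r (l i) = i" if "i \<in> D" for i
  proof -
    define F where "F = f i"
    define E where "E = oth R F (g' F)"
    have F: "F \<in> fac R" "\<rho> F = i" using D[OF that] by (auto simp: F_def)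
    have E: "E \<in> fac R" "g' F \<in> fac E" using oth(1,3)[OF R F(1) gm(2)[OF F(1)]] by (auto simp: E_def)
    have b: "oth R E (g' F) = F" using bk[OF F(1) gm(2)[OF F(1)]] by (simp add: E_def)
    have "g' F \<noteq> g' E" using hexagon_asym(2)[OF \<rho>6[OF F(1)] \<rho>6[OF E(1)]] g(4)[OF F(1)] g(4)[OF E(1)] b
      unfolding E_def by metis
    then have "g' F = g E" using g(1)[OF E(1)] E(2) by auto
    then have "r (\<rho> E) = i" using b F f[OF E(1)] by (simp add: r_def)
    then show ?thesis by (simp add: l_def F_def E_def)
  qed
  have rD: "r i \<in> D" "l i \<in> D" if "i \<in> D" for i
    unfolding r_def l_def using D[OF that] oth(1)[OF R] gm \<rho>D by blast+
  have r2: "r i = (i + 1) mod 6 \<or> r i = (i + 2) mod 6" "l i = (i + 5) mod 6 \<or> l i = (i + 4) mod 6" if "i \<in> D" for i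
    using g(3,4)[of "f i"] D[OF that] by (auto simp: r_def l_def)
  have subD: "D \<subset> {..<6}" using sub by (simp add: D_def)
  have hex: "r i = (if (i + 1) mod 6 \<in> D then (i + 1) mod 6 else (i + 2) mod 6)"
    "l i = (if (i + 5) mod 6 \<in> D then (i + 5) mod 6 else (i + 4) mod 6)" if "i \<in> D" for i
    by (rule hexagon_neighbours[OF subD rD lr rl r2 that]; assumption)+
  \<comment> \<open>For a missing direction this is the height of the vertex between the two
    neighbouring sides, which \<open>gap\<close> shows to be present.\<close>
  define h where "h u j = (if j \<in> D then u (f j) else u (f ((j + 5) mod 6)) + u (f ((j + 1) mod 6)))"
    for u :: "'f \<Rightarrow> real" and j
  have len: "V F (T R F u) [] = h u ((\<rho> F + 1) mod 6) + h u ((\<rho> F + 5) mod 6) - h u (\<rho> F)"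
    if F: "F \<in> fac R" for u F
  proof -
    define i where "i = \<rho> F"
    have i: "i \<in> D" "f i = F" "i < 6" using \<rho>D[OF F] f[OF F] \<rho>6[OF F] by (auto simp: i_def)
    have vG: "vol G [] = 1" if "G \<in> fac F" for G by (rule vol_point[OF face_fac[OF face_fac[OF R F] that]])
    note s = sh[OF R F]
    obtain x y where xy: "\<And>E. E \<in> fac R \<Longrightarrow> dl R (sh R F) E = x * root_x (\<rho> E) + y * root_y (\<rho> E)"
      using span[OF s(1,2)] rt by auto
    have e1: "x * root_x i + y * root_y i = 1" using xy[OF F] s(3) by (simp add: i_def)
    have ri: "\<rho> (oth R F (g F)) = r i" "\<rho> (oth R F (g' F)) = l i" using i by (auto simp: r_def l_def)
    have fr: "f (r i) = oth R F (g F)" "f (l i) = oth R F (g' F)"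
      using f oth(1)[OF R F] gm[OF F] ri by metis+
    have "V F (T R F u) [] = u (oth R F (g F)) + u (oth R F (g' F))
        - u F * (dl R (sh R F) (oth R F (g F)) + dl R (sh R F) (oth R F (g' F)))"
      using g(1,2)[OF F] gm[OF F] vG by (simp add: V_def T_def algebra_simps)
    also have "dl R (sh R F) (oth R F (g F)) + dl R (sh R F) (oth R F (g' F))
        = x * (root_x (r i) + root_x (l i)) + y * (root_y (r i) + root_y (l i))"
      using xy[OF oth(1)[OF R F gm(1)[OF F]]] xy[OF oth(1)[OF R F gm(2)[OF F]]] ri by (simp add: algebra_simps)
    finally have e2: "V F (T R F u) [] = u (f (r i)) + u (f (l i))
        - u F * (x * (root_x (r i) + root_x (l i)) + y * (root_y (r i) + root_y (l i)))" using fr by simp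
    have m: "((i + 1) mod 6 + 5) mod 6 = i" "((i + 1) mod 6 + 1) mod 6 = (i + 2) mod 6"
      "((i + 5) mod 6 + 5) mod 6 = (i + 4) mod 6" "((i + 5) mod 6 + 1) mod 6 = i"
    proof -
      have "i \<in> {0, 1, 2, 3, 4, 5}" using i(3) by auto
      then show "((i + 1) mod 6 + 5) mod 6 = i" "((i + 1) mod 6 + 1) mod 6 = (i + 2) mod 6"
        "((i + 5) mod 6 + 5) mod 6 = (i + 4) mod 6" "((i + 5) mod 6 + 1) mod 6 = i"
        by (elim insertE emptyE; simp)+
    qed
    have hr: "h u ((i + 1) mod 6) = u (f (r i)) + (if (i + 1) mod 6 \<in> D then 0 else u F)"
      unfolding h_def m hex(1)[OF i(1)] using i by simp
    have hl: "h u ((i + 5) mod 6) = u (f (l i)) + (if (i + 5) mod 6 \<in> D then 0 else u F)"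
      unfolding h_def m hex(2)[OF i(1)] using i by simp
    have hi: "h u i = u F" using i by (simp add: h_def)
    \<comment> \<open>Every missing neighbour lowers the diagonal coefficient by 1. The same amount
      enters the right-hand side through the value of \<open>h\<close> at that neighbour, so both
      effects cancel.\<close>
    have tau: "x * (root_x (r i) + root_x (l i)) + y * (root_y (r i) + root_y (l i))
      = 1 - (if (i + 1) mod 6 \<in> D then 0 else 1) - (if (i + 5) mod 6 \<in> D then 0 else 1)"
      unfolding hex[OF i(1)] using root_sum[OF i(3) e1] by simp
    show ?thesis unfolding e2 tau i_def[symmetric] hr hl hi by (auto simp: algebra_simps)
  qed
  have "D \<noteq> {}" using pos by (auto simp: D_def A_def)
  then obtain i0 where i0: "i0 \<in> D" by auto
  have gap: "(j + 1) mod 6 \<in> D \<and> (j + 5) mod 6 \<in> D" if j: "j < 6" "j \<notin> D" for j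
  proof -
    have "(i + 1) mod 6 \<in> D \<or> (i + 2) mod 6 \<in> D" "(i + 5) mod 6 \<in> D \<or> (i + 4) mod 6 \<in> D" if "i \<in> D" for i
      using rD[OF that] r2[OF that] by auto
    then show ?thesis using hexagon_gap[OF i0 D6[OF i0] j] by blast
  qed
  have miss: "h u ((j + 1) mod 6) + h u ((j + 5) mod 6) - h u j = 0" if "j < 6" "j \<notin> D" for u j
    using gap[OF that] that by (simp add: h_def)
  have AB: "A R u u' [] = (\<Sum>i<6. h u i * (h u' ((i + 1) mod 6) + h u' ((i + 5) mod 6) - h u' i))" for u u'
  proof -
    have "A R u u' [] = (\<Sum>F\<in>fac R. h u (\<rho> F) * (h u' ((\<rho> F + 1) mod 6) + h u' ((\<rho> F + 5) mod 6) - h u' (\<rho> F)))"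
      unfolding A_def using len f \<rho>D by (intro sum.cong) (auto simp: h_def)
    also have "\<dots> = (\<Sum>i\<in>D. h u i * (h u' ((i + 1) mod 6) + h u' ((i + 5) mod 6) - h u' i))"
      unfolding D_def by (simp add: sum.reindex[OF inj])
    also have "\<dots> = (\<Sum>i<6. h u i * (h u' ((i + 1) mod 6) + h u' ((i + 5) mod 6) - h u' i))"
      using subD miss by (intro sum.mono_neutral_left) auto
    finally show ?thesis .
  qed
  show ?thesis using hexagon_form_hyperbolic[of "h w" "h v"] pos unfolding AB .
qed

text \<open>The induction step takes the first mark \<open>c\<close> of the list as reference and a
  strictly interior point \<phi> of that mark. In each facet the induction hypothesis, applied with
  the facet of \<phi> as second vector, bounds the term in the Bochner inequality by a quotient of
  matrix rows; this is the hypothesis of \<open>bochner_imp_negative\<close>.\<close>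

theorem (in face_system) hyperbolic:
  assumes "face (Suc (Suc d)) R" "length cs = d" "\<And>c. c \<in> set cs \<Longrightarrow> pos3 c" "A R w w cs > 0"
  shows "A R v v cs * A R w w cs \<le> (A R v w cs)\<^sup>2"
  using assms
proof (induction d arbitrary: R cs v w)
  case 0
  then show ?case using polygon_hyperbolic[of R w v] by simp
next
  case (Suc d)
  note R = Suc.prems(1)
  obtain c cs' where cs: "cs = c # cs'" "length cs' = d" using Suc.prems(2) by (cases cs) auto
  have p: "pos3 c" "\<And>c. c \<in> set cs' \<Longrightarrow> pos3 c" using Suc.prems(3) cs by auto
  obtain \<phi> where \<phi>: "\<phi> \<in> Con R" "mk \<phi> = c" "\<And>F. F \<in> fac R \<Longrightarrow> dl R \<phi> F > 0"
    using strict_ex[OF R p(1)] by blast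
  define k where "k = dl R \<phi>"
  interpret M: symmetric_matrix "fac R" "mat R cs" by (rule symmetric_mat[OF R])
  have row: "M.row u F = V F (T R F u) cs" if "F \<in> fac R" for u F by (rule row_mat[OF R that])
  have vp: "vol G cs > 0" if "F \<in> fac R" "G \<in> fac F" for F G
    using vol_pos[OF face_fac[OF face_fac[OF R that(1)] that(2)] Suc.prems(2,3)] .
  have rk: "M.row k F = vol F (c # c # cs')" if F: "F \<in> fac R" for F
    using row[OF F, of k] V_T_dl[OF R F \<phi>(1) Suc.prems(2)] \<phi>(2) by (simp add: k_def cs)
  have rkp: "M.row k F > 0" if F: "F \<in> fac R" for F
    unfolding rk[OF F] by (rule vol_pos[OF face_fac[OF R F]]) (use cs p in auto)
  have fg: "fac F \<inter> fac E \<noteq> {} \<longleftrightarrow> mat R cs F E \<noteq> 0" "mat R cs F E \<ge> 0"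
    if "F \<in> fac R" "E \<in> fac R" "F \<noteq> E" for F E
  proof -
    have m: "mat R cs F E = (\<Sum>G\<in>fac F \<inter> fac E. vol G cs)" using mat_off_diagonal[OF R that(1,2)] that(3) by auto
    have fin: "finite (fac F \<inter> fac E)" using finite_fac[OF face_fac[OF R that(1)]] by blast
    show "mat R cs F E \<ge> 0" unfolding m by (intro sum_nonneg less_imp_le vp[OF that(1)]) auto
    show "fac F \<inter> fac E \<noteq> {} \<longleftrightarrow> mat R cs F E \<noteq> 0"
    proof
      assume "fac F \<inter> fac E \<noteq> {}"
      then have "0 < (\<Sum>G\<in>fac F \<inter> fac E. vol G cs)" using vp[OF that(1)] by (intro sum_pos[OF fin]) auto
      then show "mat R cs F E \<noteq> 0" using m by simp
    qed (use m in auto)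
  qed
  have neg: "M.form u u \<le> 0" if "M.form u k = 0" for u
  proof (rule M.bochner_imp_negative[OF _ _ _ _ _ that])
    show "mat R cs i j \<ge> 0" if "i \<in> fac R" "j \<in> fac R" "i \<noteq> j" for i j using fg(2)[OF that] .
    show "k i > 0" if "i \<in> fac R" for i using \<phi>(3)[OF that] by (simp add: k_def)
    show "M.row k i > 0" if "i \<in> fac R" for i by (rule rkp[OF that])
    show "S = fac R" if S: "S \<subseteq> fac R" "S \<noteq> {}"
      "\<And>i j. i \<in> S \<Longrightarrow> j \<in> fac R \<Longrightarrow> i \<noteq> j \<Longrightarrow> mat R cs i j \<noteq> 0 \<Longrightarrow> j \<in> S" for S
    proof (rule connected[OF R S(1,2)])
      fix E F assume "E \<in> S" "F \<in> fac R" "fac E \<inter> fac F \<noteq> {}"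
      then show "F \<in> S" using S fg(1)[of E F] by (cases "E = F") auto
    qed
    fix u
    have "M.form u u = A R u u (c # cs')" using form_mat[OF R] by (simp add: cs)
    also have "\<dots> \<le> (\<Sum>F\<in>fac R. k F * A F (T R F u) (T R F u) cs')"
      unfolding k_def by (rule bochner_inequality[OF R cs(2) p(2) \<phi>])
    also have "\<dots> \<le> (\<Sum>F\<in>fac R. k F * (M.row u F)\<^sup>2 / M.row k F)"
    proof (rule sum_mono)
      fix F assume F: "F \<in> fac R"
      note FF = face_fac[OF R F]
      obtain \<phi>' where q: "\<phi>' \<in> Con F" "mk \<phi>' = c" "\<And>G. G \<in> fac F \<Longrightarrow> T R F k G = dl F \<phi>' G"
        using T_dl[OF R F \<phi>(1)] \<phi>(2) by (auto simp: k_def)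
      have a1: "A F (T R F u) (dl F \<phi>') cs' = M.row u F"
        using A_dl[OF FF q(1) cs(2)] q(2) row[OF F] by (simp add: cs)
      have "A F (dl F \<phi>') (dl F \<phi>') cs' = V F (dl F \<phi>') cs"
        using A_dl[OF FF q(1) cs(2)] q(2) by (simp add: cs)
      also have "\<dots> = M.row k F" using row[OF F] q(3) V_cong[of F "T R F k" "dl F \<phi>'" cs] by simp
      finally have a2: "A F (dl F \<phi>') (dl F \<phi>') cs' = M.row k F" .
      have "A F (T R F u) (T R F u) cs' * M.row k F \<le> (M.row u F)\<^sup>2"
        using Suc.IH[OF FF cs(2) p(2), of "dl F \<phi>'" "T R F u"] rkp[OF F] a1 a2 by simp
      then have "A F (T R F u) (T R F u) cs' \<le> (M.row u F)\<^sup>2 / M.row k F"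
        using rkp[OF F] by (simp add: field_simps)
      then have "k F * A F (T R F u) (T R F u) cs' \<le> k F * ((M.row u F)\<^sup>2 / M.row k F)"
        using \<phi>(3)[OF F] by (intro mult_left_mono) (auto simp: k_def)
      then show "k F * A F (T R F u) (T R F u) cs' \<le> k F * (M.row u F)\<^sup>2 / M.row k F" by simp
    qed
    finally show "M.form u u \<le> (\<Sum>F\<in>fac R. k F * (M.row u F)\<^sup>2 / M.row k F)" .
  qed
  show ?case
    using M.reversed_cauchy_schwarz[of k w v] neg Suc.prems(4) unfolding form_mat[OF R] by blast
qed

corollary (in face_system) alexandrov_fenchel:
  assumes R: "face (Suc (Suc d)) R" and cs: "length cs = d" "\<And>c. c \<in> set cs \<Longrightarrow> pos3 c"
    and \<phi>: "\<phi> \<in> Con R" "\<psi> \<in> Con R" and pos: "vol R (mk \<psi> # mk \<psi> # cs) > 0"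
  shows "vol R (mk \<phi> # mk \<phi> # cs) * vol R (mk \<psi> # mk \<psi> # cs) \<le> (vol R (mk \<phi> # mk \<psi> # cs))\<^sup>2"
proof -
  have "A R (dl R \<phi>) (dl R \<psi>) cs = vol R (mk \<phi> # mk \<psi> # cs)" if "\<phi> \<in> Con R" "\<psi> \<in> Con R" for \<phi> \<psi>
    using A_dl[OF R that(2) cs(1), of "dl R \<phi>"] V_dl[OF R that(1), of "mk \<psi> # cs"] cs by simp
  then show ?thesis using hyperbolic[OF R cs, of "dl R \<psi>" "dl R \<phi>"] \<phi> pos by simp
qed

section \<open>Preorders and covering pairs\<close>

definition eqv :: "('y \<Rightarrow> 'y \<Rightarrow> bool) \<Rightarrow> 'y \<Rightarrow> 'y \<Rightarrow> bool" where "eqv R x y \<longleftrightarrow> R x y \<and> R y x"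
definition lt :: "('y \<Rightarrow> 'y \<Rightarrow> bool) \<Rightarrow> 'y \<Rightarrow> 'y \<Rightarrow> bool" where "lt R x y \<longleftrightarrow> R x y \<and> \<not> R y x"
definition cover :: "('y \<Rightarrow> 'y \<Rightarrow> bool) \<Rightarrow> 'y \<Rightarrow> 'y \<Rightarrow> bool" where
  "cover R u v \<longleftrightarrow> R u v \<and> \<not> R v u \<and> (\<forall>w. R u w \<longrightarrow> R w v \<longrightarrow> R w u \<or> R v w)"
text \<open>For a preorder \<open>R\<close> this is the preorder generated by \<open>R\<close> and
  the reversed pair, that is by putting \<open>v\<close> below \<open>u\<close>; everything between
  \<open>u\<close> and \<open>v\<close> becomes one class.\<close>

definition add :: "('y \<Rightarrow> 'y \<Rightarrow> bool) \<Rightarrow> 'y \<Rightarrow> 'y \<Rightarrow> 'y \<Rightarrow> 'y \<Rightarrow> bool" where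
  "add R u v = (\<lambda>x y. R x y \<or> (R x v \<and> R u y))"

lemma add_mono: "R x y \<Longrightarrow> add R u v x y"
  by (simp add: add_def)

lemma add_commute: "add (add R u v) x y = add (add R x y) u v"
  by (intro ext) (auto simp: add_def)

locale finite_preorder =
  fixes Y :: "'y set" and R :: "'y \<Rightarrow> 'y \<Rightarrow> bool"
  assumes finite_Y: "finite Y"
    and carrier: "R x y \<Longrightarrow> x \<in> Y \<and> y \<in> Y"
    and rfl: "x \<in> Y \<Longrightarrow> R x x"
    and tr: "R x y \<Longrightarrow> R y z \<Longrightarrow> R x z"
begin

lemma preorder_add:
  assumes "cover R u v"
  shows "finite_preorder Y (add R u v)"
proof
  show "finite Y" by (rule finite_Y)
  show "x \<in> Y \<and> y \<in> Y" if "add R u v x y" for x y using that carrier unfolding add_def by blast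
  show "add R u v x x" if "x \<in> Y" for x using that rfl unfolding add_def by blast
  show "add R u v x z" if "add R u v x y" "add R u v y z" for x y z
    using that tr unfolding add_def by blast
qed

lemma add_rev: "cover R u v \<Longrightarrow> add R u v v u"
  using carrier rfl by (auto simp: add_def cover_def)

lemma eqv_refl: "x \<in> Y \<Longrightarrow> eqv R x x"
  by (simp add: eqv_def rfl)

lemma eqv_sym: "eqv R x y \<Longrightarrow> eqv R y x"
  by (simp add: eqv_def)

lemma eqv_trans: "eqv R x y \<Longrightarrow> eqv R y z \<Longrightarrow> eqv R x z"
  using tr by (auto simp: eqv_def)

lemma cover_cong:
  assumes "cover R u v" "eqv R u u'" "eqv R v v'"
  shows "cover R u' v'"
  unfolding cover_def
proof (intro conjI allI impI)
  show "R u' v'" "\<not> R v' u'" using assms tr unfolding cover_def eqv_def by blast+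
  fix w assume "R u' w" "R w v'"
  then have "R u w" "R w v" using assms tr unfolding eqv_def by blast+
  then have "R w u \<or> R v w" using assms unfolding cover_def by blast
  then show "R w u' \<or> R v' w" using assms tr unfolding eqv_def by blast
qed

lemma add_cong:
  assumes "eqv R u u'" "eqv R v v'"
  shows "add R u v = add R u' v'"
  using assms tr unfolding add_def eqv_def by (intro ext) blast

text \<open>A reversed relation needs \<open>u \<le> s\<close> and \<open>t \<le> v\<close>, and
  nothing fits strictly between the ends of a cover. Hence a facet determines its covering pair up
  to equivalence, which makes choices of such a pair harmless.\<close>

lemma reversed_pair:
  assumes uv: "cover R u v" and st: "R s t" "\<not> R t s" and rev: "add R u v t s"
  shows "eqv R s u \<and> eqv R t v"
proof -
  have "R t v" "R u s" using rev st by (auto simp: add_def)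
  then have "R u t" "R s v" using st tr by blast+
  have "R s u \<or> R v s" "R t u \<or> R v t"
    using uv \<open>R u s\<close> \<open>R s v\<close> \<open>R u t\<close> \<open>R t v\<close> unfolding cover_def by blast+
  then show ?thesis using st tr \<open>R t v\<close> \<open>R u s\<close> unfolding eqv_def by blast
qed

lemma add_eqD:
  assumes "cover R u v" "cover R s t" "add R u v = add R s t"
  shows "eqv R s u \<and> eqv R t v"
  using reversed_pair[OF assms(1), of s t] assms(2,3) add_rev[OF assms(2)] unfolding cover_def by simp

lemma cover_between:
  assumes "R a b" "\<not> R b a"
  shows "\<exists>s t. cover R s t \<and> R a s \<and> R t b"
  using assms
proof (induction "card {w. R a w \<and> R w b}" arbitrary: a b rule: less_induct)
  case less
  show ?case
  proof (cases "cover R a b")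
    case True
    then show ?thesis using less.prems carrier rfl by blast
  next
    case False
    then obtain w where w: "R a w" "R w b" "\<not> R w a" "\<not> R b w" using less.prems unfolding cover_def by blast
    have "{x. R a x \<and> R x w} \<subset> {x. R a x \<and> R x b}" using w tr less.prems carrier rfl by blast
    moreover have "finite {x. R a x \<and> R x b}" by (rule finite_subset[OF _ finite_Y]) (use carrier in blast)
    ultimately have "card {x. R a x \<and> R x w} < card {x. R a x \<and> R x b}" by (simp add: psubset_card_mono)
    then obtain s t where "cover R s t" "R a s" "R t w" using less.hyps w by blast
    then show ?thesis using w tr by blast
  qed
qed

text \<open>The class of \<open>add R u v\<close> that merges the classes of \<open>u\<close> and \<open>v\<close> is
  \<open>{w. R u w \<and> R w v}\<close>; all other classes are unchanged.\<close>

lemma eqv_add: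
  assumes "cover R u v" "eqv (add R u v) a b"
  shows "eqv R a b \<or> (R u a \<and> R a v \<and> R u b \<and> R b v)"
proof -
  have "R u v" using assms(1) by (simp add: cover_def)
  then show ?thesis using assms(2) tr unfolding eqv_def add_def by blast
qed

lemma merged_eqv:
  assumes "cover R u v" "R u a" "R a v"
  shows "eqv R a u \<or> eqv R a v"
  using assms unfolding cover_def eqv_def by blast

text \<open>Only an end in the merged class needs care. As a lower end it is represented by
  \<open>v\<close> if that lies below the upper end, and by \<open>u\<close> otherwise; dually for
  an upper end.\<close>

lemma lift_cover:
  assumes uv: "cover R u v" and xy: "cover (add R u v) x y"
  shows "\<exists>x' y'. cover R x' y' \<and> eqv (add R u v) x x' \<and> eqv (add R u v) y y'"
proof -
  interpret F: finite_preorder Y "add R u v" by (rule preorder_add[OF uv])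
  let ?F = "add R u v"
  have Ruv: "R u v" "\<not> R v u" "u \<in> Y" "v \<in> Y" "R u u" "R v v" using uv carrier rfl unfolding cover_def by blast+
  have F: "?F a b \<longleftrightarrow> R a b \<or> (R a v \<and> R u b)" for a b by (simp add: add_def)
  have Fu: "?F a u \<longleftrightarrow> R a v" "?F a v \<longleftrightarrow> R a v" "?F u a \<longleftrightarrow> R u a" "?F v a \<longleftrightarrow> R u a" for a
    using Ruv tr unfolding F by blast+
  have xyY: "x \<in> Y" "y \<in> Y" using xy F.carrier unfolding cover_def by blast+
  have Fxy: "?F x y" "\<not> ?F y x" "\<And>w. ?F x w \<Longrightarrow> ?F w y \<Longrightarrow> ?F w x \<or> ?F y w" using xy unfolding cover_def by blast+
  define m where "m a \<longleftrightarrow> R u a \<and> R a v" for a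
  consider "\<not> m x" "\<not> m y" | "m x" "\<not> m y" | "\<not> m x" "m y"
  proof -
    have "\<not> (m x \<and> m y)" using Fxy(2) unfolding m_def F by blast
    then show ?thesis using that by blast
  qed
  then show ?thesis
  proof cases
    case 1
    have "R x y"
    proof (rule ccontr)
      assume "\<not> R x y"
      then have "R x v" "R u y" using Fxy(1) F by blast+
      then have "?F u x \<or> ?F y u" using Fxy(3)[of u] Fu by blast
      then show False using 1 \<open>R x v\<close> \<open>R u y\<close> unfolding m_def Fu by blast
    qed
    moreover have "\<not> R y x" using Fxy(2) F by blast
    moreover have "R w x \<or> R y w" if w: "R x w" "R w y" for w
    proof -
      have "?F w x \<or> ?F y w" using Fxy(3)[of w] w unfolding F by blast
      then show ?thesis using w tr 1 unfolding F m_def by blast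
    qed
    ultimately have "cover R x y" unfolding cover_def by blast
    then show ?thesis using F.eqv_refl xyY by blast
  next
    case 2
    have uy: "R u y" using 2 Fxy(1) tr unfolding m_def F by blast
    then have nyv: "\<not> R y v" using 2 unfolding m_def by blast
    show ?thesis
    proof (cases "R v y")
      case True
      have "R w v \<or> R y w" if w: "R v w" "R w y" for w
      proof -
        have "?F x w" using 2 w tr unfolding m_def F by blast
        then have "?F w x \<or> ?F y w" using Fxy(3)[of w] w unfolding F by blast
        then show ?thesis using 2 nyv tr unfolding F m_def by blast
      qed
      then have "cover R v y" using True nyv unfolding cover_def by blast
      moreover have "eqv ?F x v" using 2 unfolding eqv_def Fu m_def by blast
      ultimately show ?thesis using F.eqv_refl xyY by blast
    next
      case False
      have "R w u \<or> R y w" if w: "R u w" "R w y" for w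
      proof -
        have "?F x w" using 2 w tr unfolding m_def F by blast
        then have "?F w x \<or> ?F y w" using Fxy(3)[of w] w unfolding F by blast
        then have "R w v \<or> R y w" using 2 nyv tr unfolding F m_def by blast
        moreover have "R w u" if "R w v" using uv w that False tr unfolding cover_def by blast
        ultimately show ?thesis by blast
      qed
      moreover have "\<not> R y u" using nyv tr Ruv by blast
      ultimately have "cover R u y" using uy unfolding cover_def by blast
      moreover have "eqv ?F x u" using 2 unfolding eqv_def Fu m_def by blast
      ultimately show ?thesis using F.eqv_refl xyY by blast
    qed
  next
    case 3
    have xv: "R x v" using 3 Fxy(1) tr unfolding m_def F by blast
    then have nux: "\<not> R u x" using 3 unfolding m_def by blast
    show ?thesis
    proof (cases "R x u")
      case True
      have "R w x \<or> R u w" if w: "R x w" "R w u" for w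
      proof -
        have "?F w y" using 3 w tr unfolding m_def F by blast
        then have "?F w x \<or> ?F y w" using Fxy(3)[of w] w unfolding F by blast
        then show ?thesis using 3 nux tr unfolding F m_def by blast
      qed
      then have "cover R x u" using True nux unfolding cover_def by blast
      moreover have "eqv ?F y u" using 3 unfolding eqv_def Fu m_def by blast
      ultimately show ?thesis using F.eqv_refl xyY by blast
    next
      case False
      have "R w x \<or> R v w" if w: "R x w" "R w v" for w
      proof -
        have "?F w y" using 3 w tr unfolding m_def F by blast
        then have "?F w x \<or> ?F y w" using Fxy(3)[of w] w unfolding F by blast
        then have "R w x \<or> R u w" using 3 nux tr unfolding F m_def by blast
        moreover have "R v w" if "R u w" using uv w that False tr unfolding cover_def by blast
        ultimately show ?thesis by blast
      qed
      moreover have "\<not> R v x" using nux tr Ruv by blast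
      ultimately have "cover R x v" using xv unfolding cover_def by blast
      moreover have "eqv ?F y v" using 3 unfolding eqv_def Fu m_def by blast
      ultimately show ?thesis using F.eqv_refl xyY by blast
    qed
  qed
qed

text \<open>Makes the order of two merges irrelevant: a face of codimension 2 reached through one
  facet is also reached through the other.\<close>

lemma cover_add_swap:
  assumes uv: "cover R u v" and xy: "cover R x y" and F: "cover (add R u v) x y"
  shows "cover (add R x y) u v"
proof -
  have Ruv: "R u v" "\<not> R v u" "R u u" "R v v" using uv carrier rfl unfolding cover_def by blast+
  have Rxy: "R x y" "\<not> R y x" "R x x" "R y y" using xy carrier rfl unfolding cover_def by blast+
  have cuv: "R w u \<or> R v w" if "R u w" "R w v" for w using uv that unfolding cover_def by blast
  have cxy: "R w x \<or> R y w" if "R x w" "R w y" for w using xy that unfolding cover_def by blast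
  have ne: "\<not> (R y v \<and> R u x)" using F unfolding cover_def add_def by blast
  have cF: "R w x \<or> (R w v \<and> R u x) \<or> R y w \<or> (R y v \<and> R u w)"
    if "R x w \<or> (R x v \<and> R u w)" "R w y \<or> (R w v \<and> R u y)" for w
    using F that unfolding cover_def add_def by blast
  have key: "R u x \<or> R y v" if "R x v" "R u y"
    using cF[of u] that Ruv tr by blast
  show ?thesis unfolding cover_def add_def
  proof (intro conjI allI impI)
    show "R u v \<or> (R u y \<and> R x v)" using Ruv by blast
    show "\<not> (R v u \<or> (R v y \<and> R x u))"
    proof
      assume "R v u \<or> (R v y \<and> R x u)"
      then have a: "R v y" "R x u" using Ruv by blast+
      then have b: "R x v" "R u y" using Ruv tr by blast+
      have "R u x" using cxy[OF a(2) b(2)] a Ruv tr by blast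
      moreover have "R y v" using cxy[OF b(1) a(1)] a Ruv tr by blast
      ultimately show False using ne by blast
    qed
    fix w
    assume l: "R u w \<or> (R u y \<and> R x w)" and r: "R w v \<or> (R w y \<and> R x v)"
    show "(R w u \<or> (R w y \<and> R x u)) \<or> (R v w \<or> (R v y \<and> R x w))"
    proof (cases "R u w \<and> R w v")
      case True then show ?thesis using cuv by blast
    next
      case False
      then have b: "R u y" "R x v" using l r tr by blast+
      consider "R u x" | "R y v" using key b by blast
      then show ?thesis
      proof cases
        case 1
        then have n: "\<not> R y v" using ne by blast
        consider "R x u" | "R v x" using cuv[OF 1 b(2)] by blast
        then show ?thesis
        proof cases
          assume "R x u"
          then have "R u w" using l 1 tr by blast
          then have "R w y" using r False by blast
          then show ?thesis using \<open>R x u\<close> by blast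
        next
          assume vx: "R v x"
          then have vy: "R v y" using tr Rxy by blast
          consider "R w v" | "R w y" "R x w" | "R w y" "R u w" using l r by blast
          then show ?thesis
          proof cases
            assume "R w v" then show ?thesis using l False vy by blast
          next
            assume "R x w" then show ?thesis using vx tr by blast
          next
            assume w: "R w y" "R u w"
            have "R w x \<or> R w v \<or> R y w" using cF[of w] b n w by blast
            then have "R w v \<or> R v w" using tr[OF _ b(2), of w] tr[OF vy, of w] by blast
            then show ?thesis using cuv[OF w(2)] by blast
          qed
        qed
      next
        case 2
        then have n: "\<not> R u x" using ne by blast
        consider "R v y" | "R y u" using cuv[OF b(1) 2] by blast
        then show ?thesis
        proof cases
          assume "R v y"
          have "R w v" using r 2 tr by blast
          then have "R x w" using l False by blast
          then show ?thesis using \<open>R v y\<close> by blast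
        next
          assume yu: "R y u"
          then have xu: "R x u" using tr Rxy by blast
          consider "R u w" | "R x w" "R w y" | "R x w" "R w v" using l r by blast
          then show ?thesis
          proof cases
            assume "R u w" then show ?thesis using r False xu by blast
          next
            assume "R w y" then show ?thesis using xu by blast
          next
            assume w: "R x w" "R w v"
            have "R w x \<or> R u w \<or> R y w" using cF[of w] b n w by blast
            then have "R w u \<or> R u w" using tr[OF _ xu, of w] tr[OF b(1), of w] by blast
            then show ?thesis using cuv[OF _ w(2)] by blast
          qed
        qed
      qed
    qed
  qed
qed

text \<open>Two different lifts would share one end, up to equivalence, and have \<open>u\<close>
  and \<open>v\<close> as their other ends. Then \<open>u < v\<close> puts a class strictly inside
  the longer one, which is no cover.\<close>

lemma cover_lift_unique:
  assumes uv: "cover R u v" and xy: "cover R x y" and st: "cover R s t"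
    and e: "eqv (add R u v) s x" "eqv (add R u v) t y" and n: "\<not> add R u v y x"
  shows "eqv R s x \<and> eqv R t y"
proof -
  have Ruv: "R u v" "\<not> R v u" using uv unfolding cover_def by blast+
  have sx: "eqv R s x \<or> (R u s \<and> R s v \<and> R u x \<and> R x v)" by (rule eqv_add[OF uv e(1)])
  have ty: "eqv R t y \<or> (R u t \<and> R t v \<and> R u y \<and> R y v)" by (rule eqv_add[OF uv e(2)])
  have nb: "\<not> (R y v \<and> R u x)" using n by (auto simp: add_def)
  have A: False if c: "cover R p q" "cover R p' q'" and e: "eqv R q q'" "eqv R p u" "eqv R p' v" for p q p' q'
  proof -
    have f: "R p u" "R u p" "R p' v" "R v p'" "R q q'" "R q' q" "R p' q'" "\<not> R q' p'"
      using c e unfolding eqv_def cover_def by blast+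
    have "R p v" "R v q" by (rule tr[OF f(1) Ruv(1)], rule tr[OF f(4) tr[OF f(7,6)]])
    moreover have "\<not> R v p" using tr[OF _ f(1), of v] Ruv by blast
    moreover have "\<not> R q v" using tr[OF f(6) tr[OF _ f(4)]] f(8) by blast
    ultimately show False using c(1) unfolding cover_def by blast
  qed
  have B: False if c: "cover R p q" "cover R p' q'" and e: "eqv R p p'" "eqv R q u" "eqv R q' v" for p q p' q'
  proof -
    have f: "R q u" "R u q" "R q' v" "R v q'" "R p p'" "R p' p" "R p q" "\<not> R q p"
      using c e unfolding eqv_def cover_def by blast+
    have "R p' u" "R u q'" by (rule tr[OF f(6) tr[OF f(7,1)]], rule tr[OF Ruv(1) f(4)])
    moreover have "\<not> R q' u" using tr[OF f(4), of u] Ruv by blast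
    moreover have "\<not> R u p'" using tr[OF f(1) tr[OF _ f(6)]] f(8) by blast
    ultimately show False using c(2) unfolding cover_def by blast
  qed
  have 1: "eqv R s x" if m: "R u s" "R s v" "R u x" "R x v"
  proof -
    have ty': "eqv R t y" "eqv R y t" using ty m nb unfolding eqv_def by blast+
    have "eqv R s u \<or> eqv R s v" "eqv R x u \<or> eqv R x v" using merged_eqv[OF uv] m by blast+
    then show ?thesis using A[OF st xy ty'(1)] A[OF xy st ty'(2)] eqv_sym eqv_trans by blast
  qed
  have 2: "eqv R t y" if m: "R u t" "R t v" "R u y" "R y v"
  proof -
    have sx': "eqv R s x" "eqv R x s" using sx m nb unfolding eqv_def by blast+
    have "eqv R t u \<or> eqv R t v" "eqv R y u \<or> eqv R y v" using merged_eqv[OF uv] m by blast+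
    then show ?thesis using B[OF st xy sx'(1)] B[OF xy st sx'(2)] eqv_sym eqv_trans by blast
  qed
  show ?thesis using sx ty 1 2 by blast
qed

lemma reversed_pair2:
  assumes uv: "cover R u v" and xy: "cover R x y" and F: "cover (add R u v) x y"
    and st: "cover R s t" and rev: "add (add R u v) x y t s"
  shows "(eqv R s u \<and> eqv R t v) \<or> (eqv R s x \<and> eqv R t y)"
proof -
  interpret F: finite_preorder Y "add R u v" by (rule preorder_add[OF uv])
  have Rst: "R s t" "\<not> R t s" using st unfolding cover_def by blast+
  show ?thesis
  proof (cases "add R u v t s")
    case True then show ?thesis using reversed_pair[OF uv Rst] by blast
  next
    case False
    then have e: "eqv (add R u v) s x \<and> eqv (add R u v) t y"
      using F.reversed_pair[OF F add_mono[of R, OF Rst(1)] False rev] by blast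
    moreover have "\<not> add R u v y x" using F unfolding cover_def by blast
    ultimately show ?thesis using cover_lift_unique[OF uv xy st] by blast
  qed
qed

end

section \<open>Faces as preorders\<close>

locale marked_ground =
  fixes Y :: "'y set" and B T z1 z2 z3 :: 'y
  assumes fin: "finite Y" and marks: "B \<in> Y" "T \<in> Y" "z1 \<in> Y" "z2 \<in> Y" "z3 \<in> Y"
begin

text \<open>A preorder with this property is a face of the polytope of all order preserving maps
  with prescribed differences \<open>z2 - z1\<close>, \<open>z3 - z2\<close> and \<open>T - B\<close>.\<close>

definition valid :: "('y \<Rightarrow> 'y \<Rightarrow> bool) \<Rightarrow> bool" where
  "valid R \<longleftrightarrow> \<not> R z2 z1 \<and> \<not> R z3 z2 \<and> \<not> (R z1 B \<and> R T z3)"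
definition pre :: "('y \<Rightarrow> 'y \<Rightarrow> bool) \<Rightarrow> bool" where
  "pre R \<longleftrightarrow> finite_preorder Y R \<and> (\<forall>y\<in>Y. R B y \<and> R y T) \<and> R z1 z2 \<and> R z2 z3 \<and> valid R"
definition fac :: "('y \<Rightarrow> 'y \<Rightarrow> bool) \<Rightarrow> ('y \<Rightarrow> 'y \<Rightarrow> bool) set" where
  "fac R = {F. \<exists>u v. cover R u v \<and> F = add R u v \<and> valid F}"

text \<open>\<open>Con R\<close> consists of the maps that are constant on the classes of \<open>R\<close>; \<open>dl R \<theta> F\<close> is the
  distance from \<open>\<theta>\<close> to the hyperplane of the facet \<open>F\<close>, and \<open>mk \<theta>\<close> lists the prescribed differences.\<close>

definition Con :: "('y \<Rightarrow> 'y \<Rightarrow> bool) \<Rightarrow> ('y \<Rightarrow> real) set" where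
  "Con R = {\<theta>. \<forall>x y. eqv R x y \<longrightarrow> \<theta> x = \<theta> y}"
definition dl :: "('y \<Rightarrow> 'y \<Rightarrow> bool) \<Rightarrow> ('y \<Rightarrow> real) \<Rightarrow> ('y \<Rightarrow> 'y \<Rightarrow> bool) \<Rightarrow> real" where
  "dl R \<theta> F = (let p = (SOME p. cover R (fst p) (snd p) \<and> F = add R (fst p) (snd p)) in \<theta> (snd p) - \<theta> (fst p))"
definition mk :: "('y \<Rightarrow> real) \<Rightarrow> real \<times> real \<times> real" where
  "mk \<theta> = (\<theta> T - \<theta> B - (\<theta> z3 - \<theta> z1), \<theta> z2 - \<theta> z1, \<theta> z3 - \<theta> z2)"

lemma preD:
  assumes "pre R"
  shows "finite_preorder Y R" "\<And>y. y \<in> Y \<Longrightarrow> R B y" "\<And>y. y \<in> Y \<Longrightarrow> R y T" "R z1 z2" "R z2 z3" "valid R"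
  using assms unfolding pre_def by blast+

lemma valid_mono: "valid H \<Longrightarrow> (\<And>x y. F x y \<Longrightarrow> H x y) \<Longrightarrow> valid F"
  unfolding valid_def by blast

lemma facE:
  assumes "F \<in> fac R"
  obtains u v where "cover R u v" "F = add R u v" "valid F"
  using assms unfolding fac_def by blast

lemma facI: "cover R u v \<Longrightarrow> valid (add R u v) \<Longrightarrow> add R u v \<in> fac R"
  unfolding fac_def by blast

lemma fac_mono: "F \<in> fac R \<Longrightarrow> R x y \<Longrightarrow> F x y"
  unfolding fac_def using add_mono by fast

lemma pre_fac:
  assumes "pre R" "F \<in> fac R"
  shows "pre F"
proof -
  obtain u v where f: "cover R u v" "F = add R u v" "valid F" using facE[OF assms(2)] .
  have "finite_preorder Y F" using finite_preorder.preorder_add[OF preD(1)[OF assms(1)] f(1)] f(2) by simp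
  then show ?thesis using f fac_mono[OF assms(2)] preD[OF assms(1)] unfolding pre_def by blast
qed

lemma finite_fac:
  assumes "pre R"
  shows "finite (fac R)"
proof (rule finite_subset)
  show "fac R \<subseteq> (\<lambda>(u, v). add R u v) ` (Y \<times> Y)"
    using finite_preorder.carrier[OF preD(1)[OF assms]] unfolding fac_def cover_def by fast
  show "finite ((\<lambda>(u, v). add R u v) ` (Y \<times> Y))" using fin by simp
qed

lemma dl_add:
  assumes R: "pre R" and uv: "cover R u v" and \<theta>: "\<theta> \<in> Con R"
  shows "dl R \<theta> (add R u v) = \<theta> v - \<theta> u"
proof -
  interpret finite_preorder Y R by (rule preD(1)[OF R])
  define p where "p = (SOME p. cover R (fst p) (snd p) \<and> add R u v = add R (fst p) (snd p))"
  have "cover R (fst p) (snd p) \<and> add R u v = add R (fst p) (snd p)"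
    unfolding p_def by (rule someI[of _ "(u, v)"]) (use uv in auto)
  then have "eqv R (fst p) u" "eqv R (snd p) v" using add_eqD[OF uv, of "fst p" "snd p"] by auto
  then have "\<theta> (snd p) = \<theta> v" "\<theta> (fst p) = \<theta> u" using \<theta> unfolding Con_def by blast+
  then show ?thesis by (simp add: dl_def Let_def p_def[symmetric])
qed

lemma Con_add:
  assumes R: "pre R" and uv: "cover R u v"
  shows "\<theta> \<in> Con (add R u v) \<longleftrightarrow> \<theta> \<in> Con R \<and> \<theta> v = \<theta> u"
proof -
  interpret finite_preorder Y R by (rule preD(1)[OF R])
  have "eqv (add R u v) v u" using uv add_rev[OF uv] add_mono[of R] unfolding eqv_def cover_def by blast
  moreover have "eqv R a b \<Longrightarrow> eqv (add R u v) a b" for a b unfolding eqv_def using add_mono[of R] by blast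
  moreover have "\<theta> a = \<theta> b" if "eqv (add R u v) a b" "\<theta> \<in> Con R" "\<theta> v = \<theta> u" for a b
  proof -
    have "\<theta> c = \<theta> u" if "R u c" "R c v" for c
      using merged_eqv[OF uv that] \<open>\<theta> \<in> Con R\<close> \<open>\<theta> v = \<theta> u\<close> unfolding Con_def by auto
    then show ?thesis using eqv_add[OF uv \<open>eqv (add R u v) a b\<close>] \<open>\<theta> \<in> Con R\<close> unfolding Con_def by auto
  qed
  ultimately show ?thesis unfolding Con_def by blast
qed

lemma Con_fac:
  assumes "pre R" "F \<in> fac R"
  shows "\<theta> \<in> Con F \<longleftrightarrow> \<theta> \<in> Con R \<and> dl R \<theta> F = 0"
proof -
  obtain u v where f: "cover R u v" "F = add R u v" using facE[OF assms(2)] .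
  show ?thesis using Con_add[OF assms(1) f(1)] dl_add[OF assms(1) f(1)] f(2) by auto
qed

lemma two_step:
  assumes R: "pre R" and c: "cover R u v" "cover R x y" "cover (add R u v) x y"
    and v: "valid (add (add R u v) x y)"
  shows "add R u v \<in> fac R" "add R x y \<in> fac R" "add (add R u v) x y \<in> fac (add R u v)"
    "add (add R u v) x y \<in> fac (add R x y)" "add R u v \<noteq> add R x y"
proof -
  interpret finite_preorder Y R by (rule preD(1)[OF R])
  have m1: "add R u v a b \<Longrightarrow> add (add R u v) x y a b" for a b by (rule add_mono)
  have m2: "add R x y a b \<Longrightarrow> add (add R u v) x y a b" for a b unfolding add_commute[of R u v] by (rule add_mono)
  show "add R u v \<in> fac R" "add R x y \<in> fac R"
    using facI c valid_mono[OF v m1] valid_mono[OF v m2] by blast+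
  show "add (add R u v) x y \<in> fac (add R u v)" by (rule facI[OF c(3) v])
  show "add (add R u v) x y \<in> fac (add R x y)"
    unfolding add_commute[of R u v] by (rule facI[OF cover_add_swap[OF c]]) (use v in \<open>simp add: add_commute[of R u v]\<close>)
  show "add R u v \<noteq> add R x y"
    using c(3) add_rev[OF c(2)] unfolding cover_def by metis
qed

lemma two_stepE:
  assumes R: "pre R" and uv: "cover R u v" and G: "G \<in> fac (add R u v)"
  obtains x y where "cover R x y" "cover (add R u v) x y" "G = add (add R u v) x y" "valid G"
proof -
  interpret finite_preorder Y R by (rule preD(1)[OF R])
  interpret F: finite_preorder Y "add R u v" by (rule preorder_add[OF uv])
  obtain a b where ab: "cover (add R u v) a b" "G = add (add R u v) a b" "valid G" using facE[OF G] .
  obtain x y where xy: "cover R x y" "eqv (add R u v) a x" "eqv (add R u v) b y"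
    using lift_cover[OF uv ab(1)] by blast
  show ?thesis using that[OF xy(1) F.cover_cong[OF ab(1) xy(2,3)]] F.add_cong[OF xy(2,3)] ab by simp
qed

lemma fac_below_cases:
  assumes R: "pre R" and c: "cover R u v" "cover R x y" "cover (add R u v) x y"
    and E: "E \<in> fac R" and sub: "\<And>a b. E a b \<Longrightarrow> add (add R u v) x y a b"
  shows "E = add R u v \<or> E = add R x y"
proof -
  interpret finite_preorder Y R by (rule preD(1)[OF R])
  obtain s t where st: "cover R s t" "E = add R s t" using facE[OF E] .
  have "add (add R u v) x y t s" using sub add_rev[OF st(1)] st(2) by simp
  then have "(eqv R s u \<and> eqv R t v) \<or> (eqv R s x \<and> eqv R t y)" by (rule reversed_pair2[OF c st(1)])
  then show ?thesis using add_cong st(2) by blast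
qed

lemma other_ex:
  assumes R: "pre R" and F: "F \<in> fac R" and G: "G \<in> fac F"
  shows "\<exists>F'. F' \<in> fac R \<and> F' \<noteq> F \<and> G \<in> fac F' \<and> (\<forall>E\<in>fac R. G \<in> fac E \<longrightarrow> E = F \<or> E = F')
         \<and> (\<forall>\<theta>\<in>Con F. dl F \<theta> G = dl R \<theta> F')"
proof -
  obtain u v where uv: "cover R u v" "F = add R u v" using facE[OF F] .
  obtain x y where xy: "cover R x y" "cover F x y" "G = add F x y" "valid G"
    using two_stepE[OF R uv(1), of G] G uv(2) by metis
  note c = uv(1) xy(1) xy(2)[unfolded uv(2)]
  note t = two_step[OF R c]
  have "E = F \<or> E = add R x y" if "E \<in> fac R" "G \<in> fac E" for E
    using fac_below_cases[OF R c that(1)] fac_mono[OF that(2)] xy(3) uv(2) by blast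
  moreover have "dl F \<theta> G = dl R \<theta> (add R x y)" if "\<theta> \<in> Con F" for \<theta>
    using dl_add[OF R xy(1)] dl_add[OF pre_fac[OF R F] xy(2) that] Con_fac[OF R F] that xy(3) by simp
  ultimately show ?thesis using t xy uv by (intro exI[of _ "add R x y"]) auto
qed

lemma join_unique:
  assumes R: "pre R" and E: "E \<in> fac R" and F: "F \<in> fac R" "E \<noteq> F"
    and G: "G \<in> fac E" "G \<in> fac F" "G' \<in> fac E" "G' \<in> fac F"
  shows "G = G'"
proof -
  obtain u v where uv: "cover R u v" "E = add R u v" using facE[OF E] .
  interpret finite_preorder Y R by (rule preD(1)[OF R])
  obtain s t where st: "cover R s t" "F = add R s t" using facE[OF F(1)] .
  have "H = add E s t" if H: "H \<in> fac E" "H \<in> fac F" for H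
  proof -
    interpret E: finite_preorder Y E by (rule preD(1)[OF pre_fac[OF R E]])
    obtain x y where xy: "cover R x y" "cover E x y" "H = add E x y"
      using two_stepE[OF R uv(1), of H] H(1) uv(2) by metis
    note c = uv(1) xy(1) xy(2)[unfolded uv(2)]
    have "F = E \<or> F = add R x y"
      using fac_below_cases[OF R c F(1)] fac_mono[OF H(2)] xy(3) uv(2) by blast
    then have "add R x y = add R s t" using F(2) st(2) by blast
    then have e: "eqv R s x" "eqv R t y" using add_eqD[OF xy(1) st(1)] by blast+
    then have "eqv E s x" "eqv E t y" using fac_mono[OF E] unfolding eqv_def by blast+
    then show ?thesis using E.add_cong xy(3) by simp
  qed
  then show ?thesis using G by blast
qed

text \<open>Intervals of length 2 in the face lattice are diamonds, so mere inclusion between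
  \<open>G\<close> and \<open>H\<close> already makes \<open>H\<close> a facet of
  \<open>G\<close>.\<close>

lemma fac_interval:
  assumes F: "pre F" and G0: "G0 \<in> fac F" "H \<in> fac G0" and G: "G \<in> fac F" "\<And>a b. G a b \<Longrightarrow> H a b"
  shows "H \<in> fac G"
proof -
  obtain u v where uv: "cover F u v" "G0 = add F u v" using facE[OF G0(1)] .
  obtain x y where xy: "cover F x y" "cover G0 x y" "H = add G0 x y" "valid H"
    using two_stepE[OF F uv(1), of H] G0(2) uv(2) by metis
  note c = uv(1) xy(1) xy(2)[unfolded uv(2)]
  have "G = G0 \<or> G = add F x y" using fac_below_cases[OF F c G(1)] G(2) xy(3) uv(2) by blast
  then show ?thesis using two_step[OF F c] xy uv G0 by auto
qed

lemma two_covers: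
  assumes E: "pre E" and G: "G \<in> fac E" "H \<in> fac G"
  obtains a b c d where "cover E a b" "cover E c d"
    "\<And>s t. cover E s t \<Longrightarrow> H t s \<Longrightarrow> (eqv E s a \<and> eqv E t b) \<or> (eqv E s c \<and> eqv E t d)"
proof -
  interpret finite_preorder Y E by (rule preD(1)[OF E])
  obtain u v where uv: "cover E u v" "G = add E u v" using facE[OF G(1)] .
  obtain x y where xy: "cover E x y" "cover G x y" "H = add G x y" "valid H"
    using two_stepE[OF E uv(1), of H] G(2) uv(2) by metis
  show ?thesis using that[OF uv(1) xy(1)] reversed_pair2[OF uv(1) xy(1)] xy uv by blast
qed

text \<open>Each of the three steps contains a cover of \<open>E\<close> that collapses in
  \<open>H\<close>, and these covers have pairwise inequivalent lower ends; but in codimension 2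
  only two covers collapse.\<close>

lemma no_chain:
  assumes E: "pre E" and G: "G \<in> fac E" "H \<in> fac G"
    and ch: "lt E a b" "lt E b c" "lt E c d" "H d a"
  shows False
proof -
  interpret finite_preorder Y E by (rule preD(1)[OF E])
  have pG: "pre G" by (rule pre_fac[OF E G(1)])
  interpret H: finite_preorder Y H by (rule preD(1)[OF pre_fac[OF pG G(2)]])
  have EH: "E x y \<Longrightarrow> H x y" for x y using fac_mono[OF G(1)] fac_mono[OF G(2)] by blast
  obtain s1 t1 where 1: "cover E s1 t1" "E a s1" "E t1 b" using cover_between ch unfolding lt_def by blast
  obtain s2 t2 where 2: "cover E s2 t2" "E b s2" "E t2 c" using cover_between ch unfolding lt_def by blast
  obtain s3 t3 where 3: "cover E s3 t3" "E c s3" "E t3 d" using cover_between ch unfolding lt_def by blast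
  have E': "E b c" "E c d" "E a b" using ch unfolding lt_def by blast+
  have "E t1 d" "E a s1" "E t2 d" "E a s2" "E t3 d" "E a s3" using 1 2 3 E' tr by meson+
  then have H: "H t1 s1" "H t2 s2" "H t3 s3" using EH H.tr ch(4) by meson+
  have sep: "\<not> eqv E s s'" if "cover E s t" "E t s'" for s t s'
    using that tr unfolding cover_def eqv_def by blast
  have "E t1 s2" "E t2 s3" "E t1 s3" using 1 2 3 E' tr by meson+
  then have n: "\<not> eqv E s1 s2" "\<not> eqv E s2 s3" "\<not> eqv E s1 s3" using sep 1 2 by blast+
  obtain p q r s where "(eqv E s' p \<and> eqv E t' q) \<or> (eqv E s' r \<and> eqv E t' s)" if "cover E s' t'" "H t' s'" for s' t'
    using two_covers[OF E G] by metis
  then have "eqv E s1 p \<or> eqv E s1 r" "eqv E s2 p \<or> eqv E s2 r" "eqv E s3 p \<or> eqv E s3 r"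
    using 1 2 3 H by blast+
  then show False using n eqv_sym eqv_trans by blast
qed

lemma join_in_link:
  assumes R: "pre R" and G0: "cover R u v" "add R u v \<in> fac R" "G0 \<in> fac (add R u v)" "H \<in> fac G0"
    and st: "cover R s t" "cover (add R u v) s t" "H t s"
  shows "add (add R u v) s t \<in> fac (add R u v)" "add (add R u v) s t \<in> fac (add R s t)"
    "H \<in> fac (add (add R u v) s t)" "add R s t \<in> fac R"
proof -
  let ?E = "add R u v"
  have E: "pre ?E" by (rule pre_fac[OF R G0(2)])
  have H: "pre H" by (rule pre_fac[OF pre_fac[OF E G0(3)] G0(4)])
  interpret H: finite_preorder Y H by (rule preD(1)[OF H])
  have EH: "?E a b \<Longrightarrow> H a b" for a b using fac_mono[OF G0(3)] fac_mono[OF G0(4)] by blast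
  have GH: "add ?E s t a b \<Longrightarrow> H a b" for a b
    unfolding add_def[of ?E] using EH H.tr st(3) by meson
  have v: "valid (add ?E s t)" by (rule valid_mono[OF preD(6)[OF H] GH])
  note ts = two_step[OF R G0(1) st(1,2) v]
  show "add (add R u v) s t \<in> fac (add R u v)" "add (add R u v) s t \<in> fac (add R s t)" "add R s t \<in> fac R"
    using ts by blast+
  show "H \<in> fac (add (add R u v) s t)" by (rule fac_interval[OF E G0(3,4) ts(3) GH])
qed

text \<open>Two facets through a codimension 3 face that have no common codimension 2 face there
  are opposite edges of a 4-cycle in a Hasse diagram.\<close>

lemma square:
  assumes R: "pre R" and up: "up = {F \<in> fac R. \<exists>G\<in>fac F. H \<in> fac G}"
    and E: "E \<in> up" and F: "F \<in> up" and EF: "E \<noteq> F"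
  shows "(\<exists>G. G \<in> fac E \<and> G \<in> fac F \<and> H \<in> fac G) \<or>
      (\<exists>P Q. up = {E, F, P, Q} \<and> (\<forall>\<theta>\<in>Con R. dl R \<theta> E + dl R \<theta> F = dl R \<theta> P + dl R \<theta> Q))"
proof -
  interpret finite_preorder Y R by (rule preD(1)[OF R])
  obtain G0 where G0: "G0 \<in> fac E" "H \<in> fac G0" and Ef: "E \<in> fac R" using E up by blast
  obtain u v where uv: "cover R u v" "E = add R u v" using facE[OF Ef] .
  have pE: "pre E" by (rule pre_fac[OF R Ef])
  interpret E: finite_preorder Y E by (rule preD(1)[OF pE])
  have pH: "pre H" by (rule pre_fac[OF pre_fac[OF pE G0(1)] G0(2)])
  interpret H: finite_preorder Y H by (rule preD(1)[OF pH])
  have EH: "E a b \<Longrightarrow> H a b" for a b using fac_mono[OF G0(1)] fac_mono[OF G0(2)] by blast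
  have RE: "R a b \<Longrightarrow> E a b" for a b by (rule fac_mono[OF Ef])
  have rev: "H t s" if "cover R s t" "add R s t \<in> up" for s t
  proof -
    obtain G where "G \<in> fac (add R s t)" "H \<in> fac G" using \<open>add R s t \<in> up\<close> up by blast
    then show ?thesis using add_rev[OF that(1)] fac_mono by blast
  qed
  note join = join_in_link[OF R uv(1) _ _ G0(2), folded uv(2), OF Ef G0(1)]
  obtain x y where xy: "cover R x y" "F = add R x y" using facE F up by blast
  have Hyx: "H y x" using rev[OF xy(1)] F xy(2) by simp
  have nrev: "\<not> E t s" if "cover R s t" "add R s t \<noteq> E" for s t
    using reversed_pair[OF uv(1), of s t] that add_cong[of s u t v] uv(2) unfolding cover_def by blast
  show ?thesis
  proof (cases "cover E x y")
    case True
    then show ?thesis using join[OF xy(1) True Hyx] xy(2) by blast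
  next
    case False
    \<comment> \<open>Merging \<open>u\<close> and \<open>v\<close> has put something between
      \<open>s\<close> and \<open>t\<close>. By \<open>no_chain\<close> it is a single class, so
      both halves are covers of \<open>E\<close>.\<close>
    have mid: "\<exists>w. cover E s w \<and> cover E w t"
      if st: "cover R s t" "add R s t \<noteq> E" "H t s" "\<not> cover E s t" for s t
    proof -
      have "E s t" "\<not> E t s" using st(1) RE nrev[OF st(1,2)] unfolding cover_def by blast+
      then obtain w where w: "E s w" "E w t" "\<not> E w s" "\<not> E t w" using st(4) unfolding cover_def by blast
      have "E c s \<or> E w c" if c: "E s c" "E c w" for c
      proof (rule ccontr)
        assume "\<not> (E c s \<or> E w c)"
        then show False using no_chain[OF pE G0, of s c w t] c w st(3) unfolding lt_def by blast
      qed
      moreover have "E c w \<or> E t c" if c: "E w c" "E c t" for c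
      proof (rule ccontr)
        assume "\<not> (E c w \<or> E t c)"
        then show False using no_chain[OF pE G0, of s w c t] c w st(3) unfolding lt_def by blast
      qed
      ultimately show ?thesis using w unfolding cover_def by blast
    qed
    obtain w where w: "cover E x w" "cover E w y" using mid[OF xy(1) _ Hyx False] EF xy(2) by blast
    have Hw: "H w x" "H y w" using w EH H.tr Hyx unfolding cover_def by blast+
    \<comment> \<open>The two halves lift to covers of \<open>R\<close>, which are the remaining two
      edges of the 4-cycle.\<close>
    obtain x1 w1 where p: "cover R x1 w1" "eqv E x x1" "eqv E w w1"
      using lift_cover[OF uv(1)] w(1) uv(2) by metis
    obtain w2 y2 where q: "cover R w2 y2" "eqv E w w2" "eqv E y y2"
      using lift_cover[OF uv(1)] w(2) uv(2) by metis
    have pc: "cover E x1 w1" "cover E w2 y2" using E.cover_cong w p q by blast+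
    have pq: "H w1 x1" "H y2 w2" using p q Hw EH H.tr unfolding eqv_def by meson+
    note jp = join[OF p(1) pc(1) pq(1)] and jq = join[OF q(1) pc(2) pq(2)]
    have PQ: "add R x1 w1 \<in> up" "add R w2 y2 \<in> up" using jp jq up by blast+
    have nE: "\<not> E w x" "\<not> E y w" using w unfolding cover_def by blast+
    have below: "(eqv E s x \<and> eqv E t w) \<or> (eqv E s w \<and> eqv E t y)" if st: "cover E s t" "H t s" for s t
    proof -
      obtain a b c d where abcd: "\<And>s t. cover E s t \<Longrightarrow> H t s \<Longrightarrow> (eqv E s a \<and> eqv E t b) \<or> (eqv E s c \<and> eqv E t d)"
        using two_covers[OF pE G0] by metis
      have "\<not> eqv E x w" using nE unfolding eqv_def by blast
      then show ?thesis using abcd[OF st] abcd[OF w(1) Hw(1)] abcd[OF w(2) Hw(2)] E.eqv_sym E.eqv_trans by meson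
    qed
    have lu: "eqv R s a \<and> eqv R t b" if "cover R a b" "cover R s t" "eqv E s a" "eqv E t b" "\<not> E b a" for s t a b
      using cover_lift_unique[OF uv(1) that(1,2)] that(3-5) uv(2) by blast
    have "up \<subseteq> {E, F, add R x1 w1, add R w2 y2}"
    proof
      fix P assume P: "P \<in> up"
      obtain s t where st: "cover R s t" "P = add R s t" using facE P up by blast
      have Hts: "H t s" using rev[OF st(1)] P st(2) by simp
      show "P \<in> {E, F, add R x1 w1, add R w2 y2}"
      proof (cases "P = E \<or> cover E s t")
        case True
        moreover have "P = add R x1 w1 \<or> P = add R w2 y2" if c: "cover E s t"
          using below[OF c Hts]
        proof
          assume "eqv E s x \<and> eqv E t w"
          then have "eqv E s x1" "eqv E t w1" using p E.eqv_trans by blast+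
          then show ?thesis using lu[OF p(1) st(1)] pc(1) add_cong st(2) unfolding cover_def by blast
        next
          assume "eqv E s w \<and> eqv E t y"
          then have "eqv E s w2" "eqv E t y2" using q E.eqv_trans by blast+
          then show ?thesis using lu[OF q(1) st(1)] pc(2) add_cong st(2) unfolding cover_def by blast
        qed
        ultimately show ?thesis by blast
      next
        case n: False
        obtain w' where w': "cover E s w'" "cover E w' t" using mid[OF st(1) _ Hts] n st(2) by blast
        have Hw': "H w' s" "H t w'" using w' EH H.tr Hts unfolding cover_def by blast+
        have nE': "\<not> E w' s" "\<not> E t w'" using w' unfolding cover_def by blast+
        have "eqv E s x \<and> eqv E t y"
          using below[OF w'(1) Hw'(1)] below[OF w'(2) Hw'(2)] nE nE' w unfolding cover_def eqv_def
          by (meson E.tr)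
        then have "eqv R s x \<and> eqv R t y"
          using lu[OF xy(1) st(1)] nrev[OF xy(1)] EF xy(2) by blast
        then show ?thesis using add_cong st(2) xy(2) by blast
      qed
    qed
    then have up4: "up = {E, F, add R x1 w1, add R w2 y2}" using E F PQ by blast
    have "\<theta> v - \<theta> u + (\<theta> y - \<theta> x) = (\<theta> w1 - \<theta> x1) + (\<theta> y2 - \<theta> w2)" if \<theta>: "\<theta> \<in> Con R" for \<theta>
    proof -
      have th: "\<theta> a = \<theta> b" if "eqv R a b" for a b using that \<theta> unfolding Con_def by blast
      define m where "m a \<longleftrightarrow> R u a \<and> R a v" for a
      have em: "eqv R a b \<or> (m a \<and> m b)" if "eqv E a b" for a b
        using eqv_add[OF uv(1)] that uv(2) unfolding m_def by blast
      have me: "eqv R a u \<or> eqv R a v" if "m a" for a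
        using merged_eqv[OF uv(1)] that unfolding m_def by blast
      have mm: "E a b" if "m a" "m b" for a b
        using that unfolding m_def uv(2) add_def by blast
      have mc: "m b" if "m a" "eqv R a b" for a b using that tr unfolding m_def eqv_def by blast
      have Exy: "\<not> E y x" using nE w E.tr unfolding cover_def by blast
      have Ruv: "R u v" "\<not> R v u" using uv unfolding cover_def by blast+
      have n3: "\<not> (m x \<and> m w)" "\<not> (m w \<and> m y)" "\<not> (m x \<and> m y)" using mm nE Exy by blast+
      have Rx1: "R x1 w1" "\<not> R w1 x1" and Rw2: "R w2 y2" "\<not> R y2 w2" using p q unfolding cover_def by blast+
      have cxy: "R c x \<or> R y c" if "R x c" "R c y" for c using xy(1) that unfolding cover_def by blast
      have bet: False if "R x c" "R c y" "\<not> eqv R c x" "\<not> eqv R c y" for c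
        using cxy[OF that(1,2)] that unfolding eqv_def by blast
      \<comment> \<open>The class that merges \<open>u\<close> and \<open>v\<close> must be that of
        \<open>w\<close>, \<open>x\<close> or \<open>y\<close>, since otherwise \<open>w\<close>
        would lie strictly between \<open>x\<close> and \<open>y\<close> already in
        \<open>R\<close>. In the first case the 4-cycle is a crown with two minimal elements
        \<open>u\<close>, \<open>x\<close>; in the other two it is a diamond.\<close>
      consider "m w" "\<not> m x" "\<not> m y" | "m x" "\<not> m w" "\<not> m y" | "m y" "\<not> m w" "\<not> m x" | "\<not> m w" "\<not> m x" "\<not> m y"
        using n3 by blast
      then show ?thesis
      proof cases
        case 1
        have e: "eqv R x x1" "eqv R y y2" "m w1" "m w2"
          using em[OF p(2)] em[OF q(3)] em[OF p(3)] em[OF q(2)] 1 mc by blast+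
        have r: "R x w1" "R w2 y" using e Rx1 Rw2 tr unfolding eqv_def by blast+
        have d: "\<not> eqv R c x \<and> \<not> eqv R c y" if "m c" for c
          using 1 mc[OF that] by blast
        have b1: False if "R x c" "R c y" "m c" for c using bet[OF that(1,2)] d[OF that(3)] by blast
        have mu: "m u" "m v" using Ruv uv carrier rfl unfolding m_def cover_def by blast+
        have "eqv R w1 v"
        proof (rule ccontr)
          assume "\<not> eqv R w1 v"
          then have "R x u" using me[OF e(3)] r tr unfolding eqv_def by blast
          moreover have "R u y" using e(4) r tr unfolding m_def by blast
          ultimately show False using b1[of u] mu by blast
        qed
        moreover have "eqv R w2 u"
        proof (rule ccontr)
          assume "\<not> eqv R w2 u"
          then have "R v y" using me[OF e(4)] r tr unfolding eqv_def by blast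
          moreover have "R x v" using e(3) r tr unfolding m_def by blast
          ultimately show False using b1[of v] mu by blast
        qed
        ultimately show ?thesis using th[OF e(1)] th[OF e(2)] th by simp
      next
        case 2
        have e: "eqv R w w1" "eqv R w w2" "eqv R y y2" "m x1"
          using em[OF p(3)] em[OF q(2)] em[OF q(3)] em[OF p(2)] 2 mc by blast+
        have r: "R x1 w" "R w y" using e Rx1 Rw2 tr unfolding eqv_def by blast+
        have d: "\<not> eqv R w x" "\<not> eqv R w y" using nE RE unfolding eqv_def by blast+
        have nx: "\<not> eqv R x x1" using bet[of w] r d tr unfolding eqv_def by blast
        have "eqv R x v \<and> eqv R x1 u"
        proof (rule ccontr)
          assume "\<not> (eqv R x v \<and> eqv R x1 u)"
          then have a: "eqv R x u" "eqv R x1 v"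
            using nx me[OF 2(1)] me[OF e(4)] eqv_sym eqv_trans by blast+
          then have "R x w" using r Ruv tr unfolding eqv_def by blast
          then show False using bet[of w] r d by blast
        qed
        then show ?thesis using th[of x v] th[of x1 u] th[OF e(1)] th[OF e(2)] th[OF e(3)] by simp
      next
        case 3
        have e: "eqv R w w1" "eqv R w w2" "eqv R x x1" "m y2"
          using em[OF p(3)] em[OF q(2)] em[OF p(2)] em[OF q(3)] 3 mc by blast+
        have r: "R x w" "R w y2" using e Rx1 Rw2 tr unfolding eqv_def by blast+
        have d: "\<not> eqv R w x" "\<not> eqv R w y" using nE RE unfolding eqv_def by blast+
        have ny: "\<not> eqv R y y2" using bet[of w] r d tr unfolding eqv_def by blast
        have "eqv R y u \<and> eqv R y2 v"
        proof (rule ccontr)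
          assume "\<not> (eqv R y u \<and> eqv R y2 v)"
          then have a: "eqv R y v" "eqv R y2 u"
            using ny me[OF 3(1)] me[OF e(4)] eqv_sym eqv_trans by blast+
          then have "R w y" using r Ruv tr unfolding eqv_def by blast
          then show False using bet[of w] r d by blast
        qed
        then show ?thesis using th[of y u] th[of y2 v] th[OF e(1)] th[OF e(2)] th[OF e(3)] by simp
      next
        case 4
        have e: "eqv R w w1" "eqv R w w2" "eqv R x x1" "eqv R y y2"
          using em[OF p(3)] em[OF q(2)] em[OF p(2)] em[OF q(3)] 4 by blast+
        have r: "R x w" "R w y" using e Rx1 Rw2 tr unfolding eqv_def by blast+
        have d: "\<not> eqv R w x" "\<not> eqv R w y" using nE RE unfolding eqv_def by blast+
        then show ?thesis using bet[of w] r by blast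
      qed
    qed
    then have "dl R \<theta> E + dl R \<theta> F = dl R \<theta> (add R x1 w1) + dl R \<theta> (add R w2 y2)" if "\<theta> \<in> Con R" for \<theta>
      using that dl_add[OF R] uv xy p(1) q(1) by simp
    then show ?thesis using up4 by blast
  qed
qed

end

section \<open>Translations of facets and connectedness of the facet graph\<close>

lemma (in finite_preorder) cover_above:
  assumes "R a b" "\<not> R b a"
  shows "\<exists>t. cover R a t \<and> R t b"
  using assms
proof (induction "card {w. R a w \<and> R w b}" arbitrary: b rule: less_induct)
  case less
  show ?case
  proof (cases "cover R a b")
    case True
    then show ?thesis using less.prems carrier rfl by blast
  next
    case False
    then obtain w where w: "R a w" "R w b" "\<not> R w a" "\<not> R b w" using less.prems unfolding cover_def by blast
    have "{x. R a x \<and> R x w} \<subset> {x. R a x \<and> R x b}" using w tr less.prems carrier rfl by blast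
    moreover have "finite {x. R a x \<and> R x b}" by (rule finite_subset[OF _ finite_Y]) (use carrier in blast)
    ultimately have "card {x. R a x \<and> R x w} < card {x. R a x \<and> R x b}" by (simp add: psubset_card_mono)
    then obtain t where "cover R a t" "R t w" using less.hyps w by blast
    then show ?thesis using w tr by blast
  qed
qed

lemma (in finite_preorder) cover_below:
  assumes "R a b" "\<not> R b a"
  shows "\<exists>s. cover R s b \<and> R a s"
  using assms
proof (induction "card {w. R a w \<and> R w b}" arbitrary: a rule: less_induct)
  case less
  show ?case
  proof (cases "cover R a b")
    case True
    then show ?thesis using less.prems carrier rfl by blast
  next
    case False
    then obtain w where w: "R a w" "R w b" "\<not> R w a" "\<not> R b w" using less.prems unfolding cover_def by blast
    have "{x. R w x \<and> R x b} \<subset> {x. R a x \<and> R x b}" using w tr less.prems carrier rfl by blast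
    moreover have "finite {x. R a x \<and> R x b}" by (rule finite_subset[OF _ finite_Y]) (use carrier in blast)
    ultimately have "card {x. R w x \<and> R x b} < card {x. R a x \<and> R x b}" by (simp add: psubset_card_mono)
    then obtain t where "cover R t b" "R w t" using less.hyps w by blast
    then show ?thesis using w tr by blast
  qed
qed

context marked_ground
begin

definition marker :: "('y \<Rightarrow> 'y \<Rightarrow> bool) \<Rightarrow> 'y \<Rightarrow> bool" where
  "marker R y \<longleftrightarrow> (\<exists>m\<in>{B, z1, z2, z3, T}. eqv R y m)"

lemma marker_comparable:
  assumes R: "pre R" and "marker R x" "marker R y"
  shows "R x y \<or> R y x"
proof -
  interpret finite_preorder Y R by (rule preD(1)[OF R])
  obtain m n where m: "m \<in> {B, z1, z2, z3, T}" "eqv R x m" and n: "n \<in> {B, z1, z2, z3, T}" "eqv R y n"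
    using assms(2,3) unfolding marker_def by blast
  have c: "R B z1" "R z1 z2" "R z2 z3" "R z3 T" using preD[OF R] marks by blast+
  then have c': "R z1 z3" "R B z2" "R z2 T" "R B z3" "R z1 T" "R B T" using tr by blast+
  have "R m n \<or> R n m" using m(1) n(1) c c' rfl marks by blast
  then show ?thesis using m(2) n(2) tr unfolding eqv_def by blast
qed

lemma marker_cover:
  assumes R: "pre R" and uv: "cover R u v" and m: "marker R u" "marker R v"
  shows "(eqv R u B \<and> eqv R v z1) \<or> (eqv R u z1 \<and> eqv R v z2) \<or> (eqv R u z2 \<and> eqv R v z3) \<or> (eqv R u z3 \<and> eqv R v T)"
proof -
  interpret finite_preorder Y R by (rule preD(1)[OF R])
  have Ruv: "R u v" "\<not> R v u" "u \<in> Y" "v \<in> Y" using uv carrier unfolding cover_def by blast+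
  have Bu: "R B u" "R v T" using preD[OF R] Ruv by blast+
  have nT: "\<not> R T u" using Bu Ruv tr by blast
  have key: "eqv R u p \<and> eqv R v q"
    if pq: "R p u" "\<not> R q u" "\<And>m. m \<in> {B, z1, z2, z3, T} \<Longrightarrow> R m p \<or> R q m" "R p q" for p q
  proof -
    obtain i where i: "i \<in> {B, z1, z2, z3, T}" "eqv R u i" using m unfolding marker_def by blast
    have "R i p" using pq(2) pq(3)[OF i(1)] i(2) tr unfolding eqv_def by blast
    then have up: "eqv R u p" using i(2) pq(1) tr unfolding eqv_def by blast
    obtain j where j: "j \<in> {B, z1, z2, z3, T}" "eqv R v j" using m unfolding marker_def by blast
    have "R q j" using pq(1) pq(3)[OF j(1)] j(2) tr Ruv unfolding eqv_def by blast
    then have "R q v" using j tr unfolding eqv_def by blast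
    moreover have "R u q" using up pq(4) tr unfolding eqv_def by blast
    ultimately have "R v q" using uv pq(2) unfolding cover_def by blast
    then show ?thesis using up \<open>R q v\<close> unfolding eqv_def by blast
  qed
  have c: "R B z1" "R z1 z2" "R z2 z3" "R z3 T" using preD[OF R] marks by blast+
  then have c': "R z1 z3" "R B z2" "R z2 T" "R B z3" "R z1 T" "R B T" using tr by blast+
  note cc = c c' rfl marks
  consider "\<not> R z1 u" | "R z1 u" "\<not> R z2 u" | "R z2 u" "\<not> R z3 u" | "R z3 u" by blast
  then show ?thesis
  proof cases
    case 1 then show ?thesis using key[of B z1] Bu cc by blast
  next
    case 2 then show ?thesis using key[of z1 z2] cc by blast
  next
    case 3 then show ?thesis using key[of z2 z3] cc by blast
  next
    case 4 then show ?thesis using key[of z3 T] nT cc by blast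
  qed
qed

text \<open>If merging a cover reverses a strict relation between two marks, then the covering
  property forces these marks to be the ends of the cover, up to equivalence.\<close>

lemma valid_nonmarker:
  assumes R: "pre R" and uv: "cover R u v" and n: "\<not> marker R u \<or> \<not> marker R v"
  shows "valid (add R u v)"
proof -
  interpret finite_preorder Y R by (rule preD(1)[OF R])
  have key: "\<not> (R q v \<and> R u p)" if pq: "R p q" "\<not> R q p" "p \<in> {B, z1, z2, z3, T}" "q \<in> {B, z1, z2, z3, T}" for p q
  proof
    assume a: "R q v \<and> R u p"
    then have b: "R p v" "R u q" using pq tr by blast+
    have "R p u \<or> R v p" "R q u \<or> R v q" using uv a b unfolding cover_def by blast+
    then have "R p u" "R v q" using a pq tr by blast+
    then have "eqv R u p" "eqv R v q" using a unfolding eqv_def by blast+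
    then show False using n pq unfolding marker_def by blast
  qed
  note p = preD[OF R]
  have v: "\<not> R z2 z1" "\<not> R z3 z2" "\<not> (R z1 B \<and> R T z3)" using p(6) unfolding valid_def by blast+
  have c: "R B z1" "R z3 T" using p marks by blast+
  show ?thesis unfolding valid_def add_def
    using key[OF p(4) v(1)] key[OF p(5) v(2)] key[OF c(1)] key[OF c(2)] v by blast
qed

text \<open>An unmarked end can be moved alone. If both ends are marked, then validity leaves only
  the pairs at \<open>B\<close> and at \<open>T\<close>, and there \<open>z1\<close>,
  \<open>z2\<close>, \<open>z3\<close> have to move as one block; the block is separated from the
  other end because the opposite outer difference has not collapsed.\<close>

lemma shift_ex:
  assumes R: "pre R" and F: "F \<in> fac R"
  shows "\<exists>\<theta>. \<theta> \<in> Con R \<and> mk \<theta> = (0, 0, 0) \<and> dl R \<theta> F = 1"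
proof -
  interpret finite_preorder Y R by (rule preD(1)[OF R])
  obtain u v where uv: "cover R u v" "F = add R u v" "valid F" using facE[OF F] .
  have Ruv: "R u v" "\<not> R v u" "u \<in> Y" "v \<in> Y" using uv carrier unfolding cover_def by blast+
  have ind: "\<exists>\<theta>. \<theta> \<in> Con R \<and> mk \<theta> = (0, 0, 0) \<and> dl R \<theta> F = 1"
    if th: "\<And>x y. eqv R x y \<Longrightarrow> \<theta> x = \<theta> y" "\<theta> T = \<theta> B" "\<theta> z1 = \<theta> z2" "\<theta> z3 = \<theta> z2" "\<theta> v - \<theta> u = 1" for \<theta> :: "'y \<Rightarrow> real"
  proof -
    have "\<theta> \<in> Con R" unfolding Con_def using th(1) by blast
    then show ?thesis using dl_add[OF R uv(1)] uv(2) th by (intro exI[of _ \<theta>]) (simp add: mk_def)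
  qed
  have c: "R B z1" "R z1 z2" "R z2 z3" "R z3 T" using preD[OF R] marks by blast+
  have V: "\<not> R z2 z1" "\<not> R z3 z2" using preD(6)[OF R] unfolding valid_def by blast+
  show ?thesis
  proof (cases "marker R u \<and> marker R v")
    case False
    show ?thesis
    proof (cases "marker R v")
      case False
      then have "\<not> eqv R v m" if "m \<in> {B, z1, z2, z3, T}" for m using that unfolding marker_def by blast
      moreover have "\<not> eqv R v u" "eqv R v v" using Ruv eqv_refl unfolding eqv_def by blast+
      moreover have "eqv R v x \<longleftrightarrow> eqv R v y" if "eqv R x y" for x y using that eqv_sym eqv_trans by blast
      ultimately show ?thesis by (intro ind[of "\<lambda>y. if eqv R v y then 1 else 0"]) auto
    next
      case True
      then have "\<not> marker R u" using False by blast
      then have "\<not> eqv R u m" if "m \<in> {B, z1, z2, z3, T}" for m using that unfolding marker_def by blast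
      moreover have "\<not> eqv R u v" "eqv R u u" using Ruv eqv_refl unfolding eqv_def by blast+
      moreover have "eqv R u x \<longleftrightarrow> eqv R u y" if "eqv R x y" for x y using that eqv_sym eqv_trans by blast
      ultimately show ?thesis by (intro ind[of "\<lambda>y. if eqv R u y then - 1 else 0"]) auto
    qed
  next
    case True
    define Z where "Z y \<longleftrightarrow> eqv R y z1 \<or> eqv R y z2 \<or> eqv R y z3" for y
    have Zc: "Z x \<longleftrightarrow> Z y" if "eqv R x y" for x y using that eqv_sym eqv_trans unfolding Z_def by blast
    have ZY: "Z z1" "Z z2" "Z z3" using eqv_refl marks unfolding Z_def by blast+
    have Zle: "R y z3" "R z1 y" if "Z y" for y using that c tr unfolding Z_def eqv_def by blast+
    have Fv: "\<not> (R z2 v \<and> R u z1)" "\<not> (R z3 v \<and> R u z2)"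
      "\<not> ((R z1 B \<or> (R z1 v \<and> R u B)) \<and> (R T z3 \<or> (R T v \<and> R u z3)))"
      using uv(2,3) unfolding valid_def add_def by blast+
    have d: "(eqv R u B \<and> eqv R v z1) \<or> (eqv R u z3 \<and> eqv R v T)"
      using marker_cover[OF R uv(1)] True Fv(1,2) unfolding eqv_def by blast
    then show ?thesis
    proof
      assume e: "eqv R u B \<and> eqv R v z1"
      then have "\<not> R T z3" using Fv(3) unfolding eqv_def by blast
      then have "\<not> Z T" using Zle by blast
      moreover have "\<not> Z u" using Zle(2)[of u] e Ruv tr unfolding eqv_def by blast
      moreover have "\<not> Z B" "Z v" using e Zc \<open>\<not> Z u\<close> ZY by blast+
      ultimately show ?thesis using Zc ZY by (intro ind[of "\<lambda>y. if Z y then 1 else 0"]) auto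
    next
      assume e: "eqv R u z3 \<and> eqv R v T"
      then have "\<not> R z1 B" using Fv(3) unfolding eqv_def by blast
      then have "\<not> Z B" using Zle by blast
      moreover have "\<not> Z v" using Zle(1)[of v] e Ruv tr unfolding eqv_def by blast
      moreover have "\<not> Z T" "Z u" using e Zc \<open>\<not> Z v\<close> ZY by blast+
      ultimately show ?thesis using Zc ZY by (intro ind[of "\<lambda>y. if Z y then - 1 else 0"]) auto
    qed
  qed
qed

text \<open>The one exceptional pair of facets: each collapses one of the two outer segments, which
  is allowed, but both together would destroy the outer difference.\<close>

definition spec :: "('y \<Rightarrow> 'y \<Rightarrow> bool) \<Rightarrow> 'y \<Rightarrow> 'y \<Rightarrow> 'y \<Rightarrow> 'y \<Rightarrow> bool" where
  "spec R u v x y \<longleftrightarrow> eqv R u B \<and> eqv R v z1 \<and> eqv R x z3 \<and> eqv R y T"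

lemma specD:
  assumes R: "pre R" and s: "spec R u v x y"
  shows "R v x" "\<not> R x v" "\<not> R x u" "\<not> R y u" "R u x" "R u y"
proof -
  interpret finite_preorder Y R by (rule preD(1)[OF R])
  have c: "R B z1" "R z1 z2" "R z2 z3" "R z3 T" using preD[OF R] marks by blast+
  then have c': "R z1 z3" "R B z3" "R z1 T" "R B T" using tr by blast+
  have V: "\<not> R z2 z1" using preD(6)[OF R] unfolding valid_def by blast
  have n: "\<not> R z3 z1" "\<not> R z3 B" "\<not> R T B" using V c c' tr by blast+
  show "R v x" "\<not> R x v" "\<not> R x u" "\<not> R y u" "R u x" "R u y"
    using s c' n tr unfolding spec_def eqv_def by blast+
qed

definition adj :: "('y \<Rightarrow> 'y \<Rightarrow> bool) \<Rightarrow> ('y \<Rightarrow> 'y \<Rightarrow> bool) \<Rightarrow> ('y \<Rightarrow> 'y \<Rightarrow> bool) \<Rightarrow> bool" where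
  "adj R F F' \<longleftrightarrow> F \<in> fac R \<and> F' \<in> fac R \<and> fac F \<inter> fac F' \<noteq> {}"

lemma adj_sym: "(adj R)\<^sup>*\<^sup>* F F' \<Longrightarrow> (adj R)\<^sup>*\<^sup>* F' F"
proof (induction rule: rtranclp_induct)
  case (step G H)
  have "adj R H G" using step.hyps(2) unfolding adj_def by blast
  then show ?case using step.IH by (rule converse_rtranclp_into_rtranclp)
qed simp

text \<open>After \<open>u\<close> and \<open>v\<close> are merged, the pair \<open>x\<close>,
  \<open>y\<close> stops being a cover only through the detour \<open>x \<le> v\<close>,
  \<open>u \<le> y\<close>, and a common lower or upper end makes this detour harmless. Then the
  facets meet in the face that merges both pairs, unless they form the exceptional pair.\<close>

lemma adjI:
  assumes R: "pre R" and uv: "cover R u v" "valid (add R u v)" and xy: "cover R x y" "valid (add R x y)"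
    and c: "\<not> (R x v \<and> R u y) \<or> eqv R x u \<or> eqv R y v"
    and s: "\<not> spec R u v x y" "\<not> spec R x y u v"
  shows "(adj R)\<^sup>*\<^sup>* (add R u v) (add R x y)"
proof (cases "add R u v = add R x y")
  case False
  interpret finite_preorder Y R by (rule preD(1)[OF R])
  let ?F = "add R u v"
  have Ruv: "R u v" "\<not> R v u" using uv unfolding cover_def by blast+
  have Rxy: "R x y" "\<not> R y x" using xy unfolding cover_def by blast+
  have "cover ?F x y"
    unfolding cover_def
  proof (intro conjI allI impI)
    show "?F x y" using Rxy by (simp add: add_def)
    show "\<not> ?F y x" using reversed_pair[OF uv(1) Rxy] add_cong[of x u y v] False by metis
    fix w assume w: "?F x w" "?F w y"
    show "?F w x \<or> ?F y w"
    proof (cases "R x w \<and> R w y")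
      case True
      then show ?thesis using xy(1) unfolding cover_def add_def by blast
    next
      case n: False
      then have "R x v" "R u y" using w tr unfolding add_def by blast+
      then consider "eqv R x u" | "eqv R y v" using c by blast
      then show ?thesis
      proof cases
        case 1
        then have "R w v" using n w tr unfolding add_def eqv_def by blast
        then show ?thesis using 1 unfolding add_def eqv_def by blast
      next
        case 2
        then have "R u w" using n w tr unfolding add_def eqv_def by blast
        then show ?thesis using 2 unfolding add_def eqv_def by blast
      qed
    qed
  qed
  moreover have "valid (add ?F x y)"
  proof -
    \<comment> \<open>A reversed relation in the joint face is reversed already in one of the two
      facets. So validity can only fail when the two halves of its last condition are violated by
      different facets.\<close>
    have key: "?F q p \<or> add R x y q p" if pq: "R p q" and G: "add ?F x y q p" for p q
    proof (rule ccontr)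
      assume "\<not> (?F q p \<or> add R x y q p)"
      then have n: "\<not> R q p" "\<not> (R q v \<and> R u p)" "\<not> (R q y \<and> R x p)" unfolding add_def by blast+
      have "(R q y \<or> (R q v \<and> R u y)) \<and> (R x p \<or> (R x v \<and> R u p))" using G n unfolding add_def by blast
      then consider "R q y" "R x v" "R u p" | "R q v" "R u y" "R x p" using n by blast
      then show False
      proof cases
        case 1
        then have "R u y" using pq tr by blast
        then show False using c 1 n tr unfolding eqv_def by blast
      next
        case 2
        then have "R x v" using pq tr by blast
        then show False using c 2 n tr unfolding eqv_def by blast
      qed
    qed
    note p = preD[OF R]
    have B: "R B z1" "R z3 T" using p marks by blast+
    have BY: "R B u" "R B x" "R v T" "R y T" using p carrier Ruv Rxy by blast+
    have v1: "\<not> ?F z2 z1" "\<not> ?F z3 z2" "\<not> (?F z1 B \<and> ?F T z3)" using uv(2) unfolding valid_def by blast+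
    have v2: "\<not> add R x y z2 z1" "\<not> add R x y z3 z2" "\<not> (add R x y z1 B \<and> add R x y T z3)"
      using xy(2) unfolding valid_def by blast+
    have sp: "spec R a b a' b'"
      if ab: "cover R a b" "cover R a' b'" "add R a b z1 B" "add R a' b' T z3"
        "\<not> R z1 B" "\<not> R T z3" for a b a' b'
    proof -
      have r: "R z1 b" "R a B" "R T b'" "R a' z3" using ab unfolding add_def by blast+
      have bt: "R B a" "R b' T" using p carrier ab(1,2) unfolding cover_def by blast+
      have "R a z1" using r(2) B(1) tr by blast
      then have "R z1 a \<or> R b z1" using ab(1) r unfolding cover_def by blast
      then have "R b z1" using r(2) ab(5) tr by blast
      have "R z3 b'" using r(3) B(2) tr by blast
      then have "R z3 a' \<or> R b' z3" using ab(2) r unfolding cover_def by blast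
      then have "R z3 a'" using r(3) ab(6) tr by blast
      then show ?thesis using r bt \<open>R b z1\<close> unfolding spec_def eqv_def by blast
    qed
    have "\<not> (add ?F x y z1 B \<and> add ?F x y T z3)"
    proof
      assume "add ?F x y z1 B \<and> add ?F x y T z3"
      then have a: "?F z1 B \<or> add R x y z1 B" "?F T z3 \<or> add R x y T z3" using key B by blast+
      have "\<not> R z1 B" "\<not> R T z3" using a v1(3) v2(3) add_mono[of R] by blast+
      then show False using a v1(3) v2(3) sp[OF uv(1) xy(1)] sp[OF xy(1) uv(1)] s by blast
    qed
    then show ?thesis unfolding valid_def using key p(4,5) v1 v2 by blast
  qed
  ultimately have "adj R ?F (add R x y)"
    using two_step[OF R uv(1) xy(1)] unfolding adj_def by blast
  then show ?thesis by blast
qed simp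

text \<open>A class other than that of \<open>v\<close> and the marked ones takes part in a cover
  that is compatible with both given covers; the facet of that cover is a common neighbour.\<close>

lemma link_consecutive_free:
  assumes R: "pre R" and e: "cover R u v" "valid (add R u v)" and f: "cover R v y" "valid (add R v y)"
    and m: "marker R u" "marker R y" "\<not> marker R v"
    and free: "w \<in> Y" "\<not> marker R w" "\<not> eqv R w v"
  shows "(adj R)\<^sup>*\<^sup>* (add R u v) (add R v y)"
proof -
  interpret finite_preorder Y R by (rule preD(1)[OF R])
  have Ruv: "R u v" "\<not> R v u" and Rvy: "R v y" "\<not> R y v" using e f unfolding cover_def by blast+
  have mk_eq: "marker R a \<longleftrightarrow> marker R b" if "eqv R a b" for a b
    using that eqv_sym eqv_trans unfolding marker_def by blast
  have nsp: "\<not> spec R a b c d" if "\<not> marker R a \<or> \<not> marker R b \<or> \<not> marker R c \<or> \<not> marker R d" for a b c d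
    using that unfolding spec_def marker_def by blast
  have ex: "\<exists>s. cover R s w" "\<exists>t. cover R w t" if w: "w \<in> Y" "\<not> marker R w" for w
  proof -
    have "R B w" "R w T" using preD[OF R] w by blast+
    moreover have "\<not> eqv R w B" "\<not> eqv R w T" using w unfolding marker_def by blast+
    ultimately show "\<exists>s. cover R s w" "\<exists>t. cover R w t"
      using cover_below[of B w] cover_above[of w T] unfolding eqv_def by blast+
  qed
  have nm: "\<not> eqv R w u" "\<not> eqv R w y" if "\<not> marker R w" for w using that m mk_eq by blast+
  have via: ?thesis if g: "cover R s t" "\<not> marker R s \<or> \<not> marker R t"
    and ce: "\<not> (R s v \<and> R u t) \<or> eqv R s u \<or> eqv R t v"
    and cf: "\<not> (R s y \<and> R v t) \<or> eqv R s v \<or> eqv R t y" for s t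
  proof -
    have vg: "valid (add R s t)" by (rule valid_nonmarker[OF R g])
    have "(adj R)\<^sup>*\<^sup>* (add R u v) (add R s t)" using adjI[OF R e g(1) vg ce] nsp m(3) by blast
    moreover have "(adj R)\<^sup>*\<^sup>* (add R v y) (add R s t)" using adjI[OF R f g(1) vg cf] nsp m(3) by blast
    ultimately show ?thesis using adj_sym rtranclp_trans by metis
  qed
  consider w where "w \<in> Y" "\<not> marker R w" "\<not> eqv R w v" "R v w"
    | w where "w \<in> Y" "\<not> marker R w" "\<not> eqv R w v" "R w v"
    | "\<And>w. w \<in> Y \<Longrightarrow> \<not> marker R w \<Longrightarrow> \<not> eqv R w v \<Longrightarrow> \<not> R v w \<and> \<not> R w v" by blast
  then show ?thesis
  proof cases
    case (1 w)
    obtain t where t: "cover R w t" using ex 1 by blast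
    have "\<not> R w v" using 1 unfolding eqv_def by blast
    moreover have "\<not> R w y"
    proof
      assume "R w y"
      then have "R w v \<or> R y w" using f(1) 1(4) unfolding cover_def by blast
      then show False using \<open>\<not> R w v\<close> nm[OF 1(2)] \<open>R w y\<close> unfolding eqv_def by blast
    qed
    ultimately show ?thesis using via[OF t] 1 by blast
  next
    case (2 w)
    obtain s where s: "cover R s w" using ex 2 by blast
    have "\<not> R v w" using 2 unfolding eqv_def by blast
    moreover have "\<not> R u w"
    proof
      assume "R u w"
      then have "R w u \<or> R v w" using e(1) 2(4) unfolding cover_def by blast
      then show False using \<open>\<not> R v w\<close> nm[OF 2(2)] \<open>R u w\<close> unfolding eqv_def by blast
    qed
    ultimately show ?thesis using via[OF s] 2 by blast
  next
    case 3
    obtain s where s: "cover R s w" using ex free by blast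
    have w: "\<not> R v w" "\<not> R w v" using 3 free by blast+
    have Rsw: "R s w" "s \<in> Y" using s carrier unfolding cover_def by blast+
    have "eqv R s u" if a: "R s v" "R u w"
    proof -
      have "marker R s"
      proof (rule ccontr)
        assume n: "\<not> marker R s"
        then have "eqv R s v" using 3 Rsw a by blast
        then show False using w Rsw tr unfolding eqv_def by blast
      qed
      then have "R u s \<or> R s u" using marker_comparable[OF R] m by blast
      then show ?thesis
      proof
        assume "R u s"
        then have "R s u \<or> R v s" using e(1) a unfolding cover_def by blast
        moreover have "\<not> R v s" using w Rsw tr by blast
        ultimately show ?thesis using \<open>R u s\<close> unfolding eqv_def by blast
      next
        assume "R s u"
        then have "R u s \<or> R w u" using s a unfolding cover_def by blast
        moreover have "\<not> R w u" using nm[OF free(2)] a unfolding eqv_def by blast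
        ultimately show ?thesis using \<open>R s u\<close> unfolding eqv_def by blast
      qed
    qed
    then show ?thesis using via[OF s] free w by blast
  qed
qed

text \<open>Another valid cover that starts in \<open>u\<close> or ends in \<open>y\<close> gives a
  facet between the two. Otherwise one tries to merge all three classes. If this fails because of a
  further element between \<open>u\<close> and \<open>y\<close>, or because a prescribed difference
  would collapse, then \<open>u\<close> and \<open>y\<close> are marked and \<open>v\<close> is not,
  the situation of \<open>link_consecutive_free\<close>.\<close>

lemma link_consecutive:
  assumes R: "pre R" and e: "cover R u v" "valid (add R u v)" and f: "cover R v y" "valid (add R v y)"
    and free: "\<And>v. \<exists>w\<in>Y. \<not> marker R w \<and> \<not> eqv R w v"
  shows "(adj R)\<^sup>*\<^sup>* (add R u v) (add R v y)"
proof -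
  interpret finite_preorder Y R by (rule preD(1)[OF R])
  let ?F = "add R u v"
  have Ruv: "R u v" "\<not> R v u" and Rvy: "R v y" "\<not> R y v" using e f unfolding cover_def by blast+
  have Y: "u \<in> Y" "v \<in> Y" "y \<in> Y" using Ruv Rvy carrier by blast+
  have Ruy: "R u y" "\<not> R y u" using Ruv Rvy tr by blast+
  have eu: "R w u \<or> R v w" if "R u w" "R w v" for w using e(1) that unfolding cover_def by blast
  have fv: "R w v \<or> R y w" if "R v w" "R w y" for w using f(1) that unfolding cover_def by blast
  consider t where "cover R u t" "valid (add R u t)" "\<not> eqv R t v"
    | s where "cover R s y" "valid (add R s y)" "\<not> eqv R s v"
    | "\<And>t. cover R u t \<Longrightarrow> \<not> eqv R t v \<Longrightarrow> \<not> valid (add R u t)" "\<And>s. cover R s y \<Longrightarrow> \<not> eqv R s v \<Longrightarrow> \<not> valid (add R s y)"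
    by blast
  then show ?thesis
  proof cases
    case (1 t)
    have Rut: "R u t" "\<not> R t u" using 1(1) unfolding cover_def by blast+
    have nvt: "\<not> R v t"
    proof
      assume "R v t"
      then have "R v u \<or> R t v" using 1(1) Ruv unfolding cover_def by blast
      then show False using Ruv \<open>R v t\<close> 1(3) unfolding eqv_def by blast
    qed
    have ntv: "\<not> R t v" using eu[of t] Rut nvt by blast
    have "(adj R)\<^sup>*\<^sup>* (add R u v) (add R u t)"
      using adjI[OF R e 1(1,2)] eqv_refl[OF Y(1)] specD(3)[OF R, of u v u t] specD(3)[OF R, of u t u v] rfl[OF Y(1)] by blast
    moreover have "(adj R)\<^sup>*\<^sup>* (add R u t) (add R v y)"
      using adjI[OF R 1(1,2) f] nvt specD(1)[OF R, of u t v y] specD(4)[OF R, of v y u t] ntv Ruv Rvy Rut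
        specD(3)[OF R, of v y u t] Ruv by blast
    ultimately show ?thesis by (rule rtranclp_trans)
  next
    case (2 s)
    have Rsy: "R s y" "\<not> R y s" using 2(1) unfolding cover_def by blast+
    have nsv: "\<not> R s v"
    proof
      assume "R s v"
      then have "R v s \<or> R y v" using 2(1) Rvy unfolding cover_def by blast
      then show False using Rvy \<open>R s v\<close> 2(3) unfolding eqv_def by blast
    qed
    have nvs: "\<not> R v s" using fv[of s] Rsy nsv by blast
    have "(adj R)\<^sup>*\<^sup>* (add R v y) (add R s y)"
      using adjI[OF R f 2(1,2)] eqv_refl[OF Y(3)] specD(2)[OF R, of v y s y] specD(2)[OF R, of s y v y] Rvy Rsy by blast
    moreover have "(adj R)\<^sup>*\<^sup>* (add R u v) (add R s y)"
      using adjI[OF R e 2(1,2)] nsv specD(1)[OF R, of u v s y] specD(2)[OF R, of s y u v] nvs Ruy by blast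
    ultimately show ?thesis using adj_sym rtranclp_trans by metis
  next
    case 3
    have chain: "R B z1" "R z1 z2" "R z2 z3" "R z3 T" using preD[OF R] marks by blast+
    have V: "\<not> R z2 z1" "\<not> R z3 z2" "\<not> (R z1 B \<and> R T z3)" using preD(6)[OF R] unfolding valid_def by blast+
    have mm: "marker R m" if "m \<in> {B, z1, z2, z3, T}" for m
      using that eqv_refl marks unfolding marker_def by blast
    have mk_eq: "marker R a \<longleftrightarrow> marker R b" if "eqv R a b" for a b
      using that eqv_sym eqv_trans unfolding marker_def by blast
    have conc: ?thesis if m: "marker R u" "marker R y" "\<not> marker R v"
      using link_consecutive_free[OF R e f m] free[of v] by blast
    show ?thesis
    proof (cases "\<exists>w. R u w \<and> R w y \<and> \<not> R v w \<and> \<not> R w v")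
      case True
      then obtain w where w: "R u w" "R w y" "\<not> R v w" "\<not> R w v" by blast
      have "\<not> R w u" "\<not> R y w" using w Ruv Rvy tr by blast+
      then obtain t s where t: "cover R u t" "R t w" and s: "cover R s y" "R w s"
        using cover_above[of u w] cover_below[of w y] w by blast
      have nt: "\<not> R v t" "\<not> R s v" using t s w tr by blast+
      then have "\<not> valid (add R u t)" "\<not> valid (add R s y)" using 3 t s unfolding eqv_def by blast+
      then have m: "marker R u" "marker R t" "marker R y" using valid_nonmarker[OF R] t s by blast+
      have "\<not> marker R v"
      proof
        assume "marker R v"
        then have "R t v" using marker_comparable[OF R m(2)] nt by blast
        then have "R t u" using eu[of t] t nt unfolding cover_def by blast
        then show False using t unfolding cover_def by blast
      qed
      then show ?thesis using conc m by blast
    next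
      case cmp: False
      have bet: "eqv R m u \<or> eqv R m v \<or> eqv R m y" if "R u m" "R m y" for m
        using cmp that eu[of m] fv[of m] unfolding eqv_def by blast
      have F: "?F a b \<longleftrightarrow> R a b \<or> (R a v \<and> R u b)" for a b by (simp add: add_def)
      have cF: "cover ?F v y" unfolding cover_def
      proof (intro conjI allI impI)
        show "?F v y" using Rvy F by blast
        show "\<not> ?F y v" using Rvy F by blast
        fix w assume "?F v w" "?F w y"
        then have "R u w" "R w v \<or> R w y" using Ruv tr unfolding F by blast+
        then have "R u w" "R w y" using Rvy tr by blast+
        then have "R w v \<or> R y w" using cmp fv by blast
        then show "?F w v \<or> ?F y w" unfolding F by blast
      qed
      show ?thesis
      proof (cases "valid (add ?F v y)")
        case True
        have "adj R ?F (add R v y)" using two_step[OF R e(1) f(1) cF True] unfolding adj_def by blast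
        then show ?thesis by blast
      next
        case inv: False
        have G: "R u p \<and> R q y" if "R p q" "\<not> R q p" "add ?F v y q p" "\<not> (R q v \<and> R u p)" "\<not> (R q y \<and> R v p)" for p q
          using that Ruv Rvy tr unfolding add_def by blast
        have ve: "\<not> (R z2 v \<and> R u z1)" "\<not> (R z3 v \<and> R u z2)"
          "\<not> ((R z1 B \<or> (R z1 v \<and> R u B)) \<and> (R T z3 \<or> (R T v \<and> R u z3)))"
          using e(2) unfolding valid_def add_def by blast+
        have vf: "\<not> (R z2 y \<and> R v z1)" "\<not> (R z3 y \<and> R v z2)"
          "\<not> ((R z1 B \<or> (R z1 y \<and> R v B)) \<and> (R T z3 \<or> (R T y \<and> R v z3)))"
          using f(2) unfolding valid_def add_def by blast+
        have ends: ?thesis if pq: "R p q" "\<not> R q p" "R u p" "R q y" "p \<in> {B, z1, z2, z3, T}" "q \<in> {B, z1, z2, z3, T}"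
          "\<not> (R q v \<and> R u p)" "\<not> (R q y \<and> R v p)"
          "\<And>a b. cover R a b \<Longrightarrow> eqv R a p \<Longrightarrow> marker R b \<Longrightarrow> eqv R b q" for p q
        proof -
          have "R p y" "R u q" using pq tr by blast+
          then have "eqv R p u" "eqv R q y"
            using bet[of p] bet[of q] pq tr unfolding eqv_def by blast+
          then have "marker R u" "marker R y" "\<not> marker R v"
            using mk_eq mm[OF pq(5)] mm[OF pq(6)] pq(7,3) pq(9)[OF e(1)] unfolding eqv_def by blast+
          then show ?thesis using conc by blast
        qed
        have mc: "eqv R b q" if "(p, q) \<in> {(B, z1), (z1, z2), (z2, z3), (z3, T)}" "\<not> R q p" "cover R a b" "eqv R a p" "marker R b" for a b p q
        proof -
          have "marker R a" using that mm mk_eq by blast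
          then have "(eqv R a B \<and> eqv R b z1) \<or> (eqv R a z1 \<and> eqv R b z2) \<or> (eqv R a z2 \<and> eqv R b z3) \<or> (eqv R a z3 \<and> eqv R b T)"
            using marker_cover[OF R that(3)] that(5) by blast
          then obtain p' q' where p': "(p', q') \<in> {(B, z1), (z1, z2), (z2, z3), (z3, T)}" "eqv R a p'" "eqv R b q'" by blast
          have "eqv R p p'" using p' that eqv_sym eqv_trans by blast
          moreover have "\<not> R q' p'" using p' that(3) tr unfolding cover_def eqv_def by blast
          ultimately have "p = p' \<and> q = q' \<or> eqv R q q'"
            using that(1,2) p'(1) chain tr unfolding eqv_def by (smt (verit) empty_iff insert_iff prod.inject)
          then show ?thesis using p' eqv_sym eqv_trans by blast
        qed
        consider "add ?F v y z2 z1" | "add ?F v y z3 z2" | "add ?F v y z1 B" "add ?F v y T z3"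
          using inv unfolding valid_def by blast
        then show ?thesis
        proof cases
          case 1
          then show ?thesis using ends[of z1 z2] G[of z1 z2] chain V ve vf mc[of z1 z2] by blast
        next
          case 2
          then show ?thesis using ends[of z2 z3] G[of z2 z3] chain V ve vf mc[of z2 z3] by blast
        next
          case 3
          consider "R z1 B" "\<not> R T z3" | "\<not> R z1 B" "R T z3" | "\<not> R z1 B" "\<not> R T z3" using V by blast
          then show ?thesis
          proof cases
            case 1
            then show ?thesis using ends[of z3 T] G[of z3 T] chain ve vf mc[of z3 T] 3 by blast
          next
            case 2
            then show ?thesis using ends[of B z1] G[of B z1] chain ve vf mc[of B z1] 3 by blast
          next
            case n: 3
            have BY: "R B u" "R y T" using preD[OF R] Y by blast+
            have z: "R u z1" "R z1 y" "R u z3" "R z3 y"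
              if "R u B" "R T y" using that chain tr by blast+
            have gB: "R z1 v \<and> R u B \<or> R z1 y \<and> R v B \<or> R u B \<and> R z1 y"
              using G[of B z1] chain n 3 by blast
            have gT: "R T v \<and> R u z3 \<or> R T y \<and> R v z3 \<or> R u z3 \<and> R T y"
              using G[of z3 T] chain n 3 by blast
            have uB: "R u B" using gB Ruv tr by blast
            have yT: "R T y" using gT Rvy tr by blast
            have "eqv R z1 u \<or> eqv R z1 v \<or> eqv R z1 y" "eqv R z3 u \<or> eqv R z3 v \<or> eqv R z3 y"
              using bet z[OF uB yT] by blast+
            moreover have "\<not> eqv R z1 u" "\<not> eqv R z3 y" using n uB yT tr unfolding eqv_def by blast+
            moreover have "\<not> eqv R z1 y" using n yT chain tr unfolding eqv_def by blast
            moreover have "\<not> eqv R z3 u" using n uB chain tr unfolding eqv_def by blast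
            ultimately have "R z1 z3 \<and> R z3 z1" using tr unfolding eqv_def by blast
            then show ?thesis using V chain tr by blast
          qed
        qed
      qed
    qed
  qed
qed

text \<open>The cover from \<open>u\<close> towards \<open>y\<close> shares its lower end with the
  first pair and does not cross the second, so it gives a common neighbour.\<close>

lemma link_crown:
  assumes R: "pre R" and e: "cover R u v" "valid (add R u v)" and f: "cover R x y" "valid (add R x y)"
    and c: "R x v" "R u y" "\<not> eqv R x v" "\<not> eqv R y u" "\<not> eqv R x u"
    and w: "cover R u w" "R w y" "valid (add R u w)"
  shows "(adj R)\<^sup>*\<^sup>* (add R u v) (add R x y)"
proof -
  interpret finite_preorder Y R by (rule preD(1)[OF R])
  have Ruv: "R u v" "\<not> R v u" and Ruw: "R u w" "\<not> R w u" using e w unfolding cover_def by blast+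
  have uY: "u \<in> Y" using Ruv carrier by blast
  have nwx: "\<not> R w x"
  proof
    assume "R w x"
    then have "R u x" using Ruw tr by blast
    then have "R x u \<or> R v x" using e(1) c unfolding cover_def by blast
    then show False using \<open>R w x\<close> Ruw tr c unfolding eqv_def by blast
  qed
  have "(adj R)\<^sup>*\<^sup>* (add R u v) (add R u w)"
    using adjI[OF R e w(1,3)] eqv_refl[OF uY] specD(3)[OF R, of u v u w] specD(3)[OF R, of u w u v] rfl[OF uY] by blast
  moreover have "\<not> (R x w \<and> R u y) \<or> eqv R x u \<or> eqv R y w"
  proof -
    have "R y w" if "R x w" using f(1) that w(2) nwx unfolding cover_def by blast
    then show ?thesis using w(2) unfolding eqv_def by blast
  qed
  then have "(adj R)\<^sup>*\<^sup>* (add R u w) (add R x y)"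
    using adjI[OF R w(1,3) f] specD(1)[OF R, of u w x y] specD(5)[OF R, of x y u w] specD(4)[OF R, of x y u w] nwx Ruw c
      specD(1)[OF R, of x y u w] unfolding eqv_def by blast
  ultimately show ?thesis by (rule rtranclp_trans)
qed

text \<open>By \<open>adjI\<close> only three positions need a detour: the exceptional pair,
  consecutive covers, and crowns. The assumption \<open>free\<close> provides spare classes; it is
  where the dimension enters.\<close>

lemma connected:
  assumes R: "pre R" and free: "\<And>v. \<exists>w\<in>Y. \<not> marker R w \<and> \<not> eqv R w v"
    and E: "E \<in> fac R" and F: "F \<in> fac R"
  shows "(adj R)\<^sup>*\<^sup>* E F"
proof -
  interpret finite_preorder Y R by (rule preD(1)[OF R])
  have special: "(adj R)\<^sup>*\<^sup>* (add R u v) (add R x y)"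
    if e: "cover R u v" "valid (add R u v)" and f: "cover R x y" "valid (add R x y)" and s: "spec R u v x y" for u v x y
  proof -
    \<comment> \<open>The exceptional facets share no face of codimension 2; a cover ending in an
      unmarked class connects them.\<close>
    obtain w where w: "w \<in> Y" "\<not> marker R w" using free by blast
    then have n: "\<not> eqv R w m" if "m \<in> {B, z1, z2, z3, T}" for m using that unfolding marker_def by blast
    have "R B w" "\<not> R w B" using preD[OF R] w n[of B] unfolding eqv_def by blast+
    then obtain t where t: "cover R t w" using cover_below by blast
    have vt: "valid (add R t w)" by (rule valid_nonmarker[OF R t]) (use w in blast)
    have se: "eqv R u B" "eqv R v z1" "eqv R x z3" "eqv R y T" using s unfolding spec_def by blast+
    have nw: "\<not> eqv R w u" "\<not> eqv R w v" "\<not> eqv R w x" "\<not> eqv R w y"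
      using n se eqv_trans by blast+
    have "R w y" using preD(3)[OF R w(1)] se tr unfolding eqv_def by blast
    then have nxw: "\<not> R x w" using f(1) nw unfolding cover_def eqv_def by blast
    have ns: "\<not> spec R a b t w" "\<not> spec R t w a b" for a b using n unfolding spec_def by blast+
    have "(adj R)\<^sup>*\<^sup>* (add R x y) (add R t w)" using adjI[OF R f t vt] nxw ns by blast
    moreover have "(adj R)\<^sup>*\<^sup>* (add R u v) (add R t w)"
    proof (cases "eqv R v t")
      case True
      have wY: "eqv R w w" using eqv_refl w by blast
      have "cover R v w" "add R v w = add R t w"
        using cover_cong[OF t eqv_sym[OF True] wY] add_cong[OF True wY] by blast+
      then show ?thesis using link_consecutive[OF R e, of w] vt free by simp
    next
      case False
      have "eqv R t u" if "R t v" "R u w"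
      proof -
        have "R B t" using preD(2)[OF R] carrier that by blast
        then have "R u t" using se tr unfolding eqv_def by blast
        then have "R t u \<or> R v t" using e(1) that unfolding cover_def by blast
        then show ?thesis using False that \<open>R u t\<close> unfolding eqv_def by blast
      qed
      then show ?thesis using adjI[OF R e t vt] ns by blast
    qed
    ultimately show ?thesis using adj_sym rtranclp_trans by metis
  qed
  obtain u v where e: "cover R u v" "valid (add R u v)" and Ee: "E = add R u v" using facE[OF E] by metis
  obtain x y where f: "cover R x y" "valid (add R x y)" and Ff: "F = add R x y" using facE[OF F] by metis
  have Ruv: "R u v" "\<not> R v u" "u \<in> Y" "v \<in> Y" and Rxy: "R x y" "\<not> R y x" "x \<in> Y" "y \<in> Y"
    using e f carrier unfolding cover_def by blast+
  show ?thesis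
  proof (cases "spec R u v x y \<or> spec R x y u v \<or> \<not> (R x v \<and> R u y) \<or> eqv R x u \<or> eqv R y v")
    case True
    then show ?thesis using special[OF e f] adj_sym[OF special[OF f e]] adjI[OF R e f] unfolding Ee Ff by blast
  next
    case False
    then have c: "R x v" "R u y" "\<not> eqv R x u" "\<not> eqv R y v" by blast+
    consider "eqv R x v" | "eqv R y u" | "\<not> eqv R x v" "\<not> eqv R y u" by blast
    then show ?thesis
    proof cases
      case 1
      have "cover R v y" "add R v y = F" using cover_cong[OF f(1) 1 eqv_refl] add_cong[OF 1 eqv_refl] Rxy Ff by simp_all
      then show ?thesis using link_consecutive[OF R e, of y] f(2) free Ee Ff by simp
    next
      case 2
      have "cover R y v" "add R y v = E"
        using cover_cong[OF e(1) eqv_sym[OF 2] eqv_refl] add_cong[OF eqv_sym[OF 2] eqv_refl] Ruv Ee by simp_all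
      then show ?thesis using adj_sym[OF link_consecutive[OF R f, of v]] e(2) free Ee Ff by simp
    next
      case 3
      have "\<not> R y u" "\<not> R v x" using c 3 unfolding eqv_def by blast+
      then obtain w w' where w: "cover R u w" "R w y" and w': "cover R x w'" "R w' v"
        using cover_above[OF c(2)] cover_above[OF c(1)] by blast
      show ?thesis
      proof (cases "valid (add R u w)")
        case True
        then show ?thesis using link_crown[OF R e f c(1,2) 3 c(3) w] Ee Ff by simp
      next
        case nv: False
        show ?thesis
        proof (cases "valid (add R x w')")
          case True
          have "\<not> eqv R u y" "\<not> eqv R v x" "\<not> eqv R u x" using 3 c eqv_sym by blast+
          then show ?thesis using adj_sym[OF link_crown[OF R f e c(2,1) _ _ _ w' True]] Ee Ff by simp
        next
          case False
          \<comment> \<open>If neither diagonal of the crown is usable, then both lower ends are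
            marked, hence comparable; but a comparison between them would contradict one of the
            covers.\<close>
          then have "marker R u" "marker R x" using valid_nonmarker[OF R] nv w w' by blast+
          then have "R u x \<or> R x u" by (rule marker_comparable[OF R])
          then show ?thesis
          proof
            assume "R u x"
            then have "R x u \<or> R v x" using e(1) c unfolding cover_def by blast
            then show ?thesis using \<open>R u x\<close> c 3 unfolding eqv_def by blast
          next
            assume "R x u"
            then have "R u x \<or> R y u" using f(1) c unfolding cover_def by blast
            then show ?thesis using \<open>R x u\<close> c 3 unfolding eqv_def by blast
          qed
        qed
      qed
    qed
  qed
qed

end

text \<open>Mixed volumes of a product of three simplices of dimensions \<open>ns - 1\<close>, \<open>na - 1\<close>, \<open>nb - 1\<close>,
  up to a factorial. Once one of the arguments is 0, the value is 0, because truncated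
  subtraction keeps it at 0.\<close>

fun M3 :: "nat \<Rightarrow> nat \<Rightarrow> nat \<Rightarrow> (real \<times> real \<times> real) list \<Rightarrow> real" where
  "M3 na nb ns [] = (if na = 1 \<and> nb = 1 \<and> ns = 1 then 1 else 0)"
| "M3 na nb ns (c # cs) = fst c * M3 na nb (ns - 1) cs + fst (snd c) * M3 (na - 1) nb ns cs
    + snd (snd c) * M3 na (nb - 1) ns cs"

lemma M3_zero: "na = 0 \<or> nb = 0 \<or> ns = 0 \<Longrightarrow> M3 na nb ns cs = 0"
  by (induction cs arbitrary: na nb ns) auto

lemma sum_telescope_interval:
  fixes f :: "nat \<Rightarrow> real"
  assumes "a \<le> b"
  shows "(\<Sum>i\<in>{a<..b}. f i - f (i - 1)) = f b - f a"
  using assms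
proof (induction b rule: dec_induct)
  case (step n)
  have "{a<..Suc n} = insert (Suc n) {a<..n}" using step by auto
  then show ?case using step by simp
qed simp

section \<open>Mixed volumes as sums over linear extensions\<close>

context marked_ground
begin

text \<open>Linear extensions of the poset of classes of \<open>R\<close>, written as rank functions
  on elements. The value 0 outside \<open>Y\<close> makes them determined by their values on
  \<open>Y\<close>.\<close>

definition Ext :: "('y \<Rightarrow> 'y \<Rightarrow> bool) \<Rightarrow> nat \<Rightarrow> ('y \<Rightarrow> nat) set" where
  "Ext R N = {r. (\<forall>y. y \<notin> Y \<longrightarrow> r y = 0) \<and> r ` Y = {..N} \<and>
     (\<forall>x\<in>Y. \<forall>y\<in>Y. R x y \<longrightarrow> r x \<le> r y) \<and> (\<forall>x\<in>Y. \<forall>y\<in>Y. r x = r y \<longrightarrow> R x y)}"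
text \<open>The offset 3: there are \<open>d + 4\<close> levels, of which one degree of freedom is
  lost to adding constants and three to the prescribed differences.\<close>

definition face :: "nat \<Rightarrow> ('y \<Rightarrow> 'y \<Rightarrow> bool) \<Rightarrow> bool" where
  "face d R \<longleftrightarrow> pre R \<and> Ext R (d + 3) \<noteq> {}"
text \<open>A linear extension cuts out the cell of maps increasing along it. The steps from
  \<open>z1\<close> to \<open>z2\<close>, those from \<open>z2\<close> to \<open>z3\<close>, and the
  outer ones, below \<open>z1\<close> and above \<open>z3\<close> together, each have a prescribed
  sum; so the cell is a product of three simplices.\<close>

definition wt :: "('y \<Rightarrow> nat) \<Rightarrow> (real \<times> real \<times> real) list \<Rightarrow> real" where
  "wt r cs = M3 (r z2 - r z1) (r z3 - r z2) (r z1 - r B + (r T - r z3)) cs"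
definition vol :: "('y \<Rightarrow> 'y \<Rightarrow> bool) \<Rightarrow> (real \<times> real \<times> real) list \<Rightarrow> real" where
  "vol R cs = (\<Sum>r\<in>Ext R (length cs + 3). wt r cs)"
definition mg :: "nat \<Rightarrow> ('y \<Rightarrow> nat) \<Rightarrow> 'y \<Rightarrow> nat" where
  "mg i r y = (if i \<le> r y then r y - 1 else r y)"
definition sw :: "nat \<Rightarrow> ('y \<Rightarrow> nat) \<Rightarrow> 'y \<Rightarrow> nat" where
  "sw i r y = (if y \<in> Y then if r y = i - 1 then i else if r y = i then i - 1 else r y else 0)"
definition pt :: "('y \<Rightarrow> nat) \<Rightarrow> nat \<Rightarrow> 'y" where "pt r i = (SOME y. y \<in> Y \<and> r y = i)"

lemma ExtI:
  assumes "\<And>y. y \<notin> Y \<Longrightarrow> r y = 0" "r ` Y = {..N}" "\<And>x y. x \<in> Y \<Longrightarrow> y \<in> Y \<Longrightarrow> R x y \<Longrightarrow> r x \<le> r y"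
    "\<And>x y. x \<in> Y \<Longrightarrow> y \<in> Y \<Longrightarrow> r x = r y \<Longrightarrow> R x y"
  shows "r \<in> Ext R N"
  using assms unfolding Ext_def by blast

lemma ExtD:
  assumes "r \<in> Ext R N"
  shows "\<And>y. y \<notin> Y \<Longrightarrow> r y = 0" "r ` Y = {..N}" "\<And>x y. x \<in> Y \<Longrightarrow> y \<in> Y \<Longrightarrow> R x y \<Longrightarrow> r x \<le> r y"
    "\<And>x y. x \<in> Y \<Longrightarrow> y \<in> Y \<Longrightarrow> r x = r y \<Longrightarrow> R x y"
  using assms unfolding Ext_def by blast+

lemma finite_Ext: "finite (Ext R N)"
proof (rule finite_subset)
  show "Ext R N \<subseteq> {r. \<forall>y. (y \<in> Y \<longrightarrow> r y \<in> {..N}) \<and> (y \<notin> Y \<longrightarrow> r y = 0)}"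
    unfolding Ext_def by blast
  show "finite {r. \<forall>y. (y \<in> Y \<longrightarrow> r y \<in> {..N}) \<and> (y \<notin> Y \<longrightarrow> r y = (0::nat))}"
    by (rule finite_set_of_finite_funs) (use fin in auto)
qed

lemma Ext_eqv:
  assumes "r \<in> Ext R N" "x \<in> Y" "y \<in> Y"
  shows "eqv R x y \<longleftrightarrow> r x = r y"
proof
  assume "eqv R x y"
  then show "r x = r y" using ExtD(3)[OF assms(1)] assms(2,3) unfolding eqv_def by (simp add: le_antisym)
next
  assume "r x = r y"
  then show "eqv R x y" using ExtD(4)[OF assms(1)] assms(2,3) unfolding eqv_def by simp
qed

lemma Ext_marks:
  assumes R: "pre R" and r: "r \<in> Ext R N"
  shows "r B = 0" "r T = N" "r z1 < r z2" "r z2 < r z3" "r z3 \<le> N" "r z1 \<noteq> 0 \<or> r z3 \<noteq> N"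
proof -
  note p = preD[OF R] and e = ExtD[OF r]
  obtain y where "y \<in> Y" "r y = 0" using e(2) by (metis atMost_iff imageE le0)
  then show B: "r B = 0" using e(3)[of B y] p(2) marks by fastforce
  obtain y' where "y' \<in> Y" "r y' = N" using e(2) by (metis atMost_iff imageE order_refl)
  moreover have "r T \<le> N" using e(2) marks by blast
  ultimately show T: "r T = N" using e(3)[of y' T] p(3) marks by fastforce
  have v: "\<not> R z2 z1" "\<not> R z3 z2" "\<not> (R z1 B \<and> R T z3)" using p(6) unfolding valid_def by blast+
  show "r z1 < r z2" "r z2 < r z3"
    using e(3)[of z1 z2] e(4)[of z2 z1] e(3)[of z2 z3] e(4)[of z3 z2] p(4,5) v marks by fastforce+
  show "r z3 \<le> N" using e(2) marks by blast
  show "r z1 \<noteq> 0 \<or> r z3 \<noteq> N" using e(4)[of z1 B] e(4)[of T z3] B T v marks by fastforce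
qed

lemma pt:
  assumes "r \<in> Ext R N" "i \<le> N"
  shows "pt r i \<in> Y" "r (pt r i) = i"
proof -
  have "\<exists>y. y \<in> Y \<and> r y = i" using ExtD(2)[OF assms(1)] assms(2) by (metis atMost_iff imageE)
  then have "pt r i \<in> Y \<and> r (pt r i) = i" unfolding pt_def by (rule someI_ex)
  then show "pt r i \<in> Y" "r (pt r i) = i" by auto
qed

lemma rank_image:
  fixes S :: "nat set"
  assumes "finite S" "S \<noteq> {}"
  shows "(\<lambda>s. card {t \<in> S. t < s}) ` S = {..card S - 1}"
proof (rule card_subset_eq)
  have "card {t \<in> S. t < s} < card S" if "s \<in> S" for s
    by (rule psubset_card_mono[OF assms(1)]) (use that in auto)
  moreover have "card S > 0" using assms by (simp add: card_gt_0_iff)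
  moreover have "card {t \<in> S. t < s} \<le> card S - 1" if "s \<in> S" for s using calculation(1)[OF that] by linarith
  ultimately show "(\<lambda>s. card {t \<in> S. t < s}) ` S \<subseteq> {..card S - 1}" by blast
  have "card {t \<in> S. t < s} < card {t \<in> S. t < s'}" if "s \<in> S" "s < s'" for s s'
    by (rule psubset_card_mono) (use that assms in auto)
  then have "inj_on (\<lambda>s. card {t \<in> S. t < s}) S"
    by (metis (no_types, lifting) inj_onI linorder_neqE_nat less_irrefl)
  then show "card ((\<lambda>s. card {t \<in> S. t < s}) ` S) = card {..card S - 1}"
    using \<open>card S > 0\<close> by (simp add: card_image)
qed simp

lemma Ext_exists:
  assumes R: "finite_preorder Y R"
  shows "\<exists>N. Ext R N \<noteq> {}"
proof -
  interpret finite_preorder Y R by (rule R)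
  define c where "c x = {y \<in> Y. eqv R x y}" for x
  have "finite (c ` Y)" using fin by simp
  then obtain f :: "'y set \<Rightarrow> nat" and n where f: "f ` (c ` Y) = {i. i < n}" "inj_on f (c ` Y)"
    using finite_imp_inj_to_nat_seg by metis
  define h where "h x = card {y \<in> Y. R y x}" for x
  \<comment> \<open>A lexicographic key: first the size of the down-set, then an arbitrary number of
    the class. The factor \<open>n\<close> exceeds all class numbers.\<close>
  define key where "key x = h x * n + f (c x)" for x
  have fn: "f (c x) < n" if "x \<in> Y" for x using f(1) that by blast
  have ceq: "c x = c y" if "eqv R x y" for x y using that eqv_sym eqv_trans unfolding c_def by blast
  have mono: "key x < key y" if xy: "x \<in> Y" "y \<in> Y" "R x y" "\<not> R y x" for x y
  proof -
    have "{z \<in> Y. R z x} \<subset> {z \<in> Y. R z y}" using xy tr rfl by blast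
    then have "h x < h y" unfolding h_def using fin by (simp add: psubset_card_mono)
    then have "Suc (h x) * n \<le> h y * n" by (simp add: mult_le_mono1 Suc_leI del: mult_Suc)
    then show ?thesis using fn[OF xy(1)] unfolding key_def by simp
  qed
  have same: "key x = key y" if "eqv R x y" for x y
  proof -
    have "{z \<in> Y. R z x} = {z \<in> Y. R z y}" using that tr unfolding eqv_def by blast
    then show ?thesis using ceq[OF that] unfolding key_def h_def by simp
  qed
  have inj: "eqv R x y" if "x \<in> Y" "y \<in> Y" "key x = key y" for x y
  proof -
    have "key x mod n = key y mod n" using that by simp
    then have "f (c x) = f (c y)" using fn that by (simp add: key_def)
    then have "c x = c y" using f(2) that by (auto dest: inj_onD)
    then show ?thesis using that eqv_refl[OF that(2)] unfolding c_def by blast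
  qed
  define S where "S = key ` Y"
  have S: "finite S" "S \<noteq> {}" using fin marks unfolding S_def by auto
  define rk where "rk s = card {t \<in> S. t < s}" for s
  have rkm: "rk s \<le> rk s'" if "s \<le> s'" for s s'
    unfolding rk_def by (rule card_mono) (use S that in auto)
  have rks: "rk s < rk s'" if "s \<in> S" "s < s'" for s s'
    unfolding rk_def by (rule psubset_card_mono) (use S that in auto)
  define r where "r y = (if y \<in> Y then rk (key y) else 0)" for y
  have "r \<in> Ext R (card S - 1)"
  proof (rule ExtI)
    have "r ` Y = rk ` S" unfolding S_def image_image by (rule image_cong) (auto simp: r_def)
    then show "r ` Y = {..card S - 1}" using rank_image[OF S] unfolding rk_def by simp
    fix x y assume xy: "x \<in> Y" "y \<in> Y"
    show "r x \<le> r y" if "R x y"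
    proof -
      have "key x \<le> key y" using mono[OF xy that] same[of x y] that unfolding eqv_def by fastforce
      then show ?thesis using rkm xy by (simp add: r_def)
    qed
    show "R x y" if "r x = r y"
    proof -
      have "rk (key x) = rk (key y)" "key x \<in> S" "key y \<in> S" using that xy by (auto simp: r_def S_def)
      then have "key x = key y" using rks by (metis less_irrefl linorder_neqE_nat)
      then show ?thesis using inj xy unfolding eqv_def by blast
    qed
  qed (simp add: r_def)
  then show ?thesis by blast
qed

lemma Ext_length_unique:
  assumes r: "r \<in> Ext R N" and q: "q \<in> Ext R M"
  shows "N = M"
proof -
  have e: "r x = r y \<longleftrightarrow> q x = q y" if "x \<in> Y" "y \<in> Y" for x y
    using Ext_eqv[OF r that] Ext_eqv[OF q that] by simp
  define h where "h i = q (pt r i)" for i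
  have "bij_betw h {..N} {..M}"
    unfolding bij_betw_def
  proof
    show "inj_on h {..N}"
    proof (rule inj_onI)
      fix i j assume "i \<in> {..N}" "j \<in> {..N}" "h i = h j"
      then show "i = j" using e[of "pt r i" "pt r j"] pt[OF r] unfolding h_def by (metis atMost_iff)
    qed
    show "h ` {..N} = {..M}"
    proof
      show "h ` {..N} \<subseteq> {..M}" using pt[OF r] ExtD(2)[OF q] unfolding h_def by blast
      show "{..M} \<subseteq> h ` {..N}"
      proof
        fix j assume "j \<in> {..M}"
        then have j: "pt q j \<in> Y" "q (pt q j) = j" using pt[OF q] by auto
        have "r (pt q j) \<le> N" using ExtD(2)[OF r] j by blast
        moreover have "h (r (pt q j)) = j"
          using e[of "pt r (r (pt q j))" "pt q j"] pt[OF r calculation] j unfolding h_def by simp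
        ultimately show "j \<in> h ` {..N}" by (metis atMost_iff image_eqI)
      qed
    qed
  qed
  then have "card {..N} = card {..M}" by (rule bij_betw_same_card)
  then show ?thesis by simp
qed

lemma Ext_merge:
  assumes R: "pre R" and r: "r \<in> Ext R (Suc N)" and i: "1 \<le> i" "i \<le> Suc N"
    and xy: "x \<in> Y" "y \<in> Y" "r x = i - 1" "r y = i" "R x y"
  shows "cover R x y" "mg i r \<in> Ext (add R x y) N"
proof -
  note e = ExtD[OF r]
  have c: "\<not> R y x" using e(3)[OF xy(2,1)] xy(3,4) i by fastforce
  have mono: "mg i r a \<le> mg i r b" if "r a \<le> r b" for a b
    using that i unfolding mg_def by auto
  show "mg i r \<in> Ext (add R x y) N"
  proof (rule ExtI)
    show "mg i r a = 0" if "a \<notin> Y" for a using e(1)[OF that] i by (simp add: mg_def)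
    have "mg i r ` Y = (\<lambda>k. if i \<le> k then k - 1 else k) ` (r ` Y)" by (auto simp: mg_def image_image)
    also have "\<dots> = {..N}" unfolding e(2)
    proof
      show "(\<lambda>k. if i \<le> k then k - 1 else k) ` {..Suc N} \<subseteq> {..N}" using i by auto
      show "{..N} \<subseteq> (\<lambda>k. if i \<le> k then k - 1 else k) ` {..Suc N}"
      proof
        fix j assume j: "j \<in> {..N}"
        show "j \<in> (\<lambda>k. if i \<le> k then k - 1 else k) ` {..Suc N}"
          by (rule image_eqI[of _ _ "if j < i then j else Suc j"]) (use j i in auto)
      qed
    qed
    finally show "mg i r ` Y = {..N}" .
    fix a b assume ab: "a \<in> Y" "b \<in> Y"
    show "mg i r a \<le> mg i r b" if ad: "add R x y a b"
    proof -
      consider "R a b" | "R a y" "R x b" using ad unfolding add_def by blast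
      then show ?thesis
      proof cases
        case 1 then show ?thesis using e(3)[OF ab] mono by blast
      next
        case 2
        then have "r a \<le> i" "i - 1 \<le> r b" using e(3) ab xy by fastforce+
        then show ?thesis using i unfolding mg_def by auto
      qed
    qed
    show "add R x y a b" if "mg i r a = mg i r b"
    proof -
      have "r a = r b \<or> (r a = r x \<and> r b = r y) \<or> (r a = r y \<and> r b = r x)"
        using that i xy unfolding mg_def by (auto split: if_splits)
      then show ?thesis
      proof (elim disjE conjE)
        assume "r a = r b" then show ?thesis using e(4)[OF ab] unfolding add_def by blast
      next
        assume "r a = r x" "r b = r y"
        then have "R a x" "R y b" using e(4) ab xy(1-4) by metis+
        then have "R a y" "R x b" using xy(5) finite_preorder.tr[OF preD(1)[OF R]] by blast+
        then show ?thesis unfolding add_def by blast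
      next
        assume "r a = r y" "r b = r x"
        then show ?thesis using e(4) ab xy unfolding add_def by metis
      qed
    qed
  qed
  have "R w x \<or> R y w" if w: "R x w" "R w y" for w
  proof -
    have wY: "w \<in> Y" using finite_preorder.carrier[OF preD(1)[OF R]] w by blast
    have "r x \<le> r w" "r w \<le> r y" using e(3) w wY xy by blast+
    then have "r w = r x \<or> r w = r y" using xy(3,4) by linarith
    then show ?thesis using e(4) wY xy by metis
  qed
  then show "cover R x y" using c xy(5) unfolding cover_def by blast
qed

lemma Ext_split:
  assumes R: "pre R" and uv: "cover R u v" and r': "r' \<in> Ext (add R u v) N"
  obtains r where "r \<in> Ext R (Suc N)" "r u = r' u" "r v = Suc (r' u)" "mg (Suc (r' u)) r = r'"
proof -
  interpret finite_preorder Y R by (rule preD(1)[OF R])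
  have Ruv: "R u v" "\<not> R v u" "u \<in> Y" "v \<in> Y" using uv carrier unfolding cover_def by blast+
  note e = ExtD[OF r']
  define i where "i = r' u"
  have mid: "r' y = i \<longleftrightarrow> R u y \<and> R y v" if "y \<in> Y" for y
  proof -
    have "r' y = i \<longleftrightarrow> eqv (add R u v) y u" unfolding i_def using Ext_eqv[OF r' that Ruv(3)] by simp
    also have "\<dots> \<longleftrightarrow> R u y \<and> R y v" unfolding eqv_def add_def using Ruv tr rfl by blast
    finally show ?thesis .
  qed
  \<comment> \<open>\<open>p\<close> singles out what moves up by one level: everything above level
    \<open>i\<close> and, inside that level, the class of \<open>v\<close>.\<close>
  define p where "p y \<longleftrightarrow> y \<in> Y \<and> (i < r' y \<or> (r' y = i \<and> R v y))" for y
  define r where "r y = (if p y then Suc (r' y) else r' y)" for y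
  have i: "r' u = i" "r' v = i" using mid[OF Ruv(3)] mid[OF Ruv(4)] Ruv rfl by blast+
  have ru: "r u = i" "r v = Suc i" unfolding r_def p_def using i Ruv rfl by auto
  have iN: "i \<le> N" using e(2) Ruv i by blast
  have np: "r' y \<le> i" if "\<not> p y" "y \<in> Y" for y using that unfolding p_def by auto
  have pp: "i \<le> r' y" "y \<in> Y" if "p y" for y using that unfolding p_def by auto
  have "r \<in> Ext R (Suc N)"
  proof (rule ExtI)
    show "r y = 0" if "y \<notin> Y" for y using e(1)[OF that] that by (simp add: r_def p_def)
    show "r ` Y = {..Suc N}"
    proof
      have "r' y \<le> N" if "y \<in> Y" for y using e(2) that by blast
      then show "r ` Y \<subseteq> {..Suc N}" unfolding r_def by fastforce
      show "{..Suc N} \<subseteq> r ` Y"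
      proof
        fix j assume j: "j \<in> {..Suc N}"
        consider "j < i" | "j = i" | "j = Suc i" | "Suc i < j" by linarith
        then show "j \<in> r ` Y"
        proof cases
          case 1
          then have "pt r' j \<in> Y" "r' (pt r' j) = j" using pt[OF r'] iN by auto
          then have "r (pt r' j) = j" using 1 by (simp add: r_def p_def)
          then show ?thesis using \<open>pt r' j \<in> Y\<close> by force
        next
          case 2 then show ?thesis using ru Ruv by force
        next
          case 3 then show ?thesis using ru Ruv by force
        next
          case 4
          have "pt r' (j - 1) \<in> Y" "r' (pt r' (j - 1)) = j - 1" using pt[OF r', of "j - 1"] j by auto
          moreover have "i < j - 1" using 4 by simp
          ultimately have "r (pt r' (j - 1)) = j" using 4 by (simp add: r_def p_def del: One_nat_def)
          with \<open>pt r' (j - 1) \<in> Y\<close> show ?thesis by force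
        qed
      qed
    qed
    fix x y assume xy: "x \<in> Y" "y \<in> Y"
    show "r x \<le> r y" if Rxy: "R x y"
    proof -
      have le: "r' x \<le> r' y" using e(3)[OF xy] Rxy unfolding add_def by blast
      show ?thesis
      proof (cases "p x \<and> \<not> p y")
        case True
        then have "r' x = i" "r' y = i" using np[of y] pp[of x] xy le by linarith+
        then show ?thesis using True Rxy tr xy unfolding p_def by blast
      qed (use le in \<open>auto simp: r_def\<close>)
    qed
    show "R x y" if eq: "r x = r y"
    proof -
      have pq: "p x \<longleftrightarrow> p y" using eq np[of x] np[of y] pp[of x] pp[of y] xy unfolding r_def by (auto split: if_splits)
      then have r: "r' x = r' y" using eq unfolding r_def by (auto split: if_splits)
      then have E: "eqv (add R u v) x y" using Ext_eqv[OF r' xy] by simp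
      show ?thesis
      proof (cases "r' x = i")
        case False
        then show ?thesis using eqv_add[OF uv E] mid[OF xy(1)] unfolding eqv_def by blast
      next
        case True
        then have m: "R u x" "R x v" "R u y" "R y v" using r mid xy by auto
        show ?thesis
        proof (cases "p x")
          case True
          then have "R v y" using pq \<open>r' x = i\<close> r unfolding p_def by auto
          then show ?thesis using tr m(2) by blast
        next
          case False
          then have "\<not> R v x" "\<not> R v y" using pq r \<open>r' x = i\<close> xy unfolding p_def by auto
          then have "R x u" using merged_eqv[OF uv m(1,2)] unfolding eqv_def by blast
          then show ?thesis using tr m(3) by blast
        qed
      qed
    qed
  qed
  moreover have "mg (Suc i) r = r'"
  proof
    show "mg (Suc i) r y = r' y" for y
      using np[of y] pp[of y] e(1)[of y] by (cases "y \<in> Y") (auto simp: mg_def r_def)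
  qed
  ultimately show ?thesis using that ru i_def by simp
qed

lemma Ext_swap:
  assumes r: "r \<in> Ext R N" and i: "1 \<le> i" "i \<le> N" and n: "\<not> R (pt r (i - 1)) (pt r i)"
    and tr: "\<And>x y z. R x y \<Longrightarrow> R y z \<Longrightarrow> R x z"
  shows "sw i r \<in> Ext R N"
proof -
  note e = ExtD[OF r]
  have P: "pt r i \<in> Y" "pt r (i - 1) \<in> Y" "r (pt r i) = i" "r (pt r (i - 1)) = i - 1" using pt[OF r] i by auto
  have n: "\<not> R x y" if "x \<in> Y" "y \<in> Y" "r x = i - 1" "r y = i" for x y
    using n e(4)[OF P(2), of x] e(4)[of y "pt r i"] that P tr by metis
  show ?thesis
  proof (rule ExtI)
    have "sw i r ` Y = (\<lambda>k. if k = i - 1 then i else if k = i then i - 1 else k) ` (r ` Y)" by (auto simp: sw_def image_image)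
    also have "\<dots> = {..N}" unfolding e(2)
    proof
      show "{..N} \<subseteq> (\<lambda>k. if k = i - 1 then i else if k = i then i - 1 else k) ` {..N}"
      proof
        fix j assume j: "j \<in> {..N}"
        show "j \<in> (\<lambda>k. if k = i - 1 then i else if k = i then i - 1 else k) ` {..N}"
          by (rule image_eqI[of _ _ "if j = i - 1 then i else if j = i then i - 1 else j"]) (use j i in auto)
      qed
    qed (use i in auto)
    finally show "sw i r ` Y = {..N}" .
    fix x y assume xy: "x \<in> Y" "y \<in> Y"
    show "sw i r x \<le> sw i r y" if "R x y"
    proof -
      have "r x \<le> r y" "\<not> (r x = i - 1 \<and> r y = i)" using e(3)[OF xy that] n xy that by blast+
      then show ?thesis using i xy unfolding sw_def by auto
    qed
    show "R x y" if "sw i r x = sw i r y"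
      using that e(4)[OF xy] xy i unfolding sw_def by (auto split: if_splits)
  qed (simp add: sw_def)
qed

lemma sw_sw:
  assumes "r \<in> Ext R N" "1 \<le> i"
  shows "sw i (sw i r) = r" "mg i (sw i r) = mg i r"
  using ExtD(1)[OF assms(1)] assms(2) unfolding sw_def mg_def by (auto intro!: ext)

text \<open>Merging a step lowers the count of the block to which the step belongs, so the weight is
  the same for all steps of a block and the increments of \<phi> telescope to the prescribed
  difference. What results is the recursion defining \<open>M3\<close>.\<close>

lemma wt_telescope:
  assumes R: "pre R" and r: "r \<in> Ext R (Suc N)" and \<phi>: "\<phi> \<in> Con R"
  shows "(\<Sum>i\<in>{0<..Suc N}. (\<phi> (pt r i) - \<phi> (pt r (i - 1))) * wt (mg i r) cs) = wt r (mk \<phi> # cs)"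
proof -
  note m = Ext_marks[OF R r]
  define p where "p i = \<phi> (pt r i)" for i
  define na nb ns where n: "na = r z2 - r z1" "nb = r z3 - r z2" "ns = r z1 - r B + (r T - r z3)"
  have p: "p (r y) = \<phi> y" if "y \<in> Y" for y
  proof -
    have "r y \<le> Suc N" using ExtD(2)[OF r] that by blast
    then have "eqv R (pt r (r y)) y" using Ext_eqv[OF r] pt[OF r] that by simp
    then show ?thesis using \<phi> unfolding p_def Con_def by blast
  qed
  have split: "{0<..Suc N} = {0<..r z1} \<union> ({r z1<..r z2} \<union> ({r z2<..r z3} \<union> {r z3<..Suc N}))" using m by auto
  have w: "wt (mg i r) cs = M3 na nb (ns - 1) cs" if "i \<in> {0<..r z1}" for i
  proof -
    have "mg i r B = 0" "mg i r z1 = r z1 - 1" "mg i r z2 = r z2 - 1" "mg i r z3 = r z3 - 1" "mg i r T = N"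
      using that m by (auto simp: mg_def)
    moreover have "r z1 - 1 + (N - (r z3 - 1)) = ns - 1" "r z2 - 1 - (r z1 - 1) = na" "r z3 - 1 - (r z2 - 1) = nb"
      using that m by (auto simp: n)
    ultimately show ?thesis by (simp add: wt_def)
  qed
  have w1: "wt (mg i r) cs = M3 (na - 1) nb ns cs" if "i \<in> {r z1<..r z2}" for i
  proof -
    have "mg i r B = 0" "mg i r z1 = r z1" "mg i r z2 = r z2 - 1" "mg i r z3 = r z3 - 1" "mg i r T = N"
      using that m by (auto simp: mg_def)
    moreover have "r z1 + (N - (r z3 - 1)) = ns" "r z2 - 1 - r z1 = na - 1" "r z3 - 1 - (r z2 - 1) = nb"
      using that m by (auto simp: n)
    ultimately show ?thesis by (simp add: wt_def)
  qed
  have w2: "wt (mg i r) cs = M3 na (nb - 1) ns cs" if "i \<in> {r z2<..r z3}" for i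
  proof -
    have "mg i r B = 0" "mg i r z1 = r z1" "mg i r z2 = r z2" "mg i r z3 = r z3 - 1" "mg i r T = N"
      using that m by (auto simp: mg_def)
    moreover have "r z1 + (N - (r z3 - 1)) = ns" "r z3 - 1 - r z2 = nb - 1"
      using that m by (auto simp: n)
    ultimately show ?thesis by (simp add: wt_def n)
  qed
  have w3: "wt (mg i r) cs = M3 na nb (ns - 1) cs" if "i \<in> {r z3<..Suc N}" for i
  proof -
    have "mg i r B = 0" "mg i r z1 = r z1" "mg i r z2 = r z2" "mg i r z3 = r z3" "mg i r T = N"
      using that m by (auto simp: mg_def)
    moreover have "r z1 + (N - r z3) = ns - 1" using that m by (auto simp: n)
    ultimately show ?thesis by (simp add: wt_def n)
  qed
  have S: "(\<Sum>i\<in>{a<..b}. (p i - p (i - 1)) * wt (mg i r) cs) = (p b - p a) * C"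
    if "a \<le> b" "\<And>i. i \<in> {a<..b} \<Longrightarrow> wt (mg i r) cs = C" for a b C
    using sum_telescope_interval[OF that(1), of p] that(2) by (simp add: sum_distrib_right[symmetric])
  have "(\<Sum>i\<in>{0<..Suc N}. (p i - p (i - 1)) * wt (mg i r) cs) =
      (p (r z1) - p 0) * M3 na nb (ns - 1) cs + ((p (r z2) - p (r z1)) * M3 (na - 1) nb ns cs
      + ((p (r z3) - p (r z2)) * M3 na (nb - 1) ns cs + (p (Suc N) - p (r z3)) * M3 na nb (ns - 1) cs))"
    unfolding split
    using S[of 0 "r z1", OF _ w] S[of "r z1" "r z2", OF _ w1] S[of "r z2" "r z3", OF _ w2] S[of "r z3" "Suc N", OF _ w3] m
    by (subst sum.union_disjoint, simp, simp, force)+ simp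
  also have "\<dots> = wt r (mk \<phi> # cs)"
  proof -
    have "wt r (mk \<phi> # cs) = M3 na nb ns (mk \<phi> # cs)" by (simp only: wt_def n)
    moreover have "p 0 = \<phi> B" "p (Suc N) = \<phi> T" using p[OF marks(1)] p[OF marks(2)] m(1,2) by auto
    ultimately show ?thesis
      using p[OF marks(3)] p[OF marks(4)] p[OF marks(5)] by (simp add: mk_def) (simp add: algebra_simps)
  qed
  finally show ?thesis unfolding p_def .
qed

text \<open>A collapsed difference leaves a block without steps. So all merges may be summed, not
  only those that produce facets.\<close>

lemma wt_invalid:
  assumes "r \<in> Ext F N" "\<not> valid F"
  shows "wt r cs = 0"
proof -
  note e = ExtD(3)[OF assms(1)]
  have "r z2 \<le> r z1 \<or> r z3 \<le> r z2 \<or> (r z1 \<le> r B \<and> r T \<le> r z3)"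
    using assms(2) e marks unfolding valid_def by blast
  then show ?thesis unfolding wt_def by (intro M3_zero) auto
qed

lemma mg_inj:
  assumes r: "r \<in> Ext R N" and q: "q \<in> Ext R N" and i: "1 \<le> i" "i \<le> N"
    and eq: "mg i r = mg i q" and p: "eqv R (pt r i) (pt q i)"
  shows "r = q"
proof
  fix y
  show "r y = q y"
  proof (cases "y \<in> Y")
    case True
    have P: "pt r i \<in> Y" "r (pt r i) = i" "pt q i \<in> Y" "q (pt q i) = i" using pt[OF r] pt[OF q] i by auto
    have "r (pt q i) = i" using Ext_eqv[OF r P(1) P(3)] p P by simp
    then have "r y = i \<longleftrightarrow> eqv R y (pt q i)" using Ext_eqv[OF r True P(3)] by simp
    also have "\<dots> \<longleftrightarrow> q y = i" using Ext_eqv[OF q True P(3)] P by simp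
    finally have "r y = i \<longleftrightarrow> q y = i" .
    moreover have "mg i r y = mg i q y" using eq by simp
    ultimately show ?thesis unfolding mg_def by (auto split: if_splits)
  next
    case False
    then show ?thesis using ExtD(1)[OF r] ExtD(1)[OF q] by simp
  qed
qed

text \<open>By \<open>wt_telescope\<close> the left-hand side is a sum over linear extensions and
  their steps. If the classes at a step are incomparable, exchanging them negates the increment and
  keeps the merged extension, so these terms cancel in pairs. The remaining steps are covers, and
  merging them runs exactly once through the linear extensions of all facets.\<close>

theorem vol_facets:
  assumes face: "face (Suc d) R" and \<phi>: "\<phi> \<in> Con R" and cs: "length cs = d"
  shows "vol R (mk \<phi> # cs) = (\<Sum>F\<in>fac R. dl R \<phi> F * vol F cs)"
proof -
  have R: "pre R" using face unfolding face_def by blast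
  interpret finite_preorder Y R by (rule preD(1)[OF R])
  define N where "N = d + 3"
  define D where "D = Ext R (Suc N) \<times> {0<..Suc N}"
  define step where "step x = R (pt (fst x) (snd x - 1)) (pt (fst x) (snd x))" for x
  define g where "g x = (\<phi> (pt (fst x) (snd x)) - \<phi> (pt (fst x) (snd x - 1))) * wt (mg (snd x) (fst x)) cs" for x
  define fc where "fc x = add R (pt (fst x) (snd x - 1)) (pt (fst x) (snd x))" for x
  have D: "fst x \<in> Ext R (Suc N)" "1 \<le> snd x" "snd x \<le> Suc N" "snd x - 1 \<le> Suc N" if "x \<in> D" for x
    using that unfolding D_def by auto
  have finD: "finite D" unfolding D_def using finite_Ext by simp
  have P: "pt (fst x) (snd x) \<in> Y" "pt (fst x) (snd x - 1) \<in> Y" "fst x (pt (fst x) (snd x)) = snd x"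
      "fst x (pt (fst x) (snd x - 1)) = snd x - 1" if "x \<in> D" for x
    using pt[OF D(1)[OF that] D(3)[OF that]] pt[OF D(1)[OF that] D(4)[OF that]] by blast+
  have "vol R (mk \<phi> # cs) = (\<Sum>r\<in>Ext R (Suc N). \<Sum>i\<in>{0<..Suc N}. g (r, i))"
  proof -
    have "length (mk \<phi> # cs) + 3 = Suc N" using cs by (simp add: N_def)
    then show ?thesis unfolding vol_def g_def fst_conv snd_conv
      by (simp only: wt_telescope[OF R _ \<phi>] cong: sum.cong)
  qed
  also have "\<dots> = sum g D" unfolding D_def by (simp add: sum.cartesian_product)
  also have "\<dots> = sum g {x \<in> D. step x} + sum g {x \<in> D. \<not> step x}"
    by (subst sum.union_disjoint[symmetric]) (use finD in \<open>auto intro!: sum.cong\<close>)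
  also have "sum g {x \<in> D. \<not> step x} = 0"
  proof -
    define h where "h x = (sw (snd x) (fst x), snd x)" for x :: "('y \<Rightarrow> nat) \<times> nat"
    have h: "h x \<in> {x \<in> D. \<not> step x}" "h (h x) = x" "g (h x) = - g x" if x: "x \<in> {x \<in> D. \<not> step x}" for x
    proof -
      obtain r i where xr: "x = (r, i)" by (cases x)
      have xD: "x \<in> D" and ns: "\<not> R (pt r (i - 1)) (pt r i)" using x xr unfolding step_def by auto
      have r: "r \<in> Ext R (Suc N)" and i: "1 \<le> i" "i \<le> Suc N" using D[OF xD] xr by auto
      have q: "sw i r \<in> Ext R (Suc N)" by (rule Ext_swap[OF r i ns tr])
      have hD: "h x \<in> D" using q i unfolding h_def xr D_def by simp
      have Pr: "pt r i \<in> Y" "pt r (i - 1) \<in> Y" "r (pt r i) = i" "r (pt r (i - 1)) = i - 1" using P[OF xD] xr by auto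
      have Pq: "pt (sw i r) i \<in> Y" "pt (sw i r) (i - 1) \<in> Y" "sw i r (pt (sw i r) i) = i" "sw i r (pt (sw i r) (i - 1)) = i - 1"
        using P[OF hD] unfolding h_def xr by auto
      have rq: "r (pt (sw i r) i) = i - 1" "r (pt (sw i r) (i - 1)) = i"
        using Pq i unfolding sw_def by (auto split: if_splits)
      have "eqv R (pt (sw i r) i) (pt r (i - 1))" "eqv R (pt (sw i r) (i - 1)) (pt r i)"
        using Ext_eqv[OF r] Pr Pq rq by auto
      then have ph: "\<phi> (pt (sw i r) i) = \<phi> (pt r (i - 1))" "\<phi> (pt (sw i r) (i - 1)) = \<phi> (pt r i)"
        using \<phi> unfolding Con_def by blast+
      have "\<not> step (h x)"
      proof
        assume "step (h x)"
        then have "R (pt (sw i r) (i - 1)) (pt (sw i r) i)" unfolding step_def h_def xr by simp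
        then have "r (pt (sw i r) (i - 1)) \<le> r (pt (sw i r) i)" using ExtD(3)[OF r] Pq by blast
        then show False using rq i by simp
      qed
      then show "h x \<in> {x \<in> D. \<not> step x}" using hD by blast
      show "h (h x) = x" unfolding h_def xr using sw_sw[OF r i(1)] by simp
      show "g (h x) = - g x" unfolding g_def h_def xr using ph sw_sw[OF r i(1)] by (simp add: algebra_simps)
    qed
    have "sum g {x \<in> D. \<not> step x} = (\<Sum>x\<in>{x \<in> D. \<not> step x}. g (h x))"
      by (rule sum.reindex_bij_witness[of _ h h]) (use h in auto)
    also have "\<dots> = - sum g {x \<in> D. \<not> step x}" using h(3) by (simp add: sum_negf)
    finally show ?thesis by simp
  qed
  also have "sum g {x \<in> D. step x} = sum g {x \<in> D. step x \<and> valid (fc x)}"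
  proof (rule sum.mono_neutral_right)
    show "\<forall>x\<in>{x \<in> D. step x} - {x \<in> D. step x \<and> valid (fc x)}. g x = 0"
    proof
      fix x assume x: "x \<in> {x \<in> D. step x} - {x \<in> D. step x \<and> valid (fc x)}"
      then have xD: "x \<in> D" by blast
      have "mg (snd x) (fst x) \<in> Ext (fc x) N" unfolding fc_def
        by (rule Ext_merge(2)[OF R D(1-3)[OF xD] P(2,1,4,3)[OF xD]]) (use x in \<open>simp add: step_def\<close>)
      then show "g x = 0" using wt_invalid x unfolding g_def by simp
    qed
  qed (use finD in auto)
  also have "\<dots> = (\<Sum>y\<in>Sigma (fac R) (\<lambda>F. Ext F N). dl R \<phi> (fst y) * wt (snd y) cs)"
  proof -
    define h where "h x = (fc x, mg (snd x) (fst x))" for x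
    define S where "S = {x \<in> D. step x \<and> valid (fc x)}"
    have S: "cover R (pt (fst x) (snd x - 1)) (pt (fst x) (snd x))" "h x \<in> Sigma (fac R) (\<lambda>F. Ext F N)"
      if x: "x \<in> S" for x
    proof -
      have xD: "x \<in> D" and st: "R (pt (fst x) (snd x - 1)) (pt (fst x) (snd x))" and v: "valid (fc x)"
        using x unfolding S_def step_def by auto
      note m = Ext_merge[OF R D(1-3)[OF xD] P(2,1,4,3)[OF xD] st]
      show "cover R (pt (fst x) (snd x - 1)) (pt (fst x) (snd x))" by (rule m(1))
      show "h x \<in> Sigma (fac R) (\<lambda>F. Ext F N)" using facI[OF m(1)] m(2) v unfolding h_def fc_def by blast
    qed
    have inj: "inj_on h S"
    proof (rule inj_onI)
      fix x y assume x: "x \<in> S" and y: "y \<in> S" and eq: "h x = h y"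
      obtain r i where xr: "x = (r, i)" by (cases x)
      obtain q j where yq: "y = (q, j)" by (cases y)
      have xD: "x \<in> D" and yD: "y \<in> D" using x y unfolding S_def by auto
      have e: "add R (pt r (i - 1)) (pt r i) = add R (pt q (j - 1)) (pt q j)" "mg i r = mg j q"
        using eq unfolding h_def fc_def xr yq by auto
      have c: "cover R (pt r (i - 1)) (pt r i)" "cover R (pt q (j - 1)) (pt q j)" using S(1)[OF x] S(1)[OF y] xr yq by auto
      have ev: "eqv R (pt q (j - 1)) (pt r (i - 1))" "eqv R (pt q j) (pt r i)" using add_eqD[OF c e(1)] by auto
      have r: "r \<in> Ext R (Suc N)" "1 \<le> i" "i \<le> Suc N" and q: "q \<in> Ext R (Suc N)" "1 \<le> j" "j \<le> Suc N" using D[OF xD] D[OF yD] xr yq by auto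
      have Pr: "pt r (i - 1) \<in> Y" "r (pt r (i - 1)) = i - 1" and Pq: "pt q (j - 1) \<in> Y" "q (pt q (j - 1)) = j - 1"
        using P[OF xD] P[OF yD] xr yq by auto
      \<comment> \<open>The merged level is read off at the lower end of the covering pair; this
        recovers the step.\<close>
      have "r (pt q (j - 1)) = i - 1" using Ext_eqv[OF r(1) Pq(1) Pr(1)] ev Pr by simp
      then have "mg i r (pt q (j - 1)) = i - 1" using r by (simp add: mg_def)
      moreover have "mg j q (pt q (j - 1)) = j - 1" using Pq q by (simp add: mg_def)
      ultimately have "i = j" using e(2) r q by simp
      then show "x = y" using mg_inj[OF r(1) q(1) r(2,3)] e(2) ev(2) eqv_sym xr yq by blast
    qed
    have img: "h ` S = Sigma (fac R) (\<lambda>F. Ext F N)"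
    proof
      show "h ` S \<subseteq> Sigma (fac R) (\<lambda>F. Ext F N)" using S(2) by blast
      show "Sigma (fac R) (\<lambda>F. Ext F N) \<subseteq> h ` S"
      proof
        fix y assume y: "y \<in> Sigma (fac R) (\<lambda>F. Ext F N)"
        obtain F r' where yF: "y = (F, r')" "F \<in> fac R" "r' \<in> Ext F N" using y by blast
        obtain u v where uv: "cover R u v" "F = add R u v" "valid F" using facE[OF yF(2)] .
        have uvY: "u \<in> Y" "v \<in> Y" "R u v" using uv carrier unfolding cover_def by blast+
        obtain r where r: "r \<in> Ext R (Suc N)" "r u = r' u" "r v = Suc (r' u)" "mg (Suc (r' u)) r = r'"
          using Ext_split[OF R uv(1), of r' N] yF uv(2) by metis
        define i where "i = Suc (r' u)"
        have "r' u \<in> {..N}" using ExtD(2)[OF yF(3)] uvY by blast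
        then have i: "i \<le> Suc N" "1 \<le> i" by (auto simp: i_def)
        then have xD: "(r, i) \<in> D" using r unfolding D_def by simp
        have ev: "eqv R u (pt r (i - 1))" "eqv R v (pt r i)"
          using Ext_eqv[OF r(1)] P[OF xD] uvY r by (auto simp: i_def)
        then have "R (pt r (i - 1)) v" "R v (pt r i)" using tr[OF _ uvY(3)] unfolding eqv_def by blast+
        then have "R (pt r (i - 1)) (pt r i)" by (rule tr)
        moreover have "F = add R (pt r (i - 1)) (pt r i)" using add_cong[OF ev] uv by simp
        ultimately have "(r, i) \<in> S" "h (r, i) = y"
          using xD uv(3) yF(1) r(4) unfolding S_def step_def h_def fc_def i_def by simp_all
        then show "y \<in> h ` S" by (metis imageI)
      qed
    qed
    have "sum g S = (\<Sum>x\<in>S. dl R \<phi> (fst (h x)) * wt (snd (h x)) cs)"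
    proof (rule sum.cong[OF refl])
      fix x assume "x \<in> S"
      then have "dl R \<phi> (fc x) = \<phi> (pt (fst x) (snd x)) - \<phi> (pt (fst x) (snd x - 1))"
        unfolding fc_def by (rule dl_add[OF R S(1) \<phi>])
      then show "g x = dl R \<phi> (fst (h x)) * wt (snd (h x)) cs" by (simp add: g_def h_def)
    qed
    also have "\<dots> = (\<Sum>y\<in>h ` S. dl R \<phi> (fst y) * wt (snd y) cs)" by (simp add: sum.reindex[OF inj])
    finally show ?thesis unfolding img unfolding S_def .
  qed
  also have "\<dots> = (\<Sum>F\<in>fac R. dl R \<phi> F * vol F cs)"
    using finite_fac[OF R] finite_Ext cs unfolding vol_def N_def
    by (simp add: sum.Sigma sum_distrib_left case_prod_beta)
  finally show ?thesis by simp
qed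

lemma face_fac:
  assumes "face (Suc d) R" "F \<in> fac R"
  shows "face d F"
proof -
  have R: "pre R" and ne: "Ext R (Suc (d + 3)) \<noteq> {}" using assms(1) unfolding face_def by auto
  have F: "pre F" by (rule pre_fac[OF R assms(2)])
  obtain u v where uv: "cover R u v" "F = add R u v" using facE[OF assms(2)] .
  obtain N r' where r': "r' \<in> Ext F N" using Ext_exists[OF preD(1)[OF F]] by blast
  then obtain r where "r \<in> Ext R (Suc N)" using Ext_split[OF R uv(1)] uv(2) by metis
  then have "N = d + 3" using Ext_length_unique ne by (metis ex_in_conv nat.inject)
  then show ?thesis using F r' unfolding face_def by blast
qed

end

section \<open>Positivity, interior points, and faces of dimension at most 2\<close>

lemma M3_pos:
  assumes "na \<ge> 1" "nb \<ge> 1" "ns \<ge> 1" "na + nb + ns = length cs + 3" "\<And>c. c \<in> set cs \<Longrightarrow> pos3 c"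
  shows "M3 na nb ns cs > 0"
  using assms
proof (induction cs arbitrary: na nb ns)
  case Nil
  then have "na = 1" "nb = 1" "ns = 1" by auto
  then show ?case by simp
next
  case (Cons c cs)
  have c: "fst c > 0" "fst (snd c) > 0" "snd (snd c) > 0" and cs: "\<And>c. c \<in> set cs \<Longrightarrow> pos3 c"
    using Cons.prems(5) by (auto simp: pos3_def)
  have s: "M3 na nb (ns - 1) cs > 0 \<or> (ns = 1 \<and> M3 na nb (ns - 1) cs = 0)"
    using Cons.IH[of na nb "ns - 1"] Cons.prems cs by (cases "ns = 1") (auto simp: M3_zero)
  have a: "M3 (na - 1) nb ns cs > 0 \<or> (na = 1 \<and> M3 (na - 1) nb ns cs = 0)"
    using Cons.IH[of "na - 1" nb ns] Cons.prems cs by (cases "na = 1") (auto simp: M3_zero)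
  have b: "M3 na (nb - 1) ns cs > 0 \<or> (nb = 1 \<and> M3 na (nb - 1) ns cs = 0)"
    using Cons.IH[of na "nb - 1" ns] Cons.prems cs by (cases "nb = 1") (auto simp: M3_zero)
  have "\<not> (na = 1 \<and> nb = 1 \<and> ns = 1)" using Cons.prems(4) by auto
  moreover have "fst c * M3 na nb (ns - 1) cs \<ge> 0" "fst (snd c) * M3 (na - 1) nb ns cs \<ge> 0"
      "snd (snd c) * M3 na (nb - 1) ns cs \<ge> 0"
    using s a b c by (auto intro!: mult_nonneg_nonneg)
  moreover have "fst c * M3 na nb (ns - 1) cs > 0 \<or> ns = 1" "fst (snd c) * M3 (na - 1) nb ns cs > 0 \<or> na = 1"
      "snd (snd c) * M3 na (nb - 1) ns cs > 0 \<or> nb = 1"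
    using s a b c by auto
  ultimately show ?case unfolding M3.simps by linarith
qed

context marked_ground
begin

lemma vol_pos:
  assumes "face d R" "length cs = d" "\<And>c. c \<in> set cs \<Longrightarrow> pos3 c"
  shows "vol R cs > 0"
  unfolding vol_def
proof (rule sum_pos)
  show "finite (Ext R (length cs + 3))" by (rule finite_Ext)
  show "Ext R (length cs + 3) \<noteq> {}" using assms unfolding face_def by simp
  fix r assume r: "r \<in> Ext R (length cs + 3)"
  have R: "pre R" using assms unfolding face_def by simp
  show "wt r cs > 0" unfolding wt_def using Ext_marks[OF R r] assms by (intro M3_pos) auto
qed

lemma vol_point:
  assumes "face 0 R"
  shows "vol R [] = 1"
proof -
  have R: "pre R" and ne: "Ext R 3 \<noteq> {}" using assms unfolding face_def by auto
  \<comment> \<open>The four levels are all taken by marks; the only freedom is which outer segment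
    has collapsed, and that is determined by \<open>R\<close>.\<close>
  have cas: "(r z1 = 0 \<and> r z2 = 1 \<and> r z3 = 2) \<or> (r z1 = 1 \<and> r z2 = 2 \<and> r z3 = 3)" if "r \<in> Ext R 3" for r
    using Ext_marks[OF R that] by linarith
  have m: "\<exists>m\<in>{B, z1, z2, z3, T}. r y = r m" if r: "r \<in> Ext R 3" and y: "y \<in> Y" for r y
  proof -
    have "r y \<le> 3" using ExtD(2)[OF r] y by blast
    then have "r y = 0 \<or> r y = 1 \<or> r y = 2 \<or> r y = 3" by linarith
    then show ?thesis using cas[OF r] Ext_marks(1,2)[OF R r] by auto
  qed
  obtain r where r: "r \<in> Ext R 3" using ne by blast
  have "q = r" if q: "q \<in> Ext R 3" for q
  proof
    fix y
    show "q y = r y"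
    proof (cases "y \<in> Y")
      case True
      obtain n where n: "n \<in> {B, z1, z2, z3, T}" "r y = r n" using m[OF r True] by blast
      then have "n \<in> Y" using marks by blast
      then have "q y = q n" using Ext_eqv[OF r True] Ext_eqv[OF q True] n by blast
      moreover have "r z1 = r B \<longleftrightarrow> q z1 = q B" using Ext_eqv[OF r] Ext_eqv[OF q] marks by blast
      ultimately show ?thesis using n cas[OF r] cas[OF q] Ext_marks(1,2)[OF R r] Ext_marks(1,2)[OF R q] by auto
    qed (use ExtD(1)[OF r] ExtD(1)[OF q] in simp)
  qed
  then have "Ext R 3 = {r}" using r by blast
  moreover have "wt r [] = 1" using cas[OF r] Ext_marks(1,2)[OF R r] by (auto simp: wt_def)
  ultimately show ?thesis by (simp add: vol_def)
qed

text \<open>Any linear extension yields a strictly increasing map once each prescribed difference is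
  spread evenly over the steps of its block.\<close>

lemma strict_ex:
  assumes "face d R" "pos3 c"
  shows "\<exists>\<phi>\<in>Con R. mk \<phi> = c \<and> (\<forall>F\<in>fac R. dl R \<phi> F > 0)"
proof -
  have R: "pre R" using assms unfolding face_def by auto
  interpret finite_preorder Y R by (rule preD(1)[OF R])
  obtain N r where r: "r \<in> Ext R N" using assms unfolding face_def by auto
  note m = Ext_marks[OF R r]
  obtain c0 c1 c2 where c: "c = (c0, c1, c2)" by (cases c)
  have cp: "c0 > 0" "c1 > 0" "c2 > 0" using assms(2) unfolding c pos3_def by auto
  define na nb ns where n: "na = r z2 - r z1" "nb = r z3 - r z2" "ns = r z1 + (N - r z3)"
  have np: "na > 0" "nb > 0" "ns > 0" using m unfolding n by auto
  \<comment> \<open>The height of step \<open>i\<close>. The steps below \<open>z1\<close> and those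
    above \<open>z3\<close> share the outer difference \<open>c0\<close>.\<close>
  define w where "w i = (if i \<le> r z1 \<or> r z3 < i then c0 / ns else if i \<le> r z2 then c1 / na else c2 / nb)" for i
  have wp: "w i > 0" for i using cp np by (auto simp: w_def)
  define g where "g k = sum w {0<..k}" for k
  have gd: "g b - g a = sum w {a<..b}" if "a \<le> b" for a b
  proof -
    have "{0<..b} = {0<..a} \<union> {a<..b}" using that by auto
    then have "g b = g a + sum w {a<..b}" unfolding g_def by (simp add: sum.union_disjoint)
    then show ?thesis by simp
  qed
  have gm: "g a < g b" if "a < b" for a b
  proof -
    have "sum w {a<..b} > 0" by (rule sum_pos) (use wp that in auto)
    then show ?thesis using gd[of a b] that by simp
  qed
  define \<phi> where "\<phi> y = g (r y)" for y
  have co: "\<phi> \<in> Con R"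
  proof -
    have "r x = r y" if "eqv R x y" for x y
      using Ext_eqv[OF r] that carrier unfolding eqv_def by blast
    then show ?thesis unfolding Con_def \<phi>_def by simp
  qed
  have "g (r z2) - g (r z1) = c1"
  proof -
    have "sum w {r z1<..r z2} = (\<Sum>i\<in>{r z1<..r z2}. c1 / na)" by (rule sum.cong) (use m in \<open>auto simp: w_def\<close>)
    then show ?thesis using gd[of "r z1" "r z2"] m np by (simp add: n)
  qed
  moreover have "g (r z3) - g (r z2) = c2"
  proof -
    have "sum w {r z2<..r z3} = (\<Sum>i\<in>{r z2<..r z3}. c2 / nb)" by (rule sum.cong) (use m in \<open>auto simp: w_def\<close>)
    then show ?thesis using gd[of "r z2" "r z3"] m np by (simp add: n)
  qed
  moreover have "g N - g (r z3) + (g (r z1) - g 0) = c0"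
  proof -
    have "sum w {r z3<..N} = (\<Sum>i\<in>{r z3<..N}. c0 / ns)" "sum w {0<..r z1} = (\<Sum>i\<in>{0<..r z1}. c0 / ns)"
      by (rule sum.cong; use m in \<open>auto simp: w_def\<close>)+
    then have "g N - g (r z3) + (g (r z1) - g 0) = (real (N - r z3) + real (r z1)) * (c0 / ns)"
      using gd[of "r z3" N] gd[of 0 "r z1"] m by (simp add: algebra_simps)
    also have "real (N - r z3) + real (r z1) = ns" by (simp add: n)
    finally show ?thesis using np by simp
  qed
  ultimately have mk: "mk \<phi> = c" using m unfolding mk_def \<phi>_def c by simp
  have "dl R \<phi> F > 0" if F: "F \<in> fac R" for F
  proof -
    obtain u v where uv: "cover R u v" "F = add R u v" using facE[OF F] .
    have Ruv: "R u v" "\<not> R v u" "u \<in> Y" "v \<in> Y" using uv carrier unfolding cover_def by blast+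
    have "r u \<le> r v" "r u \<noteq> r v" using ExtD(3)[OF r Ruv(3,4,1)] ExtD(4)[OF r Ruv(4,3)] Ruv(2) by auto
    then have "\<phi> u < \<phi> v" unfolding \<phi>_def using gm by simp
    then show ?thesis using dl_add[OF R uv(1) co] uv(2) by simp
  qed
  then show ?thesis using co mk by blast
qed

text \<open>A face of dimension 1 or 2 has at most as many independent deformations as there are
  blocks \<open>\<beta>\<close>, besides the one carrying the index 0.\<close>

definition block_function :: "nat \<Rightarrow> ('y \<Rightarrow> 'y \<Rightarrow> bool) \<Rightarrow> ('y \<Rightarrow> nat) \<Rightarrow> bool" where
  "block_function d R \<beta> \<longleftrightarrow> (\<forall>y\<in>Y. \<beta> y \<le> d) \<and> (\<forall>x\<in>Y. \<forall>y\<in>Y. \<beta> x = \<beta> y \<longrightarrow> R x y \<or> R y x)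
    \<and> (\<forall>x y. eqv R x y \<longrightarrow> \<beta> x = \<beta> y) \<and> \<beta> T = \<beta> B \<and> \<beta> z1 = \<beta> z2 \<and> \<beta> z3 = \<beta> z2
    \<and> (\<forall>u v. cover R u v \<longrightarrow> valid (add R u v) \<longrightarrow> \<beta> u \<noteq> \<beta> v)
    \<and> (\<forall>u v u' v'. cover R u v \<longrightarrow> cover R u' v' \<longrightarrow> \<beta> u = \<beta> u' \<longrightarrow> \<beta> v = \<beta> v' \<longrightarrow> \<beta> u \<noteq> \<beta> v \<longrightarrow> lt R u u' \<longrightarrow> lt R v v' \<longrightarrow> False)
    \<and> (d = 2 \<longrightarrow> (\<exists>a b. a \<noteq> b \<and> a \<le> 2 \<and> b \<le> 2 \<and> (\<forall>u v. cover R u v \<longrightarrow> \<not> (\<beta> u = a \<and> \<beta> v = b))))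
    \<and> (\<forall>\<zeta>\<in>Con R. mk \<zeta> = (0, 0, 0) \<longrightarrow> (\<forall>x\<in>Y. \<forall>y\<in>Y. \<beta> x = \<beta> y \<longrightarrow> \<zeta> x = \<zeta> y))"

lemma marker_iff:
  assumes "r \<in> Ext R N" "y \<in> Y"
  shows "marker R y \<longleftrightarrow> r y \<in> {r B, r z1, r z2, r z3, r T}"
  using Ext_eqv[OF assms] marks unfolding marker_def by auto

text \<open>With an outer segment collapsed, vectors of mark 0 are constant on all marks: these form
  block 0. They occupy at least four of the \<open>d + 4\<close> levels, and each of the at most
  \<open>d\<close> other levels is a block.\<close>

lemma block_function_linked:
  assumes face: "face d R" and d: "d = 1 \<or> d = 2" and l: "eqv R z1 B \<or> eqv R z3 T"
  shows "\<exists>\<beta>. block_function d R \<beta>"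
proof -
  have R: "pre R" using face unfolding face_def by auto
  interpret finite_preorder Y R by (rule preD(1)[OF R])
  define N where "N = d + 3"
  obtain r where r: "r \<in> Ext R N" using face unfolding face_def N_def by auto
  note m = Ext_marks[OF R r]
  have cY: "x \<in> Y" "y \<in> Y" if "cover R x y" for x y using that carrier unfolding cover_def by blast+
  have rl: "r z1 = 0 \<or> r z3 = N" using l Ext_eqv[OF r] marks m by auto
  define f where "f = {..N} - {0, r z1, r z2, r z3, N}"
  have cf: "card f \<le> d"
  proof -
    obtain s where s: "s = {0, r z1, r z2, r z3, N}" "card s \<ge> 4" "s \<subseteq> {..N}"
    proof (cases "r z1 = 0")
      case True
      then have "card {0, r z2, r z3, N} = 4 " using m by auto
      then show ?thesis using that[of "{0, r z1, r z2, r z3, N}"] True m by (simp add: insert_commute)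
    next
      case False
      then have "card {0, r z1, r z2, N} = 4 " using m rl by auto
      then show ?thesis using that[of "{0, r z1, r z2, r z3, N}"] False rl m by (simp add: insert_commute)
    qed
    then have "card f = Suc N - card s" unfolding f_def by (subst card_Diff_subset) auto
    then show ?thesis using s N_def by simp
  qed
  have mf: "marker R y \<longleftrightarrow> r y \<notin> f" if "y \<in> Y" for y
  proof -
    have "r y \<le> N" using ExtD(2)[OF r] that by blast
    then show ?thesis using marker_iff[OF r that] m unfolding f_def by auto
  qed
  define p where "p = (SOME p. p \<in> f)"
  have p: "p \<in> f" if "f \<noteq> {}" using that unfolding p_def by (simp add: some_in_eq)
  have ff: "finite f" unfolding f_def by simp
  have f1: "i = p" if "i \<in> f" "d = 1" for i
  proof (rule ccontr)
    assume "i \<noteq> p"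
    then have "card {i, p} = 2" by simp
    moreover have "p \<in> f" using that(1) p by blast
    ultimately have "2 \<le> card f" using card_mono[OF ff, of "{i, p}"] that(1) by simp
    then show False using cf that(2) by simp
  qed
  have f2: "i = j" if "i \<in> f" "j \<in> f" "i \<noteq> p" "j \<noteq> p" for i j
  proof (rule ccontr)
    assume "i \<noteq> j"
    then have "card {i, j, p} = 3" using that by simp
    moreover have "p \<in> f" using that(1) p by blast
    ultimately have "3 \<le> card f" using card_mono[OF ff, of "{i, j, p}"] that(1,2) by simp
    then show False using cf d by linarith
  qed
  define \<beta> where "\<beta> y = (if marker R y then 0 else if r y = p then 1 else (2::nat))" for y
  have single: "r x = r y" if "x \<in> Y" "y \<in> Y" "\<beta> x = \<beta> y" "\<beta> x \<noteq> 0" for x y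
    using that f2[of "r x" "r y"] mf unfolding \<beta>_def by (auto split: if_splits)
  have b0: "\<beta> y = 0 \<longleftrightarrow> marker R y" for y by (simp add: \<beta>_def)
  have mm: "marker R B" "marker R T" "marker R z1" "marker R z2" "marker R z3"
    unfolding marker_def using eqv_refl marks by blast+
  have ev: "\<beta> x = \<beta> y" if "eqv R x y" for x y
  proof -
    have "x \<in> Y" "y \<in> Y" using that carrier unfolding eqv_def by blast+
    moreover have "r x = r y" using Ext_eqv[OF r] that calculation by blast
    ultimately show ?thesis using mf unfolding \<beta>_def by simp
  qed
  have ch: "R x y \<or> R y x" if "x \<in> Y" "y \<in> Y" "\<beta> x = \<beta> y" for x y
  proof (cases "\<beta> x = 0")
    case True
    then show ?thesis using marker_comparable[OF R] b0 that by metis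
  next
    case False
    then show ?thesis using single[OF that] ExtD(4)[OF r] that by blast
  qed
  have ne: "\<beta> u \<noteq> \<beta> v" if uv: "cover R u v" "valid (add R u v)" for u v
  proof
    assume e: "\<beta> u = \<beta> v"
    have Ruv: "R u v" "\<not> R v u" "u \<in> Y" "v \<in> Y" using uv carrier unfolding cover_def by blast+
    show False
    proof (cases "\<beta> u = 0")
      case True
      then have "marker R u" "marker R v" using e b0[of u] b0[of v] by simp_all
      then consider "eqv R u B" "eqv R v z1" | "eqv R u z1" "eqv R v z2" | "eqv R u z2" "eqv R v z3" | "eqv R u z3" "eqv R v T"
        using marker_cover[OF R uv(1)] by blast
      then show False
      proof cases
        case 1
        then have "R T z3" using l Ruv(2) tr unfolding eqv_def by blast
        then show False using 1 uv(2) unfolding valid_def add_def eqv_def by blast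
      next
        case 2 then show False using uv(2) unfolding valid_def add_def eqv_def by blast
      next
        case 3 then show False using uv(2) unfolding valid_def add_def eqv_def by blast
      next
        case 4
        then have "R z1 B" using l Ruv(2) tr unfolding eqv_def by blast
        then show False using 4 uv(2) unfolding valid_def add_def eqv_def by blast
      qed
    next
      case False
      then show False using single[OF Ruv(3,4) e] ExtD(4)[OF r Ruv(4,3)] Ruv(2) by simp
    qed
  qed
  have st: False if "cover R u v" "cover R u' v'" "\<beta> u = \<beta> u'" "\<beta> v = \<beta> v'" "\<beta> u \<noteq> \<beta> v" "lt R u u'" "lt R v v'" for u v u' v'
  proof -
    note Y = cY[OF that(1)] cY[OF that(2)]
    have "r u = r u' \<or> r v = r v'" using single Y that(3,4,5) by metis
    then show False using Ext_eqv[OF r] Y that(6,7) unfolding lt_def eqv_def by blast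
  qed
  \<comment> \<open>The blocks 1 and 2 are single classes, so covers in both directions between them
    would form a cycle.\<close>
  have six: "\<exists>a b. a \<noteq> b \<and> a \<le> 2 \<and> b \<le> 2 \<and> (\<forall>u v. cover R u v \<longrightarrow> \<not> (\<beta> u = a \<and> \<beta> v = b))"
  proof (rule ccontr)
    assume no: "\<not> ?thesis"
    have ex: "\<exists>u v. cover R u v \<and> \<beta> u = a \<and> \<beta> v = b" if "a \<noteq> b" "a \<le> 2" "b \<le> 2" for a b
      using no that by blast
    obtain u v where 1: "cover R u v" "\<beta> u = 1" "\<beta> v = 2" using ex[of 1 2] by auto
    obtain u' v' where 2: "cover R u' v'" "\<beta> u' = 2" "\<beta> v' = 1" using ex[of 2 1] by auto
    note Y = cY[OF 1(1)] cY[OF 2(1)]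
    have "r v' = r u" "r v = r u'"
      using single[OF Y(4,1)] single[OF Y(2,3)] 1(2,3) 2(2,3) by simp_all
    then have "R v' u" "R v u'" using ExtD(4)[OF r Y(4,1)] ExtD(4)[OF r Y(2,3)] by simp_all
    then have "R v u" using 2(1) tr unfolding cover_def by blast
    then show False using 1(1) unfolding cover_def by blast
  qed
  have ze: "\<zeta> x = \<zeta> y" if z: "\<zeta> \<in> Con R" "mk \<zeta> = (0, 0, 0)" and xy: "x \<in> Y" "y \<in> Y" "\<beta> x = \<beta> y" for \<zeta> x y
  proof (cases "\<beta> x = 0")
    case True
    have zc: "\<zeta> a = \<zeta> b" if "eqv R a b" for a b using z that unfolding Con_def by blast
    have "\<zeta> z1 = \<zeta> B \<or> \<zeta> z3 = \<zeta> T" using l zc by blast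
    then have e: "\<zeta> z1 = \<zeta> B" "\<zeta> z2 = \<zeta> B" "\<zeta> z3 = \<zeta> B" "\<zeta> T = \<zeta> B" using z(2) unfolding mk_def by auto
    have B: "\<zeta> w = \<zeta> B" if w: "marker R w" for w
    proof -
      obtain n where n: "n \<in> {B, z1, z2, z3, T}" "eqv R w n" using w unfolding marker_def by blast
      have "\<zeta> n = \<zeta> B" using n(1) e by (elim insertE emptyE) simp_all
      then show ?thesis using zc[OF n(2)] by simp
    qed
    have "marker R x" using True b0[of x] by simp
    moreover have "marker R y" using True xy(3) b0[of y] by simp
    ultimately show ?thesis using B[of x] B[of y] by simp
  next
    case False
    then have "eqv R x y" using single[OF xy] Ext_eqv[OF r] xy by blast
    then show ?thesis using z unfolding Con_def by blast
  qed
  have bd: "\<beta> y \<le> d" if "y \<in> Y" for y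
    using f1 mf[OF that] d unfolding \<beta>_def by auto
  have "block_function d R \<beta>" unfolding block_function_def
    using bd ch ev mm b0 ne st six ze by (intro conjI ballI allI impI) (blast | metis)+
  then show ?thesis by blast
qed

text \<open>With both outer segments present, \<open>B\<close> and \<open>T\<close> form block 0 and
  \<open>z1\<close>, \<open>z2\<close>, \<open>z3\<close> form block 1. Five levels are marked, and
  at most \<open>d - 1\<close> are left for block 2, that is none or one.\<close>

lemma block_function_unlinked:
  assumes face: "face d R" and d: "d = 1 \<or> d = 2" and l: "\<not> eqv R z1 B" "\<not> eqv R z3 T"
  shows "\<exists>\<beta>. block_function d R \<beta>"
proof -
  have R: "pre R" using face unfolding face_def by auto
  interpret finite_preorder Y R by (rule preD(1)[OF R])
  define N where "N = d + 3"
  obtain r where r: "r \<in> Ext R N" using face unfolding face_def N_def by auto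
  note m = Ext_marks[OF R r]
  have cY: "x \<in> Y" "y \<in> Y" if "cover R x y" for x y using that carrier unfolding cover_def by blast+
  have rl: "0 < r z1" "r z3 < N" using l Ext_eqv[OF r] marks m by (fastforce, fastforce)
  define f where "f = {..N} - {0, r z1, r z2, r z3, N}"
  have cf: "card f \<le> d - 1"
  proof -
    have "card {0, r z1, r z2, r z3, N} = 5" using m rl by auto
    moreover have "card f = Suc N - card {0, r z1, r z2, r z3, N}" unfolding f_def
      by (subst card_Diff_subset) (use m in auto)
    ultimately show ?thesis using N_def by simp
  qed
  have ff: "finite f" unfolding f_def by simp
  have f1: False if "i \<in> f" "d = 1" for i
    using cf that ff by auto
  have f2: "i = j" if "i \<in> f" "j \<in> f" for i j
  proof (rule ccontr)
    assume "i \<noteq> j"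
    then have "2 \<le> card f" using card_mono[OF ff, of "{i, j}"] that by simp
    then show False using cf d by linarith
  qed
  define \<beta> where "\<beta> y = (if r y = 0 \<or> r y = N then 0 else if r y \<in> {r z1, r z2, r z3} then 1 else (2::nat))" for y
  have b2: "r y \<in> f" if "y \<in> Y" "\<beta> y = 2" for y
  proof -
    have "r y \<le> N" using ExtD(2)[OF r] that by blast
    then show ?thesis using that unfolding f_def \<beta>_def by (auto split: if_splits)
  qed
  have mk2: "marker R y" if "y \<in> Y" "\<beta> y \<noteq> 2" for y
    using that marker_iff[OF r] m unfolding \<beta>_def by (auto split: if_splits)
  have b3: "\<beta> y \<le> 2" for y by (simp add: \<beta>_def)
  have bm: "\<beta> B = 0" "\<beta> T = 0" "\<beta> z1 = 1" "\<beta> z2 = 1" "\<beta> z3 = 1" using m rl unfolding \<beta>_def by auto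
  have single: "r x = r y" if "x \<in> Y" "y \<in> Y" "\<beta> x = 2" "\<beta> y = 2" for x y using f2 b2 that by blast
  have ev: "\<beta> x = \<beta> y" if "eqv R x y" for x y
  proof -
    have "x \<in> Y" "y \<in> Y" using that carrier unfolding eqv_def by blast+
    then have "r x = r y" using Ext_eqv[OF r] that by blast
    then show ?thesis unfolding \<beta>_def by simp
  qed
  have rep0: "eqv R y B \<or> eqv R y T" if "y \<in> Y" "\<beta> y = 0" for y
    using that Ext_eqv[OF r that(1)] marks m unfolding \<beta>_def by (auto split: if_splits)
  have rep1: "eqv R y z1 \<or> eqv R y z2 \<or> eqv R y z3" if "y \<in> Y" "\<beta> y = 1" for y
    using that Ext_eqv[OF r that(1)] marks m unfolding \<beta>_def by (auto split: if_splits)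
  have BT: "R B y" "R y T" if "y \<in> Y" for y using preD(2,3)[OF R] that by blast+
  have ch: "R x y \<or> R y x" if "x \<in> Y" "y \<in> Y" "\<beta> x = \<beta> y" for x y
  proof (cases "\<beta> x = 2")
    case True
    then show ?thesis using single[of x y] ExtD(4)[OF r] that by auto
  next
    case False
    then show ?thesis using marker_comparable[OF R] mk2 that by metis
  qed
  have ne: "\<beta> u \<noteq> \<beta> v" if uv: "cover R u v" "valid (add R u v)" for u v
  proof
    assume e: "\<beta> u = \<beta> v"
    have Ruv: "R u v" "\<not> R v u" "u \<in> Y" "v \<in> Y" using uv carrier unfolding cover_def by blast+
    show False
    proof (cases "\<beta> u = 2")
      case True
      then show False using single[OF Ruv(3,4)] e ExtD(4)[OF r Ruv(4,3)] Ruv(2) by simp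
    next
      case False
      then have "marker R u" "marker R v" using e mk2 Ruv by auto
      then consider "eqv R u B \<and> eqv R v z1" | "eqv R u z1 \<and> eqv R v z2" | "eqv R u z2 \<and> eqv R v z3" | "eqv R u z3 \<and> eqv R v T"
        using marker_cover[OF R uv(1)] by blast
      then show False
      proof cases
        case 1 then show False using ev[of u B] ev[of v z1] e bm by simp
      next
        case 2 then show False using uv(2) unfolding valid_def add_def eqv_def by blast
      next
        case 3 then show False using uv(2) unfolding valid_def add_def eqv_def by blast
      next
        case 4 then show False using ev[of u z3] ev[of v T] e bm by simp
      qed
    qed
  qed
  have st: False if c: "cover R u v" "cover R u' v'" and e: "\<beta> u = \<beta> u'" "\<beta> v = \<beta> v'" "\<beta> u \<noteq> \<beta> v"
      and lt: "lt R u u'" "lt R v v'" for u v u' v'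
  proof -
    note Y = cY[OF c(1)] cY[OF c(2)]
    have "\<not> (\<beta> u = 2)" "\<not> (\<beta> v = 2)"
      using single[of u u'] single[of v v'] Ext_eqv[OF r] Y lt e(1,2) unfolding lt_def eqv_def by auto
    then have "(\<beta> u = 0 \<and> \<beta> v = 1) \<or> (\<beta> u = 1 \<and> \<beta> v = 0)" using b3[of u] b3[of v] e(3) by linarith
    then show False
    proof (elim disjE conjE)
      assume "\<beta> u = 0" "\<beta> v = 1"
      then have "eqv R u' B \<or> eqv R u' T" using rep0 Y e by simp
      then have "R T u'" using lt(1) BT[OF Y(1)] tr unfolding lt_def eqv_def by blast
      then show False using BT(2)[OF Y(4)] c(2) tr unfolding cover_def by blast
    next
      assume "\<beta> u = 1" "\<beta> v = 0"
      then have "eqv R v B \<or> eqv R v T" using rep0 Y e by simp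
      then have "R v B" using lt(2) BT[OF Y(4)] tr unfolding lt_def eqv_def by blast
      then show False using BT(1)[OF Y(1)] c(1) tr unfolding cover_def by blast
    qed
  qed
  \<comment> \<open>A cover from block 0 to block 2 starts at the bottom. If block 2 also covered an
    element of block 1, that element would lie strictly in between.\<close>
  have six: "\<exists>a b. a \<noteq> b \<and> a \<le> 2 \<and> b \<le> 2 \<and> (\<forall>u v. cover R u v \<longrightarrow> \<not> (\<beta> u = a \<and> \<beta> v = b))"
  proof (rule ccontr)
    assume no: "\<not> ?thesis"
    have ex: "\<exists>u v. cover R u v \<and> \<beta> u = a \<and> \<beta> v = b" if "a \<noteq> b" "a \<le> 2" "b \<le> 2" for a b
      using no that by blast
    obtain u v where 1: "cover R u v" "\<beta> u = 0" "\<beta> v = 2" using ex[of 0 2] by auto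
    obtain u' v' where 2: "cover R u' v'" "\<beta> u' = 1" "\<beta> v' = 2" using ex[of 1 2] by auto
    note Y = cY[OF 1(1)] cY[OF 2(1)]
    have "eqv R u B"
      using rep0[OF Y(1) 1(2)] BT(2)[OF Y(2)] 1(1) tr unfolding cover_def eqv_def by blast
    then have uu: "R u u'" using BT(1)[OF Y(3)] tr unfolding eqv_def by blast
    have "r v' = r v" using single[OF Y(4,2)] 1(3) 2(3) by simp
    then have "R v' v" using ExtD(4)[OF r Y(4,2)] by simp
    then have "R u' v" using 2(1) tr unfolding cover_def by blast
    then have "R u' u \<or> R v u'" using uu 1(1) unfolding cover_def by blast
    then have "eqv R u u' \<or> eqv R v u'" using uu \<open>R u' v\<close> unfolding eqv_def by blast
    then show False using ev[of u u'] ev[of v u'] 1(2,3) 2(2,3) by auto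
  qed
  have ze: "\<zeta> x = \<zeta> y" if z: "\<zeta> \<in> Con R" "mk \<zeta> = (0, 0, 0)" and xy: "x \<in> Y" "y \<in> Y" "\<beta> x = \<beta> y" for \<zeta> x y
  proof -
    have zc: "\<zeta> a = \<zeta> b" if "eqv R a b" for a b using z that unfolding Con_def by blast
    have e: "\<zeta> z1 = \<zeta> z2" "\<zeta> z3 = \<zeta> z2" "\<zeta> T = \<zeta> B" using z(2) unfolding mk_def by auto
    have 0: "\<zeta> w = \<zeta> B" if "w \<in> Y" "\<beta> w = 0" for w
      using rep0[OF that] zc[of w B] zc[of w T] e by auto
    have 1: "\<zeta> w = \<zeta> z2" if "w \<in> Y" "\<beta> w = 1" for w
      using rep1[OF that] zc[of w z1] zc[of w z2] zc[of w z3] e by auto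
    consider "\<beta> x = 0" | "\<beta> x = 1" | "\<beta> x = 2" using b3[of x] by linarith
    then show ?thesis
    proof cases
      case 1 then show ?thesis using 0 xy by metis
    next
      case 2 then show ?thesis using 1 xy by metis
    next
      case 3
      then show ?thesis using single[of x y] zc Ext_eqv[OF r] xy by auto
    qed
  qed
  have bd: "\<beta> y \<le> d" if "y \<in> Y" for y
    using f1 b2[OF that] b3[of y] d by (cases "\<beta> y = 2") auto
  have "block_function d R \<beta>" unfolding block_function_def
    using bd ch ev bm ne st six ze by (intro conjI ballI allI impI) (blast | metis)+
  then show ?thesis by blast
qed

lemma block_functionD:
  assumes "block_function d R \<beta>"
  shows "\<And>y. y \<in> Y \<Longrightarrow> \<beta> y \<le> d" "\<And>x y. x \<in> Y \<Longrightarrow> y \<in> Y \<Longrightarrow> \<beta> x = \<beta> y \<Longrightarrow> R x y \<or> R y x"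
    "\<And>x y. eqv R x y \<Longrightarrow> \<beta> x = \<beta> y" "\<beta> T = \<beta> B" "\<beta> z1 = \<beta> z2" "\<beta> z3 = \<beta> z2"
    "\<And>u v. cover R u v \<Longrightarrow> valid (add R u v) \<Longrightarrow> \<beta> u \<noteq> \<beta> v"
    "\<And>u v u' v'. cover R u v \<Longrightarrow> cover R u' v' \<Longrightarrow> \<beta> u = \<beta> u' \<Longrightarrow> \<beta> v = \<beta> v' \<Longrightarrow> \<beta> u \<noteq> \<beta> v \<Longrightarrow> lt R u u' \<Longrightarrow> lt R v v' \<Longrightarrow> False"
    "d = 2 \<Longrightarrow> \<exists>a b. a \<noteq> b \<and> a \<le> 2 \<and> b \<le> 2 \<and> (\<forall>u v. cover R u v \<longrightarrow> \<not> (\<beta> u = a \<and> \<beta> v = b))"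
    "\<And>\<zeta> x y. \<zeta> \<in> Con R \<Longrightarrow> mk \<zeta> = (0, 0, 0) \<Longrightarrow> x \<in> Y \<Longrightarrow> y \<in> Y \<Longrightarrow> \<beta> x = \<beta> y \<Longrightarrow> \<zeta> x = \<zeta> y"
proof -
  note r1 = assms[unfolded block_function_def]
  note r2 = r1[THEN conjunct2]
  note r3 = r2[THEN conjunct2]
  note r4 = r3[THEN conjunct2]
  note r5 = r4[THEN conjunct2]
  note r6 = r5[THEN conjunct2]
  note r7 = r6[THEN conjunct2]
  note r8 = r7[THEN conjunct2]
  note r9 = r8[THEN conjunct2]
  note r10 = r9[THEN conjunct2]
  show "\<beta> y \<le> d" if "y \<in> Y" for y
    using r1[THEN conjunct1] that by blast
  show "R x y \<or> R y x" if "x \<in> Y" "y \<in> Y" "\<beta> x = \<beta> y" for x y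
    using r2[THEN conjunct1] that by blast
  show "\<beta> x = \<beta> y" if "eqv R x y" for x y
    using r3[THEN conjunct1] that by blast
  show "\<beta> T = \<beta> B" by (rule r4[THEN conjunct1])
  show "\<beta> z1 = \<beta> z2" by (rule r5[THEN conjunct1])
  show "\<beta> z3 = \<beta> z2" by (rule r6[THEN conjunct1])
  show "\<beta> u \<noteq> \<beta> v" if "cover R u v" "valid (add R u v)" for u v
    using r7[THEN conjunct1] that by blast
  show False if "cover R u v" "cover R u' v'" "\<beta> u = \<beta> u'" "\<beta> v = \<beta> v'" "\<beta> u \<noteq> \<beta> v" "lt R u u'" "lt R v v'" for u v u' v'
    using r8[THEN conjunct1] that by blast
  show "\<exists>a b. a \<noteq> b \<and> a \<le> 2 \<and> b \<le> 2 \<and> (\<forall>u v. cover R u v \<longrightarrow> \<not> (\<beta> u = a \<and> \<beta> v = b))" if "d = 2"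
    using r9[THEN conjunct1] that by blast
  show "\<zeta> x = \<zeta> y" if "\<zeta> \<in> Con R" "mk \<zeta> = (0, 0, 0)" "x \<in> Y" "y \<in> Y" "\<beta> x = \<beta> y" for \<zeta> x y
    using r10 that by blast
qed

lemma block_function_ex:
  assumes "face d R" "d = 1 \<or> d = 2"
  obtains \<beta> where "block_function d R \<beta>"
  using block_function_linked[OF assms] block_function_unlinked[OF assms] by blast

text \<open>Each block is a chain. Two covers between the same blocks cannot be nested or cross, and
  the condition on strictly parallel covers in \<open>block_function\<close> excludes the rest. So
  there are at most as many facets as ordered pairs of blocks.\<close>

lemma block_pair_unique:
  assumes R: "pre R" and b: "block_function d R \<beta>" and uv: "cover R u v" and st: "cover R s t"
    and e: "\<beta> s = \<beta> u" "\<beta> t = \<beta> v" and n: "\<beta> u \<noteq> \<beta> v"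
  shows "add R u v = add R s t"
proof -
  interpret finite_preorder Y R by (rule preD(1)[OF R])
  note bf = block_functionD[OF b]
  have key: "eqv R u s \<and> eqv R v t"
    if c: "cover R u v" "cover R s t" and e: "\<beta> s = \<beta> u" "\<beta> t = \<beta> v" "\<beta> u \<noteq> \<beta> v" and us: "R u s" for u v s t
  proof -
    have Y: "u \<in> Y" "v \<in> Y" "s \<in> Y" "t \<in> Y" using c carrier unfolding cover_def by blast+
    have ne: "\<not> eqv R s v" "\<not> eqv R u t" using bf(3)[of s v] bf(3)[of u t] e by auto
    have cuv: "R u v" "\<And>w. R u w \<Longrightarrow> R w v \<Longrightarrow> R w u \<or> R v w" and cst: "R s t" "\<And>w. R s w \<Longrightarrow> R w t \<Longrightarrow> R w s \<or> R t w"
      using c unfolding cover_def by blast+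
    consider "R t v" | "R v t" using bf(2)[OF Y(2,4)] e by auto
    then show ?thesis
    proof cases
      case 1
      then have "R s v" "R u t" using cst(1) us tr by blast+
      then have "R s u" "R v t" using cuv(2)[of s] cuv(2)[of t] ne us 1 unfolding eqv_def by blast+
      then show ?thesis using us 1 unfolding eqv_def by blast
    next
      case 2
      have "\<not> (lt R u s \<and> lt R v t)" using bf(8)[OF c] e by metis
      then have "R s u \<or> R t v" using us 2 unfolding lt_def by blast
      then show ?thesis
      proof
        assume "R s u"
        then have "R s v" using cuv(1) tr by blast
        then have "R t v" using cst(2)[OF _ 2] ne(1) unfolding eqv_def by blast
        then show ?thesis using us \<open>R s u\<close> 2 unfolding eqv_def by blast
      next
        assume "R t v"
        then have "R s v" using cst(1) tr by blast
        then have "R s u" using cuv(2)[OF us] ne unfolding eqv_def by blast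
        then show ?thesis using us 2 \<open>R t v\<close> unfolding eqv_def by blast
      qed
    qed
  qed
  have "u \<in> Y" "s \<in> Y" using uv st carrier unfolding cover_def by blast+
  then consider "R u s" | "R s u" using bf(2)[of u s] e by auto
  then show ?thesis
  proof cases
    case 1 then show ?thesis using key[OF uv st e n] add_cong by blast
  next
    case 2
    have "\<beta> s \<noteq> \<beta> t" using e n by simp
    then show ?thesis using key[OF st uv e(1)[symmetric] e(2)[symmetric] _ 2] add_cong by metis
  qed
qed

definition block_pair :: "('y \<Rightarrow> 'y \<Rightarrow> bool) \<Rightarrow> ('y \<Rightarrow> nat) \<Rightarrow> ('y \<Rightarrow> 'y \<Rightarrow> bool) \<Rightarrow> nat \<times> nat" where
  "block_pair R \<beta> F = (let p = (SOME p. cover R (fst p) (snd p) \<and> F = add R (fst p) (snd p)) in (\<beta> (fst p), \<beta> (snd p)))"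

lemma block_pair_add:
  assumes R: "pre R" and uv: "cover R u v" and b: "block_function d R \<beta>"
  shows "block_pair R \<beta> (add R u v) = (\<beta> u, \<beta> v)"
proof -
  interpret finite_preorder Y R by (rule preD(1)[OF R])
  define p where "p = (SOME p. cover R (fst p) (snd p) \<and> add R u v = add R (fst p) (snd p))"
  have "cover R (fst p) (snd p) \<and> add R u v = add R (fst p) (snd p)"
    unfolding p_def by (rule someI[of _ "(u, v)"]) (use uv in auto)
  then have "eqv R (fst p) u" "eqv R (snd p) v" using add_eqD[OF uv, of "fst p" "snd p"] by auto
  then have "\<beta> (snd p) = \<beta> v" "\<beta> (fst p) = \<beta> u" using block_functionD(3)[OF b] by blast+
  then show ?thesis by (simp add: block_pair_def Let_def p_def[symmetric])
qed

lemma block_pair: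
  assumes R: "pre R" and b: "block_function d R \<beta>"
  shows "inj_on (block_pair R \<beta>) (fac R)"
    "\<And>F. F \<in> fac R \<Longrightarrow> \<exists>i j. block_pair R \<beta> F = (i, j) \<and> i \<noteq> j \<and> i \<le> d \<and> j \<le> d"
proof -
  show "inj_on (block_pair R \<beta>) (fac R)"
  proof (rule inj_onI)
    fix E F assume "E \<in> fac R" "F \<in> fac R" and eq: "block_pair R \<beta> E = block_pair R \<beta> F"
    then obtain u v s t where uv: "cover R u v" "E = add R u v" "valid E" and st: "cover R s t" "F = add R s t"
      unfolding fac_def by blast
    have "\<beta> s = \<beta> u" "\<beta> t = \<beta> v" using eq block_pair_add[OF R uv(1) b] block_pair_add[OF R st(1) b] uv st by auto
    then show "E = F" using block_pair_unique[OF R b uv(1) st(1)] block_functionD(7)[OF b uv(1)] uv st by simp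
  qed
  fix F assume "F \<in> fac R"
  then obtain u v where uv: "cover R u v" "F = add R u v" "valid F" by (rule facE)
  have "u \<in> Y" "v \<in> Y" using uv(1) finite_preorder.carrier[OF preD(1)[OF R]] unfolding cover_def by blast+
  then show "\<exists>i j. block_pair R \<beta> F = (i, j) \<and> i \<noteq> j \<and> i \<le> d \<and> j \<le> d"
    using block_pair_add[OF R uv(1) b] block_functionD(1,7)[OF b] uv by blast
qed

lemma segment:
  assumes "face (Suc 0) R"
  shows "card (fac R) \<le> 2"
proof -
  obtain \<beta> where b: "block_function 1 R \<beta>" using block_function_ex[of 1 R] assms by auto
  have R: "pre R" using assms unfolding face_def by simp
  have "block_pair R \<beta> ` fac R \<subseteq> {(0, 1), (1, 0)}"
  proof (rule image_subsetI)
    fix F assume "F \<in> fac R"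
    then obtain i j where "block_pair R \<beta> F = (i, j)" "i \<noteq> j" "i \<le> 1" "j \<le> 1" using block_pair(2)[OF R b] by blast
    moreover then have "i = 0 \<and> j = 1 \<or> i = 1 \<and> j = 0" by linarith
    ultimately show "block_pair R \<beta> F \<in> {(0, 1), (1, 0)}" by auto
  qed
  then have "card (block_pair R \<beta> ` fac R) \<le> card {(0::nat, 1::nat), (1, 0)}" by (rule card_mono[rotated]) simp
  then show ?thesis using card_image[OF block_pair(1)[OF R b]] by simp
qed

text \<open>Numbers the ordered pairs of blocks by the cyclic order of the roots, so that the
  indicators of blocks 1 and 2 have the heights \<open>root_x\<close> and
  \<open>root_y\<close>.\<close>

definition root_index :: "nat \<times> nat \<Rightarrow> nat" where
  "root_index p = (if p = (0, 1) then 0 else if p = (0, 2) then 1 else if p = (1, 2) then 2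
     else if p = (1, 0) then 3 else if p = (2, 0) then 4 else 5)"

lemma polygon:
  assumes "face (Suc (Suc 0)) R"
  shows "\<exists>\<theta> \<eta> \<rho>. \<theta> \<in> Con R \<and> \<eta> \<in> Con R \<and> mk \<theta> = (0, 0, 0) \<and> mk \<eta> = (0, 0, 0)
      \<and> inj_on \<rho> (fac R) \<and> \<rho> ` fac R \<subset> {..<6}
      \<and> (\<forall>F\<in>fac R. dl R \<theta> F = root_x (\<rho> F) \<and> dl R \<eta> F = root_y (\<rho> F))
      \<and> (\<forall>\<zeta>\<in>Con R. mk \<zeta> = (0, 0, 0) \<longrightarrow> (\<exists>x y. \<forall>F\<in>fac R. dl R \<zeta> F = x * dl R \<theta> F + y * dl R \<eta> F))"
proof -
  obtain \<beta> where b: "block_function 2 R \<beta>" using block_function_ex[of 2 R] assms by (auto simp: numeral_2_eq_2)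
  have R: "pre R" using assms unfolding face_def by simp
  note bf = block_functionD[OF b]
  define bp where "bp = block_pair R \<beta>"
  have six: "bp F \<in> {(0, 1), (0, 2), (1, 2), (1, 0), (2, 0), (2, 1)}" if F: "F \<in> fac R" for F
  proof -
    obtain i j where ij: "bp F = (i, j)" "i \<noteq> j" "i \<le> 2" "j \<le> 2" using block_pair(2)[OF R b F] unfolding bp_def by blast
    have "i = 0 \<or> i = 1 \<or> i = 2" "j = 0 \<or> j = 1 \<or> j = 2" using ij by linarith+
    then show ?thesis using ij by auto
  qed
  have ri: "inj_on root_index {(0, 1), (0, 2), (1, 2), (1, 0), (2, 0), (2, 1)}"
    unfolding inj_on_def root_index_def by simp
  have dlF: "dl R \<zeta> F = g (snd (bp F)) - g (fst (bp F))"
    if F: "F \<in> fac R" and z: "\<zeta> \<in> Con R" "\<And>y. y \<in> Y \<Longrightarrow> \<zeta> y = g (\<beta> y)" for \<zeta> F g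
  proof -
    obtain u v where uv: "cover R u v" "F = add R u v" using facE[OF F] .
    then have "u \<in> Y" "v \<in> Y" using finite_preorder.carrier[OF preD(1)[OF R]] unfolding cover_def by blast+
    then show ?thesis using dl_add[OF R uv(1) z(1)] block_pair_add[OF R uv(1) b] z(2) uv(2) unfolding bp_def by simp
  qed
  define \<theta> \<eta> :: "'y \<Rightarrow> real" where th: "\<theta> = (\<lambda>y. if \<beta> y = 1 then 1 else 0)" "\<eta> = (\<lambda>y. if \<beta> y = 2 then 1 else 0)"
  have co: "\<theta> \<in> Con R" "\<eta> \<in> Con R" using bf(3) unfolding Con_def th by auto
  have mk0: "mk \<theta> = (0, 0, 0)" "mk \<eta> = (0, 0, 0)" using bf(4-6) unfolding mk_def th by auto
  define \<rho> where "\<rho> F = root_index (bp F)" for F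
  have inj: "inj_on \<rho> (fac R)"
  proof -
    have "inj_on root_index (bp ` fac R)" by (rule inj_on_subset[OF ri]) (use six in blast)
    then show ?thesis using comp_inj_on[OF block_pair(1)[OF R b], of root_index] unfolding \<rho>_def bp_def comp_def by simp
  qed
  have th_dl: "dl R \<theta> F = (if snd (bp F) = 1 then 1 else 0) - (if fst (bp F) = 1 then 1 else 0)"
      "dl R \<eta> F = (if snd (bp F) = 2 then 1 else 0) - (if fst (bp F) = 2 then 1 else 0)" if "F \<in> fac R" for F
    by (rule dlF[OF that co(1)], simp add: th(1), rule dlF[OF that co(2)], simp add: th(2))
  have rt: "dl R \<theta> F = root_x (\<rho> F) \<and> dl R \<eta> F = root_y (\<rho> F)" if "F \<in> fac R" for F
    using six[OF that] th_dl[OF that] unfolding \<rho>_def root_x_def root_y_def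
    by (elim insertE emptyE) (simp_all add: root_index_def del: One_nat_def)
  have "\<rho> ` fac R \<subseteq> {..<6}" unfolding \<rho>_def root_index_def by auto
  moreover obtain i j where ij: "i \<noteq> j" "i \<le> 2" "j \<le> 2" "\<And>u v. cover R u v \<Longrightarrow> \<not> (\<beta> u = i \<and> \<beta> v = j)"
    using bf(9) by blast
  have ijn: "bp F \<noteq> (i, j)" if F: "F \<in> fac R" for F
  proof -
    obtain u v where uv: "cover R u v" "F = add R u v" using facE[OF F] .
    then show ?thesis using block_pair_add[OF R uv(1) b] ij(4)[OF uv(1)] unfolding bp_def by simp
  qed
  have "root_index (i, j) \<notin> \<rho> ` fac R"
  proof
    assume "root_index (i, j) \<in> \<rho> ` fac R"
    then obtain F where F: "F \<in> fac R" "root_index (i, j) = root_index (bp F)" unfolding \<rho>_def by blast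
    have "i = 0 \<or> i = 1 \<or> i = 2" "j = 0 \<or> j = 1 \<or> j = 2" using ij by linarith+
    then have "(i, j) \<in> {(0, 1), (0, 2), (1, 2), (1, 0), (2, 0), (2, 1)}" using ij(1) by auto
    then have "bp F = (i, j)" using inj_onD[OF ri F(2)] six[OF F(1)] by simp
    then show False using ijn[OF F(1)] by simp
  qed
  moreover have "root_index (i, j) < 6" unfolding root_index_def by auto
  ultimately have "\<rho> ` fac R \<subset> {..<6}" by blast
  moreover have "\<exists>x y. \<forall>F\<in>fac R. dl R \<zeta> F = x * dl R \<theta> F + y * dl R \<eta> F"
    if z: "\<zeta> \<in> Con R" "mk \<zeta> = (0, 0, 0)" for \<zeta>
  proof -
    define val where "val i = \<zeta> (SOME y. y \<in> Y \<and> \<beta> y = i)" for i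
    have val: "\<zeta> y = val (\<beta> y)" if "y \<in> Y" for y
    proof -
      have "(SOME y'. y' \<in> Y \<and> \<beta> y' = \<beta> y) \<in> Y \<and> \<beta> (SOME y'. y' \<in> Y \<and> \<beta> y' = \<beta> y) = \<beta> y"
        by (rule someI[of _ y]) (use that in auto)
      then show ?thesis unfolding val_def using bf(10)[OF z that] by metis
    qed
    have "dl R \<zeta> F = (val 1 - val 0) * dl R \<theta> F + (val 2 - val 0) * dl R \<eta> F" if F: "F \<in> fac R" for F
    proof -
      have "dl R \<zeta> F = val (snd (bp F)) - val (fst (bp F))" by (rule dlF[OF F z(1)]) (rule val)
      then show ?thesis unfolding th_dl[OF F]
        using six[OF F] by (elim insertE emptyE) (simp_all del: One_nat_def)
    qed
    then show ?thesis by blast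
  qed
  ultimately have "\<rho> ` fac R \<subset> {..<6} \<and>
      (\<forall>\<zeta>\<in>Con R. mk \<zeta> = (0, 0, 0) \<longrightarrow> (\<exists>x y. \<forall>F\<in>fac R. dl R \<zeta> F = x * dl R \<theta> F + y * dl R \<eta> F))"
    by simp
  moreover have "\<forall>F\<in>fac R. dl R \<theta> F = root_x (\<rho> F) \<and> dl R \<eta> F = root_y (\<rho> F)" using rt by simp
  ultimately show ?thesis using co mk0 inj by (intro exI[of _ \<theta>] exI[of _ \<eta>] exI[of _ \<rho>]) simp
qed

lemma connected_facets:
  assumes face: "face (Suc (Suc (Suc d))) R" and S: "S \<subseteq> fac R" "S \<noteq> {}"
    "\<And>E F. E \<in> S \<Longrightarrow> F \<in> fac R \<Longrightarrow> fac E \<inter> fac F \<noteq> {} \<Longrightarrow> F \<in> S"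
  shows "S = fac R"
proof -
  have R: "pre R" using face unfolding face_def by simp
  define N where "N = Suc (Suc (Suc d)) + 3"
  obtain r where r: "r \<in> Ext R N" using face unfolding face_def N_def by auto
  define f where "f = {..N} - {r B, r z1, r z2, r z3, r T}"
  have free: "\<exists>w\<in>Y. \<not> marker R w \<and> \<not> eqv R w v" for v
  proof -
    \<comment> \<open>There are at least seven levels and at most five are marked, so some unmarked
      level differs from any given one.\<close>
    have "card {..N} - card {r B, r z1, r z2, r z3, r T} \<le> card f"
      unfolding f_def by (rule diff_card_le_card_Diff) simp
    moreover have "card {r B, r z1, r z2, r z3, r T} \<le> 5"
      using card_length[of "[r B, r z1, r z2, r z3, r T]"] by simp
    ultimately have "2 \<le> card f" unfolding N_def by simp
    then have "\<not> f \<subseteq> {r v}" using card_mono[of "{r v}" f] by auto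
    then obtain i where i: "i \<in> f" "i \<noteq> r v" by blast
    then have p: "pt r i \<in> Y" "r (pt r i) = i" using pt[OF r] unfolding f_def by auto
    then have "\<not> marker R (pt r i)" using marker_iff[OF r p(1)] i unfolding f_def by simp
    moreover have "\<not> eqv R (pt r i) v"
      using Ext_eqv[OF r p(1)] finite_preorder.carrier[OF preD(1)[OF R]] p i unfolding eqv_def by metis
    ultimately show ?thesis using p by blast
  qed
  obtain E where E: "E \<in> S" using S by blast
  have "F \<in> S" if "F \<in> fac R" for F
  proof -
    have "(adj R)\<^sup>*\<^sup>* E F" by (rule connected[OF R free]) (use E S that in auto)
    then show ?thesis
    proof (induction rule: rtranclp_induct)
      case (step y z) then show ?case using S(3) unfolding adj_def by blast
    qed (rule E)
  qed
  then show ?thesis using S by blast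
qed

lemma face_system: "face_system face fac Con dl mk vol"
proof
  have fp: "pre R" if "face d R" for d R using that unfolding face_def by simp
  show "finite (fac R)" if "face d R" for d R by (rule finite_fac[OF fp[OF that]])
  show "face d F" if "face (Suc d) R" "F \<in> fac R" for d R F by (rule face_fac[OF that])
  show "(\<lambda>y. 0) \<in> Con R" for R by (simp add: Con_def)
  show "(\<lambda>y. \<theta> y + x * \<eta> y) \<in> Con R" if "\<theta> \<in> Con R" "\<eta> \<in> Con R" for \<theta> \<eta> x R using that unfolding Con_def by auto
  show "dl R (\<lambda>y. \<theta> y + x * \<eta> y) F = dl R \<theta> F + x * dl R \<eta> F" for R \<theta> x \<eta> F
    unfolding dl_def Let_def by (simp add: algebra_simps)
  show "mk (\<lambda>y. 0) = (0, 0, 0)" by (simp add: mk_def)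
  show "mk (\<lambda>y. \<theta> y + x * \<eta> y) = mk \<theta>" if "mk \<eta> = (0, 0, 0)" for \<theta> \<eta> x
  proof -
    have "\<eta> z1 = \<eta> z2" "\<eta> z3 = \<eta> z2" "\<eta> T = \<eta> B" using that unfolding mk_def by auto
    then show ?thesis by (simp add: mk_def)
  qed
  show "\<theta> \<in> Con F \<longleftrightarrow> \<theta> \<in> Con R \<and> dl R \<theta> F = 0" if "face (Suc d) R" "F \<in> fac R" for d R F \<theta>
    by (rule Con_fac[OF fp[OF that(1)] that(2)])
  show "\<exists>\<theta>. \<theta> \<in> Con R \<and> mk \<theta> = (0, 0, 0) \<and> dl R \<theta> F = 1" if "face (Suc d) R" "F \<in> fac R" for d R F
    by (rule shift_ex[OF fp[OF that(1)] that(2)])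
  show "\<exists>F'. F' \<in> fac R \<and> F' \<noteq> F \<and> G \<in> fac F' \<and> (\<forall>E\<in>fac R. G \<in> fac E \<longrightarrow> E = F \<or> E = F')
         \<and> (\<forall>\<theta>\<in>Con F. dl F \<theta> G = dl R \<theta> F')" if "face (Suc (Suc d)) R" "F \<in> fac R" "G \<in> fac F" for d R F G
    by (rule other_ex[OF fp[OF that(1)] that(2,3)])
  show "G = G'" if "face (Suc (Suc d)) R" "E \<in> fac R" "F \<in> fac R" "E \<noteq> F"
      "G \<in> fac E" "G \<in> fac F" "G' \<in> fac E" "G' \<in> fac F" for d R E F G G'
    by (rule join_unique[OF fp[OF that(1)] that(2-8)])
  show "(\<exists>G. G \<in> fac E \<and> G \<in> fac F \<and> H \<in> fac G) \<or>
      (\<exists>P Q. up = {E, F, P, Q} \<and> (\<forall>\<theta>\<in>Con R. dl R \<theta> E + dl R \<theta> F = dl R \<theta> P + dl R \<theta> Q))"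
    if "face (Suc (Suc (Suc d))) R" "up = {F \<in> fac R. \<exists>G\<in>fac F. H \<in> fac G}" "E \<in> up" "F \<in> up" "E \<noteq> F" for d R up H E F
    using square[OF fp[OF that(1)] that(2-5)] .
  show "S = fac R" if "face (Suc (Suc (Suc d))) R" "S \<subseteq> fac R" "S \<noteq> {}"
      "\<And>E F. E \<in> S \<Longrightarrow> F \<in> fac R \<Longrightarrow> fac E \<inter> fac F \<noteq> {} \<Longrightarrow> F \<in> S" for d R S
    by (rule connected_facets[OF that])
  show "\<exists>\<phi>\<in>Con R. mk \<phi> = c \<and> (\<forall>F\<in>fac R. dl R \<phi> F > 0)" if "face d R" "pos3 c" for d R c
    by (rule strict_ex[OF that])
  show "vol R (mk \<phi> # cs) = (\<Sum>F\<in>fac R. dl R \<phi> F * vol F cs)" if "face (Suc d) R" "\<phi> \<in> Con R" "length cs = d" for d R \<phi> cs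
    by (rule vol_facets[OF that])
  show "vol R cs > 0" if "face d R" "length cs = d" "\<And>c. c \<in> set cs \<Longrightarrow> pos3 c" for d R cs
    by (rule vol_pos[OF that])
  show "vol R [] = 1" if "face 0 R" for R by (rule vol_point[OF that])
  show "card (fac R) \<le> 2" if "face (Suc 0) R" for R by (rule segment[OF that])
  show "\<exists>\<theta> \<eta> \<rho>. \<theta> \<in> Con R \<and> \<eta> \<in> Con R \<and> mk \<theta> = (0, 0, 0) \<and> mk \<eta> = (0, 0, 0)
      \<and> inj_on \<rho> (fac R) \<and> \<rho> ` fac R \<subset> {..<6}
      \<and> (\<forall>F\<in>fac R. dl R \<theta> F = root_x (\<rho> F) \<and> dl R \<eta> F = root_y (\<rho> F))
      \<and> (\<forall>\<zeta>\<in>Con R. mk \<zeta> = (0, 0, 0) \<longrightarrow> (\<exists>x y. \<forall>F\<in>fac R. dl R \<zeta> F = x * dl R \<theta> F + y * dl R \<eta> F))"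
    if "face (Suc (Suc 0)) R" for R by (rule polygon[OF that])
qed

end

section \<open>The inequality for linear extensions\<close>

definition leq :: "('a \<Rightarrow> 'a \<Rightarrow> bool) \<Rightarrow> 'a \<Rightarrow> 'a \<Rightarrow> bool" where
  "leq R u v \<longleftrightarrow> u = v \<or> R u v"
text \<open>The order generated by \<open>R\<close> together with \<open>z1 < z2 < z3\<close>. A
  chain may use the first new relation, the second, or both, which gives the last three
  disjuncts.\<close>

definition leq_marked :: "('a \<Rightarrow> 'a \<Rightarrow> bool) \<Rightarrow> 'a \<Rightarrow> 'a \<Rightarrow> 'a \<Rightarrow> 'a \<Rightarrow> 'a \<Rightarrow> bool" where
  "leq_marked R z1 z2 z3 u v \<longleftrightarrow> leq R u v \<or> (leq R u z1 \<and> leq R z2 v) \<or> (leq R u z2 \<and> leq R z3 v) \<or> (leq R u z1 \<and> leq R z3 v)"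

text \<open>\<open>Inr False\<close> and \<open>Inr True\<close> are added as bottom and top elements.\<close>

definition ground :: "'a set \<Rightarrow> ('a + bool) set" where
  "ground X = Inl ` X \<union> range Inr"
definition bounded_order :: "'a set \<Rightarrow> ('a \<Rightarrow> 'a \<Rightarrow> bool) \<Rightarrow> 'a \<Rightarrow> 'a \<Rightarrow> 'a \<Rightarrow> 'a + bool \<Rightarrow> 'a + bool \<Rightarrow> bool" where
  "bounded_order X R z1 z2 z3 x y \<longleftrightarrow> x \<in> ground X \<and> y \<in> ground X \<and>
     (x = Inr False \<or> y = Inr True \<or> (\<exists>u v. x = Inl u \<and> y = Inl v \<and> leq_marked R z1 z2 z3 u v))"
definition rank_of :: "'a set \<Rightarrow> ('a \<Rightarrow> nat) \<Rightarrow> 'a + bool \<Rightarrow> nat" where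
  "rank_of X L y = (case y of Inl u \<Rightarrow> if u \<in> X then L u else 0 | Inr b \<Rightarrow> if b then Suc (card X) else 0)"

locale three_marked =
  fixes X :: "'a set" and R :: "'a \<Rightarrow> 'a \<Rightarrow> bool" and z1 z2 z3 :: 'a
  assumes finite_X: "finite X" and irrefl: "irreflp_on X R" and trans: "transp_on X R"
    and zX: "z1 \<in> X" "z2 \<in> X" "z3 \<in> X"
begin

lemma leq_trans: "leq R u v \<Longrightarrow> leq R v w \<Longrightarrow> u \<in> X \<Longrightarrow> v \<in> X \<Longrightarrow> w \<in> X \<Longrightarrow> leq R u w"
  using trans unfolding leq_def transp_on_def by blast

lemma linear_extensionD:
  assumes "L \<in> linear_extensions X R"
  shows "bij_betw L X {1..card X}" "\<And>u v. u \<in> X \<Longrightarrow> v \<in> X \<Longrightarrow> leq R u v \<Longrightarrow> L u \<le> L v"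
    "\<And>u. u \<notin> X \<Longrightarrow> L u = undefined"
  using assms unfolding linear_extensions_def leq_def extensional_def by (auto simp: less_imp_le)

end

text \<open>\<open>L0\<close> witnesses that the added relations between the marks create no
  cycle.\<close>

locale marked_poset = three_marked X R z1 z2 z3
  for X :: "'a set" and R :: "'a \<Rightarrow> 'a \<Rightarrow> bool" and z1 z2 z3 :: 'a +
  fixes L0 :: "'a \<Rightarrow> nat"
  assumes L0: "L0 \<in> linear_extensions X R" "L0 z1 < L0 z2" "L0 z2 < L0 z3"
begin

abbreviation "Y \<equiv> ground X"
abbreviation "R0 \<equiv> bounded_order X R z1 z2 z3"

lemma leq_marked_le:
  assumes L: "L \<in> linear_extensions X R" "L z1 < L z2" "L z2 < L z3" and uv: "u \<in> X" "v \<in> X" "leq_marked R z1 z2 z3 u v"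
  shows "L u \<le> L v"
proof -
  note m = linear_extensionD(2)[OF L(1)]
  consider "leq R u v" | "leq R u z1" "leq R z2 v" | "leq R u z2" "leq R z3 v" | "leq R u z1" "leq R z3 v"
    using uv(3) unfolding leq_marked_def by blast
  then show ?thesis
  proof cases
    case 1 then show ?thesis using m uv by blast
  next
    case 2 then show ?thesis using m[of u z1] m[of z2 v] uv zX L by linarith
  next
    case 3 then show ?thesis using m[of u z2] m[of z3 v] uv zX L by linarith
  next
    case 4 then show ?thesis using m[of u z1] m[of z3 v] uv zX L by linarith
  qed
qed

lemma leq_marked_trans:
  assumes "leq_marked R z1 z2 z3 u v" "leq_marked R z1 z2 z3 v w" "u \<in> X" "v \<in> X" "w \<in> X"
  shows "leq_marked R z1 z2 z3 u w"
proof -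
  note t = leq_trans
  have a: "leq R u z" if "leq R u v" "leq R v z" "z \<in> X" for z using t[OF that(1,2) assms(3,4) that(3)] .
  have b: "leq R z w" if "leq R z v" "leq R v w" "z \<in> X" for z using t[OF that(1,2) that(3) assms(4,5)] .
  have c: "leq R u w" if "leq R u z" "leq R z w" "z \<in> X" for z using t[OF that(1,2) assms(3) that(3) assms(5)] .
  show ?thesis using assms(1,2) unfolding leq_marked_def
    using a[OF _ _ zX(1)] a[OF _ _ zX(2)] a[OF _ _ assms(5)] b[OF _ _ zX(2)] b[OF _ _ zX(3)] c[OF _ _ zX(2)] by blast
qed

lemma R0_cases:
  assumes "R0 x y"
  obtains "x = Inr False" | "y = Inr True" | u v where "x = Inl u" "y = Inl v" "u \<in> X" "v \<in> X" "leq_marked R z1 z2 z3 u v"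
  using assms unfolding bounded_order_def ground_def by blast

lemma R0_Inl: "R0 (Inl u) (Inl v) \<longleftrightarrow> u \<in> X \<and> v \<in> X \<and> leq_marked R z1 z2 z3 u v"
  unfolding bounded_order_def ground_def by auto

lemma antisym_R0:
  assumes xy: "R0 x y" "R0 y x"
  shows "x = y"
proof -
  have key: "u = v" if uv: "R0 (Inl u) (Inl v)" "R0 (Inl v) (Inl u)" for u v
  proof -
    have X: "u \<in> X" "v \<in> X" using uv unfolding R0_Inl by blast+
    have "L0 u \<le> L0 v" "L0 v \<le> L0 u" using uv leq_marked_le[OF L0 X] leq_marked_le[OF L0 X(2,1)] unfolding R0_Inl by blast+
    then have "L0 u = L0 v" by simp
    then show ?thesis using linear_extensionD(1)[OF L0(1)] X unfolding bij_betw_def by (meson inj_onD)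
  qed
  show ?thesis
  proof (cases "\<exists>u v. x = Inl u \<and> y = Inl v")
    case True then show ?thesis using key xy by blast
  next
    case False then show ?thesis using xy unfolding bounded_order_def by blast
  qed
qed

sublocale marked_ground Y "Inr False" "Inr True" "Inl z1" "Inl z2" "Inl z3"
  by standard (use finite_X zX in \<open>auto simp: ground_def\<close>)

lemma pre_R0: "pre R0"
proof -
  have "finite_preorder Y R0"
  proof
    show "finite Y" by (rule fin)
    show "x \<in> Y \<and> y \<in> Y" if "R0 x y" for x y using that unfolding bounded_order_def by blast
    show "R0 x x" if "x \<in> Y" for x
      using that by (auto simp: bounded_order_def ground_def leq_marked_def leq_def)
    show "R0 x z" if xy: "R0 x y" and yz: "R0 y z" for x y z
    proof -
      have Yx: "x \<in> Y" "z \<in> Y" using xy yz unfolding bounded_order_def by blast+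
      show ?thesis
      proof (cases "x = Inr False \<or> z = Inr True")
        case True then show ?thesis using Yx unfolding bounded_order_def by blast
      next
        case False
        then have "y \<noteq> Inr True" using yz unfolding bounded_order_def by auto
        then obtain u v where u: "x = Inl u" "y = Inl v" using xy False unfolding bounded_order_def by blast
        obtain w where w: "z = Inl w" using yz u False unfolding bounded_order_def by blast
        have "u \<in> X" "v \<in> X" "leq_marked R z1 z2 z3 u v" "w \<in> X" "leq_marked R z1 z2 z3 v w"
          using xy yz unfolding u w R0_Inl by blast+
        then show ?thesis using leq_marked_trans unfolding u w R0_Inl by blast
      qed
    qed
  qed
  moreover have "\<not> R0 (Inl z2) (Inl z1)" "\<not> R0 (Inl z3) (Inl z2)"
    using leq_marked_le[OF L0] L0 unfolding R0_Inl by fastforce+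
  moreover have "R0 (Inl z1) (Inl z2)" "R0 (Inl z2) (Inl z3)" using zX unfolding R0_Inl leq_marked_def leq_def by blast+
  moreover have "\<not> R0 (Inl z1) (Inr False)" by (simp add: bounded_order_def)
  moreover have "\<forall>y\<in>Y. R0 (Inr False) y \<and> R0 y (Inr True)" by (auto simp: bounded_order_def ground_def)
  ultimately show ?thesis unfolding pre_def valid_def by blast
qed

definition Ls :: "('a \<Rightarrow> nat) set" where
  "Ls = {L \<in> linear_extensions X R. L z1 < L z2 \<and> L z2 < L z3}"

lemma rank_of_Ext:
  assumes "L \<in> Ls"
  shows "rank_of X L \<in> Ext R0 (Suc (card X))"
proof -
  have L: "L \<in> linear_extensions X R" "L z1 < L z2" "L z2 < L z3" using assms unfolding Ls_def by auto
  have im: "L ` X = {1..card X}" and inj: "inj_on L X" using linear_extensionD(1)[OF L(1)] unfolding bij_betw_def by auto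
  have b: "1 \<le> L u" "L u \<le> card X" if "u \<in> X" for u using im that by auto
  show ?thesis
  proof (rule ExtI)
    show "rank_of X L y = 0" if "y \<notin> Y" for y using that by (auto simp: rank_of_def ground_def split: sum.split)
    have "rank_of X L ` Y = L ` X \<union> {0, Suc (card X)}"
      unfolding ground_def image_Un image_image by (auto simp: rank_of_def UNIV_bool)
    then show "rank_of X L ` Y = {..Suc (card X)}" using im by auto
    show "rank_of X L x \<le> rank_of X L y" if "x \<in> Y" "y \<in> Y" "R0 x y" for x y
      using that(3)
    proof (cases rule: R0_cases)
      case 2
      then show ?thesis using b that(1) by (auto simp: rank_of_def ground_def le_SucI)
    next
      case (3 u v) then show ?thesis using leq_marked_le[OF L] by (simp add: rank_of_def)
    qed (simp add: rank_of_def)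
    show "R0 x y" if xy: "x \<in> Y" "y \<in> Y" "rank_of X L x = rank_of X L y" for x y
    proof -
      have b0: "L u \<noteq> 0" "L u \<noteq> Suc (card X)" if "u \<in> X" for u using b[OF that] by auto
      have "x = y" using xy inj
        by (cases x; cases y) (auto simp: rank_of_def ground_def b0 b0[symmetric] dest: inj_onD split: if_splits)
      then show ?thesis using finite_preorder.rfl[OF preD(1)[OF pre_R0]] xy by blast
    qed
  qed
qed

text \<open>\<open>R0\<close> is antisymmetric, so its classes are single elements and its rank
  functions are linear extensions; the new bottom and top occupy the levels 0 and
  \<open>card X + 1\<close>.\<close>

lemma bij_rank_of: "bij_betw (rank_of X) Ls (Ext R0 (Suc (card X)))"
  unfolding bij_betw_def
proof
  show "inj_on (rank_of X) Ls"
  proof (rule inj_onI, rule ext)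
    fix L L' u assume L: "L \<in> Ls" "L' \<in> Ls" and eq: "rank_of X L = rank_of X L'"
    have "rank_of X L (Inl u) = rank_of X L' (Inl u)" using eq by simp
    then show "L u = L' u" using L linear_extensionD(3)[of L u] linear_extensionD(3)[of L' u]
      unfolding rank_of_def Ls_def by (cases "u \<in> X") auto
  qed
  have "r \<in> rank_of X ` Ls" if r: "r \<in> Ext R0 (Suc (card X))" for r
  proof -
    define L where "L = restrict (\<lambda>u. r (Inl u)) X"
    note e = ExtD[OF r] and m = Ext_marks[OF pre_R0 r]
    have inj: "inj_on r Y" by (rule inj_onI, rule antisym_R0) (simp_all add: e(4))
    have "r ` (Y - {Inr False, Inr True}) = {..Suc (card X)} - {0, Suc (card X)}"
      using inj_on_image_set_diff[OF inj, of Y "{Inr False, Inr True}"] e(2) m(1,2) marks(1,2) by auto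
    moreover have "Y - {Inr False, Inr True} = Inl ` X" by (auto simp: ground_def)
    moreover have "{..Suc (card X)} - {0, Suc (card X)} = {1..card X}" by auto
    ultimately have "L ` X = {1..card X}" unfolding L_def by (simp add: image_image)
    moreover have "inj_on L X" using inj unfolding L_def inj_on_def ground_def by auto
    moreover have "L u < L v" if uv: "u \<in> X" "v \<in> X" "R u v" for u v
    proof -
      have "u \<noteq> v" using irrefl uv unfolding irreflp_on_def by blast
      then have "L u \<noteq> L v" using \<open>inj_on L X\<close> uv by (meson inj_onD)
      moreover have "r (Inl u) \<le> r (Inl v)" by (rule e(3)) (use uv in \<open>auto simp: R0_Inl ground_def leq_marked_def leq_def\<close>)
      ultimately show ?thesis using uv unfolding L_def by simp
    qed
    ultimately have "L \<in> Ls" using m(3,4) zX unfolding Ls_def linear_extensions_def bij_betw_def L_def by auto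
    moreover have "rank_of X L = r"
    proof
      fix y
      show "rank_of X L y = r y"
        using e(1)[of y] m(1,2) by (cases y) (auto simp: rank_of_def L_def ground_def)
    qed
    ultimately show ?thesis by blast
  qed
  then show "rank_of X ` Ls = Ext R0 (Suc (card X))" using rank_of_Ext by blast
qed

lemma vol_R0:
  assumes "length cs + 3 = Suc (card X)"
  shows "vol R0 cs = (\<Sum>L\<in>Ls. M3 (L z2 - L z1) (L z3 - L z2) (L z1 + (Suc (card X) - L z3)) cs)"
proof -
  have "vol R0 cs = (\<Sum>L\<in>Ls. wt (rank_of X L) cs)"
    unfolding vol_def assms by (rule sum.reindex_bij_betw[OF bij_rank_of, symmetric])
  also have "\<dots> = (\<Sum>L\<in>Ls. M3 (L z2 - L z1) (L z3 - L z2) (L z1 + (Suc (card X) - L z3)) cs)"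
    unfolding wt_def using zX by (simp add: rank_of_def)
  finally show ?thesis .
qed

end

section \<open>Counts of linear extensions as mixed volumes\<close>

lemma M3_basis:
  assumes "set cs \<subseteq> {(1, 0, 0), (0, 1, 0), (0, 0, 1)}"
  shows "M3 na nb ns cs = (if na = Suc (count_list cs (0, 1, 0)) \<and> nb = Suc (count_list cs (0, 0, 1))
      \<and> ns = Suc (count_list cs (1, 0, 0)) then 1 else 0)"
  using assms
proof (induction cs arbitrary: na nb ns)
  case (Cons c cs)
  have "c = (1, 0, 0) \<or> c = (0, 1, 0) \<or> c = (0, 0, 1)" "set cs \<subseteq> {(1, 0, 0), (0, 1, 0), (0, 0, 1)}" using Cons.prems by auto
  then show ?case using Cons.IH by (elim disjE) auto
qed simp

context marked_poset
begin

text \<open>A unit mark lowers exactly one of the three block counts, and only the final counts 1,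
  1, 1 give a nonzero value. So each gap is one more than the multiplicity of its mark; the outer
  count is then forced by the length of the list.\<close>

lemma vol_basis:
  assumes len: "length cs + 3 = Suc (card X)" and cs: "set cs \<subseteq> {(1, 0, 0), (0, 1, 0), (0, 0, 1)}"
  shows "vol R0 cs = real (num_ext X R z1 z2 z3 (1 + int (count_list cs (0, 1, 0))) (1 + int (count_list cs (0, 0, 1))))"
proof -
  have len': "length cs = count_list cs (1, 0, 0) + count_list cs (0, 1, 0) + count_list cs (0, 0, 1)"
    using cs by (induction cs) auto
  define p q where "p = count_list cs (0, 1, 0)" and "q = count_list cs (0, 0, 1)"
  define S where "S = {L \<in> linear_extensions X R. int (L z2) - int (L z1) = 1 + int p \<and> int (L z3) - int (L z2) = 1 + int q}"
  have SL: "S \<subseteq> Ls" unfolding S_def Ls_def by auto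
  have finLs: "finite Ls" using bij_betw_finite[OF bij_rank_of] finite_Ext by blast
  have "M3 (L z2 - L z1) (L z3 - L z2) (L z1 + (Suc (card X) - L z3)) cs = (if L \<in> S then 1 else 0)" if "L \<in> Ls" for L
  proof -
    have "L \<in> linear_extensions X R" "L z1 < L z2" "L z2 < L z3" "L z3 \<le> card X"
      using that linear_extensionD(1)[of L] zX unfolding Ls_def bij_betw_def by auto
    then show ?thesis unfolding M3_basis[OF cs] S_def p_def q_def using len len' by auto
  qed
  then have "vol R0 cs = (\<Sum>L\<in>Ls. if L \<in> S then 1 else 0)" unfolding vol_R0[OF len] by simp
  also have "\<dots> = real (card S)" using SL finLs by (simp add: sum.If_cases Int_absorb1)
  finally show ?thesis unfolding num_ext_def S_def p_def q_def .
qed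

end

text \<open>Pushes the unit marks into the open positive octant, where the Alexandrov--Fenchel
  inequality was proved.\<close>

definition shift_all :: "real \<Rightarrow> real \<times> real \<times> real \<Rightarrow> real \<times> real \<times> real" where
  "shift_all \<epsilon> c = (fst c + \<epsilon>, fst (snd c) + \<epsilon>, snd (snd c) + \<epsilon>)"

lemma count_list_replicate: "count_list (replicate n x) y = (if x = y then n else 0)"
  by (induction n) auto

lemma M3_tendsto:
  "((\<lambda>\<epsilon>. M3 na nb ns (map (shift_all \<epsilon>) cs)) \<longlongrightarrow> M3 na nb ns cs) (at_right 0)"
proof (induction cs arbitrary: na nb ns)
  case (Cons c cs)
  have "((\<lambda>\<epsilon>. x + \<epsilon>) \<longlongrightarrow> x) (at_right 0)" for x :: real
    by (auto intro!: tendsto_eq_intros)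
  then show ?case unfolding list.map M3.simps shift_all_def fst_conv snd_conv
    by (intro tendsto_add tendsto_mult Cons.IH[unfolded shift_all_def])
qed simp

context marked_ground
begin

lemma vol_linear1:
  "vol S ((x, y, w) # cs) = x * vol S ((1, 0, 0) # cs) + y * vol S ((0, 1, 0) # cs) + w * vol S ((0, 0, 1) # cs)"
  unfolding vol_def wt_def by (simp add: sum.distrib sum_distrib_left)

lemma vol_linear2:
  "vol S (u # (x, y, w) # cs) = x * vol S (u # (1, 0, 0) # cs) + y * vol S (u # (0, 1, 0) # cs) + w * vol S (u # (0, 0, 1) # cs)"
proof -
  have "wt r (u # (x, y, w) # cs) = x * wt r (u # (1, 0, 0) # cs) + y * wt r (u # (0, 1, 0) # cs) + w * wt r (u # (0, 0, 1) # cs)" for r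
    unfolding wt_def by (simp add: algebra_simps)
  then show ?thesis unfolding vol_def by (simp add: sum.distrib sum_distrib_left)
qed

lemma vol_tendsto:
  "((\<lambda>\<epsilon>. vol S (u # v # map (shift_all \<epsilon>) cs)) \<longlongrightarrow> vol S (u # v # cs)) (at_right 0)"
  unfolding vol_def wt_def M3.simps length_Cons length_map
  by (intro tendsto_sum tendsto_add tendsto_mult tendsto_const M3_tendsto)

end

lemma (in marked_poset) alexandrov_fenchel_counts:
  fixes k l :: nat and x y :: real
  defines "N p q \<equiv> real (num_ext X R z1 z2 z3 (int p) (int q))"
  assumes k: "k \<ge> 1" and l: "l \<ge> 1" and n: "k + l + 3 \<le> card X"
  shows "N k l * (x\<^sup>2 * N (k + 2) l + 2 * x * y * N (k + 1) (l + 1) + y\<^sup>2 * N k (l + 2))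
    \<le> (x * N (k + 1) l + y * N k (l + 1))\<^sup>2"
proof -
  \<comment> \<open>Chosen so that the fixed marks and the two varying ones together match the
    dimension \<open>card X - 2\<close>.\<close>
  define m where "m = card X - k - l - 2"
  define cs :: "(real \<times> real \<times> real) list"
    where "cs = replicate (k - 1) (0, 1, 0) @ replicate (l - 1) (0, 0, 1) @ replicate m (1, 0, 0)"
  have len: "length cs + 5 = Suc (card X)" unfolding cs_def m_def using k l n by simp
  have cnt: "count_list cs (0, 1, 0) = k - 1" "count_list cs (0, 0, 1) = l - 1"
    unfolding cs_def by (simp_all add: count_list_replicate)
  have set: "set cs \<subseteq> {(1, 0, 0), (0, 1, 0), (0, 0, 1)}" unfolding cs_def by auto
  have V: "vol R0 ((1, 0, 0) # (1, 0, 0) # cs) = N k l" "vol R0 ((1, 0, 0) # (0, 1, 0) # cs) = N (k + 1) l"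
      "vol R0 ((1, 0, 0) # (0, 0, 1) # cs) = N k (l + 1)" "vol R0 ((0, 1, 0) # (0, 1, 0) # cs) = N (k + 2) l"
      "vol R0 ((0, 1, 0) # (0, 0, 1) # cs) = N (k + 1) (l + 1)" "vol R0 ((0, 0, 1) # (0, 1, 0) # cs) = N (k + 1) (l + 1)"
      "vol R0 ((0, 0, 1) # (0, 0, 1) # cs) = N k (l + 2)"
    using len k l by (subst vol_basis, simp, use set in simp, simp add: cnt N_def algebra_simps)+
  \<comment> \<open>Simple maps realizing the marks \<open>(1, 0, 0)\<close> and
    \<open>(0, x, y)\<close>. They need not preserve the order: only membership in
    \<open>Con R0\<close> matters, which is automatic by antisymmetry.\<close>
  define \<phi> \<psi> :: "'a + bool \<Rightarrow> real"
    where "\<phi> u = (if u = Inr True then 1 else 0)"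
      and "\<psi> u = (if u = Inl z2 then x else if u = Inl z3 \<or> u = Inr True then x + y else 0)" for u
  have ne: "z1 \<noteq> z2" "z2 \<noteq> z3" "z1 \<noteq> z3" using L0 by auto
  have mk: "mk \<phi> = (1, 0, 0)" "mk \<psi> = (0, x, y)" unfolding mk_def \<phi>_def \<psi>_def using ne by auto
  have con: "\<theta> \<in> Con R0" for \<theta> unfolding Con_def eqv_def using antisym_R0 by blast
  have "L0 \<in> Ls" unfolding Ls_def using L0 by simp
  then have face: "face (Suc (Suc (length cs))) R0"
    using pre_R0 rank_of_Ext len unfolding face_def by (auto simp: numeral_eq_Suc)
  have AF: "vol R0 (mk \<phi> # mk \<phi> # map (shift_all \<epsilon>) cs) * vol R0 (mk \<psi> # mk \<psi> # map (shift_all \<epsilon>) cs)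
      \<le> (vol R0 (mk \<phi> # mk \<psi> # map (shift_all \<epsilon>) cs))\<^sup>2"
    if "\<epsilon> > 0" "vol R0 (mk \<psi> # mk \<psi> # map (shift_all \<epsilon>) cs) > 0" for \<epsilon>
  proof (rule face_system.alexandrov_fenchel[OF face_system])
    show "face (Suc (Suc (length cs))) R0" by (rule face)
    show "pos3 c" if "c \<in> set (map (shift_all \<epsilon>) cs)" for c
      using that set \<open>\<epsilon> > 0\<close> by (auto simp: pos3_def shift_all_def)
  qed (use con that(2) in auto)
  have vv: "vol R0 (mk \<psi> # mk \<psi> # cs) = x\<^sup>2 * N (k + 2) l + 2 * x * y * N (k + 1) (l + 1) + y\<^sup>2 * N k (l + 2)"
    unfolding mk vol_linear1[of _ 0 x y] vol_linear2[of _ _ 0 x y] V by (simp add: power2_eq_square algebra_simps)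
  have v0: "vol R0 (mk \<phi> # mk \<psi> # cs) = x * N (k + 1) l + y * N k (l + 1)"
    unfolding mk vol_linear2[of _ _ 0 x y] V by simp
  \<comment> \<open>If the volume in question is positive, it stays so under small perturbations, as
    the Alexandrov--Fenchel inequality requires; otherwise the claim is trivial.\<close>
  have "N k l * vol R0 (mk \<psi> # mk \<psi> # cs) \<le> (vol R0 (mk \<phi> # mk \<psi> # cs))\<^sup>2"
  proof (cases "vol R0 (mk \<psi> # mk \<psi> # cs) > 0")
    case True
    have "eventually (\<lambda>\<epsilon>. vol R0 (mk \<psi> # mk \<psi> # map (shift_all \<epsilon>) cs) > 0) (at_right 0)"
      by (rule order_tendstoD(1)[OF vol_tendsto True])
    then have ev: "eventually (\<lambda>\<epsilon>. vol R0 (mk \<phi> # mk \<phi> # map (shift_all \<epsilon>) cs) * vol R0 (mk \<psi> # mk \<psi> # map (shift_all \<epsilon>) cs)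
      \<le> (vol R0 (mk \<phi> # mk \<psi> # map (shift_all \<epsilon>) cs))\<^sup>2) (at_right 0)"
      using eventually_at_right_less[of 0] by eventually_elim (rule AF)
    have "vol R0 (mk \<phi> # mk \<phi> # cs) * vol R0 (mk \<psi> # mk \<psi> # cs) \<le> (vol R0 (mk \<phi> # mk \<psi> # cs))\<^sup>2"
      by (rule tendsto_le[OF _ tendsto_power[OF vol_tendsto] tendsto_mult[OF vol_tendsto vol_tendsto] ev]) simp
    then show ?thesis unfolding mk V .
  next
    case False
    have "N k l \<ge> 0" by (simp add: N_def)
    then have "N k l * vol R0 (mk \<psi> # mk \<psi> # cs) \<le> 0" using False by (simp add: mult_nonneg_nonpos)
    then show ?thesis by (rule order_trans) simp
  qed
  then show ?thesis unfolding vv v0 .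
qed

lemma (in marked_poset) count_inequality:
  fixes k l :: nat
  defines "N p q \<equiv> real (num_ext X R z1 z2 z3 (int p) (int q))"
  assumes k: "k \<ge> 1" and l: "l \<ge> 1" and n: "k + l + 3 \<le> card X"
    and d: "N (k + 2) l > 0" and f: "N k (l + 2) > 0"
  shows "N k l * (N (k + 1) (l + 1) + sqrt (N (k + 2) l * N k (l + 2))) \<le> 2 * N (k + 1) l * N k (l + 1)"
proof -
  define a b c d e f where v: "a = N k l" "b = N (k + 1) l" "c = N k (l + 1)" "d = N (k + 2) l"
    "e = N (k + 1) (l + 1)" "f = N k (l + 2)"
  have af: "a * (x\<^sup>2 * d + 2 * x * y * e + y\<^sup>2 * f) \<le> (x * b + y * c)\<^sup>2" for x y
    using alexandrov_fenchel_counts[OF k l n, of x y] unfolding v N_def .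
  have pos: "a \<ge> 0" "b \<ge> 0" "c \<ge> 0" "e \<ge> 0" unfolding v N_def by simp_all
  have df: "d > 0" "f > 0" using assms(5,6) unfolding v by simp_all
  have "a * (e + sqrt (d * f)) \<le> 2 * b * c"
  proof (cases "a = 0")
    case False
    then have a: "a > 0" using pos by simp
    \<comment> \<open>The two pure cases of the inequality make \<open>b\<close> and
      \<open>c\<close> nonzero, which allows the cancellation of \<open>2 * b * c\<close> at the
      end.\<close>
    have "0 < a * d" "0 < a * f" using a df by simp_all
    moreover have "a * d \<le> b\<^sup>2" "a * f \<le> c\<^sup>2" using af[of 1 0] af[of 0 1] by simp_all
    ultimately have "b\<^sup>2 > 0" "c\<^sup>2 > 0" by linarith+
    then have bc: "b * c > 0" using pos by (simp add: order_less_le)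
    have "0 \<le> (c * sqrt d - b * sqrt f)\<^sup>2" by simp
    also have "\<dots> = c\<^sup>2 * d + b\<^sup>2 * f - 2 * b * c * sqrt (d * f)"
      using df by (simp add: power2_diff power_mult_distrib real_sqrt_mult)
    finally have "2 * b * c * (e + sqrt (d * f)) \<le> c\<^sup>2 * d + 2 * c * b * e + b\<^sup>2 * f" by (simp add: algebra_simps)
    then have "a * (2 * b * c * (e + sqrt (d * f))) \<le> a * (c\<^sup>2 * d + 2 * c * b * e + b\<^sup>2 * f)"
      using a by (intro mult_left_mono) auto
    also have "\<dots> \<le> (2 * b * c) * (2 * b * c)" using af[of c b] by (simp add: power2_eq_square algebra_simps)
    finally have "(2 * b * c) * (a * (e + sqrt (d * f))) \<le> (2 * b * c) * (2 * b * c)" by (simp add: algebra_simps)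
    then show ?thesis by (rule mult_left_le_imp_le) (use bc in simp)
  qed (use pos in simp)
  then show ?thesis unfolding v .
qed

section \<open>Moving single elements\<close>

definition shift :: "nat \<Rightarrow> nat \<Rightarrow> nat \<Rightarrow> nat" where
  "shift p q i = (if i = p then q else if q \<le> i \<and> i < p then Suc i else if p < i \<and> i \<le> q then i - 1 else i)"

lemma shift_shift: "shift q p (shift p q i) = i"
  unfolding shift_def by (cases "p \<le> q"; cases "i = p") auto

lemma bij_shift:
  assumes "p \<in> {1..n}" "q \<in> {1..n}"
  shows "bij_betw (shift p q) {1..n} {1..n}"
  by (rule bij_betw_byWitness[of _ "shift q p"]) (use assms in \<open>auto simp: shift_shift\<close>, auto simp: shift_def)

lemma card_le_decode:
  assumes fin: "finite D" and \<Phi>: "\<And>L. L \<in> S \<Longrightarrow> \<Phi> L \<in> D" "\<And>L. L \<in> S \<Longrightarrow> code L \<in> I (\<Phi> L)"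
    "\<And>L. L \<in> S \<Longrightarrow> g (\<Phi> L) (code L) = L"
    and I: "\<And>L. L \<in> D \<Longrightarrow> finite (I L) \<and> card (I L) \<le> N"
  shows "card S \<le> N * card D"
proof -
  have "card S = card ((\<lambda>L. (\<Phi> L, code L)) ` S)"
    by (rule card_image[symmetric], rule inj_onI) (metis \<Phi>(3) prod.inject)
  also have "\<dots> \<le> card (Sigma D I)"
    by (rule card_mono) (use fin \<Phi> I in auto)
  also have "\<dots> = (\<Sum>L\<in>D. card (I L))" using fin I by (simp add: card_SigmaI)
  also have "\<dots> \<le> (\<Sum>L\<in>D. N)" by (rule sum_mono) (use I in simp)
  finally show ?thesis by (simp add: mult.commute)
qed

context three_marked
begin

abbreviation "LE \<equiv> linear_extensions X R"

definition move :: "nat \<Rightarrow> nat \<Rightarrow> ('a \<Rightarrow> nat) \<Rightarrow> 'a \<Rightarrow> nat" where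
  "move p q L = restrict (\<lambda>u. shift p q (L u)) X"
definition gaps :: "nat \<Rightarrow> nat \<Rightarrow> ('a \<Rightarrow> nat) set" where
  "gaps p q = {L \<in> LE. L z2 = L z1 + p \<and> L z3 = L z2 + q}"

lemma num_ext_gaps: "num_ext X R z1 z2 z3 (int p) (int q) = card (gaps p q)"
  unfolding num_ext_def gaps_def by (rule arg_cong[where f = card]) auto

lemma finite_LE: "finite LE"
proof (rule finite_subset)
  show "LE \<subseteq> PiE X (\<lambda>_. {1..card X})"
    unfolding linear_extensions_def bij_betw_def by (auto simp: PiE_def)
  show "finite (PiE X (\<lambda>_. {1..card X}))" by (rule finite_PiE) (use finite_X in auto)
qed

lemma finite_gaps: "finite (gaps p q)"
  using finite_LE unfolding gaps_def by simp

lemma LE_pos: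
  assumes "L \<in> LE" "u \<in> X"
  shows "1 \<le> L u" "L u \<le> card X" "L u \<in> {1..card X}"
  using bij_betwE[OF linear_extensionD(1)[OF assms(1)]] assms(2) by auto

lemma LE_less: "L \<in> LE \<Longrightarrow> u \<in> X \<Longrightarrow> v \<in> X \<Longrightarrow> R u v \<Longrightarrow> L u < L v"
  unfolding linear_extensions_def by blast

lemma LE_inj: "L \<in> LE \<Longrightarrow> u \<in> X \<Longrightarrow> v \<in> X \<Longrightarrow> L u = L v \<longleftrightarrow> u = v"
  using linear_extensionD(1)[of L] unfolding bij_betw_def by (meson inj_on_eq_iff)

lemma LE_surj:
  assumes "L \<in> LE" "i \<in> {1..card X}"
  obtains u where "u \<in> X" "L u = i"
  using linear_extensionD(1)[OF assms(1)] assms(2) unfolding bij_betw_def by (metis imageE)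

lemma trn: "R u v \<Longrightarrow> R v w \<Longrightarrow> u \<in> X \<Longrightarrow> v \<in> X \<Longrightarrow> w \<in> X \<Longrightarrow> R u w"
  using trans unfolding transp_on_def by blast

lemma irr: "u \<in> X \<Longrightarrow> \<not> R u u"
  using irrefl unfolding irreflp_on_def by blast

lemma move_apply: "u \<in> X \<Longrightarrow> move p q L u = shift p q (L u)"
  by (simp add: move_def)

lemma move_move: "L \<in> LE \<Longrightarrow> move q p (move p q L) = L"
  using linear_extensionD(3)[of L] by (auto simp: move_def shift_shift)

lemma move_LE:
  assumes L: "L \<in> LE" and x: "x \<in> X" "L x = p" and q: "q \<in> {1..card X}"
    and down: "\<And>v. v \<in> X \<Longrightarrow> q \<le> L v \<Longrightarrow> L v < p \<Longrightarrow> \<not> R v x"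
    and up: "\<And>v. v \<in> X \<Longrightarrow> p < L v \<Longrightarrow> L v \<le> q \<Longrightarrow> \<not> R x v"
  shows "move p q L \<in> LE"
proof -
  have "bij_betw (shift p q \<circ> L) X {1..card X}"
    by (rule bij_betw_trans[OF linear_extensionD(1)[OF L] bij_shift]) (use LE_pos[OF L x(1)] x q in auto)
  then have "bij_betw (move p q L) X {1..card X}"
    by (rule bij_betw_cong[THEN iffD1, rotated]) (simp add: move_apply)
  moreover have "move p q L u < move p q L v" if uv: "u \<in> X" "v \<in> X" "R u v" for u v
  proof -
    have lt: "L u < L v" by (rule LE_less[OF L uv])
    have 1: "\<not> (q \<le> L u \<and> L u < p)" if "L v = p" using down[OF uv(1)] LE_inj[OF L uv(2) x(1)] that x uv by auto
    have 2: "\<not> (p < L v \<and> L v \<le> q)" if "L u = p" using up[OF uv(2)] LE_inj[OF L uv(1) x(1)] that x uv by auto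
    show ?thesis using lt 1 2 unfolding move_apply[OF uv(1)] move_apply[OF uv(2)] shift_def by auto
  qed
  ultimately show ?thesis unfolding linear_extensions_def by (simp add: move_def)
qed

lemma card_positions:
  assumes "L \<in> LE" "1 \<le> a" "b \<le> Suc (card X)"
  shows "card {v \<in> X. a \<le> L v \<and> L v < b} = b - a"
proof -
  have "{v \<in> X. a \<le> L v \<and> L v < b} = {v \<in> X. L v \<in> {a..<b}}" by auto
  also have "bij_betw L {v \<in> X. L v \<in> {a..<b}} {a..<b}"
    unfolding bij_betw_def
  proof
    show "inj_on L {v \<in> X. L v \<in> {a..<b}}" by (rule inj_onI) (use LE_inj[OF assms(1)] in auto)
    show "L ` {v \<in> X. L v \<in> {a..<b}} = {a..<b}"
    proof
      show "{a..<b} \<subseteq> L ` {v \<in> X. L v \<in> {a..<b}}"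
      proof
        fix i assume i: "i \<in> {a..<b}"
        then have "i \<in> {1..card X}" using assms by auto
        then obtain u where "u \<in> X" "L u = i" by (rule LE_surj[OF assms(1)])
        then show "i \<in> L ` {v \<in> X. L v \<in> {a..<b}}" using i by force
      qed
    qed auto
  qed
  then have "card {v \<in> X. L v \<in> {a..<b}} = card {a..<b}" by (rule bij_betw_same_card)
  finally show ?thesis by simp
qed

text \<open>After the move the element sits directly before \<open>z\<close>, so the distance it has
  travelled suffices to undo the move. \<open>card_up_moves\<close> is the mirror image, with the
  element directly behind \<open>z\<close>.\<close>

lemma card_down_moves:
  assumes z: "z \<in> X" and D: "finite D"
    and S: "\<And>L. L \<in> S \<Longrightarrow> L \<in> LE \<and> (\<exists>x\<in>X. L z < L x \<and> move (L x) (L z) L \<in> D \<and> L x - L z \<le> M)"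
  shows "card S \<le> M * card D"
proof -
  define x where "x L = (SOME x. x \<in> X \<and> L z < L x \<and> move (L x) (L z) L \<in> D \<and> L x - L z \<le> M)" for L
  have "x L \<in> X \<and> L z < L (x L) \<and> move (L (x L)) (L z) L \<in> D \<and> L (x L) - L z \<le> M" if L: "L \<in> S" for L
    unfolding x_def by (rule someI_ex) (use S[OF L] in blast)
  then have x: "x L \<in> X" "L z < L (x L)" "move (L (x L)) (L z) L \<in> D" "L (x L) - L z \<le> M" if "L \<in> S" for L
    using that by blast+
  show ?thesis
  proof (rule card_le_decode[where \<Phi> = "\<lambda>L. move (L (x L)) (L z) L" and code = "\<lambda>L. L (x L) - L z"
        and I = "\<lambda>_. {1..M}" and g = "\<lambda>L c. move (L z - 1) (L z - 1 + c) L", OF D])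
    fix L assume L: "L \<in> S"
    have "move (L (x L)) (L z) L z = Suc (L z)" using x[OF L] z by (simp add: move_apply shift_def)
    then show "move (move (L (x L)) (L z) L z - 1) (move (L (x L)) (L z) L z - 1 + (L (x L) - L z)) (move (L (x L)) (L z) L) = L"
      using x[OF L] S[OF L] by (simp add: move_move)
    show "move (L (x L)) (L z) L \<in> D" by (rule x(3)[OF L])
    show "L (x L) - L z \<in> {1..M}" using x[OF L] by simp
  qed simp
qed

lemma card_up_moves:
  assumes z: "z \<in> X" and D: "finite D"
    and S: "\<And>L. L \<in> S \<Longrightarrow> L \<in> LE \<and> (\<exists>x\<in>X. L x < L z \<and> move (L x) (L z) L \<in> D \<and> L z - L x \<le> M)"
  shows "card S \<le> M * card D"
proof -
  define x where "x L = (SOME x. x \<in> X \<and> L x < L z \<and> move (L x) (L z) L \<in> D \<and> L z - L x \<le> M)" for L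
  have "x L \<in> X \<and> L (x L) < L z \<and> move (L (x L)) (L z) L \<in> D \<and> L z - L (x L) \<le> M" if L: "L \<in> S" for L
    unfolding x_def by (rule someI_ex) (use S[OF L] in blast)
  then have x: "x L \<in> X" "L (x L) < L z" "move (L (x L)) (L z) L \<in> D" "L z - L (x L) \<le> M" if "L \<in> S" for L
    using that by blast+
  show ?thesis
  proof (rule card_le_decode[where \<Phi> = "\<lambda>L. move (L (x L)) (L z) L" and code = "\<lambda>L. L z - L (x L)"
        and I = "\<lambda>_. {1..M}" and g = "\<lambda>L c. move (Suc (L z)) (Suc (L z) - c) L", OF D])
    fix L assume L: "L \<in> S"
    have "Suc (move (L (x L)) (L z) L z) = L z" using x[OF L] z by (simp add: move_apply shift_def)
    then show "move (Suc (move (L (x L)) (L z) L z)) (Suc (move (L (x L)) (L z) L z) - (L z - L (x L))) (move (L (x L)) (L z) L) = L"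
      using x[OF L] S[OF L] by (simp add: move_move)
    show "move (L (x L)) (L z) L \<in> D" by (rule x(3)[OF L])
    show "L z - L (x L) \<in> {1..M}" using x[OF L] by simp
  qed simp
qed

lemma exists_first:
  assumes "y \<in> X" "P y"
  obtains x where "x \<in> X" "P x" "\<And>v. v \<in> X \<Longrightarrow> P v \<Longrightarrow> L x \<le> (L v :: nat)"
  using ex_has_least_nat[of "\<lambda>y. y \<in> X \<and> P y" y L] assms by blast

lemma exists_last:
  assumes "L \<in> LE" "y \<in> X" "P y"
  obtains x where "x \<in> X" "P x" "\<And>v. v \<in> X \<Longrightarrow> P v \<Longrightarrow> L v \<le> L x"
proof -
  have "\<exists>x. (x \<in> X \<and> P x) \<and> (\<forall>v. v \<in> X \<and> P v \<longrightarrow> L v \<le> L x)"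
    by (rule ex_has_greatest_nat[of "\<lambda>y. y \<in> X \<and> P y" y L "Suc (card X)"])
      (use assms LE_pos[OF assms(1)] in \<open>auto simp: le_SucI less_Suc_eq_le\<close>)
  then show ?thesis using that by blast
qed

abbreviation "Z \<equiv> {z1, z2, z3}"

text \<open>The elements passed are incomparable to \<open>x\<close>: not below it by assumption,
  and not above it by their positions.\<close>

lemma thin_below:
  assumes t: "thin_wrt X R Z t" and L: "L \<in> LE" and x: "x \<in> X" "x \<notin> Z" and s: "1 \<le> s"
    and n: "\<And>v. v \<in> X \<Longrightarrow> s \<le> L v \<Longrightarrow> L v < L x \<Longrightarrow> \<not> R v x"
  shows "L x - s \<le> t"
proof -
  have "L x - s = card {v \<in> X. s \<le> L v \<and> L v < L x}"
    by (rule card_positions[OF L s, symmetric]) (use LE_pos(2)[OF L x(1)] in simp)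
  also have "\<dots> \<le> card {v \<in> X. incomparable R x v}"
    by (rule card_mono) (use finite_X n LE_less[OF L x(1)] in \<open>auto simp: incomparable_def dest: less_asym\<close>)
  also have "\<dots> \<le> t" using t x unfolding thin_wrt_def by blast
  finally show ?thesis .
qed

lemma thin_above:
  assumes t: "thin_wrt X R Z t" and L: "L \<in> LE" and x: "x \<in> X" "x \<notin> Z" and s: "s \<le> card X"
    and n: "\<And>v. v \<in> X \<Longrightarrow> L x < L v \<Longrightarrow> L v \<le> s \<Longrightarrow> \<not> R x v"
  shows "s - L x \<le> t"
proof -
  have "s - L x = card {v \<in> X. Suc (L x) \<le> L v \<and> L v < Suc s}"
    using card_positions[OF L, of "Suc (L x)" "Suc s"] s by simp
  also have "\<dots> \<le> card {v \<in> X. incomparable R x v}"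
    by (rule card_mono) (use finite_X n LE_less[OF L _ x(1)] in \<open>auto simp: incomparable_def Suc_le_eq less_Suc_eq_le dest: less_asym\<close>)
  also have "\<dots> \<le> t" using t x unfolding thin_wrt_def by blast
  finally show ?thesis .
qed

text \<open>The first element of the gap that is not above \<open>z2\<close> is preceded only by
  elements above \<open>z2\<close>, so none of these is below it and it can be moved before
  \<open>z2\<close>. This widens the first gap and narrows the second in one move.\<close>

lemma card_good:
  assumes M: "M = t \<and> thin_wrt X R Z t \<or> M = Suc (card {v \<in> X. R z2 v})"
  shows "card {L \<in> gaps (Suc p) (Suc q). \<exists>y\<in>X. L z2 < L y \<and> L y < L z3 \<and> \<not> R z2 y}
    \<le> min q M * card (gaps (Suc (Suc p)) q)"
proof (rule card_down_moves[OF zX(2) finite_gaps])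
  fix L assume "L \<in> {L \<in> gaps (Suc p) (Suc q). \<exists>y\<in>X. L z2 < L y \<and> L y < L z3 \<and> \<not> R z2 y}"
  then obtain y0 where L: "L \<in> LE" "L z2 = L z1 + Suc p" "L z3 = L z2 + Suc q"
    and y0: "y0 \<in> X" "L z2 < L y0 \<and> L y0 < L z3 \<and> \<not> R z2 y0" unfolding gaps_def by blast
  obtain y where y: "y \<in> X" "L z2 < L y" "L y < L z3" "\<not> R z2 y"
    and first: "\<And>v. v \<in> X \<Longrightarrow> L z2 < L v \<and> L v < L z3 \<and> \<not> R z2 v \<Longrightarrow> L y \<le> L v"
    using exists_first[of y0 "\<lambda>v. L z2 < L v \<and> L v < L z3 \<and> \<not> R z2 v" L] y0 by metis
  have between: "R z2 v" if "v \<in> X" "L z2 < L v" "L v < L y" for v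
    using first[of v] that y by fastforce
  have n: "\<not> R v y" if v: "v \<in> X" "L z2 \<le> L v" "L v < L y" for v
  proof (cases "L v = L z2")
    case True
    then show ?thesis using LE_inj[OF L(1) v(1) zX(2)] y by simp
  next
    case False
    then show ?thesis using between[of v] v y trn[OF _ _ zX(2) v(1) y(1)] by auto
  qed
  have "move (L y) (L z2) L \<in> LE"
    by (rule move_LE[OF L(1) y(1) refl LE_pos(3)[OF L(1) zX(2)] n]) (use y in auto)
  then have D: "move (L y) (L z2) L \<in> gaps (Suc (Suc p)) q"
    using L y zX by (simp add: gaps_def move_apply shift_def)
  have "L y - L z2 \<le> M"
    using M
  proof
    assume "M = t \<and> thin_wrt X R Z t"
    moreover have "y \<notin> Z" using y L by auto
    ultimately show ?thesis using thin_below[OF _ L(1) y(1) _ LE_pos(1)[OF L(1) zX(2)] n] by blast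
  next
    assume "M = Suc (card {v \<in> X. R z2 v})"
    moreover have "L y - Suc (L z2) = card {v \<in> X. Suc (L z2) \<le> L v \<and> L v < L y}"
      by (rule card_positions[OF L(1), symmetric]) (use LE_pos(2)[OF L(1) y(1)] in auto)
    moreover have "\<dots> \<le> card {v \<in> X. R z2 v}"
      by (rule card_mono) (use finite_X between in auto)
    ultimately show ?thesis using y(2) by linarith
  qed
  moreover have "L y - L z2 \<le> q" using y L by linarith
  ultimately show "L \<in> LE \<and> (\<exists>x\<in>X. L z2 < L x \<and> move (L x) (L z2) L \<in> gaps (Suc (Suc p)) q \<and> L x - L z2 \<le> min q M)"
    using L D y by auto
qed

text \<open>What the moves of \<open>card_bad\<close> lead to. The last condition remembers that the
  element directly behind \<open>z3\<close> came out of the gap; it provides the first element of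
  the runs considered later.\<close>

definition tight :: "nat \<Rightarrow> nat \<Rightarrow> ('a \<Rightarrow> nat) set" where
  "tight p q = {L \<in> gaps p q. L z3 < card X \<and> (\<forall>v\<in>X. L z2 < L v \<and> L v < L z3 \<longrightarrow> R z2 v)
     \<and> (\<forall>v\<in>X. L v = Suc (L z3) \<longrightarrow> R z2 v)}"

lemma finite_tight: "finite (tight p q)"
  using finite_gaps unfolding tight_def by simp

text \<open>All elements of the gap are above \<open>z2\<close>, so none can go before it. Instead
  the last one not below \<open>z3\<close> is moved behind \<open>z3\<close>, which narrows the
  second gap only. If \<open>z2\<close> and \<open>z3\<close> are incomparable, this element stands
  directly before \<open>z3\<close>, because anything later would be above \<open>z2\<close> and
  below \<open>z3\<close>.\<close>

lemma card_bad:
  assumes L1: "L1 \<in> gaps p' q" and q: "q \<ge> 1"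
    and M: "M = t \<and> thin_wrt X R Z t \<or> M = q \<or> M = 1 \<and> \<not> R z2 z3"
  shows "card {L \<in> gaps (Suc p) (Suc q). \<forall>y\<in>X. L z2 < L y \<and> L y < L z3 \<longrightarrow> R z2 y}
    \<le> min q M * card (tight (Suc p) q)"
proof (rule card_up_moves[OF zX(3) finite_tight])
  fix L assume "L \<in> {L \<in> gaps (Suc p) (Suc q). \<forall>y\<in>X. L z2 < L y \<and> L y < L z3 \<longrightarrow> R z2 y}"
  then have L: "L \<in> LE" "L z2 = L z1 + Suc p" "L z3 = L z2 + Suc q"
    and above: "\<And>y. y \<in> X \<Longrightarrow> L z2 < L y \<Longrightarrow> L y < L z3 \<Longrightarrow> R z2 y" unfolding gaps_def by blast+
  have L1': "L1 \<in> LE" "L1 z3 = L1 z2 + q" using L1 unfolding gaps_def by auto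
  \<comment> \<open>Otherwise the \<open>q\<close> elements of the gap lie between \<open>z2\<close>
    and \<open>z3\<close> in every linear extension, also in \<open>L1\<close>, where there is room
    for only \<open>q - 1\<close>.\<close>
  have "\<exists>y\<in>X. L z2 < L y \<and> L y < L z3 \<and> \<not> R y z3"
  proof (rule ccontr)
    assume "\<not> ?thesis"
    then have no: "R y z3" if "y \<in> X" "L z2 < L y" "L y < L z3" for y using that by blast
    have "L z3 - Suc (L z2) = card {v \<in> X. Suc (L z2) \<le> L v \<and> L v < L z3}"
      by (rule card_positions[OF L(1), symmetric]) (use LE_pos(2)[OF L(1) zX(3)] in auto)
    also have "\<dots> \<le> card {v \<in> X. Suc (L1 z2) \<le> L1 v \<and> L1 v < L1 z3}"
      by (rule card_mono) (use finite_X no above LE_less[OF L1'(1)] zX in \<open>auto simp: Suc_le_eq\<close>)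
    also have "\<dots> = L1 z3 - Suc (L1 z2)"
      by (rule card_positions[OF L1'(1)]) (use LE_pos(2)[OF L1'(1) zX(3)] in auto)
    finally show False using L L1' q by simp
  qed
  then obtain y0 where y0: "y0 \<in> X" "L z2 < L y0 \<and> L y0 < L z3 \<and> \<not> R y0 z3" by blast
  obtain y where y: "y \<in> X" "L z2 < L y" "L y < L z3" "\<not> R y z3"
    and last: "\<And>v. v \<in> X \<Longrightarrow> L z2 < L v \<and> L v < L z3 \<and> \<not> R v z3 \<Longrightarrow> L v \<le> L y"
    using exists_last[OF L(1), of y0 "\<lambda>v. L z2 < L v \<and> L v < L z3 \<and> \<not> R v z3"] y0 by metis
  have between: "R v z3" if "v \<in> X" "L y < L v" "L v < L z3" for v
    using last[of v] that y by fastforce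
  have n: "\<not> R y v" if v: "v \<in> X" "L y < L v" "L v \<le> L z3" for v
  proof (cases "L v = L z3")
    case True
    then show ?thesis using LE_inj[OF L(1) v(1) zX(3)] y by simp
  next
    case False
    then show ?thesis using between[of v] v y trn[OF _ _ y(1) v(1) zX(3)] by auto
  qed
  let ?m = "move (L y) (L z3) L"
  have mL: "?m \<in> LE"
    by (rule move_LE[OF L(1) y(1) refl LE_pos(3)[OF L(1) zX(3)] _ n]) (use y in auto)
  have mz: "?m z1 = L z1" "?m z2 = L z2" "?m z3 = L z3 - 1" using L y zX by (auto simp: move_apply shift_def)
  have "?m \<in> gaps (Suc p) q" using mL mz L by (simp add: gaps_def)
  moreover have "?m z3 < card X" using mz LE_pos[OF L(1) zX(3)] by simp
  moreover have "R z2 v" if v: "v \<in> X" "?m z2 < ?m v" "?m v < ?m z3" for v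
  proof (rule above[OF v(1)])
    show "L z2 < L v" "L v < L z3"
      using v(2,3) y(2,3) L unfolding mz move_apply[OF v(1)] shift_def by (auto split: if_splits)
  qed
  moreover have "R z2 v" if v: "v \<in> X" "?m v = Suc (?m z3)" for v
  proof -
    have "?m v = ?m y" using v y L zX unfolding mz by (simp add: move_apply shift_def)
    then have "v = y" using LE_inj[OF mL v(1) y(1)] by simp
    then show ?thesis using above y by blast
  qed
  ultimately have D: "?m \<in> tight (Suc p) q" unfolding tight_def by blast
  have lq: "L z3 - L y \<le> q" using y L by linarith
  have "L z3 - L y \<le> M"
    using M
  proof (elim disjE conjE)
    assume "M = t" "thin_wrt X R Z t"
    moreover have "y \<notin> Z" using y L by auto
    ultimately show ?thesis using thin_above[OF _ L(1) y(1) _ LE_pos(2)[OF L(1) zX(3)] n] by blast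
  next
    assume M1: "M = 1" "\<not> R z2 z3"
    show ?thesis
    proof (rule ccontr)
      assume "\<not> ?thesis"
      then have "Suc (L y) < L z3" using M1 by linarith
      moreover have "Suc (L y) \<in> {1..card X}" using LE_pos(2)[OF L(1) zX(3)] calculation by simp
      then obtain v where v: "v \<in> X" "L v = Suc (L y)" by (rule LE_surj[OF L(1)])
      ultimately have "R v z3" "R z2 v" using between[of v] above[of v] y by auto
      then show False using trn[OF _ _ zX(2) v(1) zX(3)] M1 by blast
    qed
  qed (use lq in simp)
  then show "L \<in> LE \<and> (\<exists>x\<in>X. L x < L z3 \<and> move (L x) (L z3) L \<in> tight (Suc p) q \<and> L z3 - L x \<le> min q M)"
    using L D y lq by auto
qed

text \<open>Widens the first gap at its lower end: the last element before \<open>z1\<close> that is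
  not forced to be there moves behind \<open>z1\<close>.\<close>

lemma card_low:
  assumes M: "M = t \<and> thin_wrt X R Z t \<or> M = Suc (card {v \<in> X. R v z1})"
  shows "card {L \<in> gaps (Suc p) q. \<exists>u\<in>X. L u < L z1 \<and> \<not> R u z1} \<le> M * card (gaps (Suc (Suc p)) q)"
proof (rule card_up_moves[OF zX(1) finite_gaps])
  fix L assume "L \<in> {L \<in> gaps (Suc p) q. \<exists>u\<in>X. L u < L z1 \<and> \<not> R u z1}"
  then obtain y0 where L: "L \<in> LE" "L z2 = L z1 + Suc p" "L z3 = L z2 + q"
    and y0: "y0 \<in> X" "L y0 < L z1 \<and> \<not> R y0 z1" unfolding gaps_def by blast
  obtain y where y: "y \<in> X" "L y < L z1" "\<not> R y z1"
    and last: "\<And>v. v \<in> X \<Longrightarrow> L v < L z1 \<and> \<not> R v z1 \<Longrightarrow> L v \<le> L y"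
    using exists_last[OF L(1), of y0 "\<lambda>v. L v < L z1 \<and> \<not> R v z1"] y0 by metis
  have between: "R v z1" if "v \<in> X" "L y < L v" "L v < L z1" for v
    using last[of v] that y by fastforce
  have n: "\<not> R y v" if v: "v \<in> X" "L y < L v" "L v \<le> L z1" for v
  proof (cases "L v = L z1")
    case True
    then show ?thesis using LE_inj[OF L(1) v(1) zX(1)] y by simp
  next
    case False
    then show ?thesis using between[of v] v y trn[OF _ _ y(1) v(1) zX(1)] by auto
  qed
  have "move (L y) (L z1) L \<in> LE"
    by (rule move_LE[OF L(1) y(1) refl LE_pos(3)[OF L(1) zX(1)] _ n]) (use y in auto)
  then have D: "move (L y) (L z1) L \<in> gaps (Suc (Suc p)) q"
    using L y zX by (auto simp: gaps_def move_apply shift_def)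
  have "L z1 - L y \<le> M"
    using M
  proof
    assume "M = t \<and> thin_wrt X R Z t"
    moreover have "y \<notin> Z" using y L by auto
    ultimately show ?thesis using thin_above[OF _ L(1) y(1) _ LE_pos(2)[OF L(1) zX(1)] n] by blast
  next
    assume "M = Suc (card {v \<in> X. R v z1})"
    moreover have "L z1 - Suc (L y) = card {v \<in> X. Suc (L y) \<le> L v \<and> L v < L z1}"
      by (rule card_positions[OF L(1), symmetric]) (use LE_pos(2)[OF L(1) zX(1)] in auto)
    moreover have "\<dots> \<le> card {v \<in> X. R v z1}"
      by (rule card_mono) (use finite_X between in auto)
    ultimately show ?thesis using y(2) by linarith
  qed
  then show "L \<in> LE \<and> (\<exists>x\<in>X. L x < L z1 \<and> move (L x) (L z1) L \<in> gaps (Suc (Suc p)) q \<and> L z1 - L x \<le> M)"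
    using L D y by auto
qed

section \<open>Widening the first gap from behind the third mark\<close>

abbreviation "up v \<equiv> R z2 v \<or> R z3 v"

definition high :: "nat \<Rightarrow> nat \<Rightarrow> ('a \<Rightarrow> nat) set" where
  "high p q = {L \<in> tight p q. \<forall>u\<in>X. L u < L z1 \<longrightarrow> R u z1}"

text \<open>Otherwise every element after \<open>z2\<close> in \<open>L\<close> comes after
  \<open>z2\<close> in \<open>L1\<close> too, and every element before \<open>z1\<close> in
  \<open>L\<close> precedes \<open>z1\<close> in \<open>L1\<close>. Then the first gap of
  \<open>L1\<close> could not be larger than that of \<open>L\<close>.\<close>

lemma high_escape:
  assumes L: "L \<in> high (Suc p) q" and L1: "L1 \<in> gaps (Suc (Suc p)) q" and q: "q \<ge> 1"
  obtains w where "w \<in> X" "L z3 < L w" "\<not> up w" "\<And>v. v \<in> X \<Longrightarrow> L z3 < L v \<Longrightarrow> L v < L w \<Longrightarrow> up v"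
proof -
  have L': "L \<in> LE" "L z2 = L z1 + Suc p" "L z3 = L z2 + q"
    and above: "\<And>v. v \<in> X \<Longrightarrow> L z2 < L v \<Longrightarrow> L v < L z3 \<Longrightarrow> R z2 v"
    and below: "\<And>u. u \<in> X \<Longrightarrow> L u < L z1 \<Longrightarrow> R u z1"
    using L unfolding high_def tight_def gaps_def by blast+
  have L1': "L1 \<in> LE" "L1 z2 = L1 z1 + Suc (Suc p)" "L1 z3 = L1 z2 + q" using L1 unfolding gaps_def by auto
  have "\<exists>w\<in>X. L z3 < L w \<and> \<not> up w"
  proof (rule ccontr)
    assume no: "\<not> ?thesis"
    have after: "L1 z2 < L1 v" if v: "v \<in> X" "L z2 < L v" for v
    proof -
      have "v = z3 \<or> up v"
      proof (cases "L v" "L z3" rule: linorder_cases)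
        case less
        then show ?thesis using above[OF v] by simp
      next
        case equal
        then show ?thesis using LE_inj[OF L'(1) v(1) zX(3)] by simp
      next
        case greater
        then show ?thesis using no v(1) by blast
      qed
      then show ?thesis
        using LE_less[OF L1'(1) zX(2) v(1)] LE_less[OF L1'(1) zX(3) v(1)] L1'(3) q by fastforce
    qed
    have "Suc (card X) - Suc (L z2) = card {v \<in> X. Suc (L z2) \<le> L v \<and> L v < Suc (card X)}"
      by (rule card_positions[OF L'(1), symmetric]) auto
    also have "\<dots> \<le> card {v \<in> X. Suc (L1 z2) \<le> L1 v \<and> L1 v < Suc (card X)}"
      by (rule card_mono) (use finite_X after LE_pos[OF L1'(1)] in \<open>auto simp: Suc_le_eq less_Suc_eq_le\<close>)
    also have "\<dots> = Suc (card X) - Suc (L1 z2)"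
      by (rule card_positions[OF L1'(1)]) auto
    finally have "L1 z2 \<le> L z2" using LE_pos(2)[OF L'(1) zX(2)] LE_pos(2)[OF L1'(1) zX(2)] by linarith
    moreover have "L z1 - 1 = card {v \<in> X. 1 \<le> L v \<and> L v < L z1}"
      by (rule card_positions[OF L'(1), symmetric]) (use LE_pos(2)[OF L'(1) zX(1)] in auto)
    moreover have "\<dots> \<le> card {v \<in> X. 1 \<le> L1 v \<and> L1 v < L1 z1}"
      by (rule card_mono) (use finite_X below LE_less[OF L1'(1) _ zX(1)] LE_pos(1)[OF L1'(1)] in auto)
    moreover have "\<dots> = L1 z1 - 1"
      by (rule card_positions[OF L1'(1)]) (use LE_pos(2)[OF L1'(1) zX(1)] in auto)
    moreover have "1 \<le> L z1" "1 \<le> L1 z1" using LE_pos(1) L'(1) L1'(1) zX(1) by blast+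
    ultimately show False using L'(2) L1'(2) by linarith
  qed
  then obtain w0 where w0: "w0 \<in> X" "L z3 < L w0 \<and> \<not> up w0" by blast
  obtain w where w: "w \<in> X" "L z3 < L w \<and> \<not> up w"
    and first: "\<And>v. v \<in> X \<Longrightarrow> L z3 < L v \<and> \<not> up v \<Longrightarrow> L w \<le> L v"
    using exists_first[of w0 "\<lambda>v. L z3 < L v \<and> \<not> up v" L] w0 by metis
  have "up v" if "v \<in> X" "L z3 < L v" "L v < L w" for v
    using first[OF that(1)] that(2,3) by (metis leD)
  then show ?thesis using that[OF w(1)] w(2) by blast
qed

text \<open>What lies between \<open>z2\<close> and \<open>w\<close> belongs to the up-set of
  \<open>z2\<close> and \<open>z3\<close>, while \<open>w\<close> does not; so nothing passed is
  below \<open>w\<close>. The move pushes \<open>z2\<close> and \<open>z3\<close> together and keeps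
  the second gap.\<close>

lemma escape_move:
  assumes L: "L \<in> LE" "L z2 = L z1 + Suc p" "L z3 = L z2 + q" and q: "q \<ge> 1"
    and above: "\<And>v. v \<in> X \<Longrightarrow> L z2 < L v \<Longrightarrow> L v < L z3 \<Longrightarrow> R z2 v"
    and w: "w \<in> X" "L z3 < L w" "\<not> up w" "\<And>v. v \<in> X \<Longrightarrow> L z3 < L v \<Longrightarrow> L v < L w \<Longrightarrow> up v"
  shows "move (L w) (L z2) L \<in> gaps (Suc (Suc p)) q" "\<And>v. v \<in> X \<Longrightarrow> L z2 \<le> L v \<Longrightarrow> L v < L w \<Longrightarrow> \<not> R v w"
proof -
  show n: "\<not> R v w" if v: "v \<in> X" "L z2 \<le> L v" "L v < L w" for v
  proof -
    have "v = z2 \<or> v = z3 \<or> up v"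
    proof (cases "L v" "L z3" rule: linorder_cases)
      case less
      then show ?thesis using above[OF v(1)] v(2) LE_inj[OF L(1) v(1) zX(2)] by fastforce
    next
      case equal
      then show ?thesis using LE_inj[OF L(1) v(1) zX(3)] by simp
    next
      case greater
      then show ?thesis using w(4)[OF v(1) _ v(3)] by blast
    qed
    then show ?thesis
      using w(3) trn[of z2 v w, OF _ _ zX(2) v(1) w(1)] trn[of z3 v w, OF _ _ zX(3) v(1) w(1)] by blast
  qed
  have "move (L w) (L z2) L \<in> LE"
    by (rule move_LE[OF L(1) w(1) refl LE_pos(3)[OF L(1) zX(2)] n]) (use w L in auto)
  then show "move (L w) (L z2) L \<in> gaps (Suc (Suc p)) q"
    using L w zX q by (simp add: gaps_def move_apply shift_def)
qed

lemma highD: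
  assumes "L \<in> high p q"
  shows "L \<in> LE" "L z2 = L z1 + p" "L z3 = L z2 + q" "\<And>v. v \<in> X \<Longrightarrow> L z2 < L v \<Longrightarrow> L v < L z3 \<Longrightarrow> R z2 v"
    "L z3 < card X" "\<And>v. v \<in> X \<Longrightarrow> L v = Suc (L z3) \<Longrightarrow> R z2 v"
  using assms unfolding high_def tight_def gaps_def by blast+

lemma card_high_thin:
  assumes t: "thin_wrt X R Z t" and L1: "L1 \<in> gaps (Suc (Suc p)) q" and q: "q \<ge> 1"
  shows "card (high (Suc p) q) \<le> t * card (gaps (Suc (Suc p)) q)"
proof (rule card_down_moves[OF zX(2) finite_gaps])
  fix L assume L: "L \<in> high (Suc p) q"
  note h = highD[OF L]
  obtain w where w: "w \<in> X" "L z3 < L w" "\<not> up w" "\<And>v. v \<in> X \<Longrightarrow> L z3 < L v \<Longrightarrow> L v < L w \<Longrightarrow> up v"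
    using high_escape[OF L L1 q] by blast
  note m = escape_move[OF h(1-3) q h(4) w]
  have "w \<notin> Z" using w h by auto
  then have "L w - L z2 \<le> t" using thin_below[OF t h(1) w(1) _ LE_pos(1)[OF h(1) zX(2)] m(2)] by blast
  moreover have "L z2 < L w" using w h by linarith
  ultimately show "L \<in> LE \<and> (\<exists>x\<in>X. L z2 < L x \<and> move (L x) (L z2) L \<in> gaps (Suc (Suc p)) q \<and> L x - L z2 \<le> t)"
    using h(1) w(1) m(1) by blast
qed

text \<open>In \<open>runs p q i\<close> exactly \<open>i\<close> elements of the up-set generated by \<open>z2\<close> and \<open>z3\<close> follow \<open>z3\<close>.
  Swapping adjacent elements moves elements above \<open>z2\<close> towards the end of this run. If the last
  one is above \<open>z2\<close>, then it can serve to recover the linear extension after the element that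
  ends the run has been moved below \<open>z2\<close>.\<close>

definition runs :: "nat \<Rightarrow> nat \<Rightarrow> nat \<Rightarrow> ('a \<Rightarrow> nat) set" where
  "runs p q i = {L \<in> gaps p q. (\<forall>v\<in>X. L z2 < L v \<and> L v < L z3 \<longrightarrow> R z2 v)
     \<and> (\<forall>v\<in>X. L z3 < L v \<and> L v \<le> L z3 + i \<longrightarrow> up v) \<and> (\<exists>w\<in>X. L w = Suc (L z3 + i) \<and> \<not> up w)}"
definition marked_runs :: "nat \<Rightarrow> nat \<Rightarrow> nat \<Rightarrow> nat \<Rightarrow> ('a \<Rightarrow> nat) set" where
  "marked_runs p q i j = {L \<in> runs p q i. \<exists>x\<in>X. L x = L z3 + j \<and> R z2 x}"

lemma finite_marked_runs: "finite (marked_runs p q i j)"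
  using finite_gaps unfolding marked_runs_def runs_def by simp

text \<open>It is enough to compare the two set differences. If position \<open>j\<close> of the run
  is above \<open>z2\<close> and position \<open>j + 1\<close> is not, the two elements are
  incomparable, and exchanging them reverses the pattern injectively.\<close>

lemma card_marked_runs_Suc:
  assumes j: "1 \<le> j" "j < i"
  shows "card (marked_runs p q i j) \<le> card (marked_runs p q i (Suc j))"
proof -
  let ?A = "marked_runs p q i j" and ?B = "marked_runs p q i (Suc j)"
  let ?m = "\<lambda>L. move (L z3 + j) (Suc (L z3 + j)) L"
  have key: "?m L \<in> ?B - ?A \<and> ?m L z3 = L z3 \<and> L \<in> LE" if L: "L \<in> ?A - ?B" for L
  proof -
    have h: "L \<in> LE" "L z2 = L z1 + p" "L z3 = L z2 + q"
        "\<And>v. v \<in> X \<Longrightarrow> L z2 < L v \<Longrightarrow> L v < L z3 \<Longrightarrow> R z2 v" "\<And>v. v \<in> X \<Longrightarrow> L z3 < L v \<Longrightarrow> L v \<le> L z3 + i \<Longrightarrow> up v"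
      using L unfolding marked_runs_def runs_def gaps_def by blast+
    obtain w where w: "w \<in> X" "L w = Suc (L z3 + i)" "\<not> up w" using L unfolding marked_runs_def runs_def by blast
    obtain x where x: "x \<in> X" "L x = L z3 + j" "R z2 x" using L unfolding marked_runs_def by blast
    have "Suc (L z3 + j) \<in> {1..card X}" using LE_pos(2)[OF h(1) w(1)] w(2) j by simp
    then obtain y where y: "y \<in> X" "L y = Suc (L z3 + j)" by (rule LE_surj[OF h(1)])
    have ny: "\<not> R z2 y" using L y unfolding marked_runs_def by auto
    have nR: "\<not> R x v" if v: "v \<in> X" "L z3 + j < L v" "L v \<le> Suc (L z3 + j)" for v
    proof -
      have "L v = L y" using v y by simp
      then have "v = y" using LE_inj[OF h(1) v(1) y(1)] by simp
      then show ?thesis using trn[OF x(3) _ zX(2) x(1) y(1)] ny by blast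
    qed
    have mL: "?m L \<in> LE"
      by (rule move_LE[OF h(1) x(1,2) \<open>Suc (L z3 + j) \<in> {1..card X}\<close> _ nR]) auto
    have mz: "?m L z1 = L z1" "?m L z2 = L z2" "?m L z3 = L z3" using h j zX by (auto simp: move_apply shift_def)
    have mv: "?m L v = (if L v = L z3 + j then Suc (L z3 + j) else if L v = Suc (L z3 + j) then L z3 + j else L v)"
      if "v \<in> X" for v using that by (simp add: move_apply shift_def)
    have "?m L \<in> runs p q i"
      unfolding runs_def mem_Collect_eq mz
    proof (intro conjI ballI impI)
      show "?m L \<in> gaps p q" using mL h mz by (simp add: gaps_def)
      show "R z2 v" if "v \<in> X" "L z2 < ?m L v \<and> ?m L v < L z3" for v
        using h(4)[OF that(1)] that(2) j unfolding mv[OF that(1)] by (auto split: if_splits)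
      show "up v" if "v \<in> X" "L z3 < ?m L v \<and> ?m L v \<le> L z3 + i" for v
        using h(5)[OF that(1)] that(2) j unfolding mv[OF that(1)] by (auto split: if_splits)
      show "\<exists>w\<in>X. ?m L w = Suc (L z3 + i) \<and> \<not> up w"
        using w j by (intro bexI[of _ w]) (auto simp: mv)
    qed
    moreover have "?m L x = Suc (L z3 + j)" "?m L y = L z3 + j" using mv x y by auto
    ultimately have "?m L \<in> ?B" using x mz unfolding marked_runs_def by auto
    moreover have "?m L \<notin> ?A"
    proof
      assume "?m L \<in> ?A"
      then obtain v where v: "v \<in> X" "?m L v = ?m L y" "R z2 v"
        using mz \<open>?m L y = L z3 + j\<close> unfolding marked_runs_def by auto
      then have "v = y" using LE_inj[OF mL v(1) y(1)] by simp
      then show False using ny v by blast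
    qed
    ultimately show ?thesis using mz h(1) by blast
  qed
  have "card (?A - ?B) \<le> card (?B - ?A)"
  proof (rule card_inj_on_le[of ?m])
    show "inj_on ?m (?A - ?B)"
    proof (rule inj_onI)
      fix L L' assume L: "L \<in> ?A - ?B" "L' \<in> ?A - ?B" and eq: "?m L = ?m L'"
      have "L z3 = L' z3" using key[OF L(1)] key[OF L(2)] eq by metis
      then show "L = L'" using key[OF L(1)] key[OF L(2)] eq move_move by metis
    qed
  qed (use key finite_marked_runs in auto)
  moreover have "card ?A = card (?A \<inter> ?B) + card (?A - ?B)" "card ?B = card (?B \<inter> ?A) + card (?B - ?A)"
    using finite_marked_runs by (simp_all add: card_Int_Diff)
  ultimately show ?thesis by (simp add: Int_commute)
qed

lemma card_marked_runs:
  assumes "1 \<le> i"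
  shows "card (marked_runs p q i 1) \<le> card (marked_runs p q i i)"
proof -
  have "card (marked_runs p q i 1) \<le> card (marked_runs p q i j)" if "1 \<le> j" "j \<le> i" for j
    using that
  proof (induction j rule: dec_induct)
    case (step j)
    then show ?case using card_marked_runs_Suc[of j i p q] by simp
  qed simp
  then show ?thesis using assms by simp
qed

text \<open>The moved element may travel arbitrarily far, so its distance is useless as a code. The
  code is an element above \<open>z2\<close> instead; its position also reveals the length
  \<open>i\<close> of the run, so the summation over \<open>i\<close> costs nothing.\<close>

lemma card_high_flat:
  assumes L1: "L1 \<in> gaps (Suc (Suc p)) q" and q: "q \<ge> 1"
  shows "card (high (Suc p) q) \<le> card ({v \<in> X. R z2 v} - {z3}) * card (gaps (Suc (Suc p)) q)"
proof -
  let ?H = "marked_runs (Suc p) q" and ?I = "{1..card X}"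
  have "high (Suc p) q \<subseteq> (\<Union>i\<in>?I. ?H i 1)"
  proof
    fix L assume L: "L \<in> high (Suc p) q"
    note h = highD[OF L]
    obtain w where w: "w \<in> X" "L z3 < L w" "\<not> up w" "\<And>v. v \<in> X \<Longrightarrow> L z3 < L v \<Longrightarrow> L v < L w \<Longrightarrow> up v"
      using high_escape[OF L L1 q] by blast
    have "Suc (L z3) \<in> {1..card X}" using h(5) by simp
    then obtain x where x: "x \<in> X" "L x = Suc (L z3)" by (rule LE_surj[OF h(1)])
    have xz: "R z2 x" by (rule h(6)[OF x])
    have "L w \<noteq> Suc (L z3)" using h(6)[OF w(1)] w(3) by blast
    define i where "i = L w - L z3 - 1"
    have i: "L w = Suc (L z3 + i)" "1 \<le> i" using w(2) \<open>L w \<noteq> Suc (L z3)\<close> unfolding i_def by linarith+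
    have "L \<in> runs (Suc p) q i" unfolding runs_def gaps_def using h(1-4) w i by auto
    then have "L \<in> ?H i 1" using x xz unfolding marked_runs_def by auto
    moreover have "i \<in> ?I" using i LE_pos(2)[OF h(1) w(1)] by simp
    ultimately show "L \<in> (\<Union>i\<in>?I. ?H i 1)" by blast
  qed
  then have "card (high (Suc p) q) \<le> card (\<Union>i\<in>?I. ?H i 1)"
    by (rule card_mono[rotated]) (use finite_marked_runs in auto)
  also have "\<dots> \<le> (\<Sum>i\<in>?I. card (?H i 1))" by (rule card_UN_le) simp
  also have "\<dots> \<le> (\<Sum>i\<in>?I. card (?H i i))" by (rule sum_mono) (use card_marked_runs in auto)
  also have "\<dots> = card (Sigma ?I (\<lambda>i. ?H i i))" by (simp add: card_SigmaI finite_marked_runs)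
  also have "\<dots> \<le> card ({v \<in> X. R z2 v} - {z3}) * card (gaps (Suc (Suc p)) q)"
  proof (rule card_le_decode[where \<Phi> = "\<lambda>(i, L). move (Suc (L z3 + i)) (L z2) L"
        and code = "\<lambda>(i, L). SOME x. x \<in> X \<and> L x = L z3 + i \<and> R z2 x"
        and I = "\<lambda>_. {v \<in> X. R z2 v} - {z3}"
        and g = "\<lambda>L' x. (L' x - L' z3, move (L' z2 - 1) (L' x) L')", OF finite_gaps])
    fix iL assume "iL \<in> Sigma ?I (\<lambda>i. ?H i i)"
    then obtain i L where iL: "iL = (i, L)" "1 \<le> i" "L \<in> ?H i i" by auto
    have h: "L \<in> LE" "L z2 = L z1 + Suc p" "L z3 = L z2 + q"
        "\<And>v. v \<in> X \<Longrightarrow> L z2 < L v \<Longrightarrow> L v < L z3 \<Longrightarrow> R z2 v" "\<And>v. v \<in> X \<Longrightarrow> L z3 < L v \<Longrightarrow> L v \<le> L z3 + i \<Longrightarrow> up v"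
      using iL(3) unfolding marked_runs_def runs_def gaps_def by blast+
    obtain w where w: "w \<in> X" "L w = Suc (L z3 + i)" "\<not> up w" using iL(3) unfolding marked_runs_def runs_def by blast
    define x where "x = (SOME x. x \<in> X \<and> L x = L z3 + i \<and> R z2 x)"
    have "x \<in> X \<and> L x = L z3 + i \<and> R z2 x"
      unfolding x_def by (rule someI_ex) (use iL(3) in \<open>auto simp: marked_runs_def\<close>)
    then have x: "x \<in> X" "L x = L z3 + i" "R z2 x" by auto
    let ?m = "move (Suc (L z3 + i)) (L z2) L"
    have m: "?m \<in> gaps (Suc (Suc p)) q"
      using escape_move(1)[OF h(1-3) q h(4) w(1) _ w(3)] h(5) w(2) by simp
    have mz: "?m z2 = Suc (L z2)" "?m z3 = Suc (L z3)" "?m x = Suc (L z3 + i)"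
      using h zX x by (auto simp: move_apply shift_def)
    show "(case iL of (i, L) \<Rightarrow> move (Suc (L z3 + i)) (L z2) L) \<in> gaps (Suc (Suc p)) q" using m iL by simp
    have "x \<noteq> z3" using x iL(2) by auto
    then show "(case iL of (i, L) \<Rightarrow> SOME x. x \<in> X \<and> L x = L z3 + i \<and> R z2 x) \<in> {v \<in> X. R z2 v} - {z3}"
      using x iL by (simp add: x_def[symmetric])
    show "((case iL of (i, L) \<Rightarrow> move (Suc (L z3 + i)) (L z2) L) (case iL of (i, L) \<Rightarrow> SOME x. x \<in> X \<and> L x = L z3 + i \<and> R z2 x)
        - (case iL of (i, L) \<Rightarrow> move (Suc (L z3 + i)) (L z2) L) z3,
        move ((case iL of (i, L) \<Rightarrow> move (Suc (L z3 + i)) (L z2) L) z2 - 1)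
         ((case iL of (i, L) \<Rightarrow> move (Suc (L z3 + i)) (L z2) L) (case iL of (i, L) \<Rightarrow> SOME x. x \<in> X \<and> L x = L z3 + i \<and> R z2 x))
         (case iL of (i, L) \<Rightarrow> move (Suc (L z3 + i)) (L z2) L)) = iL"
      using mz move_move[OF h(1)] iL by (simp add: x_def[symmetric])
  qed (use finite_X in auto)
  finally show ?thesis .
qed

lemma card_tight_le:
  "card (tight (Suc p) q) \<le> card {L \<in> gaps (Suc p) q. \<exists>u\<in>X. L u < L z1 \<and> \<not> R u z1} + card (high (Suc p) q)"
proof -
  have "tight (Suc p) q \<subseteq> {L \<in> gaps (Suc p) q. \<exists>u\<in>X. L u < L z1 \<and> \<not> R u z1} \<union> high (Suc p) q"
    unfolding high_def tight_def by blast
  then have "card (tight (Suc p) q) \<le> card ({L \<in> gaps (Suc p) q. \<exists>u\<in>X. L u < L z1 \<and> \<not> R u z1} \<union> high (Suc p) q)"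
    by (rule card_mono[rotated]) (use finite_gaps finite_tight in \<open>simp add: high_def\<close>)
  then show ?thesis using card_Un_le le_trans by blast
qed

section \<open>Combining the estimates\<close>

abbreviation "good p q \<equiv> {L \<in> gaps (Suc p) (Suc q). \<exists>y\<in>X. L z2 < L y \<and> L y < L z3 \<and> \<not> R z2 y}"
abbreviation "bad p q \<equiv> {L \<in> gaps (Suc p) (Suc q). \<forall>y\<in>X. L z2 < L y \<and> L y < L z3 \<longrightarrow> R z2 y}"

lemma card_gaps_le: "card (gaps (Suc p) (Suc q)) \<le> card (good p q) + card (bad p q)"
proof -
  have "card (gaps (Suc p) (Suc q)) = card (good p q \<union> bad p q)" by (rule arg_cong[where f = card]) blast
  also have "\<dots> \<le> card (good p q) + card (bad p q)" by (rule card_Un_le)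
  finally show ?thesis .
qed

text \<open>Bounds \<open>q\<close> by \<open>t\<close> in the flat case as soon as a bad extension
  exists.\<close>

lemma bad_above:
  assumes "L \<in> bad p q"
  shows "q \<le> card ({v \<in> X. R z2 v} - {z3})"
proof -
  have L: "L \<in> LE" "L z3 = L z2 + Suc q" "\<And>y. y \<in> X \<Longrightarrow> L z2 < L y \<Longrightarrow> L y < L z3 \<Longrightarrow> R z2 y"
    using assms unfolding gaps_def by blast+
  have "L z3 - Suc (L z2) = card {v \<in> X. Suc (L z2) \<le> L v \<and> L v < L z3}"
    by (rule card_positions[OF L(1), symmetric]) (use LE_pos(2)[OF L(1) zX(3)] in auto)
  also have "\<dots> \<le> card ({v \<in> X. R z2 v} - {z3})"
    by (rule card_mono) (use finite_X L(3) in auto)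
  finally show ?thesis using L(2) by simp
qed

lemma flat_bounds:
  assumes "flat_wrt X R Z t"
  shows "card {v \<in> X. R z2 v} + card {v \<in> X. R v z2} \<le> t" "card {v \<in> X. R v z1} \<le> t"
proof -
  have "card {v \<in> X. R z2 v} + card {v \<in> X. R v z2} = card ({v \<in> X. R z2 v} \<union> {v \<in> X. R v z2})"
    by (rule card_Un_disjoint[symmetric]) (use finite_X trn[of z2 _ z2] irr zX in auto)
  also have "\<dots> \<le> card {v \<in> X. comparable R z2 v}"
    by (rule card_mono) (use finite_X irr zX in \<open>auto simp: comparable_def\<close>)
  also have "\<dots> \<le> t" using assms unfolding flat_wrt_def by simp
  finally show "card {v \<in> X. R z2 v} + card {v \<in> X. R v z2} \<le> t" .
  have "card {v \<in> X. R v z1} \<le> card {v \<in> X. comparable R z1 v}"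
    by (rule card_mono) (use finite_X irr zX in \<open>auto simp: comparable_def\<close>)
  also have "\<dots> \<le> t" using assms unfolding flat_wrt_def by simp
  finally show "card {v \<in> X. R v z1} \<le> t" .
qed

text \<open>A good extension takes one move, a bad one two: behind \<open>z3\<close> first, then
  across \<open>z1\<close> or \<open>z2\<close>. In the flat case the codes are counted by the
  elements below \<open>z1\<close> and above \<open>z2\<close>. The second alternative is the only
  configuration that misses the first bound, by one: \<open>q = 1\<close>, \<open>z2\<close> and
  \<open>z3\<close> incomparable, \<open>t\<close> elements below \<open>z1\<close> and
  \<open>t\<close> above \<open>z2\<close>. Flatness then leaves nothing below
  \<open>z2\<close>.\<close>

lemma card_gaps_bound:
  assumes t: "t \<ge> 1" and H: "thin_wrt X R Z t \<or> flat_wrt X R Z t" and q: "q \<ge> 1"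
    and ne: "gaps (Suc (Suc p)) q \<noteq> {}"
  defines "d \<equiv> card (gaps (Suc (Suc p)) q)"
  shows "card (gaps (Suc p) (Suc q)) \<le> min q t * (2 * t + 1) * d \<or>
    (card (gaps (Suc p) (Suc q)) \<le> (2 * t + 2) * d \<and> card {v \<in> X. R v z2} = 0)"
proof -
  obtain L1 where L1: "L1 \<in> gaps (Suc (Suc p)) q" using ne by blast
  let ?e = "card (gaps (Suc p) (Suc q))" and ?T = "card (tight (Suc p) q)"
  let ?p = "card {v \<in> X. R z2 v}" and ?q1 = "card {v \<in> X. R v z1}"
  note e = card_gaps_le[of p q] and T = card_tight_le[of p q]
  show ?thesis
  proof (cases "thin_wrt X R Z t")
    case True
    have "card (good p q) \<le> min q t * d" unfolding d_def by (rule card_good[where t = t]) (use True in simp)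
    moreover have "card (bad p q) \<le> min q t * ?T" by (rule card_bad[OF L1 q, where t = t]) (use True in simp)
    moreover have "?T \<le> t * d + t * d"
      using T card_low[of t t p q] card_high_thin[OF True L1 q] True unfolding d_def by linarith
    then have "min q t * ?T \<le> min q t * (t * d + t * d)" by (rule mult_le_mono2)
    ultimately have "?e \<le> min q t * d + min q t * (t * d + t * d)" using e by linarith
    also have "\<dots> = min q t * (2 * t + 1) * d" by (simp add: algebra_simps)
    finally show ?thesis ..
  next
    case False
    then have flat: "flat_wrt X R Z t" using H by blast
    note fb = flat_bounds[OF flat]
    have g: "card (good p q) \<le> min q (Suc ?p) * d" unfolding d_def by (rule card_good) simp
    show ?thesis
    proof (cases "bad p q = {}")
      case True
      have "min q (Suc ?p) \<le> min q t * (2 * t + 1)"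
      proof (cases "q \<le> t")
        case False
        have "Suc ?p \<le> t + t" using fb(1) t by linarith
        also have "\<dots> \<le> t * (2 * t + 1)" using t by (simp add: algebra_simps)
        finally show ?thesis using False by (simp add: min_def)
      qed (simp add: min_def)
      then have "min q (Suc ?p) * d \<le> min q t * (2 * t + 1) * d" by (rule mult_le_mono1)
      moreover have "card (bad p q) = 0" by (simp only: True card.empty)
      ultimately show ?thesis using e g by linarith
    next
      case False
      then obtain L where L: "L \<in> bad p q" by blast
      have qp: "q \<le> card ({v \<in> X. R z2 v} - {z3})" by (rule bad_above[OF L])
      also have "\<dots> \<le> ?p" by (rule card_mono) (use finite_X in auto)
      finally have qt: "q \<le> t" "q \<le> ?p" using fb by linarith+
      have low: "?T \<le> Suc ?q1 * d + card ({v \<in> X. R z2 v} - {z3}) * d"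
        using T card_low[of "Suc ?q1" t p q] card_high_flat[OF L1 q] unfolding d_def by linarith
      show ?thesis
      proof (cases "R z2 z3")
        case True
        \<comment> \<open>\<open>z3\<close> is above \<open>z2\<close> but never serves as a code;
          this compensates the extra code in the count for moves across \<open>z1\<close>.\<close>
        have "card ({v \<in> X. R z2 v} - {z3}) = ?p - 1" using True finite_X zX by simp
        moreover have "?p \<ge> 1" using qt q by linarith
        ultimately have "Suc ?q1 + card ({v \<in> X. R z2 v} - {z3}) \<le> 2 * t" using fb by linarith
        then have "(Suc ?q1 + card ({v \<in> X. R z2 v} - {z3})) * d \<le> 2 * t * d" by (rule mult_le_mono1)
        then have "?T \<le> 2 * t * d" using low unfolding add_mult_distrib by linarith
        then have "q * ?T \<le> q * (2 * t * d)" by (rule mult_le_mono2)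
        moreover have "card (bad p q) \<le> q * ?T" using card_bad[OF L1 q, of q t p] by simp
        moreover have "min q (Suc ?p) * d \<le> q * d" by simp
        ultimately have "?e \<le> q * d + q * (2 * t * d)" using e g by linarith
        also have "\<dots> = min q t * (2 * t + 1) * d" using qt by (simp add: algebra_simps)
        finally show ?thesis ..
      next
        case False
        \<comment> \<open>For incomparable \<open>z2\<close> and \<open>z3\<close> the move behind
          \<open>z3\<close> has length 1, so it is undone without a code and the factor
          \<open>q\<close> disappears.\<close>
        have "card (bad p q) \<le> ?T" using card_bad[OF L1 q, of 1 t p] False q by simp
        moreover have "{v \<in> X. R z2 v} - {z3} = {v \<in> X. R z2 v}" using False by auto
        then have "?T \<le> Suc ?q1 * d + ?p * d" using low by (simp only:)
        moreover have "min q (Suc ?p) * d \<le> q * d" by (rule mult_le_mono1) simp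
        ultimately have "?e \<le> q * d + (Suc ?q1 * d + ?p * d)" using e g by linarith
        also have "\<dots> = (q + Suc ?q1 + ?p) * d" by (simp add: algebra_simps)
        finally have ee: "?e \<le> (q + Suc ?q1 + ?p) * d" .
        show ?thesis
        proof (cases "q = 1 \<and> ?q1 = t \<and> ?p = t")
          case True
          then have "card {v \<in> X. R v z2} = 0" using fb(1) by linarith
          then show ?thesis using ee True by (simp add: algebra_simps)
        next
          case False
          have "Suc ?q1 + ?p \<le> q * (2 * t)"
          proof (cases "q = 1")
            case True
            then show ?thesis using False fb by (simp only: mult_1) linarith
          next
            case False
            then have "2 * (2 * t) \<le> q * (2 * t)" using q by (intro mult_le_mono1) simp
            then show ?thesis using fb t by linarith
          qed
          then have "q + Suc ?q1 + ?p \<le> min q t * (2 * t + 1)" using qt by (simp add: algebra_simps)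
          then have "(q + Suc ?q1 + ?p) * d \<le> min q t * (2 * t + 1) * d" by (rule mult_le_mono1)
          then show ?thesis using ee by linarith
        qed
      qed
    qed
  qed
qed

text \<open>With nothing above \<open>z2\<close> there is no bad extension, and in a good one the
  element directly after \<open>z2\<close> can be moved.\<close>

lemma card_gaps_no_above:
  assumes q: "q \<ge> 1" and p2: "card {v \<in> X. R z2 v} = 0"
  shows "card (gaps (Suc p) (Suc q)) \<le> card (gaps (Suc (Suc p)) q)"
proof -
  have "{v \<in> X. R z2 v} = {}" using p2 finite_X by simp
  then have "card ({v \<in> X. R z2 v} - {z3}) = 0" by (simp only: empty_Diff card.empty)
  then have "L \<notin> bad p q" for L using bad_above[of L p q] q by linarith
  then have "bad p q = {}" by blast
  then have "card (bad p q) = 0" by (simp only: card.empty)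
  moreover have "card (good p q) \<le> min q 1 * card (gaps (Suc (Suc p)) q)"
    by (rule card_good[where t = 0]) (use p2 in simp)
  moreover have "min q 1 * card (gaps (Suc (Suc p)) q) = card (gaps (Suc (Suc p)) q)" using q by simp
  ultimately show ?thesis using card_gaps_le[of p q] by linarith
qed

end

section \<open>Duality and the final inequality\<close>

lemma three_marked_dual:
  assumes "three_marked X R z1 z2 z3"
  shows "three_marked X (\<lambda>u v. R v u) z3 z2 z1"
  using assms unfolding three_marked_def irreflp_on_def transp_on_def by blast

lemma card_gaps_dual_le:
  assumes "three_marked X R z1 z2 z3"
  shows "card (three_marked.gaps X R z1 z2 z3 p q) \<le> card (three_marked.gaps X (\<lambda>u v. R v u) z3 z2 z1 q p)"
proof -
  interpret three_marked X R z1 z2 z3 by (rule assms)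
  interpret op: three_marked X "\<lambda>u v. R v u" z3 z2 z1 by (rule three_marked_dual[OF assms])
  define rv where "rv L = restrict (\<lambda>u. Suc (card X) - L u) X" for L :: "'a \<Rightarrow> nat"
  show ?thesis
  proof (rule card_inj_on_le[of rv])
    show "inj_on rv (gaps p q)"
    proof (rule inj_onI, rule ext)
      fix L L' u assume L: "L \<in> gaps p q" "L' \<in> gaps p q" and eq: "rv L = rv L'"
      have LE: "L \<in> LE" "L' \<in> LE" using L unfolding gaps_def by auto
      show "L u = L' u"
      proof (cases "u \<in> X")
        case True
        have "rv L u = rv L' u" using eq by simp
        then show ?thesis using True LE_pos(2)[OF LE(1) True] LE_pos(2)[OF LE(2) True] by (simp add: rv_def)
      next
        case False
        then show ?thesis using linear_extensionD(3)[OF LE(1)] linear_extensionD(3)[OF LE(2)] by simp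
      qed
    qed
    show "rv ` gaps p q \<subseteq> op.gaps q p"
    proof (rule image_subsetI)
      fix L assume "L \<in> gaps p q"
      then have L: "L \<in> LE" "L z2 = L z1 + p" "L z3 = L z2 + q" unfolding gaps_def by auto
      have "bij_betw (\<lambda>i. Suc (card X) - i) {1..card X} {1..card X}"
        by (rule bij_betw_byWitness[of _ "\<lambda>i. Suc (card X) - i"]) auto
      then have "bij_betw ((\<lambda>i. Suc (card X) - i) \<circ> L) X {1..card X}"
        by (rule bij_betw_trans[OF linear_extensionD(1)[OF L(1)]])
      then have "bij_betw (rv L) X {1..card X}"
        by (rule bij_betw_cong[THEN iffD1, rotated]) (simp add: rv_def)
      moreover have "rv L u < rv L v" if "u \<in> X" "v \<in> X" "R v u" for u v
        using LE_less[OF L(1) that(2,1,3)] LE_pos(2)[OF L(1) that(1)] that by (simp add: rv_def)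
      ultimately have "rv L \<in> linear_extensions X (\<lambda>u v. R v u)"
        unfolding linear_extensions_def by (simp add: rv_def)
      moreover have "L z3 \<le> card X" by (rule LE_pos(2)[OF L(1) zX(3)])
      ultimately show "rv L \<in> op.gaps q p" using L zX unfolding op.gaps_def by (simp add: rv_def)
    qed
  qed (rule op.finite_gaps)
qed

lemma card_gaps_dual:
  assumes "three_marked X R z1 z2 z3"
  shows "card (three_marked.gaps X (\<lambda>u v. R v u) z3 z2 z1 q p) = card (three_marked.gaps X R z1 z2 z3 p q)"
  using card_gaps_dual_le[OF assms, of p q] card_gaps_dual_le[OF three_marked_dual[OF assms], of q p] by simp

text \<open>In an exceptional alternative one factor is \<open>2 * t + 2\<close>, but the other is
  1, and \<open>2 * t + 2\<close> is at most the square of \<open>2 * t + 1\<close>. For the regular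
  alternatives \<open>min l t * min k t\<close> is bounded by \<open>k * l\<close> and by
  \<open>t * t\<close>.\<close>

lemma product_bound:
  fixes e d f k l t :: nat
  assumes k: "k \<ge> 1" and l: "l \<ge> 1" and t: "t \<ge> 1"
    and d: "e \<le> min l t * (2 * t + 1) * d \<or> (e \<le> (2 * t + 2) * d \<and> e \<le> f)"
    and f: "e \<le> min k t * (2 * t + 1) * f \<or> (e \<le> (2 * t + 2) * f \<and> e \<le> d)"
  shows "e * e \<le> (k * l) * ((2 * t + 1) * (2 * t + 1)) * (d * f)" "e * e \<le> (t * t) * ((2 * t + 1) * (2 * t + 1)) * (d * f)"
proof -
  let ?s = "2 * t + 1"
  have key: "e * e \<le> c * (?s * ?s) * (d * f)" if c: "c \<ge> 1" "min l t * min k t \<le> c" for c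
  proof -
    have s: "2 * t + 2 \<le> ?s * ?s" using t by simp
    have exc: "e * e \<le> c * (?s * ?s) * (d * f)" if "e * e \<le> (2 * t + 2) * (d * f)"
    proof -
      have "(2 * t + 2) * (d * f) \<le> (1 * (?s * ?s)) * (d * f)" using s by (intro mult_le_mono1) simp
      also have "\<dots> \<le> (c * (?s * ?s)) * (d * f)" using c(1) by (intro mult_le_mono1)
      finally show ?thesis using that by linarith
    qed
    consider "e \<le> (2 * t + 2) * d" "e \<le> f" | "e \<le> (2 * t + 2) * f" "e \<le> d"
      | "e \<le> min l t * ?s * d" "e \<le> min k t * ?s * f" using d f by blast
    then show ?thesis
    proof cases
      case 1
      then have "e * e \<le> ((2 * t + 2) * d) * f" by (rule mult_le_mono)
      then show ?thesis by (intro exc) (simp only: mult.assoc)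
    next
      case 2
      then have "e * e \<le> ((2 * t + 2) * f) * d" by (rule mult_le_mono)
      then show ?thesis by (intro exc) (simp only: mult.assoc mult.commute[of d f])
    next
      case 3
      then have "e * e \<le> (min l t * ?s * d) * (min k t * ?s * f)" by (rule mult_le_mono)
      also have "\<dots> = (min l t * min k t) * (?s * ?s * (d * f))" by (simp only: mult_ac)
      also have "\<dots> \<le> c * (?s * ?s * (d * f))" using c(2) by (rule mult_le_mono1)
      finally show ?thesis by (simp only: mult_ac)
    qed
  qed
  show "e * e \<le> (k * l) * (?s * ?s) * (d * f)"
  proof (rule key)
    have "min l t * min k t \<le> l * k" by (rule mult_le_mono) simp_all
    then show "min l t * min k t \<le> k * l" by (simp add: mult.commute)
  qed (use k l in simp)
  show "e * e \<le> (t * t) * (?s * ?s) * (d * f)"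
    by (rule key) (use t in \<open>simp, intro mult_le_mono, simp_all\<close>)
qed

text \<open>The dual poset turns the bound by \<open>d\<close> into the one by \<open>f\<close>. In
  the exceptional configuration nothing is below \<open>z2\<close>, hence nothing above it in the
  dual, where \<open>card_gaps_no_above\<close> yields \<open>e \<le> f\<close>.\<close>

lemma (in three_marked) middle_bound:
  fixes k l t :: nat
  assumes k: "k \<ge> 1" and l: "l \<ge> 1" and t: "t \<ge> 1" and H: "thin_wrt X R Z t \<or> flat_wrt X R Z t"
    and d: "gaps (k + 2) l \<noteq> {}" and f: "gaps k (l + 2) \<noteq> {}"
  defines "e \<equiv> card (gaps (k + 1) (l + 1))"
  shows "e * e \<le> (k * l) * ((2 * t + 1) * (2 * t + 1)) * (card (gaps (k + 2) l) * card (gaps k (l + 2)))"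
    "e * e \<le> (t * t) * ((2 * t + 1) * (2 * t + 1)) * (card (gaps (k + 2) l) * card (gaps k (l + 2)))"
proof -
  have T: "three_marked X R z1 z2 z3" by unfold_locales
  interpret op: three_marked X "\<lambda>u v. R v u" z3 z2 z1 by (rule three_marked_dual[OF T])
  note dual = card_gaps_dual[OF T]
  have H': "thin_wrt X (\<lambda>u v. R v u) {z3, z2, z1} t \<or> flat_wrt X (\<lambda>u v. R v u) {z3, z2, z1} t"
    using H unfolding thin_wrt_def flat_wrt_def incomparable_def comparable_def
    by (simp add: insert_commute conj_commute disj_commute)
  have "card (op.gaps (l + 2) k) > 0" unfolding dual using f finite_gaps by (simp add: card_gt_0_iff)
  then have f': "op.gaps (l + 2) k \<noteq> {}" by auto
  have sums: "k + 2 = Suc (Suc k)" "l + 2 = Suc (Suc l)" "k + 1 = Suc k" "l + 1 = Suc l" by simp_all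
  note eqs = e_def sums
  have A: "e \<le> min l t * (2 * t + 1) * card (gaps (k + 2) l) \<or>
      (e \<le> (2 * t + 2) * card (gaps (k + 2) l) \<and> e \<le> card (gaps k (l + 2)))"
    using card_gaps_bound[OF t H l d[unfolded sums]] op.card_gaps_no_above[OF k, of l] unfolding dual eqs by blast
  have B: "e \<le> min k t * (2 * t + 1) * card (gaps k (l + 2)) \<or>
      (e \<le> (2 * t + 2) * card (gaps k (l + 2)) \<and> e \<le> card (gaps (k + 2) l))"
    using op.card_gaps_bound[OF t H' k f'[unfolded sums]] card_gaps_no_above[OF l, of k] unfolding dual eqs by blast
  show "e * e \<le> (k * l) * ((2 * t + 1) * (2 * t + 1)) * (card (gaps (k + 2) l) * card (gaps k (l + 2)))"
    "e * e \<le> (t * t) * ((2 * t + 1) * (2 * t + 1)) * (card (gaps (k + 2) l) * card (gaps k (l + 2)))"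
    by (rule product_bound[OF k l t A B])+
qed

lemma ratio_bound:
  fixes a b c d e f m :: real
  assumes AF: "a * (e + sqrt (d * f)) \<le> 2 * b * c" and a: "a \<ge> 0" and m: "m > 0" and ee: "e \<le> m * sqrt (d * f)"
  shows "b * c \<ge> (1 / 2 + 1 / (2 * m)) * (a * e)"
proof -
  have "e / m \<le> sqrt (d * f)" using ee m by (simp add: divide_le_eq mult.commute)
  then have "a * (e / m) \<le> a * sqrt (d * f)" using a by (rule mult_left_mono)
  then have "a * e + a * (e / m) \<le> 2 * b * c" using AF by (simp add: algebra_simps)
  then show ?thesis by (simp add: algebra_simps)
qed

theorem theorem5p5:
  fixes X :: "'a set" and R :: "'a \<Rightarrow> 'a \<Rightarrow> bool"
    and z1 z2 z3 :: 'a and A :: "'a set"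
    and t :: nat and k l :: int
    and F :: "int \<Rightarrow> int \<Rightarrow> real"
  assumes "finite X" and "irreflp_on X R" and "transp_on X R"
    and "z1 \<in> X" and "z2 \<in> X" and "z3 \<in> X"
    and "z1 \<noteq> z2" and "z1 \<noteq> z3" and "z2 \<noteq> z3"
    and "A = {z1, z2, z3}"
    and "t \<ge> 1"
    and "thin_wrt X R A t \<or> flat_wrt X R A t"
    and "k \<ge> 1" and "l \<ge> 1"
    and "\<And>a b. F a b = real (num_ext X R z1 z2 z3 a b)"
    and "F k (l + 2) * F (k + 2) l > 0"
  shows "F (k + 1) l * F k (l + 1) \<ge>
           max (1 / 2 + 1 / (2 * sqrt (real_of_int (k * l)) * (2 * real t + 1)))
               (1 / 2 + 1 / (2 * (2 * (real t)\<^sup>2 + real t)))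
           * (F k l * F (k + 1) (l + 1))"
proof -
  interpret three_marked X R z1 z2 z3 by unfold_locales (use assms in auto)
  define k' l' where "k' = nat k" and "l' = nat l"
  have kl: "k = int k'" "l = int l'" "k' \<ge> 1" "l' \<ge> 1" using assms(13,14) by (auto simp: k'_def l'_def)
  have F: "F (int p) (int q) = real (card (gaps p q))" for p q
    by (simp only: assms(15) num_ext_gaps)
  define a b c d e f where "a = F k l" "b = F (k + 1) l" "c = F k (l + 1)" "d = F (k + 2) l"
    "e = F (k + 1) (l + 1)" "f = F k (l + 2)"
  note v = this
  have vF: "a = real (card (gaps k' l'))" "b = real (card (gaps (k' + 1) l'))" "c = real (card (gaps k' (l' + 1)))"
    "d = real (card (gaps (k' + 2) l'))" "e = real (card (gaps (k' + 1) (l' + 1)))" "f = real (card (gaps k' (l' + 2)))"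
    unfolding v kl F[symmetric] by (simp_all add: algebra_simps)
  have "f * d > 0" using assms(16) unfolding v .
  moreover have "f \<ge> 0" "d \<ge> 0" unfolding vF by simp_all
  ultimately have pos: "d > 0" "f > 0" by (auto simp: zero_less_mult_iff)
  then have ne: "gaps (k' + 2) l' \<noteq> {}" "gaps k' (l' + 2) \<noteq> {}" unfolding vF by auto
  \<comment> \<open>The positive count \<open>F (k + 2) l\<close> supplies an extension with
    \<open>z1\<close> and \<open>z3\<close> at distance \<open>k + l + 2\<close>: the marks can be
    put in this order, and \<open>X\<close> has at least \<open>k + l + 3\<close> elements.\<close>
  then obtain L where L: "L \<in> LE" "L z2 = L z1 + (k' + 2)" "L z3 = L z2 + l'" unfolding gaps_def by blast
  interpret marked_poset X R z1 z2 z3 L by unfold_locales (use L kl in auto)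
  have n: "k' + l' + 3 \<le> card X" using L LE_pos(1)[OF L(1) zX(1)] LE_pos(2)[OF L(1) zX(3)] by linarith
  have AF: "a * (e + sqrt (d * f)) \<le> 2 * b * c"
    using count_inequality[OF kl(3,4) n] pos unfolding vF num_ext_gaps by simp
  note mb = middle_bound[OF kl(3,4) assms(11) assms(12)[unfolded assms(10)] ne]
  have a: "a \<ge> 0" "e \<ge> 0" unfolding vF by simp_all
  \<comment> \<open>Used with \<open>x\<close> equal to \<open>k * l\<close> and to
    \<open>(real t)\<^sup>2\<close>; in the second case the factor is
    \<open>t * (2 * t + 1)\<close>.\<close>
  have rt: "e \<le> sqrt x * (2 * real t + 1) * sqrt (d * f)" if x: "x \<ge> 0" "e * e \<le> x * ((2 * real t + 1) * (2 * real t + 1)) * (d * f)" for x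
  proof (rule power2_le_imp_le)
    show "e\<^sup>2 \<le> (sqrt x * (2 * real t + 1) * sqrt (d * f))\<^sup>2"
      using x(2) pos unfolding power_mult_distrib real_sqrt_pow2[OF x(1)] by (simp add: power2_eq_square)
  qed (use x pos in simp)
  have "real (card (gaps (k' + 1) (l' + 1)) * card (gaps (k' + 1) (l' + 1))) \<le>
      real (k' * l' * ((2 * t + 1) * (2 * t + 1)) * (card (gaps (k' + 2) l') * card (gaps k' (l' + 2))))"
    using mb(1) of_nat_mono by blast
  then have "e * e \<le> real_of_int (k * l) * ((2 * real t + 1) * (2 * real t + 1)) * (d * f)"
    unfolding vF kl by (simp add: algebra_simps)
  then have 1: "e \<le> sqrt (real_of_int (k * l)) * (2 * real t + 1) * sqrt (d * f)"
    by (rule rt[rotated]) (simp add: kl)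
  have "real (card (gaps (k' + 1) (l' + 1)) * card (gaps (k' + 1) (l' + 1))) \<le>
      real (t * t * ((2 * t + 1) * (2 * t + 1)) * (card (gaps (k' + 2) l') * card (gaps k' (l' + 2))))"
    using mb(2) of_nat_mono by blast
  then have "e * e \<le> (real t)\<^sup>2 * ((2 * real t + 1) * (2 * real t + 1)) * (d * f)"
    unfolding vF by (simp add: algebra_simps power2_eq_square)
  then have 2: "e \<le> (2 * (real t)\<^sup>2 + real t) * sqrt (d * f)"
    using rt[of "(real t)\<^sup>2"] by (simp add: algebra_simps power2_eq_square)
  have "sqrt (real_of_int (k * l)) * (2 * real t + 1) > 0" using kl by simp
  then have r1: "b * c \<ge> (1 / 2 + 1 / (2 * (sqrt (real_of_int (k * l)) * (2 * real t + 1)))) * (a * e)"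
    by (rule ratio_bound[OF AF a(1) _ 1])
  have "2 * (real t)\<^sup>2 + real t > 0" using assms(11) by (simp add: add_nonneg_pos)
  then have r2: "b * c \<ge> (1 / 2 + 1 / (2 * (2 * (real t)\<^sup>2 + real t))) * (a * e)"
    by (rule ratio_bound[OF AF a(1) _ 2])
  show ?thesis using r1 r2 unfolding v max_def by (simp add: mult.assoc)
qed

end
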